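(* Let $(\Sigma^2,g_\Sigma)$ be a metric polygon satisfying conditions (A)--(F) listed in the context, and let $z=x+\sqrt{-1}\,y:\Sigma^2\to\overline{H}{}^2$ be its volumetric normal function, where $\overline{H}{}^2=\{x+\sqrt{-1}\,y : y\ge 0\}\subset\mathbb{C}$ is the closed upper half-plane. Then the analytic map $z:\Sigma^2\to\overline{H}{}^2$ is bijective.
   Context: $\varphi^1,\varphi^2$ are the standard coordinate functions of $\mathbb{R}^2$. A metric polygon $(\Sigma^2,g_\Sigma)$ is a region $\Sigma^2\subset\mathbb{R}^2$ with a Riemannian metric $g_\Sigma$; $\nabla$, $\langle\cdot,\cdot\rangle$, $\triangle_\Sigma$ are those of $g_\Sigma$, and $J_\Sigma$ is the complex structure of the oriented Riemannian surface (dual to the Hodge star). Put $\mathcal{V}=|\nabla\varphi^1|^2|\nabla\varphi^2|^2-\langle\nabla\varphi^1,\nabla\varphi^2\rangle^2$. Conditions: (A) Within the $(\varphi^1,\varphi^2)$ coordinate plane $\Sigma^2$ is a convex closed polygon, which is not compact but has finitely many edges. (B) The boundary $\partial\Sigma^2$ has one component or no components. (C) The metric $g_\Sigma$ is positive definite, $C^\infty$ up to boundary segments, and Lipschitz at corners. (D) The unit fields $\nabla\varphi^i/|\nabla\varphi^i|$ are smooth except at corner points, Lipschitz at corner points, and covariant-constant along boundary segments (in particular, boundary segments are totally geodesic). (E) The distribution $\mathrm{span}\{\nabla\varphi^1,\nabla\varphi^2\}$ is 2-dimensional on the interior of $\Sigma^2$, 1-dimensional on boundary segments, and 0-dimensional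 on boundary vertices. Also $[\nabla\varphi^1,\nabla\varphi^2]=0$. (F) $\triangle_\Sigma\sqrt{\mathcal{V}}=0$. Volumetric normal function: set $y=\sqrt{\mathcal{V}}\ge0$, a harmonic function by (F), let $x$ be its harmonic conjugate, found by solving $dx=-J_\Sigma\,dy$, and put $z=x+\sqrt{-1}\,y$.
   Formalization: The boundary of the polygon is assumed nonempty: the "no components" case of (B) is excluded, since there y>0 everywhere and z is never onto the closed half-plane (for the flat plane z is constant). *)

theory Defs
  imports "HOL-Analysis.Analysis"
begin

section \<open>Smoothness\<close>

type_synonym plane = "real^2"

text \<open>Used for open \<^term>\<open>S\<close> only, where it is the usual notion of a C-k map.\<close>

primrec Ck_on :: "nat \<Rightarrow> 'a::euclidean_space set \<Rightarrow> ('a \<Rightarrow> 'b::real_normed_vector) \<Rightarrow> bool" where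
  "Ck_on 0 S f \<longleftrightarrow> continuous_on S f"
| "Ck_on (Suc k) S f \<longleftrightarrow>
     (\<forall>x\<in>S. f differentiable (at x)) \<and> (\<forall>v. Ck_on k S (\<lambda>x. frechet_derivative f (at x) v))"

text \<open>Smoothness on an arbitrary set, in the sense of local smooth extensions; on a relatively open
  subset of a quadrant this is smoothness up to the boundary.\<close>

definition smooth_on :: "'a::euclidean_space set \<Rightarrow> ('a \<Rightarrow> 'b::real_normed_vector) \<Rightarrow> bool" where
  "smooth_on S f \<longleftrightarrow>
     (\<forall>x\<in>S. \<exists>W F. open W \<and> x \<in> W \<and> (\<forall>k. Ck_on k W F) \<and> (\<forall>u\<in>S \<inter> W. F u = f u))"

definition lipschitz_near :: "'a::metric_space set \<Rightarrow> 'a \<Rightarrow> ('a \<Rightarrow> 'b::metric_space) \<Rightarrow> bool" where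
  "lipschitz_near S x f \<longleftrightarrow> (\<exists>r>0. \<exists>L. L-lipschitz_on (S \<inter> ball x r) f)"

text \<open>Extension by continuity from the interior of \<^term>\<open>S\<close> to all of \<^term>\<open>S\<close>.\<close>

definition boundary_ext :: "plane set \<Rightarrow> (plane \<Rightarrow> 'b::t2_space) \<Rightarrow> plane \<Rightarrow> 'b" where
  "boundary_ext S f u = (if u \<in> interior S then f u else Lim (at u within interior S) f)"


section \<open>Riemannian geometry in a coordinate region\<close>

text \<open>A metric on a region \<^term>\<open>S\<close> of the plane is given by its matrix of components \<^term>\<open>h\<close>. All
  derivatives are taken within \<^term>\<open>S\<close>, so that at boundary points of a region such as a relatively
  open subset of a quadrant they are the one-sided ones (the derivative is unique there).\<close>

definition pd :: "plane set \<Rightarrow> 2 \<Rightarrow> (plane \<Rightarrow> 'b::real_normed_vector) \<Rightarrow> plane \<Rightarrow> 'b" where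
  "pd S j f p = frechet_derivative f (at p within S) (axis j 1)"

definition pos_def :: "real^2^2 \<Rightarrow> bool" where
  "pos_def M \<longleftrightarrow> transpose M = M \<and> (\<forall>v. v \<noteq> 0 \<longrightarrow> v \<bullet> (M *v v) > 0)"

definition ip :: "(plane \<Rightarrow> real^2^2) \<Rightarrow> plane \<Rightarrow> real^2 \<Rightarrow> real^2 \<Rightarrow> real" where
  "ip h p v w = v \<bullet> (h p *v w)"

definition grad :: "plane set \<Rightarrow> (plane \<Rightarrow> real^2^2) \<Rightarrow> (plane \<Rightarrow> real) \<Rightarrow> plane \<Rightarrow> real^2" where
  "grad S h f p = matrix_inv (h p) *v (\<chi> j. pd S j f p)"

definition unit_grad :: "plane set \<Rightarrow> (plane \<Rightarrow> real^2^2) \<Rightarrow> (plane \<Rightarrow> real) \<Rightarrow> plane \<Rightarrow> real^2" where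
  "unit_grad S h f p = grad S h f p /\<^sub>R sqrt (ip h p (grad S h f p) (grad S h f p))"

definition laplacian :: "plane set \<Rightarrow> (plane \<Rightarrow> real^2^2) \<Rightarrow> (plane \<Rightarrow> real) \<Rightarrow> plane \<Rightarrow> real" where
  "laplacian S h f p =
     (\<Sum>i\<in>UNIV. pd S i (\<lambda>q. sqrt (det (h q)) * grad S h f q $ i) p) / sqrt (det (h p))"

definition christoffel :: "plane set \<Rightarrow> (plane \<Rightarrow> real^2^2) \<Rightarrow> plane \<Rightarrow> 2 \<Rightarrow> 2 \<Rightarrow> 2 \<Rightarrow> real" where
  "christoffel S h p k i j =
     (\<Sum>l\<in>UNIV. matrix_inv (h p) $ k $ l *
        (pd S i (\<lambda>q. h q $ j $ l) p + pd S j (\<lambda>q. h q $ i $ l) p - pd S l (\<lambda>q. h q $ i $ j) p)) / 2"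

text \<open>The Levi-Civita derivative of the vector field \<^term>\<open>E\<close> at \<^term>\<open>p\<close> in the direction \<^term>\<open>w\<close>.\<close>

definition cov_deriv ::
  "plane set \<Rightarrow> (plane \<Rightarrow> real^2^2) \<Rightarrow> (plane \<Rightarrow> real^2) \<Rightarrow> plane \<Rightarrow> real^2 \<Rightarrow> real^2" where
  "cov_deriv S h E p w =
     frechet_derivative E (at p within S) w
       + (\<chi> k. \<Sum>i\<in>UNIV. \<Sum>j\<in>UNIV. christoffel S h p k i j * w $ i * E p $ j)"

definition lie_bracket :: "plane set \<Rightarrow> (plane \<Rightarrow> real^2) \<Rightarrow> (plane \<Rightarrow> real^2) \<Rightarrow> plane \<Rightarrow> real^2" where
  "lie_bracket S V W p =
     frechet_derivative W (at p within S) (V p) - frechet_derivative V (at p within S) (W p)"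

text \<open>Rotation by a right angle in the metric \<^term>\<open>h\<close>, for the standard orientation of the
  coordinate plane.\<close>

definition complex_structure :: "(plane \<Rightarrow> real^2^2) \<Rightarrow> plane \<Rightarrow> real^2 \<Rightarrow> real^2" where
  "complex_structure h p v =
     vector [- h p $ 1 $ 2 * v $ 1 - h p $ 2 $ 2 * v $ 2,
             h p $ 1 $ 1 * v $ 1 + h p $ 1 $ 2 * v $ 2] /\<^sub>R sqrt (det (h p))"

text \<open>The dual action on 1-forms, with the sign for which it is the Hodge star: in the
  Euclidean metric \<open>dx\<close> goes to \<open>dy\<close> and \<open>dy\<close> to \<open>- dx\<close>. With this sign \<open>dx = - J dy\<close> is the
  Cauchy-Riemann system, so that \<open>x + i y\<close> is holomorphic.\<close>

definition J_form :: "(plane \<Rightarrow> real^2^2) \<Rightarrow> plane \<Rightarrow> (real^2 \<Rightarrow> real) \<Rightarrow> real^2 \<Rightarrow> real" where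
  "J_form h p \<eta> v = - \<eta> (complex_structure h p v)"


section \<open>Metric polygons\<close>

text \<open>The coordinate functions \<open>\<phi>\<^sup>1, \<phi>\<^sup>2\<close> are smooth coordinates on the interior of the polygon
  \<^term>\<open>\<Sigma>\<close>, and there the metric is given by its components \<^term>\<open>G\<close> in these coordinates. They are
  not coordinates of the surface along its boundary: their gradients become dependent on the edges
  and vanish at the vertices, so the components \<^term>\<open>G\<close> necessarily blow up, and regularity of the
  metric up to the boundary refers to the structure of \<^term>\<open>\<Sigma>\<close> as a surface with boundary and
  corners. This structure is given by an atlas of local parametrizations \<^term>\<open>X\<close>, defined on
  relatively open subsets \<^term>\<open>D\<close> of the closed quadrant and compatible with the coordinates
  \<open>\<phi>\<^sup>1, \<phi>\<^sup>2\<close> in the interior. The components of \<^term>\<open>X\<close> are \<open>\<phi>\<^sup>1, \<phi>\<^sup>2\<close> in the parametrization. Edge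
  points of \<^term>\<open>\<Sigma>\<close> correspond to points with exactly one zero coordinate, vertices to the apex 0
  of the quadrant.\<close>

type_synonym param = "plane set \<times> (plane \<Rightarrow> plane)"

definition quadrant :: "plane set" where
  "quadrant = {u. \<forall>i. 0 \<le> u $ i}"

definition polygon_param :: "plane set \<Rightarrow> param \<Rightarrow> bool" where
  "polygon_param \<Sigma> = (\<lambda>(D, X).
     openin (top_of_set quadrant) D \<and> openin (top_of_set \<Sigma>) (X ` D) \<and>
     homeomorphism D (X ` D) X (inv_into D X) \<and>
     (\<forall>u\<in>D. X u \<in> interior \<Sigma> \<longleftrightarrow> u \<in> interior quadrant) \<and>
     (\<forall>u\<in>D. X u extreme_point_of \<Sigma> \<longleftrightarrow> u = 0) \<and>
     smooth_on (D - {0}) X \<and>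
     (\<forall>u\<in>D. X differentiable (at u within D)) \<and>
     continuous_on D (\<lambda>u. jacobian X (at u within D)) \<and>
     (\<forall>u\<in>interior D. invertible (jacobian X (at u))))"

definition polygon_atlas :: "plane set \<Rightarrow> param set \<Rightarrow> bool" where
  "polygon_atlas \<Sigma> \<A> \<longleftrightarrow>
     (\<forall>P\<in>\<A>. polygon_param \<Sigma> P) \<and> (\<Union>(D, X)\<in>\<A>. X ` D) = \<Sigma> \<and>
     (\<forall>(D, X)\<in>\<A>. \<forall>(E, Y)\<in>\<A>. smooth_on {u\<in>D. X u \<in> Y ` E} (inv_into E Y \<circ> X))"

text \<open>Components in a parametrization of the metric \<^term>\<open>G\<close>, extended to the boundary.\<close>

definition metric_in :: "(plane \<Rightarrow> real^2^2) \<Rightarrow> param \<Rightarrow> plane \<Rightarrow> real^2^2" where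
  "metric_in G = (\<lambda>(D, X). boundary_ext D
     (\<lambda>u. transpose (jacobian X (at u)) ** G (X u) ** jacobian X (at u)))"

text \<open>The fields \<open>\<nabla>\<phi>\<^sup>i\<close> and \<open>\<nabla>\<phi>\<^sup>i / |\<nabla>\<phi>\<^sup>i|\<close> in a parametrization. The latter is extended by continuity,
  because \<open>\<nabla>\<phi>\<^sup>i\<close> vanishes along an edge on which \<open>\<phi>\<^sup>i\<close> is constant.\<close>

definition grad_phi_in :: "(plane \<Rightarrow> real^2^2) \<Rightarrow> param \<Rightarrow> 2 \<Rightarrow> plane \<Rightarrow> real^2" where
  "grad_phi_in G = (\<lambda>(D, X) i. grad D (metric_in G (D, X)) (\<lambda>u. X u $ i))"

definition unit_grad_phi_in :: "(plane \<Rightarrow> real^2^2) \<Rightarrow> param \<Rightarrow> 2 \<Rightarrow> plane \<Rightarrow> real^2" where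
  "unit_grad_phi_in G = (\<lambda>(D, X) i.
     boundary_ext D (unit_grad D (metric_in G (D, X)) (\<lambda>u. X u $ i)))"

text \<open>The fields \<open>\<nabla>\<phi>\<^sup>i\<close> in the interior, in the coordinates \<open>\<phi>\<^sup>1, \<phi>\<^sup>2\<close> themselves.\<close>

definition grad_phi :: "plane set \<Rightarrow> (plane \<Rightarrow> real^2^2) \<Rightarrow> 2 \<Rightarrow> plane \<Rightarrow> real^2" where
  "grad_phi \<Sigma> G i = grad (interior \<Sigma>) G (\<lambda>p. p $ i)"

definition volV :: "plane set \<Rightarrow> (plane \<Rightarrow> real^2^2) \<Rightarrow> plane \<Rightarrow> real" where
  "volV \<Sigma> G p =
     ip G p (grad_phi \<Sigma> G 1 p) (grad_phi \<Sigma> G 1 p) * ip G p (grad_phi \<Sigma> G 2 p) (grad_phi \<Sigma> G 2 p)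
       - (ip G p (grad_phi \<Sigma> G 1 p) (grad_phi \<Sigma> G 2 p))\<^sup>2"


section \<open>The conditions (A)--(F)\<close>

text \<open>\<^const>\<open>polyhedron\<close>: a finite intersection of closed half-planes, i.e. a closed convex set with
  finitely many faces.\<close>

definition cond_A :: "plane set \<Rightarrow> bool" where
  "cond_A \<Sigma> \<longleftrightarrow> polyhedron \<Sigma> \<and> interior \<Sigma> \<noteq> {} \<and> \<not> compact \<Sigma>"

text \<open>The case of no boundary components is admitted here, but excluded by a separate assumption of the
  theorem: for the flat plane, \<open>G = mat 1\<close> on \<^term>\<open>UNIV\<close>, all conditions hold and \<open>z\<close> is constant; and
  whenever the boundary is empty, \<open>y > 0\<close> everywhere, so \<open>z\<close> is never onto the closed half-plane.\<close>

definition cond_B :: "plane set \<Rightarrow> bool" where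
  "cond_B \<Sigma> \<longleftrightarrow> components (frontier \<Sigma>) = {} \<or> (\<exists>C. components (frontier \<Sigma>) = {C})"

definition cond_C :: "param set \<Rightarrow> (plane \<Rightarrow> real^2^2) \<Rightarrow> bool" where
  "cond_C \<A> G \<longleftrightarrow> (\<forall>(D, X)\<in>\<A>.
     (\<forall>u\<in>D. pos_def (metric_in G (D, X) u)) \<and>
     smooth_on (D - {0}) (metric_in G (D, X)) \<and>
     (0 \<in> D \<longrightarrow> lipschitz_near D 0 (metric_in G (D, X))))"

text \<open>At an edge point \<open>u\<close>, with \<open>u $ j = 0\<close>, the vectors tangent to the edge are those whose
  \<open>j\<close>-th component is 0.\<close>

definition cond_D :: "param set \<Rightarrow> (plane \<Rightarrow> real^2^2) \<Rightarrow> bool" where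
  "cond_D \<A> G \<longleftrightarrow> (\<forall>(D, X)\<in>\<A>. \<forall>i.
     smooth_on (D - {0}) (unit_grad_phi_in G (D, X) i) \<and>
     (0 \<in> D \<longrightarrow> lipschitz_near D 0 (unit_grad_phi_in G (D, X) i)) \<and>
     (\<forall>u\<in>D - {0}. \<forall>j w. u $ j = 0 \<and> w $ j = 0 \<longrightarrow>
        cov_deriv D (metric_in G (D, X)) (unit_grad_phi_in G (D, X) i) u w = 0))"

definition cond_E :: "plane set \<Rightarrow> param set \<Rightarrow> (plane \<Rightarrow> real^2^2) \<Rightarrow> bool" where
  "cond_E \<Sigma> \<A> G \<longleftrightarrow>
     (\<forall>(D, X)\<in>\<A>. \<forall>u\<in>D.
        dim (span {grad_phi_in G (D, X) 1 u, grad_phi_in G (D, X) 2 u}) =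
          (if X u \<in> interior \<Sigma> then 2 else if X u extreme_point_of \<Sigma> then 0 else 1)) \<and>
     (\<forall>p\<in>interior \<Sigma>. lie_bracket (interior \<Sigma>) (grad_phi \<Sigma> G 1) (grad_phi \<Sigma> G 2) p = 0)"

definition cond_F :: "plane set \<Rightarrow> (plane \<Rightarrow> real^2^2) \<Rightarrow> bool" where
  "cond_F \<Sigma> G \<longleftrightarrow>
     (\<forall>p\<in>interior \<Sigma>. laplacian (interior \<Sigma>) G (\<lambda>q. sqrt (volV \<Sigma> G q)) p = 0)"


section \<open>The volumetric normal function\<close>

text \<open>The values of \<open>z\<close> on the boundary are determined by continuity; by the definition of
  \<^const>\<open>volV\<close> and condition (E), \<open>y = 0\<close> there.\<close>

definition volumetric_normal_function ::
  "plane set \<Rightarrow> (plane \<Rightarrow> real^2^2) \<Rightarrow> (plane \<Rightarrow> complex) \<Rightarrow> bool" where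
  "volumetric_normal_function \<Sigma> G z \<longleftrightarrow>
     continuous_on \<Sigma> z \<and>
     (\<forall>p\<in>interior \<Sigma>. Im (z p) = sqrt (volV \<Sigma> G p)) \<and>
     (\<forall>p\<in>interior \<Sigma>.
        ((\<lambda>q. Re (z q)) has_derivative
           (\<lambda>v. - J_form G p (frechet_derivative (\<lambda>q. Im (z q)) (at p)) v)) (at p))"

end

theory Submission imports Defs
begin

text \<open>Let \<open>A\<close> be the inverse metric in the coordinates \<open>\<phi>\<close>, so \<open>y = sqrt (det A)\<close>. The vanishing bracket means
  \<open>div A = 2 A (grad y) / y\<close>, and it follows that \<open>L f = A : D\<^sup>2f\<close>, which annihilates affine functions, also
  annihilates \<open>x\<close>, \<open>y\<^sup>2\<close>, \<open>|z - a|\<close>, \<open>(x - a) / |z - a|\<close> and \<open>y\<^sup>2 / |z|\<^sup>3\<close> for real \<open>a\<close>. Since \<open>\<Sigma>\<close> lies in a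
  half-plane, affine functions serve as barriers at infinity and \<open>L\<close> satisfies a Phragmen-Lindelof principle.

  On the boundary \<open>y = 0\<close>. There \<open>x\<close> is not constant on any arc (otherwise \<open>ln |z - a|\<close>, harmonic in a smooth
  boundary chart, would be \<open>-\<infinity>\<close> on an arc), it has no fold, and it is unbounded in both directions, so it maps the
  boundary homeomorphically onto the line. The principle then shows that \<open>{|z| < \<rho>}\<close> and \<open>{|z| > \<rho>}\<close> are connected,
  because each of their components must reach the boundary. By unicoherence of convex sets the level \<open>{|z| = \<rho>}\<close> is
  connected, hence \<open>z\<close> is onto. For almost every \<open>\<rho>\<close> the level contains no critical point, by Sard's theorem, and a
  connected level on which \<open>z\<close> is locally injective is mapped injectively. As \<open>z\<close> is an open map, injectivity on almost
  all levels implies injectivity.\<close>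

section \<open>Second-order operators and the maximum principle\<close>

text \<open>Two features of the boundary shape the proof. The global part therefore uses nothing but
  the interior equation and continuous boundary values, and compares explicit solutions with each
  other. Charts serve only to show that \<open>y\<close> vanishes on the boundary, that the metric
  is positive definite and its inverse smooth inside, and that \<open>x\<close> is not constant on
  an arc of an edge. Local properties of holomorphic maps are obtained without isothermal
  coordinates: \<open>z\<close> solves a Cauchy-Riemann system with variable coefficients,
  \<open>ln |z - w|\<close> is annihilated by the operator in divergence form that belongs to it,
  and the maximum principle for this logarithm, with suitable barriers, gives isolated zeros,
  openness and the uniqueness statement at an edge.\<close>

text \<open>\<open>sop A b f p g l\<close> says that \<open>f\<close> is twice differentiable at \<open>p\<close> with gradient \<open>g\<close>, and that the
  operator \<open>A : D\<^sup>2f + b \<bullet> grad f\<close> has the value \<open>l\<close> there. A relation avoids speaking of second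
  derivatives of functions that have none.\<close>

definition sop :: "real^2^2 \<Rightarrow> real^2 \<Rightarrow> (plane \<Rightarrow> real) \<Rightarrow> plane \<Rightarrow> real^2 \<Rightarrow> real \<Rightarrow> bool" where
  "sop A b f p g l \<longleftrightarrow>
     (\<exists>F D. (\<forall>\<^sub>F q in nhds p. (f has_derivative (\<lambda>v. F q \<bullet> v)) (at q)) \<and> F p = g \<and>
        (F has_derivative D) (at p) \<and> l = (\<Sum>i\<in>UNIV. (A *v axis i 1) \<bullet> D (axis i 1)) + b \<bullet> g)"

lemma sopI:
  assumes "\<forall>\<^sub>F q in nhds p. (f has_derivative (\<lambda>v. F q \<bullet> v)) (at q)" "(F has_derivative D) (at p)"
    "g = F p" "l = (\<Sum>i\<in>UNIV. (A *v axis i 1) \<bullet> D (axis i 1)) + b \<bullet> g"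
  shows "sop A b f p g l"
  unfolding sop_def using assms by blast

lemma sop_derivative:
  assumes "sop A b f p g l"
  shows "(f has_derivative (\<lambda>v. g \<bullet> v)) (at p)"
  using assms unfolding sop_def by (auto dest: eventually_nhds_x_imp_x)

lemma sop_isCont:
  assumes "sop A b f p g l"
  shows "isCont f p"
  using sop_derivative[OF assms] has_derivative_continuous by blast

lemma sop_cong:
  assumes "sop A b f p g l" "\<forall>\<^sub>F q in nhds p. f q = f' q"
  shows "sop A b f' p g l"
proof -
  obtain F D where F: "\<forall>\<^sub>F q in nhds p. (f has_derivative (\<lambda>v. F q \<bullet> v)) (at q)"
    and st: "F p = g" "(F has_derivative D) (at p)"
      "l = (\<Sum>i\<in>UNIV. (A *v axis i 1) \<bullet> D (axis i 1)) + b \<bullet> g"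
    using assms(1) unfolding sop_def by blast
  have "\<forall>\<^sub>F q in nhds p. \<forall>\<^sub>F q' in nhds q. f q' = f' q'"
    using assms(2) by (simp add: eventually_eventually)
  with F have "\<forall>\<^sub>F q in nhds p. (f' has_derivative (\<lambda>v. F q \<bullet> v)) (at q)"
  proof eventually_elim
    case (elim q)
    obtain U where U: "open U" "q \<in> U" "\<forall>x\<in>U. f x = f' x"
      using elim(2) unfolding eventually_nhds by blast
    show ?case
      by (rule has_derivative_transform_within_open[OF elim(1) U(1,2)]) (use U(3) in auto)
  qed
  then show ?thesis using st by (intro sopI[where F=F and D=D]) auto
qed

lemma sop_const: "sop A b (\<lambda>_. c) p 0 0"
  by (rule sopI[where F="\<lambda>_. 0" and D="\<lambda>_. 0"]) auto

lemma sop_inner: "sop A b (\<lambda>q. w \<bullet> q) p w (b \<bullet> w)"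
  by (rule sopI[where F="\<lambda>_. w" and D="\<lambda>_. 0"])
    (auto intro!: bounded_linear_imp_has_derivative bounded_linear_inner_right always_eventually)

lemma sop_add:
  assumes "sop A b f p g l" "sop A b f' p g' l'"
  shows "sop A b (\<lambda>q. f q + f' q) p (g + g') (l + l')"
proof -
  obtain F D where F: "\<forall>\<^sub>F q in nhds p. (f has_derivative (\<lambda>v. F q \<bullet> v)) (at q)"
    and st: "F p = g" "(F has_derivative D) (at p)"
      "l = (\<Sum>i\<in>UNIV. (A *v axis i 1) \<bullet> D (axis i 1)) + b \<bullet> g"
    using assms(1) unfolding sop_def by blast
  obtain F' D' where F': "\<forall>\<^sub>F q in nhds p. (f' has_derivative (\<lambda>v. F' q \<bullet> v)) (at q)"
    and st': "F' p = g'" "(F' has_derivative D') (at p)"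
      "l' = (\<Sum>i\<in>UNIV. (A *v axis i 1) \<bullet> D' (axis i 1)) + b \<bullet> g'"
    using assms(2) unfolding sop_def by blast
  show ?thesis
  proof (rule sopI[where F="\<lambda>q. F q + F' q" and D="\<lambda>v. D v + D' v"])
    show "\<forall>\<^sub>F q in nhds p. ((\<lambda>q. f q + f' q) has_derivative (\<lambda>v. (F q + F' q) \<bullet> v)) (at q)"
      using F F' by eventually_elim (auto intro!: derivative_eq_intros simp: inner_add_left)
    show "((\<lambda>q. F q + F' q) has_derivative (\<lambda>v. D v + D' v)) (at p)"
      using st st' by (auto intro!: derivative_eq_intros)
  qed (use st st' in \<open>auto simp: inner_add_right sum.distrib\<close>)
qed

lemma symmetric_12:
  fixes A :: "real^2^2"
  assumes "transpose A = A"
  shows "A $ 1 $ 2 = A $ 2 $ 1"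
proof -
  have "transpose A $ 1 $ 2 = A $ 2 $ 1" by (simp add: transpose_def)
  then show ?thesis using assms by simp
qed

text \<open>The trace of \<open>A\<close> against the rank-one map sending \<open>v\<close> to
  \<open>(g \<bullet> v) *\<^sub>R h\<close>. Such maps are what the product and chain rules add to
  a second derivative.\<close>

lemma sum_axis_inner:
  fixes A :: "real^2^2"
  assumes "transpose A = A"
  shows "(\<Sum>i\<in>UNIV. (A *v axis i 1) \<bullet> ((g \<bullet> axis i 1) *\<^sub>R h)) = g \<bullet> (A *v h)"
proof -
  have "A $ 1 $ 2 = A $ 2 $ 1" using assms by (rule symmetric_12)
  then show ?thesis
    by (simp add: sum_2 matrix_vector_mult_basis column_def inner_axis)
      (simp add: inner_vec_def matrix_vector_mult_def sum_2)
qed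

lemma sop_mult:
  assumes "sop A b f p g l" "sop A b f' p g' l'" "transpose A = A"
  shows "sop A b (\<lambda>q. f q * f' q) p (f p *\<^sub>R g' + f' p *\<^sub>R g) (f p * l' + f' p * l + 2 * (g \<bullet> (A *v g')))"
proof -
  obtain F D where F: "\<forall>\<^sub>F q in nhds p. (f has_derivative (\<lambda>v. F q \<bullet> v)) (at q)"
    and st: "F p = g" "(F has_derivative D) (at p)"
      "l = (\<Sum>i\<in>UNIV. (A *v axis i 1) \<bullet> D (axis i 1)) + b \<bullet> g"
    using assms(1) unfolding sop_def by blast
  obtain F' D' where F': "\<forall>\<^sub>F q in nhds p. (f' has_derivative (\<lambda>v. F' q \<bullet> v)) (at q)"
    and st': "F' p = g'" "(F' has_derivative D') (at p)"
      "l' = (\<Sum>i\<in>UNIV. (A *v axis i 1) \<bullet> D' (axis i 1)) + b \<bullet> g'"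
    using assms(2) unfolding sop_def by blast
  have df: "(f has_derivative (\<lambda>v. g \<bullet> v)) (at p)" "(f' has_derivative (\<lambda>v. g' \<bullet> v)) (at p)"
    using assms sop_derivative by blast+
  let ?D = "\<lambda>v. f p *\<^sub>R D' v + (g \<bullet> v) *\<^sub>R g' + (f' p *\<^sub>R D v + (g' \<bullet> v) *\<^sub>R g)"
  have sym: "g' \<bullet> (A *v g) = g \<bullet> (A *v g')"
    by (metis assms(3) dot_lmul_matrix inner_commute transpose_matrix_vector)
  show ?thesis
  proof (rule sopI[where F="\<lambda>q. f q *\<^sub>R F' q + f' q *\<^sub>R F q" and D="?D"])
    show "\<forall>\<^sub>F q in nhds p. ((\<lambda>q. f q * f' q) has_derivative (\<lambda>v. (f q *\<^sub>R F' q + f' q *\<^sub>R F q) \<bullet> v)) (at q)"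
      using F F' by eventually_elim (auto intro!: derivative_eq_intros simp: inner_add_left)
    show "((\<lambda>q. f q *\<^sub>R F' q + f' q *\<^sub>R F q) has_derivative ?D) (at p)"
      using st st' df by (auto intro!: derivative_eq_intros)
    have "(\<Sum>i\<in>UNIV. (A *v axis i 1) \<bullet> ?D (axis i 1)) =
       f p * (\<Sum>i\<in>UNIV. (A *v axis i 1) \<bullet> D' (axis i 1)) +
       (\<Sum>i\<in>UNIV. (A *v axis i 1) \<bullet> ((g \<bullet> axis i 1) *\<^sub>R g')) +
       (f' p * (\<Sum>i\<in>UNIV. (A *v axis i 1) \<bullet> D (axis i 1)) +
       (\<Sum>i\<in>UNIV. (A *v axis i 1) \<bullet> ((g' \<bullet> axis i 1) *\<^sub>R g)))"
      unfolding inner_add_right sum.distrib by (simp add: sum_distrib_left)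
    also have "\<dots> = f p * (l' - b \<bullet> g') + f' p * (l - b \<bullet> g) + 2 * (g \<bullet> (A *v g'))"
      unfolding sum_axis_inner[OF assms(3)] using st st' sym by simp
    finally have s: "(\<Sum>i\<in>UNIV. (A *v axis i 1) \<bullet> ?D (axis i 1)) = f p * (l' - b \<bullet> g') + f' p * (l - b \<bullet> g) + 2 * (g \<bullet> (A *v g'))" .
    show "f p * l' + f' p * l + 2 * (g \<bullet> (A *v g')) =
        (\<Sum>i\<in>UNIV. (A *v axis i 1) \<bullet> ?D (axis i 1)) + b \<bullet> (f p *\<^sub>R g' + f' p *\<^sub>R g)"
      unfolding s by (simp add: inner_add_right algebra_simps)
  qed (use st st' in auto)
qed

lemma sop_cmult:
  assumes "sop A b f p g l"
  shows "sop A b (\<lambda>q. c * f q) p (c *\<^sub>R g) (c * l)"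
proof -
  obtain F D where F: "\<forall>\<^sub>F q in nhds p. (f has_derivative (\<lambda>v. F q \<bullet> v)) (at q)"
    and st: "F p = g" "(F has_derivative D) (at p)"
      "l = (\<Sum>i\<in>UNIV. (A *v axis i 1) \<bullet> D (axis i 1)) + b \<bullet> g"
    using assms(1) unfolding sop_def by blast
  show ?thesis
  proof (rule sopI[where F="\<lambda>q. c *\<^sub>R F q" and D="\<lambda>v. c *\<^sub>R D v"])
    show "\<forall>\<^sub>F q in nhds p. ((\<lambda>q. c * f q) has_derivative (\<lambda>v. (c *\<^sub>R F q) \<bullet> v)) (at q)"
      using F by eventually_elim (auto intro!: derivative_eq_intros)
  qed (use st in \<open>auto intro!: derivative_eq_intros simp: sum_distrib_left algebra_simps\<close>)
qed

lemma sop_diff: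
  assumes "sop A b f p g l" "sop A b f' p g' l'"
  shows "sop A b (\<lambda>q. f q - f' q) p (g - g') (l - l')"
  using sop_add[OF assms(1) sop_cmult[OF assms(2), of "-1"]] by simp

lemma sop_comp:
  assumes "sop A b f p g l" "transpose A = A"
    and \<phi>: "\<forall>\<^sub>F t in nhds (f p). (\<phi> has_real_derivative \<phi>' t) (at t)"
    and \<phi>': "(\<phi>' has_real_derivative \<phi>2) (at (f p))"
  shows "sop A b (\<lambda>q. \<phi> (f q)) p (\<phi>' (f p) *\<^sub>R g) (\<phi>' (f p) * l + \<phi>2 * (g \<bullet> (A *v g)))"
proof -
  obtain F D where F: "\<forall>\<^sub>F q in nhds p. (f has_derivative (\<lambda>v. F q \<bullet> v)) (at q)"
    and st: "F p = g" "(F has_derivative D) (at p)"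
      "l = (\<Sum>i\<in>UNIV. (A *v axis i 1) \<bullet> D (axis i 1)) + b \<bullet> g"
    using assms(1) unfolding sop_def by blast
  have df: "(f has_derivative (\<lambda>v. g \<bullet> v)) (at p)"
    using assms sop_derivative by blast
  have "\<forall>\<^sub>F q in nhds p. (\<phi> has_real_derivative \<phi>' (f q)) (at (f q))"
    using sop_isCont[OF assms(1)] eventually_compose_filterlim[OF \<phi>, of f "nhds p"]
    unfolding isCont_def tendsto_at_iff_tendsto_nhds by simp
  with F have F': "\<forall>\<^sub>F q in nhds p. ((\<lambda>q. \<phi> (f q)) has_derivative (\<lambda>v. (\<phi>' (f q) *\<^sub>R F q) \<bullet> v)) (at q)"
  proof eventually_elim
    case (elim q)
    show ?case
      using has_derivative_compose[OF elim(1) elim(2)[unfolded has_field_derivative_def]] by simp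
  qed
  let ?D = "\<lambda>v. \<phi>' (f p) *\<^sub>R D v + \<phi>2 *\<^sub>R ((g \<bullet> v) *\<^sub>R g)"
  have d2: "((\<lambda>q. \<phi>' (f q)) has_derivative (\<lambda>v. \<phi>2 * (g \<bullet> v))) (at p)"
    using has_derivative_compose[OF df \<phi>'[unfolded has_field_derivative_def]] by simp
  show ?thesis
  proof (rule sopI[OF F', where D="?D"])
    show "((\<lambda>q. \<phi>' (f q) *\<^sub>R F q) has_derivative ?D) (at p)"
      using st(2) st(1) d2 by (auto intro!: derivative_eq_intros)
    have "(\<Sum>i\<in>UNIV. (A *v axis i 1) \<bullet> ?D (axis i 1)) = \<phi>' (f p) * (\<Sum>i\<in>UNIV. (A *v axis i 1) \<bullet> D (axis i 1))
       + \<phi>2 * (\<Sum>i\<in>UNIV. (A *v axis i 1) \<bullet> ((g \<bullet> axis i 1) *\<^sub>R g))"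
      unfolding inner_add_right sum.distrib by (simp add: sum_distrib_left mult.assoc)
    also have "\<dots> = \<phi>' (f p) * (l - b \<bullet> g) + \<phi>2 * (g \<bullet> (A *v g))"
      unfolding sum_axis_inner[OF assms(2)] using st by simp
    finally show "\<phi>' (f p) * l + \<phi>2 * (g \<bullet> (A *v g)) = (\<Sum>i\<in>UNIV. (A *v axis i 1) \<bullet> ?D (axis i 1)) + b \<bullet> (\<phi>' (f p) *\<^sub>R g)"
      by (simp add: algebra_simps)
  qed (use st in auto)
qed

text \<open>The gradient \<open>F\<close> is differentiable at \<open>p\<close> alone, so no Taylor
  formula applies. If \<open>v \<bullet> D v\<close> were positive, \<open>F \<bullet> v\<close>
  would be positive for a short while along the ray from \<open>p\<close> in direction
  \<open>v\<close>, and the mean value theorem would make \<open>f\<close> exceed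
  \<open>f p\<close>.\<close>

lemma second_derivative_nonpos_at_max:
  fixes F :: "plane \<Rightarrow> real^2"
  assumes F: "\<forall>\<^sub>F q in nhds p. (f has_derivative (\<lambda>v. F q \<bullet> v)) (at q)"
    and D: "(F has_derivative D) (at p)" and max: "\<forall>\<^sub>F q in nhds p. f q \<le> f p"
  shows "F p = 0" "v \<bullet> D v \<le> 0"
proof -
  have df: "(f has_derivative (\<lambda>v. F p \<bullet> v)) (at p)"
    using F by (auto dest: eventually_nhds_x_imp_x)
  obtain S where S: "open S" "p \<in> S" "\<And>q. q \<in> S \<Longrightarrow> f q \<le> f p"
    using max unfolding eventually_nhds by blast
  have "(\<lambda>v. F p \<bullet> v) = (\<lambda>v. 0)"
    using differential_zero_maxmin[OF S(2) S(1) df] S(3) by blast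
  then show 0: "F p = 0" by (metis inner_eq_zero_iff)
  show "v \<bullet> D v \<le> 0"
  proof (rule ccontr)
    assume neg: "\<not> v \<bullet> D v \<le> 0"
    define \<phi> where "\<phi> t = F (p + t *\<^sub>R v) \<bullet> v" for t :: real
    have line: "((\<lambda>t. p + t *\<^sub>R v) has_derivative (\<lambda>t. t *\<^sub>R v)) (at 0)"
      by (auto intro!: derivative_eq_intros)
    have D': "(F has_derivative D) (at (p + 0 *\<^sub>R v))" using D by simp
    have lin: "D (t *\<^sub>R v) = t *\<^sub>R D v" for t using D has_derivative_linear linear_cmul by blast
    have "((\<lambda>t. F (p + t *\<^sub>R v)) has_derivative (\<lambda>t. D (t *\<^sub>R v))) (at 0)"
      using has_derivative_compose[OF line D'] .
    then have "(\<phi> has_derivative (\<lambda>t. D (t *\<^sub>R v) \<bullet> v)) (at 0)"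
      unfolding \<phi>_def by (rule has_derivative_inner_left)
    then have "(\<phi> has_real_derivative (v \<bullet> D v)) (at 0)"
      unfolding has_field_derivative_def lin by (simp add: inner_commute mult.commute mult_commute_abs)
    with neg obtain d where d: "d > 0" "\<And>h. 0 < h \<Longrightarrow> h < d \<Longrightarrow> \<phi> 0 < \<phi> (0 + h)"
      using DERIV_pos_inc_right[of \<phi> "v \<bullet> D v" 0] by auto
    obtain U where U: "open U" "p \<in> U" "\<And>q. q \<in> U \<Longrightarrow> (f has_derivative (\<lambda>v. F q \<bullet> v)) (at q)"
      using F unfolding eventually_nhds by blast
    have "((\<lambda>t. p + t *\<^sub>R v) \<longlongrightarrow> p) (at_right 0)"
      by (auto intro!: tendsto_eq_intros)
    then have "\<forall>\<^sub>F t in at_right 0. p + t *\<^sub>R v \<in> S \<inter> U"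
      using S U by (intro topological_tendstoD) auto
    then obtain e where e: "e > 0" "\<And>t. 0 < t \<Longrightarrow> t < e \<Longrightarrow> p + t *\<^sub>R v \<in> S \<inter> U"
      unfolding eventually_at_right_field by auto
    define h where "h = min d e / 2"
    have h: "0 < h" "h < d" "h < e" using d(1) e(1) by (auto simp: h_def)
    have der: "((\<lambda>t. f (p + t *\<^sub>R v)) has_real_derivative \<phi> t) (at t)" if "0 \<le> t" "t \<le> h" for t
    proof -
      have "p + t *\<^sub>R v \<in> U" using e(2)[of t] U(2) that h by (cases "t = 0") auto
      then have 1: "(f has_derivative (\<lambda>w. F (p + t *\<^sub>R v) \<bullet> w)) (at (p + t *\<^sub>R v))" using U by blast
      have 2: "((\<lambda>t. p + t *\<^sub>R v) has_derivative (\<lambda>t. t *\<^sub>R v)) (at t)"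
        by (auto intro!: derivative_eq_intros)
      show ?thesis using has_derivative_compose[OF 2 1]
        unfolding has_field_derivative_def \<phi>_def by (simp add: mult_commute_abs)
    qed
    obtain t where t: "0 < t" "t < h" "f (p + h *\<^sub>R v) - f (p + 0 *\<^sub>R v) = (h - 0) * \<phi> t"
      using MVT2[OF h(1), of "\<lambda>t. f (p + t *\<^sub>R v)" \<phi>] der by auto
    have "\<phi> t > 0" using d(2)[of t] t h 0 by (simp add: \<phi>_def)
    then have "h * \<phi> t > 0" using h by simp
    then have "f (p + h *\<^sub>R v) > f p" using t(3) by simp
    moreover have "f (p + h *\<^sub>R v) \<le> f p" using e(2)[of h] h S(3) by blast
    ultimately show False by simp
  qed
qed

text \<open>The sign of a trace without diagonalization, and without symmetry of \<open>D\<close>.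
  For \<open>a > 0\<close>, multiplying the trace by \<open>a\<close> gives the quadratic form of
  \<open>D\<close> at \<open>(a, b)\<close> plus \<open>det A\<close> times \<open>k\<close>, and
  both are nonpositive.\<close>

lemma psd_trace_nonpos:
  fixes A :: "real^2^2" and D :: "real^2 \<Rightarrow> real^2"
  assumes A: "transpose A = A" "\<And>v. 0 \<le> v \<bullet> (A *v v)" and D: "linear D" "\<And>v. v \<bullet> D v \<le> 0"
  shows "(\<Sum>i\<in>UNIV. (A *v axis i 1) \<bullet> D (axis i 1)) \<le> 0"
proof -
  define M where "M = matrix D"
  have DM: "D v = M *v v" for v using D(1) by (simp add: M_def)
  have sym: "A $ 1 $ 2 = A $ 2 $ 1" using A(1) by (rule symmetric_12)
  define a b c where "a = A $ 1 $ 1" "b = A $ 1 $ 2" "c = A $ 2 $ 2"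
  define m n k where "m = M $ 1 $ 1" "n = M $ 1 $ 2 + M $ 2 $ 1" "k = M $ 2 $ 2"
  have q: "0 \<le> a * x\<^sup>2 + 2 * b * x * y + c * y\<^sup>2" for x y
    using A(2)[of "vector [x, y]"] sym
    by (simp add: a_b_c_def inner_vec_def sum_2 matrix_vector_mult_def power2_eq_square algebra_simps)
  have r: "m * x\<^sup>2 + n * x * y + k * y\<^sup>2 \<le> 0" for x y
    using D(2)[of "vector [x, y]"] unfolding DM
    by (simp add: m_n_k_def inner_vec_def sum_2 matrix_vector_mult_def power2_eq_square algebra_simps)
  have eq: "(\<Sum>i\<in>UNIV. (A *v axis i 1) \<bullet> D (axis i 1)) = a * m + b * n + c * k"
    unfolding DM using sym by (simp add: a_b_c_def m_n_k_def inner_vec_def sum_2 matrix_vector_mult_def axis_def algebra_simps)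
  have a0: "a \<ge> 0" using q[of 1 0] by simp
  have c0: "c \<ge> 0" using q[of 0 1] by simp
  have k0: "k \<le> 0" using r[of 0 1] by simp
  have m0: "m \<le> 0" using r[of 1 0] by simp
  have "a * m + b * n + c * k \<le> 0"
  proof (cases "a = 0")
    case True
    have "b = 0"
    proof (rule ccontr)
      assume "b \<noteq> 0"
      have "0 \<le> 2 * b * (- (c + 1) / (2 * b)) * 1 + c" using q[of "- (c + 1) / (2 * b)" 1] True by simp
      then show False using \<open>b \<noteq> 0\<close> by simp
    qed
    then show ?thesis using True c0 k0 by (simp add: mult_nonneg_nonpos)
  next
    case False
    then have "a > 0" using a0 by simp
    have "0 \<le> a * (b\<^sup>2) - 2 * b * b * a + c * a\<^sup>2"
      using q[of "-b" a] by (simp add: power2_eq_square algebra_simps)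
    also have "\<dots> = a * (a * c - b\<^sup>2)" by (simp add: power2_eq_square algebra_simps)
    finally have "0 \<le> a * c - b\<^sup>2" using \<open>a > 0\<close> by (simp add: zero_le_mult_iff)
    then have "(a * c - b\<^sup>2) * k \<le> 0" using k0 by (simp add: mult_nonneg_nonpos)
    moreover have "a * (a * m + b * n + c * k) = (m * a\<^sup>2 + n * a * b + k * b\<^sup>2) + (a * c - b\<^sup>2) * k"
      by (simp add: power2_eq_square algebra_simps)
    ultimately have "a * (a * m + b * n + c * k) \<le> 0" using r[of a b] by linarith
    then show ?thesis using \<open>a > 0\<close> by (simp add: mult_le_0_iff)
  qed
  then show ?thesis using eq by simp
qed

lemma sop_at_max:
  assumes "sop A b f p g l" "transpose A = A" "\<And>v. 0 \<le> v \<bullet> (A *v v)"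
    and "\<forall>\<^sub>F q in nhds p. f q \<le> f p"
  shows "g = 0" "l \<le> 0"
proof -
  obtain F D where F: "\<forall>\<^sub>F q in nhds p. (f has_derivative (\<lambda>v. F q \<bullet> v)) (at q)"
    and st: "F p = g" "(F has_derivative D) (at p)"
      "l = (\<Sum>i\<in>UNIV. (A *v axis i 1) \<bullet> D (axis i 1)) + b \<bullet> g"
    using assms(1) unfolding sop_def by blast
  note m = second_derivative_nonpos_at_max[OF F st(2) assms(4)]
  show g: "g = 0" using m(1) st by simp
  show "l \<le> 0" using psd_trace_nonpos[OF assms(2,3) has_derivative_linear[OF st(2)] m(2)] st g by simp
qed

section \<open>Maximum principles on bounded and unbounded regions\<close>

lemma strict_maximum_principle:
  fixes f :: "plane \<Rightarrow> real"
  assumes K: "compact K" "continuous_on K f" "p \<in> K" and W: "open W" "W \<subseteq> K"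
    and A: "\<And>q. q \<in> W \<Longrightarrow> transpose (A q) = A q" "\<And>q v. q \<in> W \<Longrightarrow> 0 \<le> v \<bullet> (A q *v v)"
    and L: "\<And>q. q \<in> W \<Longrightarrow> \<exists>g l. sop (A q) (b q) f q g l \<and> 0 < l"
  shows "\<exists>q\<in>K - W. f p \<le> f q"
proof -
  obtain q where q: "q \<in> K" "\<And>x. x \<in> K \<Longrightarrow> f x \<le> f q"
    using continuous_attains_sup[OF K(1) _ K(2)] K(3) by blast
  have "q \<notin> W"
  proof
    assume qW: "q \<in> W"
    then obtain g l where gl: "sop (A q) (b q) f q g l" "0 < l" using L by blast
    have "\<forall>\<^sub>F x in nhds q. f x \<le> f q"
      unfolding eventually_nhds using W qW q by (intro exI[of _ W]) auto
    from sop_at_max(2)[OF gl(1) A(1)[OF qW] A(2)[OF qW] this] gl(2) show False by simp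
  qed
  then show ?thesis using q K(3) by blast
qed

lemma rotation_identity:
  fixes w p :: "real^2"
  shows "(w \<bullet> p)\<^sup>2 + (vector [- w$2, w$1] \<bullet> p)\<^sup>2 = (norm w)\<^sup>2 * (norm p)\<^sup>2"
  unfolding power2_norm_eq_inner inner_vec_def sum_2
  by (simp add: power2_eq_square algebra_simps)

text \<open>\<open>sqrt (1 + u \<bullet> q)\<close> is concave where \<open>u \<bullet> q\<close> is
  nonnegative, so subtracting a small multiple of it keeps \<open>f\<close> a strict subsolution,
  and its growth dominates the bounded \<open>f\<close> far out in the strip. Concavity is available
  on one side only, which is why half of the strip is treated and the middle segment
  \<open>u \<bullet> q = 0\<close> counts as boundary.\<close>

lemma half_strip_bound:
  fixes f :: "plane \<Rightarrow> real" and w u :: plane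
  assumes u: "\<And>p. (w \<bullet> p)\<^sup>2 + (u \<bullet> p)\<^sup>2 = (norm w)\<^sup>2 * (norm p)\<^sup>2" "w \<noteq> 0"
    and V: "open V" "\<And>p. p \<in> closure V \<Longrightarrow> c \<le> w \<bullet> p"
    and A: "\<And>q. q \<in> V \<Longrightarrow> transpose (A q) = A q" "\<And>q v. q \<in> V \<Longrightarrow> 0 \<le> v \<bullet> (A q *v v)"
    and f: "continuous_on (closure V) f"
    and M: "\<And>q. q \<in> closure V \<Longrightarrow> w \<bullet> q \<le> d \<Longrightarrow> f q \<le> M"
    and L: "\<And>q. q \<in> V \<Longrightarrow> w \<bullet> q < d \<Longrightarrow> \<exists>g l. sop (A q) 0 f q g l \<and> 0 < l"
    and s: "0 \<le> s" "\<And>q. q \<in> closure V \<Longrightarrow> q \<notin> V \<Longrightarrow> w \<bullet> q \<le> d \<Longrightarrow> f q \<le> s"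
      "\<And>q. q \<in> closure V \<Longrightarrow> w \<bullet> q = d \<Longrightarrow> f q \<le> s"
      "\<And>q. q \<in> closure V \<Longrightarrow> w \<bullet> q \<le> d \<Longrightarrow> u \<bullet> q = 0 \<Longrightarrow> f q \<le> s"
    and p: "p \<in> V" "w \<bullet> p < d" "0 < u \<bullet> p"
  shows "f p \<le> s"
proof (rule field_le_epsilon)
  fix e :: real assume e: "0 < e"
  define \<epsilon> where "\<epsilon> = e / sqrt (1 + u \<bullet> p)"
  have sp: "sqrt (1 + u \<bullet> p) > 0" using p by simp
  have ep: "\<epsilon> > 0" using e sp by (simp add: \<epsilon>_def)
  define h where "h q = f q - \<epsilon> * sqrt (1 + u \<bullet> q)" for q
  \<comment> \<open>This makes \<open>\<epsilon> * sqrt (1 + R)\<close> at least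
    \<open>\<bar>M\<bar> + \<bar>s\<bar>\<close>, so the far end of the truncated strip carries no
    large value.\<close>
  define R where "R = max (u \<bullet> p) (((\<bar>M\<bar> + \<bar>s\<bar>) / \<epsilon>)\<^sup>2)"
  define K where "K = closure V \<inter> {q. w \<bullet> q \<le> d} \<inter> {q. 0 \<le> u \<bullet> q} \<inter> {q. u \<bullet> q \<le> R}"
  define W where "W = V \<inter> {q. w \<bullet> q < d} \<inter> {q. 0 < u \<bullet> q} \<inter> {q. u \<bullet> q < R + 1} \<inter> {q. u \<bullet> q < R}"
  have "p \<in> K" using p closure_subset unfolding K_def R_def by auto
  have "closed K" unfolding K_def
    by (intro closed_Int closed_closure closed_Collect_le continuous_intros)
  moreover have "bounded K"
  proof -
    have "(norm w)\<^sup>2 * (norm q)\<^sup>2 \<le> (max \<bar>c\<bar> \<bar>d\<bar>)\<^sup>2 + R\<^sup>2" if "q \<in> K" for q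
    proof -
      have "c \<le> w \<bullet> q" "w \<bullet> q \<le> d" "0 \<le> u \<bullet> q" "u \<bullet> q \<le> R" using that V(2) by (auto simp: K_def)
      then have "\<bar>w \<bullet> q\<bar> \<le> max \<bar>c\<bar> \<bar>d\<bar>" "\<bar>u \<bullet> q\<bar> \<le> R" by auto
      then have "(w \<bullet> q)\<^sup>2 \<le> (max \<bar>c\<bar> \<bar>d\<bar>)\<^sup>2" "(u \<bullet> q)\<^sup>2 \<le> R\<^sup>2"
        by (metis abs_ge_zero power2_abs power_mono)+
      then show ?thesis using u(1)[of q] by linarith
    qed
    then have "(norm q)\<^sup>2 \<le> ((max \<bar>c\<bar> \<bar>d\<bar>)\<^sup>2 + R\<^sup>2) / (norm w)\<^sup>2" if "q \<in> K" for q
      using that u(2) by (simp add: field_simps)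
    then have "norm q \<le> sqrt (((max \<bar>c\<bar> \<bar>d\<bar>)\<^sup>2 + R\<^sup>2) / (norm w)\<^sup>2)" if "q \<in> K" for q
      using that real_le_rsqrt by blast
    then show ?thesis unfolding bounded_iff by blast
  qed
  ultimately have "compact K" by (simp add: compact_eq_bounded_closed)
  moreover have "continuous_on K h" unfolding h_def
    by (intro continuous_intros continuous_on_subset[OF f]) (auto simp: K_def)
  moreover have "open W" unfolding W_def
    by (intro open_Int V open_Collect_less continuous_intros)
  moreover have "W \<subseteq> K" using closure_subset unfolding W_def K_def by auto
  moreover have "\<exists>g l. sop (A q) 0 h q g l \<and> 0 < l" if "q \<in> W" for q
  proof -
    have q: "q \<in> V" "w \<bullet> q < d" "0 < u \<bullet> q" using that by (auto simp: W_def)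
    obtain g l where gl: "sop (A q) 0 f q g l" "0 < l" using L[OF q(1,2)] by blast
    have 1: "sop (A q) 0 (\<lambda>x. 1 + u \<bullet> x) q u 0"
      using sop_add[OF sop_const[of "A q" 0 1 q] sop_inner[of "A q" 0 u q]] by simp
    let ?t = "1 + u \<bullet> q"
    have t: "?t > 0" using q by simp
    have "\<forall>\<^sub>F t in nhds ?t. (sqrt has_real_derivative (inverse (sqrt t) / 2)) (at t)"
    proof -
      have "\<forall>\<^sub>F t in nhds ?t. 0 < t" using t
        by (intro eventually_nhds_in_open[of "{0<..}", simplified]) auto
      then show ?thesis by eventually_elim (rule DERIV_real_sqrt)
    qed
    moreover have "((\<lambda>t. inverse (sqrt t) / 2) has_real_derivative (- (inverse (sqrt ?t) ^ 3) / 4)) (at ?t)"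
      using t by (auto intro!: derivative_eq_intros simp: power3_eq_cube power2_eq_square divide_simps)
    ultimately have "sop (A q) 0 (\<lambda>x. sqrt (1 + u \<bullet> x)) q ((inverse (sqrt ?t) / 2) *\<^sub>R u)
       (inverse (sqrt ?t) / 2 * 0 + (- (inverse (sqrt ?t) ^ 3) / 4) * (u \<bullet> (A q *v u)))"
      by (rule sop_comp[OF 1 A(1)[OF q(1)]])
    from sop_diff[OF gl(1) sop_cmult[OF this, of \<epsilon>]]
    have "sop (A q) 0 h q (g - \<epsilon> *\<^sub>R ((inverse (sqrt ?t) / 2) *\<^sub>R u))
       (l - \<epsilon> * (inverse (sqrt ?t) / 2 * 0 + (- (inverse (sqrt ?t) ^ 3) / 4) * (u \<bullet> (A q *v u))))"
      unfolding h_def .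
    moreover have "0 < l - \<epsilon> * (inverse (sqrt ?t) / 2 * 0 + (- (inverse (sqrt ?t) ^ 3) / 4) * (u \<bullet> (A q *v u)))"
      using gl(2) ep A(2)[OF q(1), of u] t by (simp add: add_pos_nonneg)
    ultimately show ?thesis by blast
  qed
  ultimately obtain q where q: "q \<in> K - W" "h p \<le> h q"
    using strict_maximum_principle[of K h p W A "\<lambda>_. 0"] \<open>p \<in> K\<close> A unfolding W_def by blast
  have "h q \<le> s"
  proof (cases "u \<bullet> q = R")
    case True
    have "f q \<le> M" using q M by (auto simp: K_def)
    moreover have "\<bar>M\<bar> + \<bar>s\<bar> \<le> \<epsilon> * sqrt (1 + R)"
    proof -
      have "(\<bar>M\<bar> + \<bar>s\<bar>) / \<epsilon> \<le> sqrt (1 + R)"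
        by (rule real_le_rsqrt) (simp add: R_def)
      then show ?thesis using ep by (simp add: field_simps)
    qed
    ultimately show ?thesis using True s(1) unfolding h_def by simp
  next
    case False
    have "0 \<le> u \<bullet> q" using q by (auto simp: K_def)
    then have "h q \<le> f q" using ep unfolding h_def by simp
    also have "f q \<le> s"
      using q False s(2-4)[of q] unfolding K_def W_def by force
    finally show ?thesis .
  qed
  then have "f p \<le> s + \<epsilon> * sqrt (1 + u \<bullet> p)" using q unfolding h_def by simp
  then show "f p \<le> s + e" using sp by (simp add: \<epsilon>_def)
qed

text \<open>The affine function \<open>\<eta>\<close> is annihilated by the operator and nonnegative
  on \<open>V\<close>. Subtracting \<open>M / N * \<eta>\<close> makes \<open>\<beta>\<close>
  nonpositive on the line \<open>\<eta> = N\<close>, and a large \<open>N\<close> preserves the sign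
  at \<open>p\<close>. In the remaining strip the half-strip bound on both sides reduces the
  supremum to the compact middle segment. So it is attained, which a strict subsolution forbids at
  an interior point.\<close>

proposition phragmen_lindelof:
  fixes \<beta> :: "plane \<Rightarrow> real" and w :: plane
  assumes w: "w \<noteq> 0" and V: "open V" "\<And>p. p \<in> closure V \<Longrightarrow> c \<le> w \<bullet> p"
    and A: "\<And>q. q \<in> V \<Longrightarrow> transpose (A q) = A q" "\<And>q v. q \<in> V \<Longrightarrow> v \<noteq> 0 \<Longrightarrow> 0 < v \<bullet> (A q *v v)"
    and \<beta>: "continuous_on (closure V) \<beta>" "\<And>q. q \<in> V \<Longrightarrow> \<beta> q \<le> M0"
    and L: "\<And>q. q \<in> V \<Longrightarrow> \<exists>g l. sop (A q) 0 \<beta> q g l \<and> 0 \<le> l"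
    and bd: "\<And>q. q \<in> closure V \<Longrightarrow> q \<notin> V \<Longrightarrow> \<beta> q \<le> 0"
    and p: "p \<in> V"
  shows "\<beta> p \<le> 0"
proof (rule ccontr)
  assume neg: "\<not> \<beta> p \<le> 0"
  define M where "M = max M0 1"
  have M: "\<beta> q \<le> M" if "q \<in> closure V" for q
    by (rule continuous_le_on_closure[OF \<beta>(1) that]) (auto simp: M_def intro: order_trans[OF \<beta>(2)])
  have M1: "M \<ge> 1" by (simp add: M_def)
  define \<eta> where "\<eta> q = w \<bullet> q - c" for q
  have \<eta>: "0 \<le> \<eta> q" if "q \<in> closure V" for q using V(2)[OF that] by (simp add: \<eta>_def)
  have \<eta>p: "0 \<le> \<eta> p" using \<eta> p closure_subset by blast
  \<comment> \<open>The first summand keeps \<open>\<beta> p - M / N * \<eta> p\<close> positive;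
    the others give \<open>\<eta> p < N\<close> and positivity of \<open>N\<close>.\<close>
  define N where "N = M * \<eta> p / \<beta> p + M * \<eta> p + \<eta> p + 1"
  have N: "N > 0" "\<eta> p < N" using neg M1 \<eta>p unfolding N_def by (auto intro!: add_nonneg_pos add_nonneg_nonneg)
  have "M * \<eta> p < N * \<beta> p"
  proof -
    have "N * \<beta> p = M * \<eta> p + (M * \<eta> p + \<eta> p + 1) * \<beta> p" using neg by (simp add: N_def field_simps)
    moreover have "(M * \<eta> p + \<eta> p + 1) * \<beta> p > 0" using neg M1 \<eta>p by (auto intro!: mult_pos_pos add_nonneg_pos add_nonneg_nonneg)
    ultimately show ?thesis by simp
  qed
  then have "\<beta> p - M / N * \<eta> p > 0" using N by (simp add: field_simps)
  \<comment> \<open>The exponential term makes the subsolution strict and is nonpositive in the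
    strip. With this factor it costs at most half of the positive value at \<open>p\<close>.\<close>
  define \<delta> where "\<delta> = (\<beta> p - M / N * \<eta> p) / (2 * exp N)"
  have \<delta>: "\<delta> > 0" using \<open>\<beta> p - M / N * \<eta> p > 0\<close> by (simp add: \<delta>_def)
  define f where "f q = \<beta> q - M / N * \<eta> q + \<delta> * (exp (\<eta> q) - exp N)" for q
  have fp: "f p > 0"
  proof -
    have "\<delta> * (exp (\<eta> p) - exp N) \<ge> - (\<delta> * exp N)" using \<delta> by (simp add: algebra_simps)
    moreover have "\<delta> * exp N = (\<beta> p - M / N * \<eta> p) / 2" by (simp add: \<delta>_def)
    ultimately have "- ((\<beta> p - M / N * \<eta> p) / 2) \<le> \<delta> * (exp (\<eta> p) - exp N)" by simp
    moreover have "0 < X - X / 2" if "0 < X" for X :: real using that by simp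
    ultimately show ?thesis using \<open>\<beta> p - M / N * \<eta> p > 0\<close> unfolding f_def
      by (smt (verit, best))
  qed
  have f_cont: "continuous_on (closure V) f"
    unfolding f_def \<eta>_def by (intro continuous_intros \<beta>)
  have exp_le: "\<delta> * (exp (\<eta> q) - exp N) \<le> 0" if "\<eta> q \<le> N" for q
    using that \<delta> by (simp add: mult_nonneg_nonpos)
  have f_M: "f q \<le> M" if "q \<in> closure V" "\<eta> q \<le> N" for q
  proof -
    have "M / N * \<eta> q \<ge> 0" using \<eta>[OF that(1)] M1 N by simp
    then show ?thesis using M[OF that(1)] exp_le[OF that(2)] unfolding f_def by linarith
  qed
  have f_bd: "f q \<le> 0" if "q \<in> closure V" "q \<notin> V" "\<eta> q \<le> N" for q
  proof -
    have "M / N * \<eta> q \<ge> 0" using \<eta>[OF that(1)] M1 N by simp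
    then show ?thesis using bd[OF that(1,2)] exp_le[OF that(3)] unfolding f_def by linarith
  qed
  have f_N: "f q \<le> 0" if "q \<in> closure V" "\<eta> q = N" for q
    using M[OF that(1)] that N unfolding f_def by simp
  have f_L: "\<exists>g l. sop (A q) 0 f q g l \<and> 0 < l" if q: "q \<in> V" for q
  proof -
    obtain g l where gl: "sop (A q) 0 \<beta> q g l" "0 \<le> l" using L[OF q] by blast
    have 1: "sop (A q) 0 \<eta> q w 0"
      using sop_diff[OF sop_inner[of "A q" 0 w q] sop_const[of "A q" 0 c q]] unfolding \<eta>_def by simp
    have "sop (A q) 0 (\<lambda>x. exp (\<eta> x)) q (exp (\<eta> q) *\<^sub>R w) (exp (\<eta> q) * 0 + exp (\<eta> q) * (w \<bullet> (A q *v w)))"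
      by (rule sop_comp[OF 1 A(1)[OF q]]) (auto intro!: derivative_eq_intros always_eventually)
    from sop_add[OF sop_diff[OF gl(1) sop_cmult[OF 1, of "M / N"]]
        sop_cmult[OF sop_diff[OF this sop_const[of _ _ "exp N"]], of \<delta>]]
    have "\<exists>g'. sop (A q) 0 f q g' (l - M / N * 0 + \<delta> * (exp (\<eta> q) * 0 + exp (\<eta> q) * (w \<bullet> (A q *v w)) - 0))"
      unfolding f_def by blast
    moreover have "0 < l - M / N * 0 + \<delta> * (exp (\<eta> q) * 0 + exp (\<eta> q) * (w \<bullet> (A q *v w)) - 0)"
      using gl(2) \<delta> A(2)[OF q w] by (simp add: add_nonneg_pos)
    ultimately show ?thesis by blast
  qed
  have psd: "0 \<le> v \<bullet> (A q *v v)" if "q \<in> V" for q v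
    using A(2)[OF that, of v] by (cases "v = 0") auto
  define u where "u = (vector [- w$2, w$1] :: plane)"
  have u: "(w \<bullet> q)\<^sup>2 + (u \<bullet> q)\<^sup>2 = (norm w)\<^sup>2 * (norm q)\<^sup>2" for q
    unfolding u_def by (rule rotation_identity)
  have u': "(w \<bullet> q)\<^sup>2 + (- u \<bullet> q)\<^sup>2 = (norm w)\<^sup>2 * (norm q)\<^sup>2" for q
    using u[of q] by simp
  define K where "K = closure V \<inter> {q. w \<bullet> q \<le> N + c} \<inter> {q. u \<bullet> q = 0}"
  have "closed K" unfolding K_def
    by (intro closed_Int closed_closure closed_Collect_le closed_Collect_eq continuous_intros)
  moreover have "bounded K"
  proof -
    have "norm q \<le> max \<bar>c\<bar> \<bar>N + c\<bar> / norm w" if "q \<in> K" for q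
    proof -
      have "c \<le> w \<bullet> q" "w \<bullet> q \<le> N + c" "u \<bullet> q = 0" using that V(2) by (auto simp: K_def)
      then have "(norm w * norm q)\<^sup>2 = (w \<bullet> q)\<^sup>2" using u[of q] by (simp add: power_mult_distrib)
      then have "norm w * norm q = w \<bullet> q \<or> norm w * norm q = - (w \<bullet> q)" by (simp only: power2_eq_iff)
      moreover have "0 \<le> norm w * norm q" by simp
      ultimately have "norm w * norm q = \<bar>w \<bullet> q\<bar>" by linarith
      also have "\<dots> \<le> max \<bar>c\<bar> \<bar>N + c\<bar>" using \<open>c \<le> w \<bullet> q\<close> \<open>w \<bullet> q \<le> N + c\<close> by auto
      finally show ?thesis using w by (simp add: field_simps)
    qed
    then show ?thesis unfolding bounded_iff by blast
  qed
  ultimately have "compact K" by (simp add: compact_eq_bounded_closed)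
  \<comment> \<open>A positive \<open>s\<close> is the maximum of \<open>f\<close> over the middle
    segment, hence a value of \<open>f\<close>.\<close>
  have "\<exists>s\<ge>0. (\<forall>q\<in>K. f q \<le> s) \<and> (s = 0 \<or> (\<exists>q\<in>K. f q = s))"
  proof (cases "K = {}")
    case False
    have "continuous_on K f" by (rule continuous_on_subset[OF f_cont]) (auto simp: K_def)
    then obtain q where "q \<in> K" "\<And>x. x \<in> K \<Longrightarrow> f x \<le> f q"
      using continuous_attains_sup[OF \<open>compact K\<close> False] by blast
    then show ?thesis by (intro exI[of _ "max 0 (f q)"]) (force simp: max_def)
  qed auto
  then obtain s where s: "s \<ge> 0" "\<And>q. q \<in> K \<Longrightarrow> f q \<le> s" "s = 0 \<or> (\<exists>q\<in>K. f q = s)" by blast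
  have hs: "f q \<le> M" if "q \<in> closure V" "w \<bullet> q \<le> N + c" for q
    using f_M that by (simp add: \<eta>_def)
  have hb: "f q \<le> s" if "q \<in> closure V" "q \<notin> V" "w \<bullet> q \<le> N + c" for q
    using f_bd[OF that(1,2)] that(3) s(1) by (simp add: \<eta>_def)
  have hN: "f q \<le> s" if "q \<in> closure V" "w \<bullet> q = N + c" for q
    using f_N[OF that(1)] that(2) s(1) by (simp add: \<eta>_def)
  have hK: "f q \<le> s" if "q \<in> closure V" "w \<bullet> q \<le> N + c" "u \<bullet> q = 0" for q
    using s(2)[of q] that by (simp add: K_def)
  have f_s: "f q \<le> s" if q: "q \<in> V" "w \<bullet> q < N + c" for q
  proof -
    consider "u \<bullet> q = 0" | "0 < u \<bullet> q" | "0 < - u \<bullet> q" by force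
    then show ?thesis
    proof cases
      case 1
      then show ?thesis using q closure_subset by (intro s(2)) (auto simp: K_def)
    next
      case 2
      show ?thesis
        by (rule half_strip_bound[OF u w V A(1) psd f_cont, where d="N + c" and M=M])
          (use hs hb hN hK s(1) f_L q 2 in auto)
    next
      case 3
      show ?thesis
        by (rule half_strip_bound[OF u' w V A(1) psd f_cont, where d="N + c" and M=M])
          (use hs hb hN hK s(1) f_L q 3 in auto)
    qed
  qed
  have "w \<bullet> p < N + c" using N(2) by (simp add: \<eta>_def)
  then have "s > 0" using f_s[OF p] fp by simp
  then obtain q where q: "q \<in> K" "f q = s" using s(3) by auto
  then have qc: "q \<in> closure V" "\<eta> q \<le> N" by (auto simp: K_def \<eta>_def)
  have "q \<in> V" using f_bd[OF qc(1) _ qc(2)] q \<open>s > 0\<close> by force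
  have "\<eta> q < N" using f_N[OF qc(1)] q \<open>s > 0\<close> qc(2) by force
  define W where "W = V \<inter> {q. w \<bullet> q < N + c}"
  have "open W" unfolding W_def by (intro open_Int V open_Collect_less continuous_intros)
  then have "\<forall>\<^sub>F x in nhds q. f x \<le> f q"
    unfolding eventually_nhds using f_s q \<open>q \<in> V\<close> \<open>\<eta> q < N\<close>
    by (intro exI[of _ W]) (auto simp: W_def \<eta>_def)
  then show False
    using f_L[OF \<open>q \<in> V\<close>] sop_at_max(2)[OF _ A(1)[OF \<open>q \<in> V\<close>] psd[OF \<open>q \<in> V\<close>]] by force
qed

lemma sop_sum:
  assumes "finite Z" "\<And>c. c \<in> Z \<Longrightarrow> \<exists>g l. sop A b (f c) p g l \<and> l < 0"
  shows "\<exists>g l. sop A b (\<lambda>q. \<Sum>c\<in>Z. f c q) p g l \<and> (if Z = {} then l = 0 else l < 0)"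
  using assms
proof (induction Z rule: finite_induct)
  case empty
  then show ?case using sop_const[of A b 0 p] by auto
next
  case (insert c Z)
  obtain g l where 1: "sop A b (f c) p g l" "l < 0" using insert.prems by blast
  obtain g' l' where 2: "sop A b (\<lambda>q. \<Sum>c\<in>Z. f c q) p g' l'" "if Z = {} then l' = 0 else l' < 0"
    using insert by blast
  have "l + l' < 0" using 1(2) 2(2) by (auto split: if_splits)
  then show ?case using sop_add[OF 1(1) 2(1)] insert(1,2) by auto
qed

section \<open>The boundary of an unbounded convex region\<close>

text \<open>A cluster point of the unit directions from a base point towards points of
  \<open>S\<close> that escape to infinity.\<close>

lemma recession_direction:
  fixes S :: "'a::euclidean_space set"
  assumes S: "closed S" "convex S" "\<not> bounded S"
  obtains d where "norm d = 1" "\<And>p t. p \<in> S \<Longrightarrow> 0 \<le> t \<Longrightarrow> p + t *\<^sub>R d \<in> S"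
proof -
  obtain p0 where p0: "p0 \<in> S" using S(3) by fastforce
  have "\<exists>q\<in>S. norm (q - p0) \<ge> real n + 1" for n
  proof (rule ccontr)
    assume "\<not> ?thesis"
    then have "norm q \<le> norm p0 + real n + 1" if "q \<in> S" for q
      using that norm_triangle_sub[of q p0] by force
    then show False using S(3) unfolding bounded_iff by blast
  qed
  then obtain q where q: "\<And>n. q n \<in> S" "\<And>n. norm (q n - p0) \<ge> real n + 1" by metis
  define N where "N n = norm (q n - p0)" for n
  have N: "N n \<ge> real n + 1" "N n > 0" for n
    using q(2)[of n] by (auto simp: N_def intro: less_le_trans[of 0 "real n + 1"])
  define e where "e n = (1 / N n) *\<^sub>R (q n - p0)" for n
  have "e n \<in> sphere 0 1" for n using N(2)[of n] by (simp add: e_def N_def)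
  then obtain d r where d: "d \<in> sphere 0 1" "strict_mono r" "(e \<circ> r) \<longlonglongrightarrow> d"
    using compact_sphere[of "0::'a" 1] unfolding compact_def by blast
  have r: "r n \<ge> n" for n using d(2) by (rule seq_suble)
  have "p + t *\<^sub>R d \<in> S" if p: "p \<in> S" "0 \<le> t" for p t
  proof -
    define s where "s n = t / N (r n)" for n
    have "(\<lambda>n. 1 / N (r n)) \<longlonglongrightarrow> 0"
    proof (rule tendsto_sandwich[OF _ _ tendsto_const LIMSEQ_inverse_real_of_nat])
      show "\<forall>\<^sub>F n in sequentially. 0 \<le> 1 / N (r n)" using N(2) by (simp add: less_imp_le)
      have "1 / N (r n) \<le> inverse (real (Suc n))" for n
      proof -
        have "real (Suc n) \<le> N (r n)" using N(1)[of "r n"] r[of n] by simp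
        then show ?thesis by (simp add: field_simps)
      qed
      then show "\<forall>\<^sub>F n in sequentially. 1 / N (r n) \<le> inverse (real (Suc n))" by simp
    qed
    from tendsto_mult_left[OF this, of t] have s0: "s \<longlonglongrightarrow> 0" by (simp add: s_def[abs_def])
    have "(\<lambda>n. p + t *\<^sub>R (e \<circ> r) n + s n *\<^sub>R (p0 - p)) \<longlonglongrightarrow> p + t *\<^sub>R d + 0 *\<^sub>R (p0 - p)"
      by (intro tendsto_intros d s0)
    then have lim: "(\<lambda>n. p + t *\<^sub>R (e \<circ> r) n + s n *\<^sub>R (p0 - p)) \<longlonglongrightarrow> p + t *\<^sub>R d" by simp
    have "\<forall>\<^sub>F n in sequentially. s n < 1"
      by (rule order_tendstoD(2)[OF s0]) simp
    then have "\<forall>\<^sub>F n in sequentially. p + t *\<^sub>R (e \<circ> r) n + s n *\<^sub>R (p0 - p) \<in> S"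
    proof eventually_elim
      case (elim n)
      have "p + t *\<^sub>R (e \<circ> r) n + s n *\<^sub>R (p0 - p) = (1 - s n) *\<^sub>R p + s n *\<^sub>R q (r n)"
        by (simp add: e_def s_def algebra_simps)
      moreover have "0 \<le> s n" using p N(2) by (simp add: s_def less_imp_le)
      ultimately show ?case using convexD_alt[OF S(2) p(1) q(1)] elim by simp
    qed
    then show ?thesis by (rule Lim_in_closed_set[OF S(1) _ sequentially_bot lim])
  qed
  then show thesis using d(1) that by simp
qed

text \<open>Rays from an interior point \<open>c\<close> meet the frontier of the convex set at most
  once, so the frontier is parametrized by directions. A recession direction \<open>d\<close> is
  never one of them, and stereographic projection from \<open>d\<close> identifies the other
  directions with the line. Connectedness makes the image an interval.\<close>

lemma stereographic_homeomorphism: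
  fixes S :: "plane set"
  assumes S: "closed S" "convex S" "interior S \<noteq> {}" "\<not> bounded S" "connected (frontier S)"
  obtains T \<beta> \<sigma> where "is_interval (T::real set)" "homeomorphism T (frontier S) \<beta> \<sigma>"
proof -
  obtain d where d: "norm d = 1" "\<And>p t. p \<in> S \<Longrightarrow> 0 \<le> t \<Longrightarrow> p + t *\<^sub>R d \<in> S"
    using recession_direction[OF S(1,2,4)] by blast
  obtain c where c: "c \<in> interior S" using S(3) by blast
  have ray: "c + t *\<^sub>R d \<in> interior S" if "0 \<le> t" for t
  proof -
    have "(\<lambda>p. t *\<^sub>R d + p) ` interior S \<subseteq> S"
      using d(2)[OF _ that] interior_subset[of S] by (auto simp: add.commute)
    then have "(\<lambda>p. t *\<^sub>R d + p) ` interior S \<subseteq> interior S"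
      by (rule interior_maximal) (rule open_translation, simp)
    then show ?thesis using c by (auto simp: add.commute)
  qed
  have fr: "frontier S \<subseteq> S" "frontier S \<inter> interior S = {}"
    using S(1) by (auto simp: frontier_def)
  define e where "e = (vector [- d$2, d$1] :: plane)"
  have de: "(d \<bullet> v)\<^sup>2 + (e \<bullet> v)\<^sup>2 = (norm v)\<^sup>2" for v
    using rotation_identity[of d v] d(1) by (simp add: e_def)
  have expand: "v = (d \<bullet> v) *\<^sub>R d + (e \<bullet> v) *\<^sub>R e" for v :: plane
  proof -
    have "(d$1)\<^sup>2 + (d$2)\<^sup>2 = 1" using d(1) power2_norm_eq_inner[of d] by (simp add: inner_vec_def sum_2 power2_eq_square)
    then have s: "d$1 * d$1 = 1 - d$2 * d$2" by (simp add: power2_eq_square)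
    have "v $ 1 = ((d \<bullet> v) *\<^sub>R d + (e \<bullet> v) *\<^sub>R e) $ 1"
      by (simp add: e_def inner_vec_def sum_2 algebra_simps) (simp add: s mult.assoc[symmetric] left_diff_distrib)
    moreover have "v $ 2 = ((d \<bullet> v) *\<^sub>R d + (e \<bullet> v) *\<^sub>R e) $ 2"
      by (simp add: e_def inner_vec_def sum_2 algebra_simps) (simp add: s mult.assoc[symmetric] left_diff_distrib)
    ultimately show ?thesis by (simp add: vec_eq_iff forall_2)
  qed
  \<comment> \<open>The stereographic coordinate, with pole \<open>d\<close>, of the unit vector
    from \<open>c\<close> towards \<open>q\<close>; \<open>u\<close> below is its inverse.\<close>
  define \<sigma> where "\<sigma> q = (e \<bullet> (q - c)) / (norm (q - c) - d \<bullet> (q - c))" for q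
  define u where "u s = (1 / (s\<^sup>2 + 1)) *\<^sub>R ((2 * s) *\<^sub>R e + (s\<^sup>2 - 1) *\<^sub>R d)" for s :: real
  have pos: "norm (q - c) - d \<bullet> (q - c) > 0" if q: "q \<in> frontier S" for q
  proof (rule ccontr)
    assume "\<not> ?thesis"
    moreover have "d \<bullet> (q - c) \<le> norm (q - c)" using norm_cauchy_schwarz[of d "q - c"] d(1) by simp
    ultimately have "d \<bullet> (q - c) = norm (q - c)" by simp
    with de[of "q - c"] have "e \<bullet> (q - c) = 0" by simp
    then have "q - c = norm (q - c) *\<^sub>R d" using expand[of "q - c"] \<open>d \<bullet> (q - c) = norm (q - c)\<close> by simp
    then have "q = c + norm (q - c) *\<^sub>R d" by (metis add_diff_cancel_left' diff_add_cancel add.commute)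
    with ray[of "norm (q - c)"] have "q \<in> interior S" by simp
    then show False using q fr by blast
  qed
  have polar: "q = c + norm (q - c) *\<^sub>R u (\<sigma> q)" "norm (q - c) > 0" if q: "q \<in> frontier S" for q
  proof -
    define n a b where "n = norm (q - c)" and "a = e \<bullet> (q - c)" and "b = d \<bullet> (q - c)"
    have nb: "n - b > 0" "n\<^sup>2 = a\<^sup>2 + b\<^sup>2" "\<sigma> q = a / (n - b)"
      using pos[OF q] de[of "q - c"] by (auto simp: n_def a_def b_def \<sigma>_def)
    have "n \<noteq> 0"
      using nb by (auto simp: sum_power2_eq_zero_iff)
    then show n: "norm (q - c) > 0" unfolding n_def by simp
    have 1: "(\<sigma> q)\<^sup>2 + 1 = 2 * n / (n - b)"
    proof -
      have "(\<sigma> q)\<^sup>2 + 1 = (a\<^sup>2 + (n - b)\<^sup>2) / (n - b)\<^sup>2"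
        unfolding nb(3) power_divide using nb(1) by (simp add: add_divide_distrib)
      also have "a\<^sup>2 + (n - b)\<^sup>2 = 2 * n * (n - b)" using nb(2) by (simp add: power2_eq_square algebra_simps)
      finally show ?thesis using nb by (simp add: power2_eq_square)
    qed
    have 2: "(\<sigma> q)\<^sup>2 - 1 = 2 * b / (n - b)"
    proof -
      have "(\<sigma> q)\<^sup>2 - 1 = 2 * n / (n - b) - 2" using 1 by simp
      also have "\<dots> = 2 * b / (n - b)" using nb by (simp add: field_simps)
      finally show ?thesis .
    qed
    have k: "1 / ((\<sigma> q)\<^sup>2 + 1) = (n - b) / (2 * n)" unfolding 1 by simp
    have "n *\<^sub>R u (\<sigma> q) = (n * ((n - b) / (2 * n)) * (2 * (a / (n - b)))) *\<^sub>R e + (n * ((n - b) / (2 * n)) * (2 * b / (n - b))) *\<^sub>R d"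
    proof -
      have "2 * \<sigma> q = 2 * (a / (n - b))" by (simp add: nb(3))
      then show ?thesis unfolding u_def k 2 by (simp add: scaleR_add_right)
    qed
    also have "\<dots> = a *\<^sub>R e + b *\<^sub>R d" using nb(1) \<open>n \<noteq> 0\<close> by simp
    also have "\<dots> = q - c" using expand[of "q - c"] by (simp add: a_def b_def add.commute)
    finally show "q = c + norm (q - c) *\<^sub>R u (\<sigma> q)" by (simp add: n_def)
  qed
  have shrink: "c + (t * norm (q - c)) *\<^sub>R u (\<sigma> q) \<in> interior S" if "q \<in> frontier S" "0 \<le> t" "t < 1" for q t
  proof -
    have "q - (1 - t) *\<^sub>R (q - c) \<in> interior S"
      using mem_interior_convex_shrink[OF S(2) c, of q "1 - t"] that fr by auto
    moreover have "q - (1 - t) *\<^sub>R (q - c) = c + t *\<^sub>R (q - c)" by (simp add: algebra_simps)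
    moreover have "q - c = norm (q - c) *\<^sub>R u (\<sigma> q)" using polar(1)[OF that(1)] by (metis add_diff_cancel_left')
    ultimately show ?thesis by (metis scaleR_scaleR)
  qed
  have le: "norm (q - c) \<le> t" if q: "q \<in> frontier S" "0 \<le> t" "c + t *\<^sub>R u (\<sigma> q) \<notin> interior S" for q t
  proof (rule ccontr)
    assume "\<not> ?thesis"
    then have "t / norm (q - c) < 1" "norm (q - c) \<noteq> 0" using q by (auto simp: divide_less_eq_1)
    with shrink[OF q(1), of "t / norm (q - c)"] q show False by simp
  qed
  have inj: "inj_on \<sigma> (frontier S)"
  proof (rule inj_onI)
    fix q q' assume q: "q \<in> frontier S" "q' \<in> frontier S" "\<sigma> q = \<sigma> q'"
    have "norm (q - c) \<le> norm (q' - c)" "norm (q' - c) \<le> norm (q - c)"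
      using le[OF q(1), of "norm (q' - c)"] le[OF q(2), of "norm (q - c)"] polar(1)[OF q(1)] polar(1)[OF q(2)] q fr
      by (metis disjoint_iff norm_ge_zero)+
    then show "q = q'" using polar(1)[OF q(1)] polar(1)[OF q(2)] q(3) by simp
  qed
  have cont: "continuous_on (frontier S) \<sigma>"
    unfolding \<sigma>_def using pos by (intro continuous_intros) force
  have contu: "continuous_on UNIV u"
    unfolding u_def by (intro continuous_intros) (metis add_pos_nonneg zero_less_one zero_le_power2 add.commute less_numeral_extra(3))
  define T where "T = \<sigma> ` frontier S"
  define \<beta> where "\<beta> = the_inv_into (frontier S) \<sigma>"
  have \<beta>: "\<beta> (\<sigma> q) = q" if "q \<in> frontier S" for q
    unfolding \<beta>_def using the_inv_into_f_f[OF inj that] .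
  have "is_interval T"
    unfolding T_def is_interval_connected_1 by (rule connected_continuous_image[OF cont S(5)])
  moreover have "continuous_on T \<beta>"
    unfolding continuous_on_eq_continuous_within
  proof
    fix s0 assume "s0 \<in> T"
    then obtain q0 where q0: "q0 \<in> frontier S" "s0 = \<sigma> q0" by (auto simp: T_def)
    \<comment> \<open>The point at distance \<open>R\<close> on the ray through \<open>q0\<close> is
      outside the closed set \<open>S\<close>, so neighbouring rays also leave \<open>S\<close>
      before distance \<open>R\<close>. The corresponding piece of the frontier is compact, and a
      continuous injection on it has a continuous inverse.\<close>
    define R where "R = 2 * norm (q0 - c)"
    have "c + R *\<^sub>R u s0 \<notin> S"
    proof
      assume "c + R *\<^sub>R u s0 \<in> S"
      then have "(c + R *\<^sub>R u s0) - (1/2) *\<^sub>R ((c + R *\<^sub>R u s0) - c) \<in> interior S"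
        by (intro mem_interior_convex_shrink[OF S(2) c]) auto
      moreover have "(c + R *\<^sub>R u s0) - (1/2) *\<^sub>R ((c + R *\<^sub>R u s0) - c) = c + norm (q0 - c) *\<^sub>R u s0"
        by (simp add: R_def add_diff_eq[symmetric] scaleR_diff_left[symmetric])
      ultimately show False using polar(1)[OF q0(1)] q0 fr by auto
    qed
    moreover have "open (- S)" using S(1) by (rule open_Compl)
    moreover have "isCont (\<lambda>s. c + R *\<^sub>R u s) s0"
      using contu by (intro continuous_intros) (simp add: continuous_on_eq_continuous_at)
    ultimately have "\<forall>\<^sub>F s in nhds s0. c + R *\<^sub>R u s \<in> - S"
      unfolding continuous_at_open eventually_nhds by blast
    then obtain \<delta>' where \<delta>': "\<delta>' > 0" "\<And>s. dist s s0 < \<delta>' \<Longrightarrow> c + R *\<^sub>R u s \<notin> S"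
      unfolding eventually_nhds_metric by auto
    define \<delta> where "\<delta> = \<delta>' / 2"
    have \<delta>: "\<delta> > 0" using \<delta>' by (simp add: \<delta>_def)
    define K where "K = {q \<in> frontier S. \<sigma> q \<in> cball s0 \<delta>}"
    have "norm (q - c) \<le> R" if "q \<in> K" for q
      using that \<delta> \<delta>'(2)[of "\<sigma> q"] interior_subset[of S] \<delta>'(1)
      by (intro le) (auto simp: K_def R_def \<delta>_def dist_commute)
    then have "bounded K"
      unfolding bounded_def by (intro exI[of _ c]) (auto simp: dist_norm norm_minus_commute)
    moreover have "closed K"
    proof -
      have "K = frontier S \<inter> \<sigma> -` cball s0 \<delta>" by (auto simp: K_def)
      then show ?thesis using continuous_closed_preimage[OF cont] by simp
    qed
    ultimately have "compact K" by (simp add: compact_eq_bounded_closed)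
    have "continuous_on (\<sigma> ` K) \<beta>"
      by (rule continuous_on_inv[OF continuous_on_subset[OF cont] \<open>compact K\<close>]) (auto simp: K_def \<beta>)
    moreover have "\<sigma> ` K = T \<inter> cball s0 \<delta>" by (auto simp: K_def T_def)
    ultimately have "continuous_on (T \<inter> cball s0 \<delta>) \<beta>" by simp
    then have "continuous (at s0 within T \<inter> cball s0 \<delta>) \<beta>"
      using \<open>s0 \<in> T\<close> \<delta> by (simp add: continuous_on_eq_continuous_within)
    moreover have "at s0 within T \<inter> cball s0 \<delta> = at s0 within T"
      by (rule at_within_nhd[of _ "ball s0 \<delta>"]) (use \<delta> in auto)
    ultimately show "continuous (at s0 within T) \<beta>" by simp
  qed
  moreover have "homeomorphism T (frontier S) \<beta> \<sigma>"
    unfolding homeomorphism_def using cont calculation(2) \<beta> by (auto simp: T_def image_image)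
  ultimately show thesis using that by blast
qed

section \<open>Bijectivity from the behaviour at the boundary\<close>

lemma not_connected_open:
  assumes "open W" "\<not> connected W"
  shows "\<exists>P Q. open P \<and> open Q \<and> W = P \<union> Q \<and> P \<inter> Q = {} \<and> P \<noteq> {} \<and> Q \<noteq> {}"
proof -
  obtain A B where "open A" "open B" "W \<subseteq> A \<union> B" "A \<inter> B \<inter> W = {}" "A \<inter> W \<noteq> {}" "B \<inter> W \<noteq> {}"
    using assms(2) unfolding connected_def by blast
  then show ?thesis using assms(1) by (intro exI[of _ "A \<inter> W"] exI[of _ "B \<inter> W"]) auto
qed

text \<open>\<open>A\<close> is the inverse metric in the coordinates \<open>\<phi>\<close>. Assumption \<open>xy_sop\<close> combines the
  Cauchy-Riemann equations for \<open>x + i y\<close> with the vanishing of the bracket: up to a positive factor, the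
  operator \<open>A : D\<^sup>2\<close> becomes \<open>\<partial>\<^sub>x\<^sup>2 + \<partial>\<^sub>y\<^sup>2 - (1/y) \<partial>\<^sub>y\<close> in the half-plane.\<close>

locale boundary_chart =
  fixes S :: "plane set" and A :: "plane \<Rightarrow> real^2^2" and x y :: "plane \<Rightarrow> real"
  assumes closed_S: "closed S" and convex_S: "convex S" and interior_S: "interior S \<noteq> {}"
    and unbounded_S: "\<not> bounded S" and connected_frontier: "connected (frontier S)"
    and frontier_S: "frontier S \<noteq> {}"
    and A_sym: "\<And>p. p \<in> interior S \<Longrightarrow> transpose (A p) = A p"
    and A_pos: "\<And>p v. p \<in> interior S \<Longrightarrow> v \<noteq> 0 \<Longrightarrow> 0 < v \<bullet> (A p *v v)"
    and x_cont: "continuous_on S x" and y_cont: "continuous_on S y"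
    and y_pos: "\<And>p. p \<in> interior S \<Longrightarrow> 0 < y p"
    and y_frontier: "\<And>p. p \<in> frontier S \<Longrightarrow> y p = 0"
    and xy_sop: "\<And>p. p \<in> interior S \<Longrightarrow> \<exists>gx gy. sop (A p) 0 x p gx 0 \<and>
        sop (A p) 0 y p gy (- (gy \<bullet> (A p *v gy)) / y p) \<and>
        gx \<bullet> (A p *v gy) = 0 \<and> gx \<bullet> (A p *v gx) = gy \<bullet> (A p *v gy)"
    and no_flat: "\<And>U a. open U \<Longrightarrow> U \<inter> frontier S \<noteq> {} \<Longrightarrow> \<exists>q\<in>U \<inter> frontier S. x q \<noteq> a"
begin

definition r :: "real \<Rightarrow> plane \<Rightarrow> real" where
  "r a q = sqrt ((x q - a)\<^sup>2 + (y q)\<^sup>2)"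

lemma r_pos:
  assumes "p \<in> interior S"
  shows "0 < r a p"
proof -
  have "0 < (y p)\<^sup>2" using y_pos[OF assms] by simp
  then show ?thesis unfolding r_def by (simp add: add_nonneg_pos)
qed

lemma r_nonneg: "0 \<le> r a p"
  unfolding r_def by simp

lemma r_sq: "(r a p)\<^sup>2 = (x p - a)\<^sup>2 + (y p)\<^sup>2"
  unfolding r_def by simp

lemma r_ge: "\<bar>x p - a\<bar> \<le> r a p"
  unfolding r_def by (rule real_le_rsqrt) simp

lemma r_cont: "continuous_on S (r a)"
  unfolding r_def by (intro continuous_intros x_cont y_cont)

lemma r_factor: "(r a p + (x p - a)) * (r a p - (x p - a)) = (y p)\<^sup>2"
  using r_sq[of a p] by (simp add: power2_eq_square algebra_simps)

lemma psd: "p \<in> interior S \<Longrightarrow> 0 \<le> v \<bullet> (A p *v v)"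
  using A_pos[of p v] by (cases "v = 0") auto

lemma A_commute: "p \<in> interior S \<Longrightarrow> u \<bullet> (A p *v v) = v \<bullet> (A p *v u)"
  by (metis A_sym dot_lmul_matrix inner_commute transpose_matrix_vector)

text \<open>In the half-plane the operator is a positive multiple of
  \<open>d_x^2 + d_y^2 - (1/y) d_y\<close>, an axially symmetric Laplacian in formal dimension 1.
  Its Kelvin transform, inversion in \<open>a\<close> with weight \<open>|z - a|\<close>, carries
  the solutions \<open>1\<close>, \<open>x - a\<close> and \<open>y^2\<close> to
  \<open>|z - a|\<close>, \<open>(x - a) / |z - a|\<close> and
  \<open>y^2 / |z - a|^3\<close>.\<close>

lemma L_harmonics:
  assumes p: "p \<in> interior S"
  shows "\<exists>g. sop (A p) 0 (r a) p g 0"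
    and "\<exists>g. sop (A p) 0 (\<lambda>q. (x q - a) / r a q) p g 0"
    and "\<exists>g. sop (A p) 0 (\<lambda>q. (y q)\<^sup>2) p g 0"
    and "\<exists>g. sop (A p) 0 (\<lambda>q. (y q)\<^sup>2 / (r a q) ^ 3) p g 0"
proof -
  obtain gx gy where jx: "sop (A p) 0 x p gx 0"
    and jy: "sop (A p) 0 y p gy (- (gy \<bullet> (A p *v gy)) / y p)"
    and orth: "gx \<bullet> (A p *v gy) = 0" "gx \<bullet> (A p *v gx) = gy \<bullet> (A p *v gy)"
    using xy_sop[OF p] by blast
  define m where "m = gy \<bullet> (A p *v gy)"
  have yp: "y p > 0" using y_pos[OF p] .
  have orth': "gy \<bullet> (A p *v gx) = 0" using A_commute[OF p] orth by simp
  note sym = A_sym[OF p]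
  have jxa: "sop (A p) 0 (\<lambda>q. x q - a) p gx 0"
    using sop_diff[OF jx sop_const[of _ _ a]] by simp
  have jy2: "sop (A p) 0 (\<lambda>q. y q * y q) p ((2 * y p) *\<^sub>R gy) 0"
  proof -
    have "y p * (- m / y p) + y p * (- m / y p) + 2 * m = 0" using yp by simp
    then show ?thesis using sop_mult[OF jy jy sym] unfolding m_def[symmetric]
      by (simp add: scaleR_add_left[symmetric])
  qed
  then show "\<exists>g. sop (A p) 0 (\<lambda>q. (y q)\<^sup>2) p g 0" by (auto simp: power2_eq_square)
  define R where "R = r a p"
  have R: "R > 0" "R * R = (x p - a) * (x p - a) + y p * y p"
    using r_pos[OF p] r_sq[of a p] by (auto simp: R_def power2_eq_square)
  have rr: "r a q = sqrt ((x q - a) * (x q - a) + y q * y q)" for q by (simp add: r_def power2_eq_square)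
  define gr where "gr = (1 / R) *\<^sub>R ((x p - a) *\<^sub>R gx + y p *\<^sub>R gy)"
  have mgr: "gr \<bullet> (A p *v gr) = m" "gx \<bullet> (A p *v gr) = (x p - a) * m / R" "gy \<bullet> (A p *v gr) = y p * m / R"
  proof -
    have e: "A p *v gr = (1 / R) *\<^sub>R ((x p - a) *\<^sub>R (A p *v gx) + y p *\<^sub>R (A p *v gy))"
      by (simp add: gr_def scaleR_matrix_vector_assoc[symmetric] matrix_vector_mult_scaleR matrix_vector_right_distrib)
    show "gx \<bullet> (A p *v gr) = (x p - a) * m / R" "gy \<bullet> (A p *v gr) = y p * m / R"
      unfolding e by (auto simp: inner_add_right orth orth' m_def)
    have "gr \<bullet> (A p *v gr) = ((x p - a) * (gx \<bullet> (A p *v gr)) + y p * (gy \<bullet> (A p *v gr))) / R"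
      by (simp add: gr_def inner_add_left)
    also have "\<dots> = ((x p - a) * (x p - a) + y p * y p) * m / (R * R)"
      unfolding \<open>gx \<bullet> (A p *v gr) = (x p - a) * m / R\<close> \<open>gy \<bullet> (A p *v gr) = y p * m / R\<close>
      using R(1) by (simp add: field_simps)
    also have "\<dots> = m" using R by (metis mult_pos_pos nonzero_mult_div_cancel_left less_irrefl)
    finally show "gr \<bullet> (A p *v gr) = m" .
  qed
  have jr: "sop (A p) 0 (r a) p gr 0"
  proof -
    define t where "t = (x p - a) * (x p - a) + y p * y p"
    have "t = R * R" unfolding t_def by (rule R(2)[symmetric])
    then have t: "t > 0" "sqrt t = R" using R(1) by auto
    have j2: "sop (A p) 0 (\<lambda>q. (x q - a) * (x q - a) + y q * y q) p ((2 * R) *\<^sub>R gr) (2 * m)"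
      using sop_add[OF sop_mult[OF jxa jxa sym] jy2] R(1) orth
      by (simp add: gr_def m_def scaleR_add_left[symmetric] scaleR_add_right)
    have "\<forall>\<^sub>F s in nhds t. (sqrt has_real_derivative (inverse (sqrt s) / 2)) (at s)"
    proof -
      have "\<forall>\<^sub>F s in nhds t. 0 < s" using t
        by (intro eventually_nhds_in_open[of "{0<..}", simplified]) auto
      then show ?thesis by eventually_elim (rule DERIV_real_sqrt)
    qed
    moreover have "((\<lambda>s. inverse (sqrt s) / 2) has_real_derivative (- (inverse (sqrt t) ^ 3) / 4)) (at t)"
      using t(1) by (auto intro!: derivative_eq_intros simp: power3_eq_cube power2_eq_square divide_simps)
    ultimately have s: "sop (A p) 0 (\<lambda>q. sqrt ((x q - a) * (x q - a) + y q * y q)) p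
        ((inverse (sqrt t) / 2) *\<^sub>R ((2 * R) *\<^sub>R gr))
        (inverse (sqrt t) / 2 * (2 * m) + (- (inverse (sqrt t) ^ 3) / 4) * (((2 * R) *\<^sub>R gr) \<bullet> (A p *v ((2 * R) *\<^sub>R gr))))"
      unfolding t_def by (rule sop_comp[OF j2 sym, where \<phi>=sqrt and \<phi>'="\<lambda>s. inverse (sqrt s) / 2"])
    have e1: "((2 * R) *\<^sub>R gr) \<bullet> (A p *v ((2 * R) *\<^sub>R gr)) = 4 * R * R * m"
      using mgr(1) by (simp add: matrix_vector_mult_scaleR)
    have e2: "inverse R / 2 * (2 * m) + (- (inverse R ^ 3) / 4) * (4 * R * R * m) = 0"
      using R(1) by (simp add: field_simps power3_eq_cube)
    have e3: "(inverse R / 2) *\<^sub>R ((2 * R) *\<^sub>R gr) = gr" using R(1) by simp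
    show ?thesis using s unfolding rr[abs_def] t(2) e1 e2 e3 .
  qed
  then show "\<exists>g. sop (A p) 0 (r a) p g 0" by blast
  have ev: "\<forall>\<^sub>F s in nhds R. 0 < s" using R
    by (intro eventually_nhds_in_open[of "{0<..}", simplified]) auto
  have jinv: "sop (A p) 0 (\<lambda>q. inverse (r a q)) p ((- inverse (R ^ 2)) *\<^sub>R gr) (2 * m / R ^ 3)"
  proof -
    have "\<forall>\<^sub>F s in nhds R. (inverse has_real_derivative (- inverse (s ^ 2))) (at s)"
      using ev by eventually_elim (auto intro!: derivative_eq_intros simp: power2_eq_square)
    moreover have "((\<lambda>s. - inverse (s ^ 2)) has_real_derivative (2 / R ^ 3)) (at R)"
      using R(1) by (auto intro!: derivative_eq_intros simp: power2_eq_square power3_eq_cube divide_inverse)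
    ultimately show ?thesis
      using sop_comp[OF jr sym, of inverse "\<lambda>s. - inverse (s ^ 2)" "2 / R ^ 3"] mgr(1) unfolding R_def by simp
  qed
  have jinv3: "sop (A p) 0 (\<lambda>q. inverse (r a q ^ 3)) p ((- 3 * inverse (R ^ 4)) *\<^sub>R gr) (12 * inverse (R ^ 5) * m)"
  proof -
    have "\<forall>\<^sub>F s in nhds R. ((\<lambda>s. inverse (s ^ 3)) has_real_derivative (- 3 * inverse (s ^ 4))) (at s)"
      using ev by eventually_elim (auto intro!: derivative_eq_intros simp: field_simps eval_nat_numeral)
    moreover have "((\<lambda>s. - 3 * inverse (s ^ 4)) has_real_derivative (12 * inverse (R ^ 5))) (at R)"
      using R(1) by (auto intro!: derivative_eq_intros simp: field_simps eval_nat_numeral)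
    ultimately show ?thesis
      using sop_comp[OF jr sym, of "\<lambda>s. inverse (s ^ 3)" "\<lambda>s. - 3 * inverse (s ^ 4)" "12 * inverse (R ^ 5)"] mgr(1) unfolding R_def by simp
  qed
  have "(x p - a) * (2 * m / R ^ 3) + 2 * (gx \<bullet> (A p *v ((- inverse (R ^ 2)) *\<^sub>R gr))) = 0"
    using R(1) mgr(2) by (simp only: matrix_vector_mult_scaleR inner_scaleR_right)
      (simp add: field_simps eval_nat_numeral)
  then show "\<exists>g. sop (A p) 0 (\<lambda>q. (x q - a) / r a q) p g 0"
    using sop_mult[OF jxa jinv sym] unfolding divide_inverse by auto
  have "(y p * y p) * (12 * inverse (R ^ 5) * m) + 2 * (((2 * y p) *\<^sub>R gy) \<bullet> (A p *v ((- 3 * inverse (R ^ 4)) *\<^sub>R gr))) = 0"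
    using R(1) mgr(3) by (simp only: matrix_vector_mult_scaleR inner_scaleR_right inner_scaleR_left)
      (simp add: field_simps eval_nat_numeral)
  then show "\<exists>g. sop (A p) 0 (\<lambda>q. (y q)\<^sup>2 / (r a q) ^ 3) p g 0"
    using sop_mult[OF jy2 jinv3 sym] unfolding divide_inverse power2_eq_square by auto
qed

lemma supporting:
  obtains w c where "w \<noteq> 0" "\<And>p. p \<in> S \<Longrightarrow> c \<le> w \<bullet> p"
proof -
  obtain q where q: "q \<in> frontier S" using frontier_S by blast
  then have "q \<in> S" "q \<notin> rel_interior S"
    using closed_S interior_S rel_interior_nonempty_interior by (auto simp: frontier_def)
  then obtain w where "w \<noteq> 0" "\<And>p. p \<in> S \<Longrightarrow> w \<bullet> q \<le> w \<bullet> p"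
    using supporting_hyperplane_rel_boundary[OF convex_S, of q] by metis
  then show thesis using that by blast
qed

lemma maximum_principle:
  assumes V: "open V" "V \<subseteq> interior S"
    and \<beta>: "continuous_on (closure V) \<beta>" "\<And>q. q \<in> V \<Longrightarrow> \<beta> q \<le> M"
    and L: "\<And>q. q \<in> V \<Longrightarrow> \<exists>g l. sop (A q) 0 \<beta> q g l \<and> 0 \<le> l"
    and bd: "\<And>q. q \<in> closure V \<Longrightarrow> q \<notin> V \<Longrightarrow> \<beta> q \<le> 0"
    and p: "p \<in> V"
  shows "\<beta> p \<le> 0"
proof -
  obtain w c where w: "w \<noteq> 0" "\<And>p. p \<in> S \<Longrightarrow> c \<le> w \<bullet> p" using supporting by blast
  have "closure V \<subseteq> S" using V(2) interior_subset closed_S closure_minimal by (metis order_trans)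
  then show ?thesis
    using V w L A_sym A_pos p by (intro phragmen_lindelof[OF w(1) V(1) _ _ _ \<beta> L bd p]) blast+
qed

text \<open>Solution with boundary values 0 on the left and 2 on the right of \<open>a\<close>.\<close>

definition kap :: "real \<Rightarrow> plane \<Rightarrow> real" where
  "kap a q = 1 + (x q - a) / r a q"

lemma kap_sop: "p \<in> interior S \<Longrightarrow> \<exists>g. sop (A p) 0 (kap a) p g 0"
  unfolding kap_def using L_harmonics(2)[of p a] sop_add[OF sop_const[of "A p" 0 1 p]] by fastforce

lemma kap_le: "kap a p \<le> 2"
proof -
  have "(x p - a) / r a p \<le> 1"
    using r_ge[of p a] r_nonneg[of a p] by (cases "r a p = 0") (auto simp: divide_le_eq_1)
  then show ?thesis by (simp add: kap_def)
qed

lemma kap_zero: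
  assumes "y p = 0" "x p < a"
  shows "kap a p = 0"
proof -
  have "r a p = a - x p" using assms unfolding r_def by simp
  then show ?thesis using assms by (simp add: kap_def field_simps)
qed

text \<open>Multiplying by the conjugate \<open>r - (x - a)\<close> turns the cancellation in
  \<open>r + (x - a)\<close> into the factor \<open>y^2\<close>, which exhibits the quadratic
  vanishing at boundary points with \<open>x < a\<close>.\<close>

lemma kap_eq:
  assumes "0 < r a p" "x p < a \<or> y p \<noteq> 0"
  shows "0 < r a p + a - x p" "kap a p = (y p)\<^sup>2 / (r a p * (r a p + a - x p))"
proof -
  show *: "0 < r a p + a - x p"
  proof (cases "x p < a")
    case False
    then have "(y p)\<^sup>2 > 0" using assms by simp
    then have "(r a p + (x p - a)) * (r a p - (x p - a)) > 0" using r_factor by simp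
    then show ?thesis using False assms(1) by (auto simp: zero_less_mult_iff)
  qed (use assms(1) in simp)
  have "kap a p = (r a p + (x p - a)) / r a p" using assms(1) by (simp add: kap_def field_simps)
  also have "\<dots> = ((r a p + (x p - a)) * (r a p - (x p - a))) / (r a p * (r a p - (x p - a)))"
    using * by simp
  finally show "kap a p = (y p)\<^sup>2 / (r a p * (r a p + a - x p))"
    unfolding r_factor by (simp add: algebra_simps)
qed

lemma kap_cont:
  assumes "X \<subseteq> S" "\<And>q. q \<in> X \<Longrightarrow> 0 < r a q"
  shows "continuous_on X (kap a)"
  unfolding kap_def
  by (intro continuous_intros continuous_on_subset[OF x_cont] continuous_on_subset[OF r_cont] assms(1))
    (use assms(2) in force)

lemma S_cases: "p \<in> S \<longleftrightarrow> p \<in> interior S \<or> p \<in> frontier S"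
  using closed_S interior_subset by (auto simp: frontier_def)

text \<open>At a local maximum \<open>a\<close> of \<open>x\<close> on the boundary, \<open>kap (a + \<eta>)\<close> vanishes on the nearby boundary, so
  it is at most \<open>C y\<^sup>2\<close> with \<open>C\<close> independent of \<open>\<eta>\<close>; but near the maximum it is about
  \<open>y\<^sup>2 / (2 \<eta>\<^sup>2)\<close>.\<close>

lemma no_fold:
  assumes hom: "homeomorphism T (frontier S) \<beta> \<sigma>" and T: "is_interval (T::real set)"
    and t: "t1 \<in> T" "t3 \<in> T" "t1 < t2" "t2 < t3"
    and lt: "x (\<beta> t1) < x (\<beta> t2)" "x (\<beta> t3) < x (\<beta> t2)"
  shows False
proof -
  have frS: "frontier S \<subseteq> S" using closed_S by (simp add: frontier_subset_closed)
  have \<beta>: "continuous_on T \<beta>" "\<And>t. t \<in> T \<Longrightarrow> \<beta> t \<in> frontier S" "\<And>t. t \<in> T \<Longrightarrow> \<sigma> (\<beta> t) = t"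
    and \<sigma>: "continuous_on (frontier S) \<sigma>" "\<And>q. q \<in> frontier S \<Longrightarrow> \<sigma> q \<in> T" "\<And>q. q \<in> frontier S \<Longrightarrow> \<beta> (\<sigma> q) = q"
    using hom unfolding homeomorphism_def by auto
  define f where "f = x \<circ> \<beta>"
  have IT: "{t1..t3} \<subseteq> T" using mem_is_interval_1_I[OF T t(1,2)] by auto
  have f: "continuous_on {t1..t3} f"
    unfolding f_def using \<beta> frS IT by (intro continuous_on_compose continuous_on_subset[OF \<beta>(1)] continuous_on_subset[OF x_cont]) auto
  obtain s where s: "s \<in> {t1..t3}" "\<And>t. t \<in> {t1..t3} \<Longrightarrow> f t \<le> f s"
    using continuous_attains_sup[of "{t1..t3}" f] f t by auto
  define a where "a = f s"
  have "f t1 < a" "f t3 < a" using s(2)[of t2] lt t by (auto simp: a_def f_def)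
  have near: "\<exists>\<delta>>0. \<forall>t\<in>{t1..t3}. \<bar>t - t0\<bar> < \<delta> \<longrightarrow> f t < a" if tt: "t0 \<in> {t1..t3}" "f t0 < a" for t0
  proof -
    obtain \<delta> where "\<delta> > 0" "\<And>t. t \<in> {t1..t3} \<Longrightarrow> dist t t0 < \<delta> \<Longrightarrow> dist (f t) (f t0) < a - f t0"
      using f[unfolded continuous_on_iff, rule_format, OF tt(1), of "a - f t0"] tt(2) by auto
    then show ?thesis by (intro exI[of _ \<delta>]) (force simp: dist_real_def)
  qed
  obtain \<delta>1 where \<delta>1: "\<delta>1 > 0" "\<And>t. t \<in> {t1..t3} \<Longrightarrow> \<bar>t - t1\<bar> < \<delta>1 \<Longrightarrow> f t < a"
    using near[of t1] \<open>f t1 < a\<close> t by auto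
  obtain \<delta>3 where \<delta>3: "\<delta>3 > 0" "\<And>t. t \<in> {t1..t3} \<Longrightarrow> \<bar>t - t3\<bar> < \<delta>3 \<Longrightarrow> f t < a"
    using near[of t3] \<open>f t3 < a\<close> t by auto
  \<comment> \<open>All parameters where \<open>f\<close> attains its maximum lie in
    \<open>{u1..u3}\<close>, a compact subset of the open interval from \<open>t1\<close> to
    \<open>t3\<close>.\<close>
  define u1 u3 where "u1 = min s (t1 + \<delta>1 / 2)" and "u3 = max s (t3 - \<delta>3 / 2)"
  have u: "t1 \<le> u1" "u1 \<le> s" "s \<le> u3" "u3 \<le> t3" "t1 < s" "s < t3"
    using s(1) \<delta>1(1) \<delta>3(1) \<open>f t1 < a\<close> \<open>f t3 < a\<close> by (auto simp: u1_def u3_def a_def less_le)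
  have out: "f t < a" if "t \<in> {t1..t3}" "t < u1 \<or> u3 < t" for t
    using that \<delta>1 \<delta>3 by (auto simp: u1_def u3_def)
  have "u1 > t1" "u3 < t3" using u \<delta>1(1) \<delta>3(1) by (auto simp: u1_def u3_def)
  define K where "K = \<beta> ` {u1..u3}"
  have K: "compact K" "K \<noteq> {}"
    unfolding K_def using IT u by (auto intro!: compact_continuous_image continuous_on_subset[OF \<beta>(1)])
  have sK: "\<beta> s \<in> K" using u by (auto simp: K_def)
  have "openin (top_of_set (frontier S)) (frontier S \<inter> \<sigma> -` {t1<..<t3})"
    by (rule continuous_openin_preimage_gen[OF \<sigma>(1)]) simp
  then obtain O0 where O0: "open O0" "frontier S \<inter> \<sigma> -` {t1<..<t3} = frontier S \<inter> O0"
    by (metis Int_commute openin_open)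
  have "K \<subseteq> O0"
  proof
    fix q assume "q \<in> K"
    then obtain t where tt: "t \<in> {u1..u3}" "q = \<beta> t" by (auto simp: K_def)
    then have "t \<in> T" using IT u by auto
    then have "q \<in> frontier S \<inter> \<sigma> -` {t1<..<t3}" using tt \<beta> u \<open>u1 > t1\<close> \<open>u3 < t3\<close> by auto
    then show "q \<in> O0" using O0 by blast
  qed
  then obtain \<epsilon> where \<epsilon>: "\<epsilon> > 0" "(\<Union>k\<in>K. cball k \<epsilon>) \<subseteq> O0"
    using compact_subset_open_imp_cball_epsilon_subset[OF K(1) O0(1)] by blast
  have inO0: "q \<in> O0" if "infdist q K \<le> \<epsilon>" for q
  proof -
    obtain k where "k \<in> K" "infdist q K = dist q k"
      using infdist_attains_inf[OF compact_imp_closed[OF K(1)] K(2)] by blast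
    then have "q \<in> cball k \<epsilon>" "k \<in> K" using that by (auto simp: dist_commute)
    then show ?thesis using \<epsilon>(2) by blast
  qed
  have fr_le: "x q \<le> a" if "q \<in> frontier S" "infdist q K \<le> \<epsilon>" for q
  proof -
    have "q \<in> frontier S \<inter> \<sigma> -` {t1<..<t3}" using inO0[OF that(2)] that O0 by blast
    then have "\<sigma> q \<in> {t1..t3}" "x q = f (\<sigma> q)" using \<sigma>(3) by (auto simp: f_def)
    then show ?thesis using s(2) by (simp add: a_def)
  qed
  have fr_lt: "x q < a" if "q \<in> frontier S" "infdist q K = \<epsilon>" for q
  proof -
    have "q \<in> frontier S \<inter> \<sigma> -` {t1<..<t3}" using inO0[of q] that O0 by auto
    then have 1: "\<sigma> q \<in> {t1..t3}" "x q = f (\<sigma> q)" using \<sigma>(3) by (auto simp: f_def)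
    have "q \<notin> K" using that(2) \<epsilon>(1) K by auto
    then have "\<sigma> q \<notin> {u1..u3}" using \<sigma>(3)[OF that(1)] unfolding K_def by (metis imageI)
    then show ?thesis using out[OF 1(1)] 1 by auto
  qed
  define E where "E = S \<inter> {q. infdist q K = \<epsilon>}"
  have clos: "closed {q. infdist q K \<le> \<epsilon>}" "closed {q. infdist q K = \<epsilon>}"
    by (intro closed_Collect_le closed_Collect_eq continuous_intros)+
  have bdd: "bounded {q. infdist q K \<le> \<epsilon>}"
  proof -
    obtain b where b: "\<And>k. k \<in> K \<Longrightarrow> norm k \<le> b" using compact_imp_bounded[OF K(1)] unfolding bounded_iff by blast
    have "norm q \<le> b + \<epsilon>" if q: "infdist q K \<le> \<epsilon>" for q
    proof -
      obtain k where "k \<in> K" "infdist q K = dist q k"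
        using infdist_attains_inf[OF compact_imp_closed[OF K(1)] K(2)] by blast
      then show ?thesis using b[of k] q norm_triangle_sub[of q k] by (simp add: dist_norm)
    qed
    then show ?thesis unfolding bounded_iff by blast
  qed
  have "compact E" unfolding compact_eq_bounded_closed E_def
    using clos closed_S by (auto intro: bounded_subset[OF bdd])
  \<comment> \<open>The quotient of \<open>kap (a + \<eta>)\<close> by \<open>y^2\<close>. On
    \<open>E\<close> it stays continuous down to \<open>\<eta> = 0\<close>, so compactness bounds it
    uniformly in \<open>\<eta>\<close>.\<close>
  define H where "H = (\<lambda>(q, \<eta>). 1 / (r (a + \<eta>) q * (r (a + \<eta>) q + (a + \<eta>) - x q)))"
  have E_pos: "0 < r (a + \<eta>) q" "0 < r (a + \<eta>) q + (a + \<eta>) - x q" "kap (a + \<eta>) q = (y q)\<^sup>2 * H (q, \<eta>)"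
    if "q \<in> E" "0 \<le> \<eta>" for q \<eta>
  proof -
    have *: "x q < a + \<eta> \<or> y q \<noteq> 0"
    proof (cases "q \<in> interior S")
      case True then show ?thesis using y_pos[of q] by auto
    next
      case False
      then have "q \<in> frontier S" using that S_cases by (auto simp: E_def)
      then show ?thesis using fr_lt[of q] that by (auto simp: E_def)
    qed
    then show 1: "0 < r (a + \<eta>) q" unfolding r_def by (auto simp: add_pos_nonneg add_nonneg_pos)
    show "0 < r (a + \<eta>) q + (a + \<eta>) - x q" "kap (a + \<eta>) q = (y q)\<^sup>2 * H (q, \<eta>)"
      using kap_eq[OF 1 *] by (auto simp: H_def)
  qed
  have "continuous_on (E \<times> {0..1}) H"
  proof -
    have x': "continuous_on (E \<times> {0..1}) (\<lambda>p. x (fst p))" "continuous_on (E \<times> {0..1::real}) (\<lambda>p. y (fst p))"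
      by (auto intro!: continuous_on_compose2[OF x_cont] continuous_on_compose2[OF y_cont] continuous_intros simp: E_def)
    have "continuous_on (E \<times> {0..1}) (\<lambda>p. r (a + snd p) (fst p))"
      unfolding r_def by (intro continuous_intros x')
    moreover have "r (a + snd p) (fst p) * (r (a + snd p) (fst p) + (a + snd p) - x (fst p)) \<noteq> 0"
      if "p \<in> E \<times> {0..1}" for p
      using mult_pos_pos[OF E_pos(1,2)[of "fst p" "snd p"]] that E_pos(1)[of "fst p" "snd p"]
      by (auto simp: mem_Times_iff)
    ultimately show ?thesis unfolding H_def case_prod_beta
      by (intro continuous_intros x') blast+
  qed
  moreover have "compact (E \<times> {0..1::real})" using \<open>compact E\<close> by (intro compact_Times) auto
  ultimately have "bounded (H ` (E \<times> {0..1}))" by (intro compact_imp_bounded compact_continuous_image)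
  then obtain C0 where C0: "\<And>q \<eta>. q \<in> E \<Longrightarrow> \<eta> \<in> {0..1} \<Longrightarrow> \<bar>H (q, \<eta>)\<bar> \<le> C0"
    unfolding bounded_iff by force
  define C where "C = max C0 1"
  have C: "C \<ge> 1" "\<And>q \<eta>. q \<in> E \<Longrightarrow> 0 \<le> \<eta> \<Longrightarrow> \<eta> \<le> 1 \<Longrightarrow> H (q, \<eta>) \<le> C"
    using C0 by (fastforce simp: C_def)+
  define V where "V = interior S \<inter> {q. infdist q K < \<epsilon>}"
  have V: "open V" "V \<subseteq> interior S" unfolding V_def
    by (auto intro!: open_Int open_Collect_less continuous_intros)
  have clV: "closure V \<subseteq> S \<inter> {q. infdist q K \<le> \<epsilon>}"
    using clos closed_S interior_subset[of S] unfolding V_def by (intro closure_minimal closed_Int) auto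
  have key: "1 \<le> C * (2 * \<eta>\<^sup>2)" if \<eta>: "0 < \<eta>" "\<eta> \<le> 1" for \<eta>
  proof -
    define b where "b = a + \<eta>"
    have bpos: "0 < r b q" if "q \<in> closure V" for q
    proof -
      have "q \<in> interior S \<or> q \<in> frontier S \<and> x q \<le> a" using that clV S_cases fr_le by blast
      then show ?thesis using r_pos[of q b] \<eta> by (auto simp: r_def b_def add_pos_nonneg)
    qed
    have neg: "kap b p - C * (y p)\<^sup>2 \<le> 0" if p: "p \<in> V" for p
    proof (rule maximum_principle[OF V, where M=2])
      show "continuous_on (closure V) (\<lambda>q. kap b q - C * (y q)\<^sup>2)"
        using clV by (intro continuous_intros kap_cont bpos continuous_on_subset[OF y_cont]) auto
      show "kap b q - C * (y q)\<^sup>2 \<le> 2" for q using kap_le[of b q] C(1) by (simp add: add_increasing2 diff_le_eq)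
      show "\<exists>g l. sop (A q) 0 (\<lambda>q. kap b q - C * (y q)\<^sup>2) q g l \<and> 0 \<le> l" if q: "q \<in> V" for q
      proof -
        have "q \<in> interior S" using q V by blast
        then obtain g g' where "sop (A q) 0 (kap b) q g 0" "sop (A q) 0 (\<lambda>q. (y q)\<^sup>2) q g' 0"
          using kap_sop L_harmonics(3) by blast
        from sop_diff[OF this(1) sop_cmult[OF this(2), of C]] show ?thesis by auto
      qed
      show "kap b q - C * (y q)\<^sup>2 \<le> 0" if q: "q \<in> closure V" "q \<notin> V" for q
      proof (cases "q \<in> frontier S")
        case True
        then have "y q = 0" "x q < b" using fr_le[of q] q clV \<eta> y_frontier by (auto simp: b_def)
        then show ?thesis using kap_zero by simp
      next
        case False
        then have "q \<in> E" using q clV S_cases by (force simp: V_def E_def)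
        then have "kap b q \<le> (y q)\<^sup>2 * C"
          unfolding b_def E_pos(3)[OF \<open>q \<in> E\<close> less_imp_le[OF \<eta>(1)]] using C(2) \<eta> by (intro mult_left_mono) auto
        then show ?thesis by (simp add: mult.commute)
      qed
    qed (use p in auto)
    \<comment> \<open>Dividing by \<open>y^2\<close> leaves an inequality between continuous
      functions, which persists at the boundary point \<open>\<beta> s\<close>, where
      \<open>r b\<close> equals \<open>\<eta>\<close>.\<close>
    have ge: "1 \<le> C * (r b p * (r b p + b - x p))" if p: "p \<in> V" for p
    proof -
      have "y p > 0" using p V y_pos by auto
      then have k: "0 < r b p + b - x p" "kap b p = (y p)\<^sup>2 / (r b p * (r b p + b - x p))"
        using kap_eq[OF bpos, of p] p closure_subset[of V] by auto
      have "(y p)\<^sup>2 / (r b p * (r b p + b - x p)) \<le> C * (y p)\<^sup>2" using neg[OF p] k by simp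
      then have "(y p)\<^sup>2 \<le> C * (y p)\<^sup>2 * (r b p * (r b p + b - x p))"
        using k(1) bpos[of p] p closure_subset[of V] by (simp add: divide_le_eq subset_iff)
      then have "(y p)\<^sup>2 * 1 \<le> (y p)\<^sup>2 * (C * (r b p * (r b p + b - x p)))" by (simp only: mult_ac mult_1_right)
      then show ?thesis using \<open>y p > 0\<close> by (simp only: mult_le_cancel_left_pos zero_less_power)
    qed
    have "s \<in> T" using IT s(1) by blast
    then have "\<beta> s \<in> closure (interior S)"
      using convex_closure_interior[OF convex_S interior_S] closed_S \<beta>(2)[of s] frS by auto
    moreover have "open {q. infdist q K < \<epsilon>}" by (intro open_Collect_less continuous_intros)
    moreover have "\<beta> s \<in> {q. infdist q K < \<epsilon>}" using sK \<epsilon> by simp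
    ultimately have "\<beta> s \<in> closure V"
      unfolding V_def using open_Int_closure_subset[of "{q. infdist q K < \<epsilon>}" "interior S"]
      by (auto simp: Int_commute)
    moreover have "continuous_on (closure V) (\<lambda>p. C * (r b p * (r b p + b - x p)))"
      using clV by (intro continuous_intros continuous_on_subset[OF r_cont] continuous_on_subset[OF x_cont]) auto
    ultimately have "1 \<le> C * (r b (\<beta> s) * (r b (\<beta> s) + b - x (\<beta> s)))"
      using continuous_ge_on_closure[of V "\<lambda>p. C * (r b p * (r b p + b - x p))" "\<beta> s" 1] ge by blast
    moreover have "x (\<beta> s) = a" by (simp add: a_def f_def)
    moreover have "r b (\<beta> s) = \<eta>"
      unfolding r_def using \<eta> y_frontier[OF \<beta>(2)[OF \<open>s \<in> T\<close>]] \<open>x (\<beta> s) = a\<close> by (auto simp: b_def)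
    ultimately show ?thesis by (simp add: b_def power2_eq_square)
  qed
  \<comment> \<open>With this value the inequality \<open>key\<close> reads
    \<open>1 \<le> 1 / (2 * C)\<close>, against \<open>C \<ge> 1\<close>.\<close>
  define \<eta> where "\<eta> = 1 / (2 * C)"
  have "1 \<le> C * (2 * \<eta>\<^sup>2)" using C(1) by (intro key) (auto simp: \<eta>_def divide_le_eq_1)
  moreover have "C * (2 * \<eta>\<^sup>2) = 1 / (2 * C)" using C(1) by (simp add: \<eta>_def power2_eq_square field_simps)
  ultimately show False using C(1) by (simp add: le_divide_eq)
qed

text \<open>Reflection in the imaginary axis turns facts about maxima and upper bounds of
  \<open>x\<close> into facts about minima and lower bounds.\<close>

lemma boundary_chart_reflect: "boundary_chart S A (\<lambda>p. - x p) y"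
proof
  fix p assume p: "p \<in> interior S"
  obtain gx gy where *: "sop (A p) 0 x p gx 0"
    "sop (A p) 0 y p gy (- (gy \<bullet> (A p *v gy)) / y p)"
    "gx \<bullet> (A p *v gy) = 0" "gx \<bullet> (A p *v gx) = gy \<bullet> (A p *v gy)"
    using xy_sop[OF p] by blast
  have "A p *v (- gx) = - (A p *v gx)"
    using matrix_vector_mult_scaleR[of "A p" "-1" gx] by simp
  then show "\<exists>gx gy. sop (A p) 0 (\<lambda>p. - x p) p gx 0 \<and>
      sop (A p) 0 y p gy (- (gy \<bullet> (A p *v gy)) / y p) \<and>
      gx \<bullet> (A p *v gy) = 0 \<and> gx \<bullet> (A p *v gx) = gy \<bullet> (A p *v gy)"
    using * sop_cmult[OF *(1), of "-1"] by (intro exI[of _ "- gx"] exI[of _ gy]) simp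
next
  fix U a assume "open U" "U \<inter> frontier S \<noteq> {}"
  then show "\<exists>q\<in>U \<inter> frontier S. - x q \<noteq> a" using no_flat[of U "- a"] by fastforce
qed (use closed_S convex_S interior_S unbounded_S connected_frontier frontier_S A_sym A_pos
    y_cont y_pos y_frontier x_cont in \<open>auto intro!: continuous_intros\<close>)

lemma frontier_subset_S: "frontier S \<subseteq> S"
  using closed_S by (simp add: frontier_subset_closed)

lemma closure_interior_S: "closure (interior S) = S"
  using convex_closure_interior[OF convex_S interior_S] closed_S by simp

text \<open>Between two boundary points with equal \<open>x\<close> there is, by
  \<open>no_flat\<close>, one with another value. It is a fold of \<open>x\<close> or of
  \<open>- x\<close>.\<close>

lemma inj_on_x_frontier: "inj_on x (frontier S)"
proof -
  obtain T \<beta> \<sigma> where T: "is_interval (T::real set)" and hom: "homeomorphism T (frontier S) \<beta> \<sigma>"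
    using stereographic_homeomorphism[OF closed_S convex_S interior_S unbounded_S connected_frontier] by blast
  interpret neg: boundary_chart S A "\<lambda>p. - x p" y by (rule boundary_chart_reflect)
  have \<beta>: "\<And>t. t \<in> T \<Longrightarrow> \<beta> t \<in> frontier S" "\<And>t. t \<in> T \<Longrightarrow> \<sigma> (\<beta> t) = t"
    and \<sigma>: "continuous_on (frontier S) \<sigma>" "\<And>q. q \<in> frontier S \<Longrightarrow> \<sigma> q \<in> T" "\<And>q. q \<in> frontier S \<Longrightarrow> \<beta> (\<sigma> q) = q"
    using hom unfolding homeomorphism_def by auto
  have *: "x (\<beta> t1) \<noteq> x (\<beta> t3)" if t: "t1 \<in> T" "t3 \<in> T" "t1 < t3" for t1 t3
  proof
    assume eq: "x (\<beta> t1) = x (\<beta> t3)"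
    have "openin (top_of_set (frontier S)) (frontier S \<inter> \<sigma> -` {t1<..<t3})"
      by (rule continuous_openin_preimage_gen[OF \<sigma>(1)]) simp
    then obtain U where U: "open U" "frontier S \<inter> \<sigma> -` {t1<..<t3} = U \<inter> frontier S"
      unfolding openin_open by (auto simp: Int_commute)
    have "(t1 + t3) / 2 \<in> T" using mem_is_interval_1_I[OF T t(1,2)] t(3) by auto
    then have "\<beta> ((t1 + t3) / 2) \<in> frontier S \<inter> \<sigma> -` {t1<..<t3}" using \<beta> t(3) by auto
    then have "U \<inter> frontier S \<noteq> {}" using U(2) by blast
    from no_flat[OF U(1) this, of "x (\<beta> t1)"] obtain q where q: "q \<in> frontier S" "\<sigma> q \<in> {t1<..<t3}" "x q \<noteq> x (\<beta> t1)"
      using U(2) by blast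
    have "x (\<beta> (\<sigma> q)) = x q" using \<sigma>(3)[OF q(1)] by simp
    then show False
      using no_fold[OF hom T t(1,2), of "\<sigma> q"] neg.no_fold[OF hom T t(1,2), of "\<sigma> q"] q eq
      by (cases "x q" "x (\<beta> t1)" rule: linorder_cases) auto
  qed
  show ?thesis
  proof (rule inj_onI)
    fix p q assume p: "p \<in> frontier S" "q \<in> frontier S" "x p = x q"
    then have "\<sigma> p = \<sigma> q" using *[of "\<sigma> p" "\<sigma> q"] *[of "\<sigma> q" "\<sigma> p"] \<sigma>
      by (metis linorder_neqE)
    then show "p = q" using \<sigma>(3) p by metis
  qed
qed

text \<open>If \<open>x\<close> were at most \<open>B\<close> on the frontier,
  \<open>kap (B + 1)\<close> would be bounded, continuous on \<open>S\<close> and zero on the whole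
  frontier, hence nonpositive. It is positive inside.\<close>

lemma x_frontier_unbounded_above: "\<exists>q\<in>frontier S. B < x q"
proof (rule ccontr)
  assume "\<not> ?thesis"
  then have B: "x q \<le> B" if "q \<in> frontier S" for q using that by force
  obtain p where p: "p \<in> interior S" using interior_S by blast
  have rp: "0 < r (B + 1) q" if "q \<in> S" for q
  proof (cases "q \<in> interior S")
    case False
    then have "x q \<le> B" using that S_cases B by blast
    then show ?thesis by (simp add: r_def add_pos_nonneg)
  qed (rule r_pos)
  have "kap (B + 1) p \<le> 0"
  proof (rule maximum_principle[OF open_interior subset_refl _ kap_le])
    show "continuous_on (closure (interior S)) (kap (B + 1))"
      unfolding closure_interior_S by (rule kap_cont) (use rp in auto)
    show "\<exists>g l. sop (A q) 0 (kap (B + 1)) q g l \<and> 0 \<le> l" if "q \<in> interior S" for q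
      using kap_sop[OF that, of "B + 1"] by blast
    show "kap (B + 1) q \<le> 0" if "q \<in> closure (interior S)" "q \<notin> interior S" for q
    proof -
      have "q \<in> frontier S" using that S_cases by (simp add: closure_interior_S)
      then show ?thesis using kap_zero[of q "B + 1"] y_frontier B[of q] by simp
    qed
  qed (rule p)
  moreover have "0 < kap (B + 1) p"
    using kap_eq[OF r_pos[OF p], of "B + 1"] y_pos[OF p] r_pos[OF p, of "B + 1"] by simp
  ultimately show False by simp
qed

lemma x_frontier_homeomorphism:
  obtains \<gamma> where "homeomorphism (frontier S) UNIV x \<gamma>"
proof -
  obtain T \<beta> \<sigma> where T: "is_interval (T::real set)" and hom: "homeomorphism T (frontier S) \<beta> \<sigma>"
    using stereographic_homeomorphism[OF closed_S convex_S interior_S unbounded_S connected_frontier] by blast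
  interpret neg: boundary_chart S A "\<lambda>p. - x p" y by (rule boundary_chart_reflect)
  have "path_connected T" using T is_interval_path_connected_1 by blast
  then have pc: "path_connected (frontier S)"
    using hom unfolding homeomorphism_def by (metis path_connected_continuous_image)
  have cont: "continuous_on (frontier S) x" using x_cont frontier_subset_S by (rule continuous_on_subset)
  obtain \<gamma> where \<gamma>: "homeomorphism (frontier S) (x ` frontier S) x \<gamma>"
    using injective_into_1d_eq_homeomorphism[OF cont pc] inj_on_x_frontier by blast
  have "is_interval (x ` frontier S)"
    unfolding is_interval_connected_1 by (rule connected_continuous_image[OF cont connected_frontier])
  moreover have "\<exists>s\<in>x ` frontier S. t \<le> s" for t
    using x_frontier_unbounded_above[of t] by (auto intro: less_imp_le)
  moreover have "\<exists>s\<in>x ` frontier S. s \<le> t" for t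
    using neg.x_frontier_unbounded_above[of "- t"] by (auto intro: less_imp_le)
  ultimately have "x ` frontier S = UNIV"
    by (intro UNIV_eq_I[symmetric]) (meson mem_is_interval_1_I)
  with \<gamma> show thesis by (intro that) simp
qed

section \<open>Connectedness of the sets \<open>r 0 < \<rho>\<close> and
  \<open>r 0 > \<rho>\<close>\<close>

lemma r_frontier: "q \<in> frontier S \<Longrightarrow> r a q = \<bar>x q - a\<bar>"
  using y_frontier by (simp add: r_def)

lemma frontier_arc_connected:
  assumes "is_interval I"
  shows "connected {q \<in> frontier S. x q \<in> I}"
proof -
  obtain \<gamma> where g: "homeomorphism (frontier S) UNIV x \<gamma>" using x_frontier_homeomorphism .
  then have "\<And>q. q \<in> frontier S \<Longrightarrow> \<gamma> (x q) = q" "\<And>t. x (\<gamma> t) = t" "range \<gamma> = frontier S"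
    unfolding homeomorphism_def by auto
  then have "{q \<in> frontier S. x q \<in> I} = \<gamma> ` I"
    by (auto simp: image_iff) (metis rangeI)+
  moreover have "continuous_on I \<gamma>" using g unfolding homeomorphism_def by (auto intro: continuous_on_subset)
  ultimately show ?thesis using assms by (simp add: connected_continuous_image is_interval_connected)
qed

text \<open>A small ball about a frontier point meets the convex interior in a connected set, which
  lies in only one of \<open>P\<close> and \<open>Q\<close>. Hence the parts of \<open>I\<close>
  bordering on \<open>P\<close> and on \<open>Q\<close> are disjoint and relatively closed, and
  connectedness of \<open>I\<close> leaves one of them empty.\<close>

lemma frontier_arc_one_side:
  assumes I: "connected I" "I \<subseteq> frontier S"
    and W: "\<And>q. q \<in> I \<Longrightarrow> \<exists>e>0. ball q e \<inter> interior S \<subseteq> P \<union> Q"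
    and PQ: "open P" "open Q" "P \<inter> Q = {}" "P \<subseteq> interior S" "Q \<subseteq> interior S"
  shows "I \<inter> closure P = {} \<or> I \<inter> closure Q = {}"
proof (rule ccontr)
  assume neg: "\<not> ?thesis"
  have sub: "I \<subseteq> closure P \<union> closure Q"
  proof
    fix q assume q: "q \<in> I"
    obtain e where e: "e > 0" "ball q e \<inter> interior S \<subseteq> P \<union> Q" using W[OF q] by blast
    have "q \<in> closure (interior S)" using q I frontier_subset_S closure_interior_S by auto
    then have "q \<in> closure (ball q e \<inter> interior S)"
      using open_Int_closure_subset[of "ball q e" "interior S"] e by auto
    then show "q \<in> closure P \<union> closure Q" using closure_mono[OF e(2)] by auto
  qed
  have "I \<inter> closure P \<inter> closure Q = {}"
  proof (rule ccontr)
    assume "I \<inter> closure P \<inter> closure Q \<noteq> {}"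
    then obtain q where q: "q \<in> I" "q \<in> closure P" "q \<in> closure Q" by blast
    obtain e where e: "e > 0" "ball q e \<inter> interior S \<subseteq> P \<union> Q" using W[OF q(1)] by blast
    have "ball q e \<inter> P \<noteq> {}" "ball q e \<inter> Q \<noteq> {}"
      using q centre_in_ball[of q e] e(1) open_Int_closure_eq_empty[of "ball q e" P]
        open_Int_closure_eq_empty[of "ball q e" Q] by blast+
    then have "P \<inter> (ball q e \<inter> interior S) \<noteq> {}" "Q \<inter> (ball q e \<inter> interior S) \<noteq> {}" using PQ by auto
    moreover have "connected (ball q e \<inter> interior S)"
      using convex_S by (intro convex_connected convex_Int convex_interior) auto
    ultimately show False
      using connectedD[of "ball q e \<inter> interior S" P Q] PQ e(2) by auto
  qed
  then show False using neg sub I(1) connected_closedD[of I "closure P" "closure Q"] by (auto simp: Int_ac)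
qed

lemma near_frontier:
  assumes "q \<in> S" "open U" "r a q \<in> U"
  shows "\<exists>e>0. \<forall>p\<in>ball q e \<inter> S. r a p \<in> U"
proof -
  have "openin (top_of_set S) (S \<inter> r a -` U)"
    using continuous_openin_preimage_gen[OF r_cont assms(2)] .
  then obtain O' where "open O'" "S \<inter> r a -` U = S \<inter> O'" unfolding openin_open by blast
  moreover then obtain e where "e > 0" "ball q e \<subseteq> O'" using assms by (metis IntI IntD2 open_contains_ball vimageI)
  ultimately show ?thesis by (intro exI[of _ e]) blast
qed

lemma closure_in_S: "P \<subseteq> interior S \<Longrightarrow> closure P \<subseteq> S"
  using closed_S interior_subset closure_minimal by (metis order_trans)

text \<open>One of two separating pieces does not border on the arc \<open>I\<close>. On the
  boundary of that piece \<open>r 0\<close> is at least \<open>\<rho>\<close>, so the maximum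
  principle for the bounded function \<open>\<rho> - r 0\<close> empties it.\<close>

lemma connected_r_less: "connected {p \<in> interior S. r 0 p < \<rho>}"
proof -
  define W where "W = {p \<in> interior S. r 0 p < \<rho>}"
  define I where "I = {q \<in> frontier S. x q \<in> {-\<rho><..<\<rho>}}"
  have I: "connected I" "I \<subseteq> frontier S"
    unfolding I_def using frontier_arc_connected[of "{-\<rho><..<\<rho>}"] by (auto simp: is_interval_oo)
  have Iq: "\<exists>e>0. ball q e \<inter> interior S \<subseteq> W" if "q \<in> I" for q
  proof -
    have "q \<in> S" "r 0 q \<in> {..<\<rho>}" using that frontier_subset_S r_frontier[of q 0] by (auto simp: I_def)
    then obtain e where "e > 0" "\<forall>p\<in>ball q e \<inter> S. r 0 p \<in> {..<\<rho>}"
      using near_frontier[of q "{..<\<rho>}" 0] by auto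
    then show ?thesis using interior_subset by (intro exI[of _ e]) (auto simp: W_def)
  qed
  have *: "Q = {}" if PQ: "open P" "open Q" "P \<inter> Q = {}" "P \<union> Q = W" "I \<inter> closure Q = {}" for P Q
  proof (rule ccontr)
    assume "Q \<noteq> {}"
    then obtain p where p: "p \<in> Q" by blast
    have Qi: "Q \<subseteq> interior S" using PQ by (auto simp: W_def)
    have "\<rho> - r 0 p \<le> 0"
    proof (rule maximum_principle[OF PQ(2) Qi, where M=\<rho>])
      show "continuous_on (closure Q) (\<lambda>q. \<rho> - r 0 q)"
        by (intro continuous_intros continuous_on_subset[OF r_cont] closure_in_S Qi)
      show "\<exists>g l. sop (A q) 0 (\<lambda>q. \<rho> - r 0 q) q g l \<and> 0 \<le> l" if "q \<in> Q" for q
      proof -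
        obtain g where "sop (A q) 0 (r 0) q g 0" using L_harmonics(1) \<open>q \<in> Q\<close> Qi by blast
        from sop_diff[OF sop_const[of _ _ \<rho>] this] show ?thesis by auto
      qed
      show "\<rho> - r 0 q \<le> 0" if q: "q \<in> closure Q" "q \<notin> Q" for q
      proof (rule ccontr)
        assume "\<not> \<rho> - r 0 q \<le> 0"
        then have lt: "r 0 q < \<rho>" by simp
        show False
        proof (cases "q \<in> interior S")
          case True
          then have "q \<in> P" using lt q PQ(4) by (auto simp: W_def)
          then show False using q PQ(1,3) open_Int_closure_eq_empty[of P Q] by blast
        next
          case False
          then have "q \<in> frontier S" using q closure_in_S[OF Qi] S_cases by blast
          then have "q \<in> I" using lt r_frontier[of q 0] by (auto simp: I_def)
          then show False using q PQ(5) by blast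
        qed
      qed
    qed (use p r_nonneg in auto)
    moreover have "p \<in> W" using p PQ(4) by blast
    ultimately show False by (simp add: W_def)
  qed
  have Wo: "open W"
  proof -
    have "continuous_on (interior S) (r 0)" using r_cont interior_subset by (rule continuous_on_subset)
    then have "openin (top_of_set (interior S)) (interior S \<inter> r 0 -` {..<\<rho>})"
      by (rule continuous_openin_preimage_gen) simp
    moreover have "interior S \<inter> r 0 -` {..<\<rho>} = W" by (auto simp: W_def)
    ultimately show ?thesis by (metis open_interior openin_open_eq)
  qed
  show "connected {p \<in> interior S. r 0 p < \<rho>}"
    unfolding W_def[symmetric]
  proof (rule ccontr)
    assume "\<not> connected W"
    then obtain P Q where PQ: "open P" "open Q" "W = P \<union> Q" "P \<inter> Q = {}" "P \<noteq> {}" "Q \<noteq> {}"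
      using not_connected_open[OF Wo] by metis
    have "P \<subseteq> interior S" "Q \<subseteq> interior S" using PQ(3) by (auto simp: W_def)
    then consider "I \<inter> closure P = {}" | "I \<inter> closure Q = {}"
      using frontier_arc_one_side[OF I _ PQ(1,2,4)] Iq PQ(3) by metis
    then show False using *[of P Q] *[of Q P] PQ by cases auto
  qed
qed

text \<open>A lower bound of order \<open>y^2 / R^2\<close>, to be played against
  \<open>y^2 / R^3\<close> for large \<open>R\<close>. Both factors of the denominator in
  \<open>kap_eq\<close> are controlled by
  \<open>r (2 * \<rho>) p \<le> r 0 p + 2 * \<rho>\<close>.\<close>

lemma kap_ge:
  assumes "p \<in> interior S" "0 < \<rho>" "r 0 p \<le> R"
  shows "(y p)\<^sup>2 / (2 * (R + 2 * \<rho>)\<^sup>2) \<le> kap (2 * \<rho>) p"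
proof -
  have p: "0 < r (2 * \<rho>) p" "0 < r (2 * \<rho>) p + 2 * \<rho> - x p"
    "kap (2 * \<rho>) p = (y p)\<^sup>2 / (r (2 * \<rho>) p * (r (2 * \<rho>) p + 2 * \<rho> - x p))"
    using kap_eq[OF r_pos[OF assms(1)], of "2 * \<rho>"] r_pos[OF assms(1)] y_pos[OF assms(1)] by auto
  have ax: "\<bar>x p\<bar> \<le> r 0 p" using r_ge[of p 0] by simp
  have "(r (2 * \<rho>) p)\<^sup>2 \<le> (R + 2 * \<rho>)\<^sup>2"
  proof -
    have "(r (2 * \<rho>) p)\<^sup>2 = (r 0 p)\<^sup>2 - 4 * \<rho> * x p + 4 * \<rho>\<^sup>2"
      unfolding r_sq by (simp add: power2_eq_square algebra_simps)
    also have "\<dots> \<le> (r 0 p)\<^sup>2 + 4 * \<rho> * r 0 p + 4 * \<rho>\<^sup>2"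
    proof -
      have "4 * \<rho> * (- x p) \<le> 4 * \<rho> * r 0 p" using ax assms(2) by (intro mult_left_mono) auto
      then show ?thesis by simp
    qed
    also have "\<dots> = (r 0 p + 2 * \<rho>)\<^sup>2" by (simp add: power2_eq_square algebra_simps)
    also have "\<dots> \<le> (R + 2 * \<rho>)\<^sup>2" using assms r_nonneg[of 0 p] by (intro power_mono) auto
    finally show ?thesis .
  qed
  then have "r (2 * \<rho>) p \<le> R + 2 * \<rho>"
    using assms r_nonneg[of 0 p] by (intro power2_le_imp_le[of "r (2 * \<rho>) p"]) auto
  moreover have "r (2 * \<rho>) p + 2 * \<rho> - x p \<le> 2 * (R + 2 * \<rho>)" using calculation ax assms by simp
  ultimately have "r (2 * \<rho>) p * (r (2 * \<rho>) p + 2 * \<rho> - x p) \<le> (R + 2 * \<rho>) * (2 * (R + 2 * \<rho>))"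
    using p assms r_nonneg[of 0 p] by (intro mult_mono) auto
  moreover have "(R + 2 * \<rho>) * (2 * (R + 2 * \<rho>)) = 2 * (R + 2 * \<rho>)\<^sup>2" by (simp add: power2_eq_square)
  ultimately have le: "r (2 * \<rho>) p * (r (2 * \<rho>) p + 2 * \<rho> - x p) \<le> 2 * (R + 2 * \<rho>)\<^sup>2" by simp
  have D: "0 < r (2 * \<rho>) p * (r (2 * \<rho>) p + 2 * \<rho> - x p)" using p by (intro mult_pos_pos)
  show ?thesis unfolding p(3)
    using le D mult_pos_pos[OF less_le_trans[OF D le] D] by (intro divide_left_mono) auto
qed

text \<open>The function \<open>r 0 - \<rho>\<close> is unbounded, so it must first be shown that \<open>Q\<close> is bounded in terms of \<open>r 0\<close>;
  this comes from comparing \<open>kap (2\<rho>)\<close>, of order \<open>y\<^sup>2 / r\<^sup>2\<close>, with \<open>y\<^sup>2 / r\<^sup>3\<close>.\<close>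

lemma r_greater_component:
  assumes \<rho>: "0 < \<rho>" and PQ: "open P" "open Q" "P \<inter> Q = {}" "P \<union> Q = {p \<in> interior S. \<rho> < r 0 p}"
    and R: "\<And>q. q \<in> frontier S \<Longrightarrow> \<rho> < x q \<Longrightarrow> q \<notin> closure Q"
    and Lf: "(\<forall>q\<in>frontier S. x q < - \<rho> \<longrightarrow> q \<notin> closure P) \<or> (\<forall>q\<in>frontier S. x q < - \<rho> \<longrightarrow> q \<notin> closure Q)"
  shows "Q = {}"
proof -
  have Qi: "Q \<subseteq> interior S" and Qr: "\<And>q. q \<in> Q \<Longrightarrow> \<rho> < r 0 q" using PQ(4) by blast+
  have clQ: "closure Q \<subseteq> S" by (rule closure_in_S[OF Qi])
  have clr: "\<rho> \<le> r 0 q" if "q \<in> closure Q" for q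
    using continuous_ge_on_closure[of Q "r 0" q \<rho>] that Qr continuous_on_subset[OF r_cont clQ] by fastforce
  have bdQ: "r 0 q = \<rho> \<or> q \<in> frontier S" if q: "q \<in> closure Q" "q \<notin> Q" for q
  proof (rule ccontr)
    assume "\<not> ?thesis"
    then have "q \<in> interior S" "r 0 q > \<rho>" using clQ q clr[OF q(1)] S_cases by auto
    then have "q \<in> P" using q PQ(4) by blast
    then show False using q PQ(1,3) open_Int_closure_eq_empty[of P Q] by blast
  qed
  have frQ: "x q \<le> \<rho>" "\<bar>x q\<bar> \<ge> \<rho>" if "q \<in> closure Q" "q \<in> frontier S" for q
    using R[of q] that clr[of q] r_frontier[of q 0] by force+
  have r2: "0 < r (2 * \<rho>) q" if "q \<in> closure Q" for q
  proof (cases "q \<in> interior S")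
    case False
    then have "x q \<le> \<rho>" using that frQ clQ S_cases by blast
    then show ?thesis using \<rho> by (simp add: r_def add_pos_nonneg)
  qed (rule r_pos)
  have r1: "0 < r 0 q" if "q \<in> closure Q" for q using clr[OF that] \<rho> by simp
  \<comment> \<open>The factor \<open>\<rho> / 2\<close> comes from the level
    \<open>r 0 = \<rho>\<close>: there the two factors of the denominator of
    \<open>kap (2 * \<rho>)\<close> are at least \<open>\<rho>\<close> and
    \<open>2 * \<rho>\<close>, so it is at most \<open>y^2 / (2 \<rho>^2)\<close>, which is
    \<open>\<rho> / 2\<close> times \<open>y^2 / \<rho>^3\<close>.\<close>
  have key: "kap (2 * \<rho>) p - \<rho> / 2 * ((y p)\<^sup>2 / (r 0 p) ^ 3) \<le> 0" if "p \<in> Q" for p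
  proof (rule maximum_principle[OF PQ(2) Qi, where M=2])
    show "continuous_on (closure Q) (\<lambda>q. kap (2 * \<rho>) q - \<rho> / 2 * ((y q)\<^sup>2 / (r 0 q) ^ 3))"
      by (intro continuous_intros kap_cont r2 clQ continuous_on_subset[OF y_cont] continuous_on_subset[OF r_cont])
        (auto dest: r1)
    show "kap (2 * \<rho>) q - \<rho> / 2 * ((y q)\<^sup>2 / (r 0 q) ^ 3) \<le> 2" for q
    proof -
      have "0 \<le> \<rho> / 2 * ((y q)\<^sup>2 / (r 0 q) ^ 3)" using \<rho> r_nonneg[of 0 q] by simp
      then show ?thesis using kap_le[of "2 * \<rho>" q] by linarith
    qed
    show "\<exists>g l. sop (A q) 0 (\<lambda>q. kap (2 * \<rho>) q - \<rho> / 2 * ((y q)\<^sup>2 / (r 0 q) ^ 3)) q g l \<and> 0 \<le> l" if q: "q \<in> Q" for q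
    proof -
      have "q \<in> interior S" using q Qi by blast
      then obtain g g' where "sop (A q) 0 (kap (2 * \<rho>)) q g 0" "sop (A q) 0 (\<lambda>q. (y q)\<^sup>2 / (r 0 q) ^ 3) q g' 0"
        using kap_sop L_harmonics(4) by blast
      from sop_diff[OF this(1) sop_cmult[OF this(2), of "\<rho> / 2"]] show ?thesis by auto
    qed
    show "kap (2 * \<rho>) q - \<rho> / 2 * ((y q)\<^sup>2 / (r 0 q) ^ 3) \<le> 0" if q: "q \<in> closure Q" "q \<notin> Q" for q
    proof (cases "q \<in> frontier S")
      case True
      then show ?thesis using kap_zero[of q "2 * \<rho>"] y_frontier frQ[OF q(1)] \<rho> by simp
    next
      case False
      then have rq: "r 0 q = \<rho>" using bdQ q by blast
      then have xq: "x q \<le> \<rho>" using r_ge[of q 0] by simp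
      have k: "kap (2 * \<rho>) q = (y q)\<^sup>2 / (r (2 * \<rho>) q * (r (2 * \<rho>) q + 2 * \<rho> - x q))"
        using kap_eq(2)[OF r2[OF q(1)]] xq \<rho> by simp
      have "\<rho> \<le> r (2 * \<rho>) q" using r_ge[of q "2 * \<rho>"] xq by simp
      then have le: "\<rho> * (2 * \<rho>) \<le> r (2 * \<rho>) q * (r (2 * \<rho>) q + 2 * \<rho> - x q)"
        using xq \<rho> by (intro mult_mono) auto
      have pos: "0 < \<rho> * (2 * \<rho>)" using \<rho> by simp
      from le have "kap (2 * \<rho>) q \<le> (y q)\<^sup>2 / (\<rho> * (2 * \<rho>))"
        unfolding k using mult_pos_pos[OF less_le_trans[OF pos le] pos] by (intro divide_left_mono) auto
      then show ?thesis unfolding rq using \<rho> by (simp add: power3_eq_cube)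
    qed
  qed (use that in auto)
  \<comment> \<open>At \<open>t \<ge> 5 * \<rho>\<close> the inequality
    \<open>t^3 \<le> \<rho> (t + 2 \<rho>)^2\<close> would give
    \<open>t^3 \<le> (1/5) (7/5)^2 t^3\<close>, with a constant below 1.\<close>
  have small: "r 0 p < 5 * \<rho>" if p: "p \<in> Q" for p
  proof (rule ccontr)
    assume large: "\<not> r 0 p < 5 * \<rho>"
    define t where "t = r 0 p"
    have t: "5 * \<rho> \<le> t" "0 < t" using large \<rho> by (auto simp: t_def)
    have pi: "p \<in> interior S" using p Qi by blast
    have "(y p)\<^sup>2 / (2 * (t + 2 * \<rho>)\<^sup>2) \<le> \<rho> / 2 * ((y p)\<^sup>2 / t ^ 3)"
      using kap_ge[OF pi \<rho>, of t] key[OF p] unfolding t_def by simp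
    then have "(y p)\<^sup>2 * (1 / (2 * (t + 2 * \<rho>)\<^sup>2)) \<le> (y p)\<^sup>2 * (\<rho> / (2 * t ^ 3))" by (simp add: mult.commute)
    then have "1 / (2 * (t + 2 * \<rho>)\<^sup>2) \<le> \<rho> / (2 * t ^ 3)"
      using y_pos[OF pi] by (simp only: mult_le_cancel_left_pos zero_less_power)
    then have "t ^ 3 \<le> \<rho> * (t + 2 * \<rho>)\<^sup>2" using t \<rho> by (simp add: divide_simps split: if_splits)
    also have "\<dots> \<le> (t / 5) * (t + 2 * (t / 5))\<^sup>2" using t \<rho> by (intro mult_mono power_mono) auto
    also have "\<dots> = (49 / 125) * t ^ 3" by (simp add: power2_eq_square power3_eq_cube field_simps)
    finally show False using t by simp
  qed
  \<comment> \<open>Far out on the left arc, for instance at \<open>x = - 6 * \<rho>\<close>,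
    \<open>r 0\<close> exceeds \<open>5 * \<rho>\<close>, so the region next to it belongs to
    \<open>P\<close>. The left arc borders on one piece only, which is therefore
    \<open>P\<close>.\<close>
  have leftQ: "q \<notin> closure Q" if "q \<in> frontier S" "x q < - \<rho>" for q
  proof
    assume "q \<in> closure Q"
    then have noP: "\<forall>q\<in>frontier S. x q < - \<rho> \<longrightarrow> q \<notin> closure P" using Lf that by blast
    obtain \<gamma> where g: "homeomorphism (frontier S) UNIV x \<gamma>" using x_frontier_homeomorphism .
    define q' where "q' = \<gamma> (- 6 * \<rho>)"
    have q': "q' \<in> frontier S" "x q' = - 6 * \<rho>" using g unfolding homeomorphism_def q'_def by auto
    then have "r 0 q' \<in> {5 * \<rho><..}" using r_frontier[of q' 0] \<rho> by simp
    then obtain e where e: "e > 0" "\<And>p. p \<in> ball q' e \<inter> S \<Longrightarrow> 5 * \<rho> < r 0 p"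
      using near_frontier[of q' "{5 * \<rho><..}" 0] subsetD[OF frontier_subset_S q'(1)] by auto
    have sub: "ball q' e \<inter> interior S \<subseteq> P"
    proof
      fix p assume p: "p \<in> ball q' e \<inter> interior S"
      then have "5 * \<rho> < r 0 p" using e(2)[of p] interior_subset by auto
      then show "p \<in> P" using small[of p] p PQ(4) \<rho> by fastforce
    qed
    have "q' \<in> closure (interior S)" using q' frontier_subset_S closure_interior_S by auto
    then have "q' \<in> closure (ball q' e \<inter> interior S)"
      using open_Int_closure_subset[of "ball q' e" "interior S"] e by auto
    then have "q' \<in> closure P" using closure_mono[OF sub] by blast
    then show False using noP q' \<rho> by auto
  qed
  have "\<not> p \<in> Q" for p
  proof
    assume p: "p \<in> Q"
    have "r 0 p - \<rho> \<le> 0"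
    proof (rule maximum_principle[OF PQ(2) Qi, where M="4 * \<rho>"])
      show "continuous_on (closure Q) (\<lambda>q. r 0 q - \<rho>)"
        by (intro continuous_intros continuous_on_subset[OF r_cont] clQ)
      show "\<exists>g l. sop (A q) 0 (\<lambda>q. r 0 q - \<rho>) q g l \<and> 0 \<le> l" if "q \<in> Q" for q
      proof -
        obtain g where "sop (A q) 0 (r 0) q g 0" using L_harmonics(1) \<open>q \<in> Q\<close> Qi by blast
        from sop_diff[OF this sop_const[of _ _ \<rho>]] show ?thesis by auto
      qed
      show "r 0 q - \<rho> \<le> 0" if q: "q \<in> closure Q" "q \<notin> Q" for q
      proof (cases "q \<in> frontier S")
        case True
        then have "\<bar>x q\<bar> \<le> \<rho>" using frQ[OF q(1)] leftQ[of q] q by force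
        then show ?thesis using r_frontier[OF True, of 0] by simp
      qed (use bdQ q in force)
    qed (use p small in \<open>force+\<close>)
    then show False using Qr[OF p] by simp
  qed
  then show ?thesis by blast
qed

text \<open>Two frontier arcs border on this set. The pieces are named so that the right arc misses
  \<open>Q\<close>; the left arc may miss either, which accounts for the disjunction in
  \<open>r_greater_component\<close>.\<close>

lemma connected_r_greater:
  assumes \<rho>: "0 < \<rho>"
  shows "connected {p \<in> interior S. \<rho> < r 0 p}"
proof -
  define W where "W = {p \<in> interior S. \<rho> < r 0 p}"
  have Wo: "open W"
  proof -
    have "continuous_on (interior S) (r 0)" using r_cont interior_subset by (rule continuous_on_subset)
    then have "openin (top_of_set (interior S)) (interior S \<inter> r 0 -` {\<rho><..})"
      by (rule continuous_openin_preimage_gen) simp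
    moreover have "interior S \<inter> r 0 -` {\<rho><..} = W" by (auto simp: W_def)
    ultimately show ?thesis by (metis open_interior openin_open_eq)
  qed
  define I J where "I = {q \<in> frontier S. x q \<in> {..<-\<rho>}}" and "J = {q \<in> frontier S. x q \<in> {\<rho><..}}"
  have I: "connected I" "I \<subseteq> frontier S" "connected J" "J \<subseteq> frontier S"
    unfolding I_def J_def using frontier_arc_connected[of "{..<-\<rho>}"] frontier_arc_connected[of "{\<rho><..}"] by (auto simp: is_interval_io is_interval_oi)
  have IJq: "\<exists>e>0. ball q e \<inter> interior S \<subseteq> W" if "q \<in> I \<union> J" for q
  proof -
    have "q \<in> S" "r 0 q \<in> {\<rho><..}" using that frontier_subset_S r_frontier[of q 0] \<rho> by (auto simp: I_def J_def)
    then obtain e where "e > 0" "\<forall>p\<in>ball q e \<inter> S. r 0 p \<in> {\<rho><..}"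
      using near_frontier[of q "{\<rho><..}" 0] by auto
    then show ?thesis using interior_subset by (intro exI[of _ e]) (auto simp: W_def)
  qed
  show ?thesis
    unfolding W_def[symmetric]
  proof (rule ccontr)
    assume "\<not> connected W"
    then obtain P Q where PQ: "open P" "open Q" "W = P \<union> Q" "P \<inter> Q = {}" "P \<noteq> {}" "Q \<noteq> {}"
      using not_connected_open[OF Wo] by metis
    have sub: "P \<subseteq> interior S" "Q \<subseteq> interior S" using PQ(3) by (auto simp: W_def)
    have i: "I \<inter> closure P = {} \<or> I \<inter> closure Q = {}"
      using frontier_arc_one_side[OF I(1,2) _ PQ(1,2,4) sub] IJq PQ(3) by blast
    have j: "J \<inter> closure P = {} \<or> J \<inter> closure Q = {}"
      using frontier_arc_one_side[OF I(3,4) _ PQ(1,2,4) sub] IJq PQ(3) by blast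
    from j show False
    proof
      assume "J \<inter> closure Q = {}"
      then have "Q = {}"
        using i PQ(3) by (intro r_greater_component[OF \<rho> PQ(1,2,4)]) (auto simp: I_def J_def W_def)
      then show False using PQ(6) by simp
    next
      assume "J \<inter> closure P = {}"
      then have "P = {}"
        using i PQ(3,4) by (intro r_greater_component[OF \<rho> PQ(2,1)]) (auto simp: I_def J_def W_def)
      then show False using PQ(5) by simp
    qed
  qed
qed

end

section \<open>Levels of the modulus and bijectivity\<close>

lemma no_interior_extremum:
  fixes f :: "real \<Rightarrow> real"
  assumes f: "continuous_on {0..1} f" "f 0 = f 1"
    and inj: "\<And>t. 0 < t \<Longrightarrow> t < 1 \<Longrightarrow> \<exists>e>0. inj_on f ({0..1} \<inter> ball t e)"
  shows False
proof -
  obtain a where a: "a \<in> {0..1}" "\<And>s. s \<in> {0..1} \<Longrightarrow> f s \<le> f a"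
    using continuous_attains_sup[of "{0..1}" f] f by auto
  obtain b where b: "b \<in> {0..1}" "\<And>s. s \<in> {0..1} \<Longrightarrow> f b \<le> f s"
    using continuous_attains_inf[of "{0..1}" f] f by auto
  \<comment> \<open>As in Rolle's theorem: if the chosen maximum and minimum points are both end
    points, \<open>f\<close> is constant and the midpoint serves.\<close>
  have "\<exists>t. 0 < t \<and> t < 1 \<and> ((\<forall>s\<in>{0..1}. f s \<le> f t) \<or> (\<forall>s\<in>{0..1}. f t \<le> f s))"
  proof (cases "(0 < a \<and> a < 1) \<or> (0 < b \<and> b < 1)")
    case True
    then show ?thesis using a b by blast
  next
    case False
    then have fab: "f a = f 0" "f b = f 0" using a(1) b(1) f(2) by (auto simp: less_le)
    have "\<forall>s\<in>{0..1}. f s \<le> f (1/2)"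
    proof
      fix s :: real assume "s \<in> {0..1}"
      then show "f s \<le> f (1/2)"
        using a(2)[of s] b(2)[of "1/2"] fab by simp
    qed
    then show ?thesis by (intro exI[of _ "1/2"]) auto
  qed
  then obtain t where t: "0 < t" "t < 1" "(\<forall>s\<in>{0..1}. f s \<le> f t) \<or> (\<forall>s\<in>{0..1}. f t \<le> f s)" by blast
  obtain e where e: "e > 0" "inj_on f ({0..1} \<inter> ball t e)" using inj[OF t(1,2)] by blast
  define d where "d = min (e / 2) (min t (1 - t))"
  have d: "0 < d" "d < e" "0 \<le> t - d" "t + d \<le> 1" using e(1) t by (auto simp: d_def)
  have "{t - d..t + d} \<subseteq> {0..1} \<inter> ball t e" using d by (auto simp: dist_real_def)
  then have "inj_on f {t - d..t + d}" using e(2) inj_on_subset by blast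
  moreover have "continuous_on {t - d..t + d} f" using f(1) d by (auto intro: continuous_on_subset)
  ultimately have "f (t - d) < f t \<and> f t < f (t + d) \<or> f (t + d) < f t \<and> f t < f (t - d)"
    using continuous_inj_imp_mono[of "t - d" t "t + d" f] d by auto
  moreover have "t - d \<in> {0..1}" "t + d \<in> {0..1}" using d t by auto
  then have "f (t - d) \<le> f t \<and> f (t + d) \<le> f t \<or> f t \<le> f (t - d) \<and> f t \<le> f (t + d)"
    using t(3) by blast
  ultimately show False by linarith
qed

text \<open>\<open>N\<close> stands for the moduli of critical values, a null set by the Sard
  argument. A level \<open>|z| = \<rho>\<close> with \<open>\<rho>\<close> outside \<open>N\<close>
  consists of points where \<open>z\<close> is locally injective.\<close>

locale volumetric_chart = boundary_chart +
  fixes N :: "real set"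
  assumes open_image: "\<And>W. open W \<Longrightarrow> W \<subseteq> interior S \<Longrightarrow> open ((\<lambda>p. Complex (x p) (y p)) ` W)"
    and negligible_N: "negligible N"
    and regular: "\<And>p. p \<in> interior S \<Longrightarrow> sqrt ((x p)\<^sup>2 + (y p)\<^sup>2) \<notin> N \<Longrightarrow>
      \<exists>W. open W \<and> p \<in> W \<and> W \<subseteq> interior S \<and> inj_on (\<lambda>p. Complex (x p) (y p)) W"
begin

definition z :: "plane \<Rightarrow> complex" where "z p = Complex (x p) (y p)"

lemma z_simps [simp]: "Re (z p) = x p" "Im (z p) = y p"
  by (auto simp: z_def)

lemma norm_z: "norm (z p) = r 0 p"
  by (simp add: r_def cmod_def)

lemma z_cont: "continuous_on S z"
  unfolding z_def Complex_eq by (intro continuous_intros x_cont y_cont)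

lemma r0_cont_interior: "continuous_on (interior S) (r 0)"
  using r_cont interior_subset by (rule continuous_on_subset)

lemma modulus_shift:
  fixes w :: complex
  assumes "open O'" "w \<in> O'" "w \<noteq> 0"
  shows "\<exists>e>0. \<forall>s. \<bar>s - 1\<bar> < e \<longrightarrow> of_real s * w \<in> O'"
proof -
  obtain d where d: "d > 0" "ball w d \<subseteq> O'" using assms open_contains_ball by blast
  have "of_real s * w \<in> O'" if "\<bar>s - 1\<bar> < d / norm w" for s
  proof -
    have "dist w (of_real s * w) = \<bar>s - 1\<bar> * norm w"
    proof -
      have "w - of_real s * w = of_real (1 - s) * w" by (simp add: algebra_simps)
      then show ?thesis by (simp add: dist_norm norm_mult abs_minus_commute del: of_real_diff)
    qed
    also have "\<dots> < d" using that assms(3) by (simp add: field_simps)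
    finally show ?thesis using d by auto
  qed
  then show ?thesis using d assms(3) by (intro exI[of _ "d / norm w"]) auto
qed

text \<open>The image of a neighbourhood of \<open>p\<close> is open, so it contains points slightly
  inside and slightly outside the circle on the ray through \<open>z p\<close>. In particular
  \<open>r 0\<close> has no interior local extremum.\<close>

lemma level_in_closure:
  assumes p: "p \<in> interior S" "r 0 p = \<rho>"
  shows "p \<in> closure {q \<in> interior S. r 0 q < \<rho>}" "p \<in> closure {q \<in> interior S. \<rho> < r 0 q}"
proof -
  have rp: "\<rho> > 0" using r_pos[OF p(1), of 0] p by simp
  have zp: "z p \<noteq> 0" using rp norm_z[of p] p(2) by auto
  have *: "(\<exists>q\<in>W. r 0 q < \<rho>) \<and> (\<exists>q\<in>W. \<rho> < r 0 q)" if W: "open W" "p \<in> W" "W \<subseteq> interior S" for W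
  proof -
    have "open (z ` W)" using open_image[OF W(1,3)] by (simp add: z_def)
    then obtain e where e: "e > 0" "\<And>s. \<bar>s - 1\<bar> < e \<Longrightarrow> of_real s * z p \<in> z ` W"
      using modulus_shift[of "z ` W" "z p"] W zp by blast
    define d where "d = min (e/2) (1/2)"
    have d: "0 < d" "d < e" "d < 1" using e by (auto simp: d_def)
    obtain q1 where q1: "q1 \<in> W" "z q1 = of_real (1 - d) * z p" using e(2)[of "1 - d"] d by force
    obtain q2 where q2: "q2 \<in> W" "z q2 = of_real (1 + d) * z p" using e(2)[of "1 + d"] d by force
    have "norm (z q1) = (1 - d) * \<rho>" "norm (z q2) = (1 + d) * \<rho>"
      unfolding q1 q2 norm_mult norm_z p(2) using d by (auto simp del: of_real_diff of_real_add)
    moreover have "(1 - d) * \<rho> < 1 * \<rho>" "1 * \<rho> < (1 + d) * \<rho>"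
      using rp d by (intro mult_strict_right_mono; simp)+
    ultimately have "r 0 q1 < \<rho>" "\<rho> < r 0 q2" by (auto simp: norm_z)
    then show ?thesis using q1 q2 by blast
  qed
  show "p \<in> closure {q \<in> interior S. r 0 q < \<rho>}"
    unfolding closure_iff_nhds_not_empty
  proof (intro allI impI)
    fix A' U assume "U \<subseteq> A'" "open U" "p \<in> U"
    then show "{q \<in> interior S. r 0 q < \<rho>} \<inter> A' \<noteq> {}" using *[of "U \<inter> interior S"] p by blast
  qed
  show "p \<in> closure {q \<in> interior S. \<rho> < r 0 q}"
    unfolding closure_iff_nhds_not_empty
  proof (intro allI impI)
    fix A' U assume "U \<subseteq> A'" "open U" "p \<in> U"
    then show "{q \<in> interior S. \<rho> < r 0 q} \<inter> A' \<noteq> {}" using *[of "U \<inter> interior S"] p by blast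
  qed
qed

definition \<Gamma> :: "real \<Rightarrow> plane set" where "\<Gamma> \<rho> = {p \<in> interior S. r 0 p = \<rho>}"

text \<open>The closed sub- and superlevel sets lie between the open ones and their closures, so
  they inherit connectedness; they cover the interior, which is unicoherent, and meet in the
  level.\<close>

lemma connected_level:
  assumes \<rho>: "0 < \<rho>"
  shows "connected (\<Gamma> \<rho>)"
proof -
  define P where "P = {p \<in> interior S. r 0 p \<le> \<rho>}"
  define Q where "Q = {p \<in> interior S. \<rho> \<le> r 0 p}"
  have "connected P"
  proof (rule connected_intermediate_closure[OF connected_r_less[of \<rho>]])
    show "P \<subseteq> closure {q \<in> interior S. r 0 q < \<rho>}"
    proof
      fix p assume "p \<in> P"
      then consider "p \<in> {q \<in> interior S. r 0 q < \<rho>}" | "p \<in> interior S" "r 0 p = \<rho>" by (force simp: P_def)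
      then show "p \<in> closure {q \<in> interior S. r 0 q < \<rho>}"
        by cases (auto intro: subsetD[OF closure_subset] level_in_closure(1))
    qed
  qed (auto simp: P_def)
  moreover have "connected Q"
  proof (rule connected_intermediate_closure[OF connected_r_greater[OF \<rho>]])
    show "Q \<subseteq> closure {q \<in> interior S. \<rho> < r 0 q}"
    proof
      fix p assume "p \<in> Q"
      then consider "p \<in> {q \<in> interior S. \<rho> < r 0 q}" | "p \<in> interior S" "r 0 p = \<rho>" by (force simp: Q_def)
      then show "p \<in> closure {q \<in> interior S. \<rho> < r 0 q}"
        by cases (auto intro: subsetD[OF closure_subset] level_in_closure(2))
    qed
  qed (auto simp: Q_def)
  moreover have "closedin (top_of_set (interior S)) P" "closedin (top_of_set (interior S)) Q"
  proof -
    have "P = interior S \<inter> r 0 -` {..\<rho>}" "Q = interior S \<inter> r 0 -` {\<rho>..}" by (auto simp: P_def Q_def)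
    then show "closedin (top_of_set (interior S)) P" "closedin (top_of_set (interior S)) Q"
      using continuous_closedin_preimage[OF r0_cont_interior] by auto
  qed
  moreover have "P \<union> Q = interior S" by (auto simp: P_def Q_def)
  moreover have "unicoherent (interior S)"
    by (rule convex_imp_unicoherent) (simp add: convex_S convex_interior)
  ultimately have "connected (P \<inter> Q)" using unicoherentD by blast
  moreover have "P \<inter> Q = \<Gamma> \<rho>" by (auto simp: P_def Q_def \<Gamma>_def)
  ultimately show ?thesis by simp
qed

text \<open>On the frontier \<open>r 0\<close> is \<open>\<bar>x\<bar>\<close>, and \<open>x\<close>
  takes values on both sides of \<open>x q\<close> near \<open>q\<close>. So the convex intersection
  of a small ball with the interior contains points with \<open>r 0\<close> below and above
  \<open>\<bar>x q\<bar>\<close>, and the intermediate value theorem applies.\<close>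

lemma level_near_frontier:
  assumes q: "q \<in> frontier S" "x q \<noteq> 0" and \<epsilon>: "0 < \<epsilon>"
  shows "\<exists>p\<in>\<Gamma> \<bar>x q\<bar>. \<bar>x p - x q\<bar> < \<epsilon>"
proof -
  obtain \<gamma> where g: "homeomorphism (frontier S) UNIV x \<gamma>" using x_frontier_homeomorphism .
  then have \<gamma>: "continuous_on UNIV \<gamma>" "\<And>t. x (\<gamma> t) = t" "\<And>t. \<gamma> t \<in> frontier S" "\<gamma> (x q) = q"
    using q unfolding homeomorphism_def by auto
  have qS: "q \<in> S" using q frontier_subset_S by blast
  obtain e where e: "e > 0" "\<And>p. p \<in> S \<Longrightarrow> dist p q < e \<Longrightarrow> dist (x p) (x q) < \<epsilon>"
    using x_cont[unfolded continuous_on_iff] qS \<epsilon> by blast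
  define B where "B = ball q e \<inter> interior S"
  have cB: "connected B" unfolding B_def
    using convex_S by (intro convex_connected convex_Int convex_interior) auto
  have "isCont \<gamma> (x q)" using \<gamma>(1) by (simp add: continuous_on_eq_continuous_at)
  then obtain d where d: "d > 0" "\<And>t. dist t (x q) < d \<Longrightarrow> dist (\<gamma> t) q < e"
    using \<gamma>(4) e(1) unfolding continuous_at_eps_delta dist_real_def
    by (metis continuous_at_eps_delta dist_commute dist_real_def)
  have near: "\<exists>p\<in>B. r 0 p \<in> U" if U: "open U" "\<bar>t\<bar> \<in> U" "dist t (x q) < d" for U t
  proof -
    have "r 0 (\<gamma> t) = \<bar>t\<bar>" using r_frontier[OF \<gamma>(3)] \<gamma>(2) by simp
    then obtain e' where e': "e' > 0" "\<forall>p\<in>ball (\<gamma> t) e' \<inter> S. r 0 p \<in> U"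
      using near_frontier[OF subsetD[OF frontier_subset_S \<gamma>(3)] U(1)] U(2) by metis
    have "\<gamma> t \<in> closure (interior S)" using \<gamma>(3) frontier_subset_S closure_interior_S by auto
    moreover have "open (ball (\<gamma> t) e' \<inter> ball q e)" "\<gamma> t \<in> ball (\<gamma> t) e' \<inter> ball q e"
      using d(2)[OF U(3)] e'(1) by (auto simp: dist_commute)
    ultimately obtain p where "p \<in> interior S" "p \<in> ball (\<gamma> t) e' \<inter> ball q e"
      using open_Int_closure_eq_empty[of "ball (\<gamma> t) e' \<inter> ball q e" "interior S"] by blast
    then show ?thesis using e'(2) interior_subset[of S] by (intro bexI[of _ p]) (auto simp: B_def)
  qed
  define s where "s = min (d / 2) (\<bar>x q\<bar> / 2)"
  have s: "s > 0" "s < d" "s < \<bar>x q\<bar>" using d(1) q(2) by (auto simp: s_def)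
  define t1 t2 where "t1 = x q - sgn (x q) * s" and "t2 = x q + sgn (x q) * s"
  have t: "dist t1 (x q) < d" "dist t2 (x q) < d" "\<bar>t1\<bar> < \<bar>x q\<bar>" "\<bar>x q\<bar> < \<bar>t2\<bar>"
    using s q(2) by (auto simp: t1_def t2_def dist_real_def sgn_if)
  obtain p1 where p1: "p1 \<in> B" "r 0 p1 < \<bar>x q\<bar>" using near[of "{..<\<bar>x q\<bar>}" t1] t by auto
  obtain p2 where p2: "p2 \<in> B" "\<bar>x q\<bar> < r 0 p2" using near[of "{\<bar>x q\<bar><..}" t2] t by auto
  have cr: "connected (r 0 ` B)"
    by (rule connected_continuous_image[OF continuous_on_subset[OF r0_cont_interior] cB]) (auto simp: B_def)
  have "\<bar>x q\<bar> \<in> r 0 ` B"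
    by (rule connectedD_interval[OF cr imageI[OF p1(1)] imageI[OF p2(1)]]) (use p1 p2 in simp_all)
  then obtain p where p: "p \<in> B" "r 0 p = \<bar>x q\<bar>" by force
  moreover have "dist (x p) (x q) < \<epsilon>"
    using p interior_subset by (intro e(2)) (auto simp: B_def dist_commute)
  ultimately show ?thesis by (intro bexI[of _ p]) (auto simp: \<Gamma>_def B_def dist_real_def)
qed

text \<open>The connected level \<open>|z| = norm w\<close> contains points with \<open>x\<close>
  close to both ends of the diameter, so \<open>x\<close> takes the value \<open>Re w\<close> on it.
  Modulus, \<open>x\<close> and the sign of \<open>y\<close> determine the point.\<close>

lemma surjective_interior:
  assumes "Im w > 0"
  shows "\<exists>p\<in>interior S. z p = w"
proof -
  define \<rho> where "\<rho> = norm w"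
  have \<rho>: "0 < \<rho>" using assms by (auto simp: \<rho>_def)
  have lt: "\<bar>Re w\<bar> < \<rho>"
  proof -
    have "(Re w)\<^sup>2 < \<rho>\<^sup>2" using assms by (simp add: \<rho>_def cmod_power2)
    then show ?thesis using \<rho> abs_le_square_iff[of \<rho> "Re w"] by linarith
  qed
  obtain \<gamma> where g: "homeomorphism (frontier S) UNIV x \<gamma>" using x_frontier_homeomorphism .
  then have \<gamma>: "\<And>t. x (\<gamma> t) = t" "\<And>t. \<gamma> t \<in> frontier S"
    unfolding homeomorphism_def by auto
  have lt2: "0 < \<rho> - Re w" "0 < \<rho> + Re w" using lt by auto
  obtain p1 where p1: "p1 \<in> \<Gamma> \<rho>" "\<bar>x p1 - \<rho>\<bar> < \<rho> - Re w"
    using level_near_frontier[of "\<gamma> \<rho>" "\<rho> - Re w"] \<gamma> \<rho> lt2 by auto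
  obtain p2 where p2: "p2 \<in> \<Gamma> \<rho>" "\<bar>x p2 + \<rho>\<bar> < \<rho> + Re w"
    using level_near_frontier[of "\<gamma> (- \<rho>)" "\<rho> + Re w"] \<gamma> \<rho> lt2 by auto
  have cx: "connected (x ` \<Gamma> \<rho>)"
    using interior_subset by (intro connected_continuous_image[OF continuous_on_subset[OF x_cont] connected_level[OF \<rho>]]) (auto simp: \<Gamma>_def)
  have "Re w \<in> x ` \<Gamma> \<rho>"
    by (rule connectedD_interval[OF cx imageI[OF p2(1)] imageI[OF p1(1)]]) (use p1(2) p2(2) in linarith)+
  then obtain p where p: "p \<in> interior S" "r 0 p = \<rho>" "x p = Re w" by (auto simp: \<Gamma>_def)
  have "(y p)\<^sup>2 = (Im w)\<^sup>2" using r_sq[of 0 p] p by (simp add: \<rho>_def cmod_power2)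
  then have "y p = Im w" using y_pos[OF p(1)] assms by (simp add: power2_eq_iff)
  then show ?thesis using p by (intro bexI[of _ p]) (auto simp: complex_eq_iff)
qed

text \<open>On one level \<open>z\<close> is determined by \<open>x\<close>, and a regular level is
  locally an arc on which \<open>x\<close> is injective. If two of its points had the same image,
  \<open>x\<close> along an arc joining them in the level would have equal end values and yet be
  locally injective in between.\<close>

lemma regular_level_inj:
  assumes \<rho>: "0 < \<rho>" "\<rho> \<notin> N"
  shows "inj_on z (\<Gamma> \<rho>)"
proof (rule inj_onI, rule ccontr)
  fix p p' assume p: "p \<in> \<Gamma> \<rho>" "p' \<in> \<Gamma> \<rho>" "z p = z p'" "p \<noteq> p'"
  define h where "h t = Complex t (sqrt (\<rho>\<^sup>2 - t\<^sup>2))" for t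
  have h: "h (x q) = z q" if "q \<in> \<Gamma> \<rho>" for q
  proof -
    have "\<rho>\<^sup>2 - (x q)\<^sup>2 = (y q)\<^sup>2" "y q > 0" using that r_sq[of 0 q] y_pos by (auto simp: \<Gamma>_def)
    then show ?thesis by (simp add: h_def z_def)
  qed
  have loc: "\<exists>T. openin (top_of_set (\<Gamma> \<rho>)) T \<and> q \<in> T \<and> path_connected T \<and> inj_on x T" if q: "q \<in> \<Gamma> \<rho>" for q
  proof -
    have qi: "q \<in> interior S" "sqrt ((x q)\<^sup>2 + (y q)\<^sup>2) \<notin> N" using q \<rho> by (auto simp: \<Gamma>_def r_def)
    obtain W where W: "open W" "q \<in> W" "W \<subseteq> interior S" "inj_on z W"
      using regular[OF qi] unfolding z_def[symmetric] by blast
    have zW: "continuous_on W z" using z_cont W(3) interior_subset by (meson continuous_on_subset order_trans)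
    have "openin (top_of_set (z ` W)) (z ` U)" if "openin (top_of_set W) U" for U
    proof -
      have "open U" "U \<subseteq> W" using that W(1) openin_open_eq by auto
      then have "open (z ` U)" using open_image[of U] W(3) by (simp add: z_def)
      then show ?thesis using \<open>U \<subseteq> W\<close> by (simp add: image_mono open_subset)
    qed
    then obtain g where g: "homeomorphism W (z ` W) z g"
      using homeomorphism_injective_open_map[OF zW refl W(4)] by blast
    have zo: "open (z ` W)" using open_image[OF W(1,3)] by (simp add: z_def)
    have yq: "y q > 0" using y_pos qi by blast
    then have "(x q)\<^sup>2 < \<rho>\<^sup>2" using r_sq[of 0 q] q by (auto simp: \<Gamma>_def)
    have "isCont h (x q)" unfolding h_def Complex_eq by (intro continuous_intros)
    moreover have "h (x q) \<in> z ` W" using h[OF q] W by auto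
    ultimately obtain d where d: "d > 0" "\<And>t. dist t (x q) < d \<Longrightarrow> h t \<in> z ` W"
      using zo unfolding continuous_at_open by (metis (no_types, opaque_lifting) dist_commute mem_ball open_contains_ball subsetD)
    \<comment> \<open>Besides keeping the half-circle \<open>h t\<close> in the image of
      \<open>W\<close>, this keeps \<open>\<bar>t\<bar>\<close> below \<open>\<rho>\<close>, so that
      the root in \<open>h\<close> is taken of a positive number.\<close>
    define e where "e = min d (\<rho> - \<bar>x q\<bar>)"
    have e: "e > 0"
      using d(1) \<open>(x q)\<^sup>2 < \<rho>\<^sup>2\<close> \<rho>(1) abs_le_square_iff[of \<rho> "x q"] by (simp add: e_def)
    define T where "T = (g \<circ> h) ` ball (x q) e"
    have hW: "h t \<in> z ` W" if "t \<in> ball (x q) e" for t using d(2) that by (auto simp: e_def dist_commute)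
    have "continuous_on (ball (x q) e) h" unfolding h_def Complex_eq by (intro continuous_intros)
    moreover have "continuous_on (h ` ball (x q) e) g"
      using g hW unfolding homeomorphism_def by (meson continuous_on_subset image_subsetI)
    ultimately have "path_connected T"
      unfolding T_def by (intro path_connected_continuous_image continuous_on_compose) (auto intro: convex_imp_path_connected)
    moreover have Teq: "T = \<Gamma> \<rho> \<inter> (W \<inter> x -` ball (x q) e)"
    proof (intro equalityI subsetI)
      fix q' assume "q' \<in> T"
      then obtain t where t: "t \<in> ball (x q) e" "q' = g (h t)" by (auto simp: T_def)
      then have q': "q' \<in> W" "z q' = h t" using g hW[OF t(1)] unfolding homeomorphism_def by auto
      then have xt: "x q' = t" "y q' = sqrt (\<rho>\<^sup>2 - t\<^sup>2)" by (metis h_def complex.sel z_simps)+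
      have "\<bar>t\<bar> < \<rho>" using t(1) by (auto simp: e_def dist_real_def)
      then have "\<bar>t\<bar>\<^sup>2 < \<rho>\<^sup>2" by (intro power_strict_mono) auto
      then have "r 0 q' = \<rho>" using \<rho>(1) unfolding r_def xt by (simp add: less_imp_le)
      then show "q' \<in> \<Gamma> \<rho> \<inter> (W \<inter> x -` ball (x q) e)" using q' xt t W(3) by (auto simp: \<Gamma>_def)
    next
      fix q' assume q': "q' \<in> \<Gamma> \<rho> \<inter> (W \<inter> x -` ball (x q) e)"
      then have "g (h (x q')) = q'" using h g unfolding homeomorphism_def by auto
      then show "q' \<in> T" unfolding T_def using q' by (intro image_eqI[of _ _ "x q'"]) auto
    qed
    moreover have "openin (top_of_set (\<Gamma> \<rho>)) T"
    proof -
      have "continuous_on W x" using x_cont W(3) interior_subset by (meson continuous_on_subset order_trans)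
      then have "openin (top_of_set W) (W \<inter> x -` ball (x q) e)"
        by (rule continuous_openin_preimage_gen) simp
      then have "open (W \<inter> x -` ball (x q) e)" using W(1) openin_open_eq by blast
      then show ?thesis unfolding Teq by (rule openin_open_Int)
    qed
    moreover have "q \<in> T" unfolding Teq using q W e by auto
    moreover have "inj_on x T"
    proof (rule inj_onI)
      fix a b assume ab: "a \<in> T" "b \<in> T" "x a = x b"
      then have "z a = z b" using h[of a] h[of b] Teq by auto
      then show "a = b" using W(4) ab Teq by (auto dest: inj_onD)
    qed
    ultimately show ?thesis by blast
  qed
  have pc: "path_connected (\<Gamma> \<rho>)"
    unfolding path_connected_component
  proof (intro ballI)
    fix a b assume ab: "a \<in> \<Gamma> \<rho>" "b \<in> \<Gamma> \<rho>"
    show "path_component (\<Gamma> \<rho>) a b"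
    proof (rule connected_equivalence_relation[OF connected_level[OF \<rho>(1)] ab])
      fix q assume "q \<in> \<Gamma> \<rho>"
      then obtain T where T: "openin (top_of_set (\<Gamma> \<rho>)) T" "q \<in> T" "path_connected T" using loc by blast
      then show "\<exists>T. openin (top_of_set (\<Gamma> \<rho>)) T \<and> q \<in> T \<and> (\<forall>x\<in>T. path_component (\<Gamma> \<rho>) q x)"
        by (metis openin_imp_subset path_component_of_subset path_connected_component)
    qed (auto intro: path_component_sym path_component_trans)
  qed
  obtain g where g: "arc g" "path_image g \<subseteq> \<Gamma> \<rho>" "pathstart g = p" "pathfinish g = p'"
    using pc p unfolding path_connected_arcwise by blast
  have gc: "continuous_on {0..1} g" and gi: "inj_on g {0..1}" using g(1) by (auto simp: arc_def path_def)
  have g\<Gamma>: "g t \<in> \<Gamma> \<rho>" if "t \<in> {0..1}" for t using g(2) that by (auto simp: path_image_def)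
  have "g ` {0..1} \<subseteq> S" using g\<Gamma> interior_subset[of S] by (auto simp: \<Gamma>_def)
  show False
  proof (rule no_interior_extremum[of "x \<circ> g"])
    show "continuous_on {0..1} (x \<circ> g)"
      by (rule continuous_on_compose[OF gc continuous_on_subset[OF x_cont \<open>g ` {0..1} \<subseteq> S\<close>]])
    show "(x \<circ> g) 0 = (x \<circ> g) 1"
      using g(3,4) arg_cong[OF p(3), of Re] by (simp add: pathstart_def pathfinish_def)
    fix t :: real assume t: "0 < t" "t < 1"
    then have "g t \<in> \<Gamma> \<rho>" using g\<Gamma> by simp
    then obtain T where T: "openin (top_of_set (\<Gamma> \<rho>)) T" "g t \<in> T" "inj_on x T" using loc by blast
    obtain O' where O': "open O'" "T = \<Gamma> \<rho> \<inter> O'" using T(1) unfolding openin_open by blast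
    have "openin (top_of_set {0..1}) ({0..1} \<inter> g -` O')"
      by (rule continuous_openin_preimage_gen[OF gc O'(1)])
    then obtain U where U: "open U" "{0..1} \<inter> g -` O' = {0..1} \<inter> U" unfolding openin_open by blast
    have "t \<in> {0..1} \<inter> g -` O'" using t T(2) O'(2) by simp
    then have "t \<in> U" unfolding U(2) by simp
    then obtain e where e: "e > 0" "ball t e \<subseteq> U" using U(1) open_contains_ball by blast
    have "inj_on (x \<circ> g) ({0..1} \<inter> ball t e)"
    proof (rule comp_inj_on)
      show "inj_on g ({0..1} \<inter> ball t e)" using gi by (rule inj_on_subset) auto
      show "inj_on x (g ` ({0..1} \<inter> ball t e))"
      proof (rule inj_on_subset[OF T(3)])
        show "g ` ({0..1} \<inter> ball t e) \<subseteq> T"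
        proof
          fix v assume "v \<in> g ` ({0..1} \<inter> ball t e)"
          then obtain s where s: "s \<in> {0..1}" "s \<in> ball t e" "v = g s" by blast
          then have "s \<in> {0..1} \<inter> U" using e(2) by blast
          then have "g s \<in> O'" unfolding U(2)[symmetric] by simp
          then show "v \<in> T" using g\<Gamma>[OF s(1)] s(3) O'(2) by simp
        qed
      qed
    qed
    then show "\<exists>e>0. inj_on (x \<circ> g) ({0..1} \<inter> ball t e)" using e by blast
  qed
qed

lemma injective_interior: "inj_on z (interior S)"
proof (rule inj_onI, rule ccontr)
  fix p p' assume p: "p \<in> interior S" "p' \<in> interior S" "z p = z p'" "p \<noteq> p'"
  obtain U U' where U: "open U" "open U'" "p \<in> U" "p' \<in> U'" "U \<inter> U' = {}"
    using hausdorff[OF p(4)] by blast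
  define W W' where "W = U \<inter> interior S" and "W' = U' \<inter> interior S"
  have "open (z ` W)" "open (z ` W')"
    using open_image[of W] open_image[of W'] U by (auto simp: W_def W'_def z_def)
  then have "open (z ` W \<inter> z ` W')" by blast
  moreover have "z p \<in> z ` W \<inter> z ` W'"
  proof
    show "z p \<in> z ` W" using p(1) U by (simp add: W_def)
    show "z p \<in> z ` W'" unfolding p(3) using p(2) U by (simp add: W'_def)
  qed
  moreover have zp: "norm (z p) > 0" using r_pos[OF p(1), of 0] by (simp add: norm_z)
  ultimately obtain e where e: "e > 0" "\<And>s. \<bar>s - 1\<bar> < e \<Longrightarrow> of_real s * z p \<in> z ` W \<inter> z ` W'"
    using modulus_shift[of "z ` W \<inter> z ` W'" "z p"] by auto
  \<comment> \<open>Moduli of points slightly beyond \<open>z p\<close> on its ray, all of which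
    have preimages in both disjoint neighbourhoods. An interval is not negligible, so one of these
    moduli is outside \<open>N\<close>.\<close>
  define J where "J = {norm (z p)<..<norm (z p) * (1 + e)}"
  have "\<not> J \<subseteq> N"
  proof
    assume "J \<subseteq> N"
    then have "negligible J" using negligible_N negligible_subset by blast
    moreover have "J \<noteq> {}" using e(1) zp by (auto simp: J_def)
    ultimately show False using open_not_negligible[of J] by (simp add: J_def)
  qed
  then obtain \<rho> where \<rho>: "\<rho> \<in> J" "\<rho> \<notin> N" by blast
  define s where "s = \<rho> / norm (z p)"
  have s: "s > 1" "s < 1 + e" using \<rho>(1) zp by (auto simp: J_def s_def field_simps)
  then have sz: "of_real s * z p \<in> z ` W \<inter> z ` W'" by (intro e(2)) auto
  obtain a where a: "of_real s * z p = z a" "a \<in> W" using IntD1[OF sz] by (rule imageE)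
  obtain b where b: "of_real s * z p = z b" "b \<in> W'" using IntD2[OF sz] by (rule imageE)
  note ab = a(2) b(2) a(1)[symmetric] b(1)[symmetric]
  have "s * norm (z p) = \<rho>" using zp by (simp add: s_def)
  then have "norm (z a) = \<rho>" "norm (z b) = \<rho>" unfolding ab norm_mult using s by auto
  then have "r 0 a = \<rho>" "r 0 b = \<rho>" by (simp_all only: norm_z)
  then have "a \<in> \<Gamma> \<rho>" "b \<in> \<Gamma> \<rho>" using ab(1,2) by (auto simp: \<Gamma>_def W_def W'_def)
  moreover have "0 < \<rho>" using \<rho>(1) less_trans[OF zp, of \<rho>] by (simp add: J_def)
  ultimately have "a = b" using inj_onD[OF regular_level_inj[OF _ \<rho>(2)], of a b] ab by simp
  then show False using ab U(5) by (auto simp: W_def W'_def)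
qed

theorem bijective: "bij_betw z S {w. 0 \<le> Im w}"
proof -
  have "inj_on z S"
  proof (rule inj_onI)
    fix p q assume pq: "p \<in> S" "q \<in> S" "z p = z q"
    have eq: "x p = x q" "y p = y q" using pq(3) by (metis z_simps)+
    consider "p \<in> interior S" "q \<in> interior S" | "p \<in> frontier S" "q \<in> frontier S"
      using pq eq S_cases y_pos y_frontier by (metis less_irrefl)
    then show "p = q"
    proof cases
      case 1 then show ?thesis using injective_interior pq by (auto dest: inj_onD)
    next
      case 2 then show ?thesis using inj_on_x_frontier eq by (auto dest: inj_onD)
    qed
  qed
  moreover have "z ` S = {w. 0 \<le> Im w}"
  proof (intro equalityI subsetI)
    fix w assume "w \<in> z ` S"
    then show "w \<in> {w. 0 \<le> Im w}" using S_cases y_pos y_frontier by (auto simp: less_imp_le)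
  next
    fix w assume w: "w \<in> {w. 0 \<le> Im w}"
    show "w \<in> z ` S"
    proof (cases "Im w = 0")
      case True
      obtain \<gamma> where "homeomorphism (frontier S) UNIV x \<gamma>" using x_frontier_homeomorphism .
      then have \<gamma>: "x (\<gamma> (Re w)) = Re w" "\<gamma> (Re w) \<in> frontier S"
        unfolding homeomorphism_def by auto
      then have "z (\<gamma> (Re w)) = w" using y_frontier True by (simp add: complex_eq_iff)
      then show ?thesis using \<gamma> frontier_subset_S by (metis image_eqI subsetD)
    next
      case False
      then show ?thesis using surjective_interior[of w] w interior_subset by fastforce
    qed
  qed
  ultimately show ?thesis by (simp add: bij_betw_def)
qed

end

section \<open>Calculus of \<open>C\<^sup>k\<close> functions\<close>

lemma frechet_derivative_eq: "(f has_derivative f') (at x) \<Longrightarrow> frechet_derivative f (at x) v = f' v"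
  by (metis frechet_derivative_at)

lemma Ck_on_differentiable: "Ck_on (Suc k) S f \<Longrightarrow> x \<in> S \<Longrightarrow> f differentiable (at x)"
  by simp

lemma Ck_on_has_derivative:
  "Ck_on (Suc k) S f \<Longrightarrow> x \<in> S \<Longrightarrow> (f has_derivative frechet_derivative f (at x)) (at x)"
  using frechet_derivative_works by (metis Ck_on_differentiable)

lemma Ck_on_cong:
  assumes "open S" "\<And>x. x \<in> S \<Longrightarrow> f x = g x" "Ck_on k S f"
  shows "Ck_on k S g"
  using assms(2,3)
proof (induction k arbitrary: f g)
  case 0
  then show ?case using continuous_on_cong[of S S f g] by simp
next
  case (Suc k)
  have d: "(g has_derivative frechet_derivative f (at x)) (at x)" if "x \<in> S" for x
    by (rule has_derivative_transform_within_open[OF Ck_on_has_derivative[OF Suc.prems(2) that] assms(1) that])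
      (use Suc.prems in auto)
  have "Ck_on k S (\<lambda>x. frechet_derivative g (at x) v)" for v
  proof (rule Suc.IH)
    show "Ck_on k S (\<lambda>x. frechet_derivative f (at x) v)" using Suc.prems(2) by simp
    show "frechet_derivative f (at x) v = frechet_derivative g (at x) v" if "x \<in> S" for x
      using frechet_derivative_eq[OF d[OF that]] by simp
  qed
  then show ?case using d by (auto simp: differentiable_def)
qed

lemma Ck_on_SucI:
  assumes "open S" "\<And>x. x \<in> S \<Longrightarrow> (f has_derivative f' x) (at x)" "\<And>v. Ck_on k S (\<lambda>x. f' x v)"
  shows "Ck_on (Suc k) S f"
proof -
  have "Ck_on k S (\<lambda>x. frechet_derivative f (at x) v)" for v
    by (rule Ck_on_cong[OF assms(1) _ assms(3)[of v]]) (use frechet_derivative_eq[OF assms(2)] in simp)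
  then show ?thesis using assms(2) by (auto simp: differentiable_def)
qed

lemma Ck_on_continuous: "Ck_on k S f \<Longrightarrow> continuous_on S f"
  by (cases k) (auto intro!: continuous_at_imp_continuous_on differentiable_imp_continuous_within)

lemma Ck_on_Suc_imp: "Ck_on (Suc k) S f \<Longrightarrow> Ck_on k S f"
proof (induction k arbitrary: f)
  case 0
  then show ?case using Ck_on_continuous by fastforce
next
  case (Suc k)
  have "\<forall>v. Ck_on (Suc k) S (\<lambda>x. frechet_derivative f (at x) v)"
    using Suc.prems unfolding Ck_on.simps(2)[of "Suc k" S f] by blast
  then have "\<forall>v. Ck_on k S (\<lambda>x. frechet_derivative f (at x) v)" using Suc.IH by blast
  then show ?case using Suc.prems by simp
qed

lemma Ck_on_subset: "Ck_on k S f \<Longrightarrow> T \<subseteq> S \<Longrightarrow> Ck_on k T f"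
  by (induction k arbitrary: f) (auto intro: continuous_on_subset)

lemma Ck_on_linear:
  assumes "open S" "bounded_linear h" "Ck_on k S f"
  shows "Ck_on k S (\<lambda>x. h (f x))"
  using assms(3)
proof (induction k arbitrary: f)
  case 0
  then show ?case using assms(2) by (auto intro: bounded_linear.continuous_on)
next
  case (Suc k)
  show ?case
    by (rule Ck_on_SucI[OF assms(1) bounded_linear.has_derivative[OF assms(2) Ck_on_has_derivative[OF Suc.prems]]])
      (use Suc in simp_all)
qed

lemma Ck_on_const: "open S \<Longrightarrow> Ck_on k S (\<lambda>x. c)"
proof (induction k arbitrary: c)
  case (Suc k)
  show ?case by (rule Ck_on_SucI[OF Suc.prems has_derivative_const]) (use Suc in simp)
qed simp

lemma Ck_on_add:
  assumes "open S" "Ck_on k S f" "Ck_on k S g"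
  shows "Ck_on k S (\<lambda>x. f x + g x)"
  using assms(2,3)
proof (induction k arbitrary: f g)
  case (Suc k)
  show ?case
    by (rule Ck_on_SucI[OF assms(1) has_derivative_add[OF Ck_on_has_derivative[OF Suc.prems(1)] Ck_on_has_derivative[OF Suc.prems(2)]]])
      (use Suc in simp_all)
qed (auto intro: continuous_intros)

lemma Ck_on_mult:
  fixes f g :: "'a::euclidean_space \<Rightarrow> real"
  assumes "open S" "Ck_on k S f" "Ck_on k S g"
  shows "Ck_on k S (\<lambda>x. f x * g x)"
  using assms(2,3)
proof (induction k arbitrary: f g)
  case (Suc k)
  have "Ck_on k S f" "Ck_on k S g" using Suc.prems Ck_on_Suc_imp by blast+
  then show ?case
    by (intro Ck_on_SucI[OF assms(1) has_derivative_mult[OF Ck_on_has_derivative[OF Suc.prems(1)] Ck_on_has_derivative[OF Suc.prems(2)]]])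
      (use Suc in \<open>simp_all add: Ck_on_add[OF assms(1)]\<close>)
qed (auto intro: continuous_intros)

lemma Ck_on_uminus:
  fixes f :: "'a::euclidean_space \<Rightarrow> real"
  assumes "open S" "Ck_on k S f"
  shows "Ck_on k S (\<lambda>x. - f x)"
  using Ck_on_mult[OF assms(1) Ck_on_const[OF assms(1), of k "-1"] assms(2)] by simp

lemma Ck_on_diff:
  fixes f g :: "'a::euclidean_space \<Rightarrow> real"
  assumes "open S" "Ck_on k S f" "Ck_on k S g"
  shows "Ck_on k S (\<lambda>x. f x - g x)"
  using Ck_on_add[OF assms(1,2) Ck_on_uminus[OF assms(1,3)]] by simp

lemma Ck_on_inverse:
  fixes f :: "'a::euclidean_space \<Rightarrow> real"
  assumes "open S" "Ck_on k S f" "\<And>x. x \<in> S \<Longrightarrow> f x \<noteq> 0"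
  shows "Ck_on k S (\<lambda>x. inverse (f x))"
  using assms(2)
proof (induction k)
  case 0
  then show ?case using assms(3) by (auto intro: continuous_on_inverse)
next
  case (Suc k)
  have "Ck_on k S (\<lambda>x. inverse (f x))" using Suc Ck_on_Suc_imp by blast
  then show ?case
    by (intro Ck_on_SucI[OF assms(1) Deriv.has_derivative_inverse[OF assms(3) Ck_on_has_derivative[OF Suc.prems]]])
      (use Suc.prems in \<open>simp_all add: Ck_on_mult[OF assms(1)] Ck_on_uminus[OF assms(1)]\<close>)
qed

lemma Ck_on_sqrt:
  fixes f :: "'a::euclidean_space \<Rightarrow> real"
  assumes "open S" "Ck_on k S f" "\<And>x. x \<in> S \<Longrightarrow> f x > 0"
  shows "Ck_on k S (\<lambda>x. sqrt (f x))"
  using assms(2)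
proof (induction k)
  case 0
  then show ?case by (auto intro: continuous_intros)
next
  case (Suc k)
  have 1: "Ck_on k S (\<lambda>x. inverse (sqrt (f x)))"
    using Suc Ck_on_Suc_imp assms(3) by (intro Ck_on_inverse[OF assms(1)]) (blast, force)
  show ?case
  proof (rule Ck_on_SucI[OF assms(1), where f'="\<lambda>x v. frechet_derivative f (at x) v * (inverse (sqrt (f x)) * (1/2))"])
    fix x assume x: "x \<in> S"
    show "((\<lambda>x. sqrt (f x)) has_derivative (\<lambda>v. frechet_derivative f (at x) v * (inverse (sqrt (f x)) * (1/2)))) (at x)"
      using has_derivative_compose[OF Ck_on_has_derivative[OF Suc.prems x]
          DERIV_real_sqrt[OF assms(3)[OF x], unfolded has_field_derivative_def]]
      by (simp add: mult_ac)
  next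
    show "Ck_on k S (\<lambda>x. frechet_derivative f (at x) v * (inverse (sqrt (f x)) * (1/2)))" for v
      using Suc.prems 1 by (intro Ck_on_mult[OF assms(1)] Ck_on_const[OF assms(1)]) simp_all
  qed
qed

section \<open>Partial derivatives in the plane\<close>

definition dd :: "2 \<Rightarrow> (plane \<Rightarrow> real) \<Rightarrow> plane \<Rightarrow> real" where
  "dd i f q = frechet_derivative f (at q) (axis i 1)"

lemma Ck_on_dd: "Ck_on (Suc k) S f \<Longrightarrow> Ck_on k S (dd i f)"
  unfolding dd_def[abs_def] by simp

lemma derivative_dd:
  assumes "f differentiable (at x)"
  shows "(f has_derivative (\<lambda>v. dd 1 f x * v $ 1 + dd 2 f x * v $ 2)) (at x)"
proof -
  have d: "(f has_derivative frechet_derivative f (at x)) (at x)" using assms frechet_derivative_works by blast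
  have "frechet_derivative f (at x) v = dd 1 f x * v $ 1 + dd 2 f x * v $ 2" for v
  proof -
    have "v = v $ 1 *\<^sub>R axis 1 1 + v $ 2 *\<^sub>R axis 2 1" by (simp add: vec_eq_iff forall_2 axis_def)
    then have "frechet_derivative f (at x) v = frechet_derivative f (at x) (v $ 1 *\<^sub>R axis 1 1 + v $ 2 *\<^sub>R axis 2 1)" by simp
    also have "\<dots> = dd 1 f x * v $ 1 + dd 2 f x * v $ 2"
      using has_derivative_linear[OF d] by (simp add: linear_add linear_cmul dd_def)
    finally show ?thesis .
  qed
  then show ?thesis using d by (metis (no_types, lifting) ext)
qed

lemma dd_eq:
  assumes "(f has_derivative f') (at x)"
  shows "dd i f x = f' (axis i 1)"
  unfolding dd_def using frechet_derivative_eq[OF assms] .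

lemma Ck_on_ddI:
  fixes f :: "plane \<Rightarrow> real"
  assumes "open S" "\<And>x. x \<in> S \<Longrightarrow> (f has_derivative (\<lambda>v. f1 x * v $ 1 + f2 x * v $ 2)) (at x)"
    "Ck_on k S f1" "Ck_on k S f2"
  shows "Ck_on (Suc k) S f"
  by (rule Ck_on_SucI[OF assms(1,2)])
    (auto intro!: Ck_on_add Ck_on_mult Ck_on_const assms)

lemma has_derivative_vecI:
  fixes g :: "'a::real_normed_vector \<Rightarrow> real^'n"
  assumes "\<And>i. ((\<lambda>x. g x $ i) has_derivative (\<lambda>v. G v $ i)) (at x within S)"
  shows "(g has_derivative G) (at x within S)"
  by (subst has_derivative_componentwise_within) (auto simp: Basis_vec_def inner_axis assms)

lemma Ck_on_compose:
  fixes f :: "plane \<Rightarrow> real" and g :: "plane \<Rightarrow> plane"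
  assumes S: "open S" "open T" "g ` S \<subseteq> T" and f: "Ck_on k T f"
    and g: "\<And>i. Ck_on k S (\<lambda>x. g x $ i)"
  shows "Ck_on k S (\<lambda>x. f (g x))"
  using f g
proof (induction k arbitrary: f)
  case 0
  have "continuous_on S (\<lambda>x. \<chi> i. g x $ i)" using "0.prems"(2) by (intro continuous_on_vec_lambda) simp
  then have "continuous_on S g" by simp
  then show ?case using "0.prems"(1) S(3) by (auto intro: continuous_on_compose2)
next
  case (Suc k)
  have gk: "Ck_on k S (\<lambda>x. g x $ i)" for i using Suc.prems(2) Ck_on_Suc_imp by blast
  have dg: "((\<lambda>x. g x $ i) has_derivative (\<lambda>v. dd 1 (\<lambda>x. g x $ i) x * v $ 1 + dd 2 (\<lambda>x. g x $ i) x * v $ 2)) (at x)"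
    if "x \<in> S" for i x
    using Suc.prems(2) that by (intro derivative_dd) simp
  define G where "G x v = (\<chi> i. dd 1 (\<lambda>x. g x $ i) x * v $ 1 + dd 2 (\<lambda>x. g x $ i) x * v $ 2)" for x and v :: plane
  have dG: "(g has_derivative G x) (at x)" if "x \<in> S" for x
    by (rule has_derivative_vecI) (simp add: G_def dg[OF that])
  show ?case
  proof (rule Ck_on_SucI[OF S(1), where f'="\<lambda>x v. dd 1 f (g x) * (dd 1 (\<lambda>x. g x $ 1) x * v $ 1 + dd 2 (\<lambda>x. g x $ 1) x * v $ 2)
       + dd 2 f (g x) * (dd 1 (\<lambda>x. g x $ 2) x * v $ 1 + dd 2 (\<lambda>x. g x $ 2) x * v $ 2)"])
    fix x assume x: "x \<in> S"
    then have "f differentiable at (g x)" using Suc.prems(1) S(3) by auto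
    from has_derivative_compose[OF dG[OF x] derivative_dd[OF this]]
    show "((\<lambda>x. f (g x)) has_derivative (\<lambda>v. dd 1 f (g x) * (dd 1 (\<lambda>x. g x $ 1) x * v $ 1 + dd 2 (\<lambda>x. g x $ 1) x * v $ 2)
       + dd 2 f (g x) * (dd 1 (\<lambda>x. g x $ 2) x * v $ 1 + dd 2 (\<lambda>x. g x $ 2) x * v $ 2))) (at x)"
      by (simp add: G_def)
  next
    show "Ck_on k S (\<lambda>x. dd 1 f (g x) * (dd 1 (\<lambda>x. g x $ 1) x * v $ 1 + dd 2 (\<lambda>x. g x $ 1) x * v $ 2)
       + dd 2 f (g x) * (dd 1 (\<lambda>x. g x $ 2) x * v $ 1 + dd 2 (\<lambda>x. g x $ 2) x * v $ 2))" for v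
    proof -
      have c: "Ck_on k S (\<lambda>x. dd i f (g x))" for i
        by (rule Suc.IH[OF Ck_on_dd[OF Suc.prems(1)] gk])
      have "Ck_on k S (dd j (\<lambda>x. g x $ i))" for i j by (rule Ck_on_dd[OF Suc.prems(2)])
      with c show ?thesis
        by (intro Ck_on_add[OF S(1)] Ck_on_mult[OF S(1)] Ck_on_const[OF S(1)])
    qed
  qed
qed

text \<open>Young's form, with first partials differentiable at the single point \<open>p\<close>.
  The mean value theorem in direction \<open>i\<close> turns the symmetric second difference of
  \<open>f\<close> into an increment of \<open>dd i f\<close>, which differentiability at
  \<open>p\<close> evaluates up to \<open>o(h^2)\<close>. Exchanging the directions evaluates the
  same difference.\<close>

lemma second_partials_commute:
  fixes f :: "plane \<Rightarrow> real"
  assumes "open S" "p \<in> S" "\<And>x. x \<in> S \<Longrightarrow> f differentiable (at x)"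
    "dd 1 f differentiable (at p)" "dd 2 f differentiable (at p)"
  shows "dd 1 (dd 2 f) p = dd 2 (dd 1 f) p"
proof -
  obtain r where r: "r > 0" "ball p r \<subseteq> S" using assms(1,2) open_contains_ball by blast
  define e :: "2 \<Rightarrow> plane" where "e i = axis i 1" for i
  have ne: "norm (e i) = 1" for i by (simp add: e_def)
  have key: "\<exists>d>0. \<forall>h. 0 < h \<and> h < d \<longrightarrow>
      \<bar>f (p + h *\<^sub>R e i + h *\<^sub>R e j) - f (p + h *\<^sub>R e i) - f (p + h *\<^sub>R e j) + f p - h * h * dd j (dd i f) p\<bar> \<le> \<epsilon> * (h * h)"
    if ij: "dd i f differentiable (at p)" and \<epsilon>: "\<epsilon> > 0" for i j \<epsilon>
  proof -
    let ?F = "dd i f" and ?D = "frechet_derivative (dd i f) (at p)"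
    have D: "(?F has_derivative ?D) (at p)" using ij frechet_derivative_works by blast
    then obtain d0 where d0: "d0 > 0" "\<And>y. norm (y - p) < d0 \<Longrightarrow> norm (?F y - ?F p - ?D (y - p)) \<le> \<epsilon> / 3 * norm (y - p)"
      unfolding has_derivative_at_alt using \<epsilon> by (metis zero_less_divide_iff zero_less_numeral)
    define d where "d = min (d0 / 2) (r / 2)"
    have "\<bar>f (p + h *\<^sub>R e i + h *\<^sub>R e j) - f (p + h *\<^sub>R e i) - f (p + h *\<^sub>R e j) + f p - h * h * dd j (dd i f) p\<bar> \<le> \<epsilon> * (h * h)"
      if h: "0 < h" "h < d" for h
    proof -
      have n2: "norm (s *\<^sub>R e i + t *\<^sub>R e j) \<le> s + t" if "0 \<le> s" "0 \<le> t" for s t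
        using norm_triangle_ineq[of "s *\<^sub>R e i" "t *\<^sub>R e j"] that by (simp add: ne)
      have inS: "p + (s *\<^sub>R e i + t *\<^sub>R e j) \<in> S" if "0 \<le> s" "s \<le> h" "0 \<le> t" "t \<le> h" for s t
      proof -
        have "norm (s *\<^sub>R e i + t *\<^sub>R e j) < r" using n2[of s t] that h by (auto simp: d_def)
        then have "p + (s *\<^sub>R e i + t *\<^sub>R e j) \<in> ball p r" unfolding mem_ball dist_norm by (metis add_diff_cancel_left' norm_minus_commute)
        then show ?thesis using r(2) by blast
      qed
      define \<phi> where "\<phi> s = f (p + (s *\<^sub>R e i + h *\<^sub>R e j)) - f (p + (s *\<^sub>R e i + 0 *\<^sub>R e j))" for s
      have der: "((\<lambda>s. f (p + (s *\<^sub>R e i + t *\<^sub>R e j))) has_real_derivative ?F (p + (s *\<^sub>R e i + t *\<^sub>R e j))) (at s)"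
        if "0 \<le> s" "s \<le> h" "0 \<le> t" "t \<le> h" for s t
      proof -
        let ?q = "p + (s *\<^sub>R e i + t *\<^sub>R e j)"
        have 1: "(f has_derivative frechet_derivative f (at ?q)) (at ?q)"
          using assms(3)[OF inS[OF that]] frechet_derivative_works by blast
        have 2: "((\<lambda>s. p + (s *\<^sub>R e i + t *\<^sub>R e j)) has_derivative (\<lambda>u. u *\<^sub>R e i)) (at s)"
          by (auto intro!: derivative_eq_intros)
        have lin: "frechet_derivative f (at ?q) (u *\<^sub>R e i) = u * ?F ?q" for u
          using linear_cmul[OF has_derivative_linear[OF 1]] by (simp add: dd_def e_def)
        have "((\<lambda>s. f (p + (s *\<^sub>R e i + t *\<^sub>R e j))) has_derivative (\<lambda>u. frechet_derivative f (at ?q) (u *\<^sub>R e i))) (at s)"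
          using has_derivative_compose[OF 2 1] .
        then show ?thesis unfolding lin has_field_derivative_def by (simp add: mult_commute_abs)
      qed
      have d\<phi>: "(\<phi> has_real_derivative (?F (p + (s *\<^sub>R e i + h *\<^sub>R e j)) - ?F (p + (s *\<^sub>R e i + 0 *\<^sub>R e j)))) (at s)"
        if "0 \<le> s" "s \<le> h" for s
        unfolding \<phi>_def using that h(1) by (intro DERIV_diff der) auto
      obtain s where s: "0 < s" "s < h" "\<phi> h - \<phi> 0 = (h - 0) * (?F (p + (s *\<^sub>R e i + h *\<^sub>R e j)) - ?F (p + (s *\<^sub>R e i + 0 *\<^sub>R e j)))"
        using MVT2[OF h(1) d\<phi>] by blast
      have est: "\<bar>?F (p + (s *\<^sub>R e i + t *\<^sub>R e j)) - ?F p - ?D (s *\<^sub>R e i + t *\<^sub>R e j)\<bar> \<le> \<epsilon> / 3 * (s + t)"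
        if "0 \<le> t" "t \<le> h" for t
      proof -
        have "norm (s *\<^sub>R e i + t *\<^sub>R e j) < d0" using n2[of s t] that s h by (auto simp: d_def)
        then have "\<bar>?F (p + (s *\<^sub>R e i + t *\<^sub>R e j)) - ?F p - ?D (s *\<^sub>R e i + t *\<^sub>R e j)\<bar> \<le> \<epsilon> / 3 * norm (s *\<^sub>R e i + t *\<^sub>R e j)"
          using d0(2)[of "p + (s *\<^sub>R e i + t *\<^sub>R e j)"] by simp
        also have "\<dots> \<le> \<epsilon> / 3 * (s + t)" using n2[of s t] s that \<epsilon> by (intro mult_left_mono) auto
        finally show ?thesis .
      qed
      have lin: "?D (s *\<^sub>R e i + h *\<^sub>R e j) - ?D (s *\<^sub>R e i + 0 *\<^sub>R e j) = h * dd j (dd i f) p"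
        using has_derivative_linear[OF D] by (simp add: linear_add linear_cmul linear_0 dd_def e_def)
      have "\<bar>(?F (p + (s *\<^sub>R e i + h *\<^sub>R e j)) - ?F (p + (s *\<^sub>R e i + 0 *\<^sub>R e j))) - h * dd j (dd i f) p\<bar> \<le> \<epsilon> / 3 * (s + h) + \<epsilon> / 3 * (s + 0)"
        using est[of h] est[of 0] h lin by linarith
      also have "\<dots> \<le> \<epsilon> / 3 * (h + h) + \<epsilon> / 3 * (h + 0)"
        using s \<epsilon> by (intro add_mono mult_left_mono) auto
      also have "\<dots> = \<epsilon> * h" by simp
      finally have *: "\<bar>(?F (p + (s *\<^sub>R e i + h *\<^sub>R e j)) - ?F (p + (s *\<^sub>R e i + 0 *\<^sub>R e j))) - h * dd j (dd i f) p\<bar> \<le> \<epsilon> * h" .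
      have "f (p + h *\<^sub>R e i + h *\<^sub>R e j) - f (p + h *\<^sub>R e i) - f (p + h *\<^sub>R e j) + f p - h * h * dd j (dd i f) p =
          h * ((?F (p + (s *\<^sub>R e i + h *\<^sub>R e j)) - ?F (p + (s *\<^sub>R e i + 0 *\<^sub>R e j))) - h * dd j (dd i f) p)"
        using s(3) unfolding \<phi>_def by (simp add: algebra_simps)
      then show ?thesis using mult_left_mono[OF *, of h] h(1) by (simp add: abs_mult mult_ac)
    qed
    moreover have "d > 0" using d0(1) r(1) by (simp add: d_def)
    ultimately show ?thesis by blast
  qed
  have "\<bar>dd 1 (dd 2 f) p - dd 2 (dd 1 f) p\<bar> \<le> 2 * \<epsilon>" if \<epsilon>: "\<epsilon> > 0" for \<epsilon>
  proof -
    obtain d1 where d1: "d1 > 0" "\<And>h. 0 < h \<Longrightarrow> h < d1 \<Longrightarrow>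
      \<bar>f (p + h *\<^sub>R e 1 + h *\<^sub>R e 2) - f (p + h *\<^sub>R e 1) - f (p + h *\<^sub>R e 2) + f p - h * h * dd 2 (dd 1 f) p\<bar> \<le> \<epsilon> * (h * h)"
      using key[OF assms(4) \<epsilon>, of 2] by blast
    obtain d2 where d2: "d2 > 0" "\<And>h. 0 < h \<Longrightarrow> h < d2 \<Longrightarrow>
      \<bar>f (p + h *\<^sub>R e 2 + h *\<^sub>R e 1) - f (p + h *\<^sub>R e 2) - f (p + h *\<^sub>R e 1) + f p - h * h * dd 1 (dd 2 f) p\<bar> \<le> \<epsilon> * (h * h)"
      using key[OF assms(5) \<epsilon>, of 1] by blast
    define h where "h = min d1 d2 / 2"
    have h: "0 < h" "h < d1" "h < d2" using d1 d2 by (auto simp: h_def)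
    have sw: "p + h *\<^sub>R e 2 + h *\<^sub>R e 1 = p + h *\<^sub>R e 1 + h *\<^sub>R e 2" by (simp add: algebra_simps)
    have "\<bar>h * h * dd 1 (dd 2 f) p - h * h * dd 2 (dd 1 f) p\<bar> \<le> \<epsilon> * (h * h) + \<epsilon> * (h * h)"
      using d1(2)[OF h(1,2)] d2(2)[OF h(1,3)] unfolding sw by linarith
    moreover have "\<bar>h * h * dd 1 (dd 2 f) p - h * h * dd 2 (dd 1 f) p\<bar> = (h * h) * \<bar>dd 1 (dd 2 f) p - dd 2 (dd 1 f) p\<bar>"
      by (simp add: right_diff_distrib[symmetric] abs_mult)
    ultimately have "(h * h) * \<bar>dd 1 (dd 2 f) p - dd 2 (dd 1 f) p\<bar> \<le> (h * h) * (2 * \<epsilon>)" by (simp add: mult_ac)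
    then show ?thesis using h(1) by (simp only: mult_le_cancel_left_pos mult_pos_pos)
  qed
  then have "\<bar>dd 1 (dd 2 f) p - dd 2 (dd 1 f) p\<bar> \<le> 0 + e" if "e > 0" for e
    using that by (metis add_0 half_gt_zero mult_2 field_sum_of_halves)
  then have "\<bar>dd 1 (dd 2 f) p - dd 2 (dd 1 f) p\<bar> \<le> 0" by (rule field_le_epsilon)
  then show ?thesis by simp
qed

definition gradv :: "(plane \<Rightarrow> real) \<Rightarrow> plane \<Rightarrow> real^2" where
  "gradv f p = vector [dd 1 f p, dd 2 f p]"

lemma gradv_nth [simp]: "gradv f p $ 1 = dd 1 f p" "gradv f p $ 2 = dd 2 f p"
  by (simp_all add: gradv_def)

lemma inner_2: "u \<bullet> v = u $ 1 * v $ 1 + u $ 2 * v $ 2" for u v :: "real^2"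
  by (simp add: inner_vec_def sum_2)

lemma mv_2: "(M *v v) $ i = M $ i $ 1 * v $ 1 + M $ i $ 2 * v $ 2" for M :: "real^2^'n"
  by (simp add: matrix_vector_mult_def sum_2)

lemma gradv_has_derivative:
  assumes "f differentiable (at p)"
  shows "(f has_derivative (\<lambda>v. gradv f p \<bullet> v)) (at p)"
  using derivative_dd[OF assms] by (simp add: inner_2)

lemma sop_Ck:
  assumes U: "open U" "p \<in> U" "Ck_on 2 U f"
  shows "sop A b f p (gradv f p)
    (A$1$1 * dd 1 (dd 1 f) p + A$2$1 * dd 1 (dd 2 f) p + A$1$2 * dd 2 (dd 1 f) p + A$2$2 * dd 2 (dd 2 f) p
      + (b$1 * dd 1 f p + b$2 * dd 2 f p))"
proof (rule sopI)
  have f2: "Ck_on (Suc (Suc 0)) U f" using U(3) by (simp only: numeral_2_eq_2)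
  have d1: "dd i f differentiable (at p)" for i using Ck_on_differentiable[OF Ck_on_dd[OF f2] U(2)] .
  have "(f has_derivative (\<lambda>v. gradv f q \<bullet> v)) (at q)" if "q \<in> U" for q
    using Ck_on_differentiable[OF f2 that] gradv_has_derivative by blast
  then show "\<forall>\<^sub>F q in nhds p. (f has_derivative (\<lambda>v. gradv f q \<bullet> v)) (at q)"
    unfolding eventually_nhds using U by blast
  let ?D = "\<lambda>v. vector [dd 1 (dd 1 f) p * v$1 + dd 2 (dd 1 f) p * v$2, dd 1 (dd 2 f) p * v$1 + dd 2 (dd 2 f) p * v$2] :: real^2"
  show "(gradv f has_derivative ?D) (at p)"
  proof (rule has_derivative_vecI)
    fix i :: 2
    show "((\<lambda>q. gradv f q $ i) has_derivative (\<lambda>v. ?D v $ i)) (at p)"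
      using derivative_dd[OF d1[of 1]] derivative_dd[OF d1[of 2]] exhaust_2[of i] by auto
  qed
  show "A$1$1 * dd 1 (dd 1 f) p + A$2$1 * dd 1 (dd 2 f) p + A$1$2 * dd 2 (dd 1 f) p + A$2$2 * dd 2 (dd 2 f) p
      + (b$1 * dd 1 f p + b$2 * dd 2 f p) = (\<Sum>i\<in>UNIV. (A *v axis i 1) \<bullet> ?D (axis i 1)) + b \<bullet> gradv f p"
    by (simp add: sum_2 inner_2 mv_2 axis_def)
qed simp

lemma dd_cong:
  assumes "open U" "p \<in> U" "\<And>q. q \<in> U \<Longrightarrow> f q = g q" "f differentiable (at p)"
  shows "dd i f p = dd i g p"
proof -
  have "(f has_derivative frechet_derivative f (at p)) (at p)" using assms(4) frechet_derivative_works by blast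
  from has_derivative_transform_within_open[OF this assms(1,2), of g] assms(3)
  have "(g has_derivative frechet_derivative f (at p)) (at p)" by simp
  from frechet_derivative_eq[OF this] show ?thesis by (simp add: dd_def)
qed

lemma dd_mult:
  assumes "f differentiable (at p)" "g differentiable (at p)"
  shows "dd i (\<lambda>q. f q * g q) p = f p * dd i g p + dd i f p * g p"
proof -
  have "(f has_derivative frechet_derivative f (at p)) (at p)" "(g has_derivative frechet_derivative g (at p)) (at p)"
    using assms frechet_derivative_works by blast+
  from dd_eq[OF has_derivative_mult[OF this]] show ?thesis by (simp add: dd_def)
qed

lemma dd_add:
  assumes "f differentiable (at p)" "g differentiable (at p)"
  shows "dd i (\<lambda>q. f q + g q) p = dd i f p + dd i g p"
proof -
  have "(f has_derivative frechet_derivative f (at p)) (at p)" "(g has_derivative frechet_derivative g (at p)) (at p)"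
    using assms frechet_derivative_works by blast+
  from dd_eq[OF has_derivative_add[OF this]] show ?thesis by (simp add: dd_def)
qed

lemma dd_uminus:
  assumes "f differentiable (at p)"
  shows "dd i (\<lambda>q. - f q) p = - dd i f p"
proof -
  have "(f has_derivative frechet_derivative f (at p)) (at p)"
    using assms frechet_derivative_works by blast
  from dd_eq[OF has_derivative_minus[OF this]] show ?thesis by (simp add: dd_def)
qed

lemma sop_dist_square:
  fixes c :: plane
  assumes "transpose A = A" and that: "q1 = p $ 1 - c $ 1" "q2 = p $ 2 - c $ 2"
  shows "sop A b (\<lambda>q. (q - c) \<bullet> (q - c)) p ((q1 + q1) *\<^sub>R axis 1 1 + (q2 + q2) *\<^sub>R axis 2 1)
    (2 * (A $ 1 $ 1 + A $ 2 $ 2) + 2 * (b \<bullet> (p - c)))"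
proof -
  have j: "sop A b (\<lambda>q. axis i 1 \<bullet> q - c $ i) p (axis i 1) (b $ i)" for i
    using sop_diff[OF sop_inner[of A b "axis i 1" p] sop_const[of _ _ "c $ i"]]
    by (simp add: inner_axis)
  have "sop A b (\<lambda>q. (axis 1 1 \<bullet> q - c $ 1) * (axis 1 1 \<bullet> q - c $ 1) + (axis 2 1 \<bullet> q - c $ 2) * (axis 2 1 \<bullet> q - c $ 2)) p
     (q1 *\<^sub>R axis 1 1 + q1 *\<^sub>R axis 1 1 + (q2 *\<^sub>R axis 2 1 + q2 *\<^sub>R axis 2 1))
     (q1 * b $ 1 + q1 * b $ 1 + 2 * (axis 1 1 \<bullet> (A *v axis 1 1)) + (q2 * b $ 2 + q2 * b $ 2 + 2 * (axis 2 1 \<bullet> (A *v axis 2 1))))"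
  proof -
    have e: "axis 1 1 \<bullet> p - c $ 1 = q1" "axis 2 1 \<bullet> p - c $ 2 = q2" using that by (simp_all add: inner_axis')
    show ?thesis
      using sop_add[OF sop_mult[OF j[of 1] j[of 1] assms(1)] sop_mult[OF j[of 2] j[of 2] assms(1)]] unfolding e .
  qed
  moreover have "(\<lambda>q. (axis 1 1 \<bullet> q - c $ 1) * (axis 1 1 \<bullet> q - c $ 1) + (axis 2 1 \<bullet> q - c $ 2) * (axis 2 1 \<bullet> q - c $ 2)) =
      (\<lambda>q. (q - c) \<bullet> (q - c))" by (simp add: fun_eq_iff inner_2 axis_def)
  moreover have "q1 * b $ 1 + q1 * b $ 1 + 2 * (axis 1 1 \<bullet> (A *v axis 1 1)) + (q2 * b $ 2 + q2 * b $ 2 + 2 * (axis 2 1 \<bullet> (A *v axis 2 1))) =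
      2 * (A $ 1 $ 1 + A $ 2 $ 2) + 2 * (b \<bullet> (p - c))"
    by (simp add: that inner_2 mv_2 axis_def algebra_simps)
  moreover have "q1 *\<^sub>R axis (1::2) (1::real) + q1 *\<^sub>R axis 1 1 + (q2 *\<^sub>R axis (2::2) (1::real) + q2 *\<^sub>R axis (2::2) 1) =
      (q1 + q1) *\<^sub>R axis 1 1 + (q2 + q2) *\<^sub>R axis 2 1"
    by (simp only: scaleR_add_left)
  ultimately show ?thesis by (simp only:)
qed

lemma Ck_on_local:
  assumes "\<And>p. p \<in> S \<Longrightarrow> \<exists>T. open T \<and> p \<in> T \<and> Ck_on k T f"
  shows "Ck_on k S f"
  using assms
proof (induction k arbitrary: f)
  case 0
  have "isCont f p" if "p \<in> S" for p
    using "0.prems"[OF that] by (auto simp: continuous_on_eq_continuous_at)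
  then show ?case by (simp add: continuous_at_imp_continuous_on)
next
  case (Suc k)
  have "f differentiable (at p)" if "p \<in> S" for p using Suc.prems[OF that] by auto
  moreover have "Ck_on k S (\<lambda>x. frechet_derivative f (at x) v)" for v
  proof (rule Suc.IH)
    fix p assume "p \<in> S"
    from Suc.prems[OF this] obtain T where "open T" "p \<in> T" "Ck_on (Suc k) T f" by blast
    then show "\<exists>T. open T \<and> p \<in> T \<and> Ck_on k T (\<lambda>x. frechet_derivative f (at x) v)"
      by (intro exI[of _ T]) simp
  qed
  ultimately show ?case by simp
qed

text \<open>Bootstrapping: by Cramer's rule the partials of \<open>Y\<close> are smooth expressions
  in the Jacobian of \<open>X\<close>, composed with \<open>Y\<close>. So if \<open>Y\<close> is of
  class \<open>k\<close>, its partials are too.\<close>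

lemma Ck_on_inverse_function:
  fixes X Y :: "plane \<Rightarrow> plane"
  assumes V: "open V" "open V'" "Y ` V' \<subseteq> V" "continuous_on V' Y"
    and XY: "\<And>p. p \<in> V' \<Longrightarrow> X (Y p) = p" 
    and X: "\<And>k i. Ck_on k V (\<lambda>u. X u $ i)"
    and det: "\<And>u. u \<in> V \<Longrightarrow> dd 1 (\<lambda>u. X u $ 1) u * dd 2 (\<lambda>u. X u $ 2) u - dd 2 (\<lambda>u. X u $ 1) u * dd 1 (\<lambda>u. X u $ 2) u \<noteq> 0"
  shows "Ck_on k V' (\<lambda>p. Y p $ i)"
proof -
  define J where "J i j = dd j (\<lambda>u. X u $ i)" for i j
  define e where "e u = inverse (J 1 1 u * J 2 2 u - J 1 2 u * J 2 1 u)" for u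
  have JC: "Ck_on k V (J i j)" for k i j using Ck_on_dd[OF X[of "Suc k" i]] by (simp add: J_def)
  have eC: "Ck_on k V e" for k unfolding e_def[abs_def]
    by (intro Ck_on_inverse V(1) Ck_on_diff Ck_on_mult JC) (use det in \<open>simp add: J_def\<close>)
  define L where "L u v = (vector [e u * J 2 2 u * v $ 1 - e u * J 1 2 u * v $ 2, e u * J 1 1 u * v $ 2 - e u * J 2 1 u * v $ 1] :: plane)" for u and v :: plane
  have e: "e u * (J 1 1 u * J 2 2 u - J 1 2 u * J 2 1 u) = 1" if "u \<in> V" for u
    using det[OF that] by (simp add: e_def J_def)
  have dX: "(X has_derivative (\<lambda>v. \<chi> i. J i 1 u * v $ 1 + J i 2 u * v $ 2)) (at u)" if "u \<in> V" for u
    by (rule has_derivative_vecI) (use derivative_dd[OF Ck_on_differentiable[OF X that]] in \<open>simp add: J_def\<close>)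
  have dY: "(Y has_derivative L (Y p)) (at p)" if p: "p \<in> V'" for p
  proof (rule has_derivative_inverse_basic[where f=X and T=V'])
    have YV: "Y p \<in> V" using V(3) p by blast
    show "(X has_derivative (\<lambda>v. \<chi> i. J i 1 (Y p) * v $ 1 + J i 2 (Y p) * v $ 2)) (at (Y p))" using dX[OF YV] .
    show "bounded_linear (L (Y p))" unfolding linear_conv_bounded_linear[symmetric]
      by (rule linearI) (auto simp: L_def vec_eq_iff forall_2 algebra_simps)
    show "L (Y p) \<circ> (\<lambda>v. \<chi> i. J i 1 (Y p) * v $ 1 + J i 2 (Y p) * v $ 2) = id"
    proof (rule ext)
      fix v :: plane
      have "(e (Y p) * (J 1 1 (Y p) * J 2 2 (Y p) - J 1 2 (Y p) * J 2 1 (Y p))) *\<^sub>R v = v" using e[OF YV] by simp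
      then show "(L (Y p) \<circ> (\<lambda>v. \<chi> i. J i 1 (Y p) * v $ 1 + J i 2 (Y p) * v $ 2)) v = id v"
        by (auto simp: L_def vec_eq_iff forall_2 algebra_simps)
    qed
    show "continuous (at p) Y" using V(2,4) p by (simp add: continuous_on_eq_continuous_at)
  qed (use V p XY in auto)
  show ?thesis
  proof (induction k arbitrary: i)
    case 0
    show ?case using V(4) by (auto intro: continuous_intros)
  next
    case (Suc k)
    note comp = Ck_on_compose[OF V(2,1,3) _ Suc]
    have 1: "Ck_on (Suc k) V' (\<lambda>p. Y p $ 1)"
    proof (rule Ck_on_ddI[OF V(2)])
      show "((\<lambda>p. Y p $ 1) has_derivative (\<lambda>v. (e (Y p) * J 2 2 (Y p)) * v $ 1 + (- (e (Y p) * J 1 2 (Y p))) * v $ 2)) (at p)"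
        if "p \<in> V'" for p
        using bounded_linear.has_derivative[OF bounded_linear_vec_nth dY[OF that], of 1] by (simp add: L_def)
      show "Ck_on k V' (\<lambda>p. e (Y p) * J 2 2 (Y p))" "Ck_on k V' (\<lambda>p. - (e (Y p) * J 1 2 (Y p)))"
        by (intro Ck_on_mult Ck_on_uminus V(2) comp eC JC)+
    qed
    have 2: "Ck_on (Suc k) V' (\<lambda>p. Y p $ 2)"
    proof (rule Ck_on_ddI[OF V(2)])
      show "((\<lambda>p. Y p $ 2) has_derivative (\<lambda>v. (- (e (Y p) * J 2 1 (Y p))) * v $ 1 + (e (Y p) * J 1 1 (Y p)) * v $ 2)) (at p)"
        if "p \<in> V'" for p
        using bounded_linear.has_derivative[OF bounded_linear_vec_nth dY[OF that], of 2] by (simp add: L_def algebra_simps)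
      show "Ck_on k V' (\<lambda>p. e (Y p) * J 1 1 (Y p))" "Ck_on k V' (\<lambda>p. - (e (Y p) * J 2 1 (Y p)))"
        by (intro Ck_on_mult Ck_on_uminus V(2) comp eC JC)+
    qed
    show ?case using 1 2 exhaust_2[of i] by auto
  qed
qed

section \<open>Lipschitz bounds, isolated points and negligible images\<close>

lemma continuous_on_bounded_cball:
  fixes f :: "plane \<Rightarrow> real"
  assumes "continuous_on (cball p0 \<rho>) f"
  shows "\<exists>K\<ge>0. \<forall>p\<in>cball p0 \<rho>. \<bar>f p\<bar> \<le> K"
proof -
  have "bounded (f ` cball p0 \<rho>)" using assms by (intro compact_imp_bounded compact_continuous_image) auto
  then obtain K where "\<forall>t\<in>f ` cball p0 \<rho>. norm t \<le> K" unfolding bounded_iff by blast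
  then have "\<bar>f p\<bar> \<le> max K 0" if "p \<in> cball p0 \<rho>" for p using that by (simp add: le_max_iff_disj)
  then show ?thesis by (intro exI[of _ "max K 0"]) simp
qed

lemma gradient_bound_Lipschitz:
  fixes f :: "plane \<Rightarrow> real"
  assumes S: "convex S" and f: "\<And>w. w \<in> S \<Longrightarrow> f differentiable (at w)"
    and C: "\<And>w. w \<in> S \<Longrightarrow> \<bar>dd 1 f w\<bar> + \<bar>dd 2 f w\<bar> \<le> C" and pq: "p \<in> S" "q \<in> S"
  shows "\<bar>f p - f q\<bar> \<le> C * norm (p - q)"
proof -
  have "norm (f p - f q) \<le> C * norm (p - q)"
  proof (rule differentiable_bound[OF S _ _ pq, where f'="\<lambda>p v. dd 1 f p * v $ 1 + dd 2 f p * v $ 2"])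
    fix w assume w: "w \<in> S"
    show "(f has_derivative (\<lambda>v. dd 1 f w * v $ 1 + dd 2 f w * v $ 2)) (at w within S)"
      by (rule has_derivative_at_withinI[OF derivative_dd[OF f[OF w]]])
    show "onorm (\<lambda>v::plane. dd 1 f w * v $ 1 + dd 2 f w * v $ 2) \<le> C"
    proof (rule onorm_bound)
      have "0 \<le> \<bar>dd 1 f w\<bar> + \<bar>dd 2 f w\<bar>" by simp
      then show "0 \<le> C" using C[OF w] by linarith
      fix v :: plane
      have "norm (dd 1 f w * v $ 1 + dd 2 f w * v $ 2) \<le> \<bar>dd 1 f w\<bar> * \<bar>v $ 1\<bar> + \<bar>dd 2 f w\<bar> * \<bar>v $ 2\<bar>"
        by (simp add: abs_mult[symmetric])
      also have "\<dots> \<le> \<bar>dd 1 f w\<bar> * norm v + \<bar>dd 2 f w\<bar> * norm v"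
        by (intro add_mono mult_left_mono component_le_norm_cart) auto
      also have "\<dots> = (\<bar>dd 1 f w\<bar> + \<bar>dd 2 f w\<bar>) * norm v" by (simp add: algebra_simps)
      also have "\<dots> \<le> C * norm v" using C[OF w] by (intro mult_right_mono) auto
      finally show "norm (dd 1 f w * v $ 1 + dd 2 f w * v $ 2) \<le> C * norm v" .
    qed
  qed
  then show ?thesis by simp
qed

lemma C1_Lipschitz:
  assumes U: "open U" "cball p0 \<rho> \<subseteq> U" and f: "Ck_on 1 U f"
  shows "\<exists>K\<ge>0. \<forall>p\<in>cball p0 \<rho>. \<forall>q\<in>cball p0 \<rho>. \<bar>f p - f q\<bar> \<le> K * norm (p - (q::plane))"
proof -
  have f1: "Ck_on (Suc 0) U f" using f by (simp add: One_nat_def)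
  have "continuous_on (cball p0 \<rho>) (dd i f)" for i
    using Ck_on_continuous[OF Ck_on_dd[OF f1]] U(2) by (rule continuous_on_subset)
  then have "continuous_on (cball p0 \<rho>) (\<lambda>p. \<bar>dd 1 f p\<bar> + \<bar>dd 2 f p\<bar>)"
    by (intro continuous_on_add continuous_on_rabs)
  from continuous_on_bounded_cball[OF this] obtain K where
    K: "K \<ge> 0" "\<forall>p\<in>cball p0 \<rho>. \<bar>dd 1 f p\<bar> + \<bar>dd 2 f p\<bar> \<le> K" by (auto simp: abs_le_iff)
  have "\<bar>f p - f q\<bar> \<le> K * norm (p - q)" if pq: "p \<in> cball p0 \<rho>" "q \<in> cball p0 \<rho>" for p q
  proof (rule gradient_bound_Lipschitz[OF convex_cball _ _ pq])
    show "f differentiable (at w)" if "w \<in> cball p0 \<rho>" for w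
      using Ck_on_differentiable[OF f1] U(2) that by blast
  qed (use K(2) in blast)
  then show ?thesis using K(1) by blast
qed

lemma isolated_zero:
  fixes g :: "plane \<Rightarrow> real^2"
  assumes g: "(g has_derivative D) (at p)" "g p = 0" and inj: "\<And>v. D v = 0 \<Longrightarrow> v = 0"
  shows "\<exists>e>0. \<forall>q\<in>ball p e. q \<noteq> p \<longrightarrow> g q \<noteq> 0"
proof -
  have lin: "linear D" using g(1) by (rule has_derivative_linear)
  have "inj D" using lin inj by (simp add: linear_injective_0)
  then obtain B where B: "B > 0" "\<And>v. B * norm v \<le> norm (D v)"
    using linear_inj_bounded_below_pos[OF lin] by blast
  have "0 < B / 2" using B(1) by simp
  then obtain d where d: "d > 0" "\<And>q. norm (q - p) < d \<Longrightarrow> norm (g q - g p - D (q - p)) \<le> B / 2 * norm (q - p)"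
    using g(1) unfolding has_derivative_at_alt by blast
  have "g q \<noteq> 0" if q: "q \<in> ball p d" "q \<noteq> p" for q
  proof
    assume "g q = 0"
    then have "norm (D (q - p)) \<le> B / 2 * norm (q - p)"
      using d(2)[of q] q(1) g(2) by (simp add: dist_norm norm_minus_commute)
    then have "B * norm (q - p) \<le> B / 2 * norm (q - p)" using B(2)[of "q - p"] by linarith
    then show False using B(1) q(2) by simp
  qed
  then show ?thesis using d(1) by blast
qed

text \<open>Each of the given balls contains at most one point of \<open>Z\<close>, and by Lindelof
  countably many of them suffice to cover \<open>X\<close>.\<close>

lemma countable_isolated:
  fixes X Z :: "plane set"
  assumes "X \<subseteq> Z" "\<And>p. p \<in> X \<Longrightarrow> \<exists>e>0. \<forall>q\<in>ball p e. q \<in> Z \<longrightarrow> q = p"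
  shows "countable X"
proof -
  obtain e where e: "\<And>p. p \<in> X \<Longrightarrow> e p > 0" "\<And>p q. p \<in> X \<Longrightarrow> q \<in> ball p (e p) \<Longrightarrow> q \<in> Z \<Longrightarrow> q = p"
    using assms(2) by metis
  define \<F> where "\<F> = (\<lambda>p. ball p (e p)) ` X"
  have "\<And>S. S \<in> \<F> \<Longrightarrow> open S" by (auto simp: \<F>_def)
  then obtain \<F>' where F: "\<F>' \<subseteq> \<F>" "countable \<F>'" "\<Union>\<F>' = \<Union>\<F>" using Lindelof by metis
  have "X \<subseteq> (\<Union>S\<in>\<F>'. S \<inter> Z)"
  proof
    fix p assume p: "p \<in> X"
    then have "p \<in> \<Union>\<F>" using e(1)[OF p] by (auto simp: \<F>_def intro!: bexI[of _ p])
    then show "p \<in> (\<Union>S\<in>\<F>'. S \<inter> Z)" using F(3) p assms(1) by auto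
  qed
  moreover have "countable (S \<inter> Z)" if "S \<in> \<F>'" for S
  proof -
    obtain p where "p \<in> X" "S = ball p (e p)" using subsetD[OF F(1) \<open>S \<in> \<F>'\<close>] unfolding \<F>_def by blast
    then have "S \<inter> Z \<subseteq> {p}" using e(2) by blast
    then show ?thesis by (rule countable_subset) simp
  qed
  ultimately show ?thesis using F(2) by (meson countable_UN countable_subset)
qed

text \<open>The square is cut into about \<open>n^2\<close> cells of side \<open>h\<close> of order
  \<open>1/n\<close>. A cell is mapped into an interval of length of order
  \<open>\<epsilon> * h^2\<close>, so the total length is of order \<open>\<epsilon>\<close>,
  independently of \<open>n\<close>.\<close>

lemma negligible_quadratic_image:
  fixes R :: "plane \<Rightarrow> real" and c :: plane
  assumes s: "0 < s" and Z: "Z \<subseteq> {q. \<bar>q $ 1 - c $ 1\<bar> \<le> s \<and> \<bar>q $ 2 - c $ 2\<bar> \<le> s}"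
    and small: "\<And>\<epsilon>. 0 < \<epsilon> \<Longrightarrow> \<exists>\<delta>>0. \<forall>p\<in>Z. \<forall>q\<in>Z. norm (p - q) < \<delta> \<longrightarrow> \<bar>R p - R q\<bar> \<le> \<epsilon> * (norm (p - q))\<^sup>2"
  shows "negligible (R ` Z)"
  unfolding negligible_outer_le
proof (intro allI impI)
  fix e :: real assume e: "0 < e"
  \<comment> \<open>There are at most \<open>(n + 1)^2 \<le> 4 n^2\<close> cells, each covered by an
    interval of length \<open>32 \<epsilon> h^2\<close>. With \<open>n h = 2 s\<close> this adds up
    to \<open>512 \<epsilon> s^2\<close>.\<close>
  define \<epsilon> where "\<epsilon> = e / (512 * s\<^sup>2)"
  have \<epsilon>: "0 < \<epsilon>" using e s by (simp add: \<epsilon>_def)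
  obtain \<delta> where \<delta>: "\<delta> > 0" "\<And>p q. p \<in> Z \<Longrightarrow> q \<in> Z \<Longrightarrow> norm (p - q) < \<delta> \<Longrightarrow> \<bar>R p - R q\<bar> \<le> \<epsilon> * (norm (p - q))\<^sup>2"
    using small[OF \<epsilon>] by blast
  \<comment> \<open>Chosen for \<open>4 * h < \<delta>\<close>, because two points of one cell are
    at distance at most \<open>4 * h\<close>.\<close>
  obtain n :: nat where n: "8 * s / \<delta> < real n" using reals_Archimedean2 by blast
  have n0: "real n > 0" using n s \<delta>(1) by (smt (verit) divide_pos_pos)
  define h where "h = 2 * s / real n"
  have h: "0 < h" "4 * h < \<delta>" "real n * h = 2 * s"
    using n n0 s \<delta>(1) by (auto simp: h_def field_simps)
  define idx where "idx i q = nat \<lfloor>(q $ i - (c $ i - s)) / h\<rfloor>" for i and q :: plane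
  have idx: "idx i q \<le> n" "\<bar>q $ i - (c $ i - s) - real (idx i q) * h\<bar> \<le> h" if "q \<in> Z" for i q
  proof -
    have b: "0 \<le> q $ i - (c $ i - s)" "q $ i - (c $ i - s) \<le> 2 * s"
      using that Z exhaust_2[of i] by (auto simp: abs_le_iff)
    define t where "t = (q $ i - (c $ i - s)) / h"
    have t: "0 \<le> t" "t \<le> real n" "t * h = q $ i - (c $ i - s)"
      using b h by (auto simp: t_def pos_divide_le_eq)
    have id: "idx i q = nat \<lfloor>t\<rfloor>" by (simp add: idx_def t_def)
    have "real (idx i q) = real_of_int \<lfloor>t\<rfloor>" unfolding id using t(1) by simp
    then have fl: "real (idx i q) \<le> t" "t \<le> real (idx i q) + 1" by linarith+
    then have "real (idx i q) \<le> real n" using t(2) by linarith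
    then show "idx i q \<le> n" by simp
    have "real (idx i q) * h \<le> t * h" "t * h \<le> (real (idx i q) + 1) * h"
      using fl h(1) by (auto intro!: mult_right_mono)
    then show "\<bar>q $ i - (c $ i - s) - real (idx i q) * h\<bar> \<le> h" unfolding t(3) by (simp add: algebra_simps)
  qed
  define cell where "cell ij = {q \<in> Z. idx 1 q = fst ij \<and> idx 2 q = snd ij}" for ij :: "nat \<times> nat"
  have cell: "\<bar>R p - R q\<bar> \<le> 16 * \<epsilon> * h\<^sup>2" if "p \<in> cell ij" "q \<in> cell ij" for p q ij
  proof -
    have pq: "p \<in> Z" "q \<in> Z" "idx 1 p = idx 1 q" "idx 2 p = idx 2 q" using that by (auto simp: cell_def)
    have b: "\<bar>(p - q) $ i\<bar> \<le> 2 * h" for i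
      using idx(2)[OF pq(1), of i] idx(2)[OF pq(2), of i] pq(3,4) exhaust_2[of i] by auto
    have "norm (p - q) \<le> 4 * h"
      using norm_le_l1_cart[of "p - q"] b[of 1] b[of 2] by (simp add: sum_2)
    moreover have "norm (p - q) < \<delta>" using calculation h(2) by simp
    ultimately have "\<bar>R p - R q\<bar> \<le> \<epsilon> * (4 * h)\<^sup>2"
      using \<delta>(2)[OF pq(1,2)] \<epsilon> by (smt (verit, best) mult_left_mono norm_ge_zero power_mono)
    then show ?thesis by (simp add: power_mult_distrib)
  qed
  define J where "J ij = (if cell ij = {} then {} else cbox (R (SOME p. p \<in> cell ij) - 16 * \<epsilon> * h\<^sup>2) (R (SOME p. p \<in> cell ij) + 16 * \<epsilon> * h\<^sup>2))" for ij
  define I where "I = {..n} \<times> {..n}"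
  have J: "J ij \<in> lmeasurable" "measure lebesgue (J ij) \<le> 32 * \<epsilon> * h\<^sup>2" for ij
    using \<epsilon> by (auto simp: J_def)
  have "R ` Z \<subseteq> (\<Union>ij\<in>I. J ij)"
  proof
    fix t assume "t \<in> R ` Z"
    then obtain q where q: "q \<in> Z" "t = R q" by blast
    define ij where "ij = (idx 1 q, idx 2 q)"
    have qc: "q \<in> cell ij" using q by (simp add: cell_def ij_def)
    then have "(SOME p. p \<in> cell ij) \<in> cell ij" by (rule someI)
    from cell[OF this qc] have "t \<in> J ij" unfolding J_def q(2) using qc by (auto simp: abs_le_iff)
    moreover have "ij \<in> I" using idx(1)[OF q(1)] by (simp add: I_def ij_def)
    ultimately show "t \<in> (\<Union>ij\<in>I. J ij)" by blast
  qed
  moreover have "(\<Union>ij\<in>I. J ij) \<in> lmeasurable"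
    by (rule fmeasurable.finite_UN) (use J in \<open>auto simp: I_def\<close>)
  moreover have "measure lebesgue (\<Union>ij\<in>I. J ij) \<le> e"
  proof -
    have "measure lebesgue (\<Union>ij\<in>I. J ij) \<le> (\<Sum>ij\<in>I. measure lebesgue (J ij))"
      by (rule measure_UNION_le) (use J(1) in \<open>auto simp: I_def fmeasurableD\<close>)
    also have "\<dots> \<le> (\<Sum>ij\<in>I. 32 * \<epsilon> * h\<^sup>2)" by (intro sum_mono J)
    also have "\<dots> = (real n + 1)\<^sup>2 * (32 * \<epsilon> * h\<^sup>2)" by (simp add: I_def card_cartesian_product power2_eq_square algebra_simps)
    also have "\<dots> \<le> (2 * real n)\<^sup>2 * (32 * \<epsilon> * h\<^sup>2)"
      using n0 \<epsilon> by (intro mult_right_mono power_mono) auto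
    also have "\<dots> = 128 * \<epsilon> * (real n * h)\<^sup>2" by (simp add: power_mult_distrib)
    also have "\<dots> = e" unfolding h(3) \<epsilon>_def using s by (simp add: power_mult_distrib)
    finally show ?thesis .
  qed
  ultimately show "\<exists>T. R ` Z \<subseteq> T \<and> T \<in> lmeasurable \<and> measure lebesgue T \<le> e" by blast
qed

section \<open>Cauchy-Riemann systems with variable coefficients\<close>

text \<open>The coefficients are those of \<open>sqrt (det h)\<close> times the inverse of a metric
  \<open>h\<close>. They depend only on the conformal class and have determinant 1;
  \<open>cr1\<close> and \<open>cr2\<close> say \<open>dx = - J dy\<close>. The system is used with
  \<open>A / y\<close> in the coordinates \<phi> and again in half-discs of boundary charts.\<close>

locale cauchy_riemann =
  fixes U :: "plane set" and x y b11 b12 b22 :: "plane \<Rightarrow> real"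
  assumes open_U: "open U"
    and x_C2: "Ck_on 2 U x" and y_C2: "Ck_on 2 U y"
    and b_C1: "Ck_on 1 U b11" "Ck_on 1 U b12" "Ck_on 1 U b22"
    and b11_pos: "\<And>p. p \<in> U \<Longrightarrow> 0 < b11 p"
    and det: "\<And>p. p \<in> U \<Longrightarrow> b11 p * b22 p - b12 p * b12 p = 1"
    and cr1: "\<And>p. p \<in> U \<Longrightarrow> dd 1 x p = b12 p * dd 1 y p + b22 p * dd 2 y p"
    and cr2: "\<And>p. p \<in> U \<Longrightarrow> dd 2 x p = - (b11 p * dd 1 y p + b12 p * dd 2 y p)"
begin

definition B :: "plane \<Rightarrow> real^2^2" where
  "B p = vector [vector [b11 p, b12 p], vector [b12 p, b22 p]]"

text \<open>The divergence of \<open>B\<close>. With it as first-order coefficient,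
  \<open>sop\<close> describes the operator in divergence form,
  \<open>div (B grad f)\<close>.\<close>

definition \<beta> :: "plane \<Rightarrow> real^2" where
  "\<beta> p = vector [dd 1 b11 p + dd 2 b12 p, dd 1 b12 p + dd 2 b22 p]"

lemma B_nth [simp]: "B p $ 1 $ 1 = b11 p" "B p $ 1 $ 2 = b12 p" "B p $ 2 $ 1 = b12 p" "B p $ 2 $ 2 = b22 p"
  by (simp_all add: B_def)

lemma B_sym: "transpose (B p) = B p"
  by (simp add: vec_eq_iff forall_2 transpose_def)

lemma B_quad: "v \<bullet> (B p *v v) = b11 p * (v$1)\<^sup>2 + 2 * b12 p * v$1 * v$2 + b22 p * (v$2)\<^sup>2"
  by (simp add: inner_2 mv_2 power2_eq_square algebra_simps)

lemma B_pos:
  assumes "p \<in> U" "v \<noteq> 0"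
  shows "0 < v \<bullet> (B p *v v)"
proof -
  have d: "b11 p * b22 p = 1 + b12 p * b12 p" using det[OF assms(1)] by simp
  have "b11 p * (v \<bullet> (B p *v v)) = (b11 p * v$1 + b12 p * v$2)\<^sup>2 + (b11 p * b22 p - b12 p * b12 p) * (v$2)\<^sup>2"
    unfolding B_quad by (simp add: power2_eq_square algebra_simps)
  also have "\<dots> = (b11 p * v$1 + b12 p * v$2)\<^sup>2 + (v$2)\<^sup>2" using det[OF assms(1)] by simp
  also have "\<dots> > 0"
  proof (cases "v$2 = 0")
    case True
    then have "v$1 \<noteq> 0" using assms(2) by (auto simp: vec_eq_iff forall_2)
    then show ?thesis using True b11_pos[OF assms(1)] by simp
  qed (simp add: add_nonneg_pos)
  finally show ?thesis using b11_pos[OF assms(1)] by (simp add: zero_less_mult_iff)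
qed

lemma B_nonneg: "p \<in> U \<Longrightarrow> 0 \<le> v \<bullet> (B p *v v)"
  using B_pos[of p v] by (cases "v = 0") auto

lemma diff_b: "p \<in> U \<Longrightarrow> b11 differentiable (at p)" "p \<in> U \<Longrightarrow> b12 differentiable (at p)" "p \<in> U \<Longrightarrow> b22 differentiable (at p)"
  using b_C1 by (auto simp: One_nat_def)

lemma C2: "Ck_on (Suc (Suc 0)) U x" "Ck_on (Suc (Suc 0)) U y"
  using x_C2 y_C2 by (simp_all only: numeral_2_eq_2)

lemma diff_xy: "p \<in> U \<Longrightarrow> x differentiable (at p)" "p \<in> U \<Longrightarrow> y differentiable (at p)"
  "p \<in> U \<Longrightarrow> dd i x differentiable (at p)" "p \<in> U \<Longrightarrow> dd i y differentiable (at p)"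
  using Ck_on_differentiable[OF C2(1)] Ck_on_differentiable[OF C2(2)]
    Ck_on_differentiable[OF Ck_on_dd[OF C2(1)]] Ck_on_differentiable[OF Ck_on_dd[OF C2(2)]] by blast+

text \<open>Equality of the mixed second partials of \<open>x\<close>, with the first ones replaced
  by the right-hand sides of the system.\<close>

lemma divergence_y:
  assumes p: "p \<in> U"
  shows "B p$1$1 * dd 1 (dd 1 y) p + B p$2$1 * dd 1 (dd 2 y) p + B p$1$2 * dd 2 (dd 1 y) p + B p$2$2 * dd 2 (dd 2 y) p
      + (\<beta> p$1 * dd 1 y p + \<beta> p$2 * dd 2 y p) = 0"
proof -
  note D = diff_b[OF p] diff_xy[OF p]
  have 1: "dd 1 (dd 2 x) p = dd 1 (\<lambda>q. - (b11 q * dd 1 y q + b12 q * dd 2 y q)) p"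
    by (rule dd_cong[OF open_U p cr2]) (use D in auto)
  have 2: "dd 2 (dd 1 x) p = dd 2 (\<lambda>q. b12 q * dd 1 y q + b22 q * dd 2 y q) p"
    by (rule dd_cong[OF open_U p cr1]) (use D in auto)
  have sw: "dd 1 (dd 2 x) p = dd 2 (dd 1 x) p"
    by (rule second_partials_commute[OF open_U p]) (use diff_xy p in auto)
  have 3: "dd 1 (\<lambda>q. - (b11 q * dd 1 y q + b12 q * dd 2 y q)) p =
     - (b11 p * dd 1 (dd 1 y) p + dd 1 b11 p * dd 1 y p + (b12 p * dd 1 (dd 2 y) p + dd 1 b12 p * dd 2 y p))"
  proof -
    have "dd 1 (\<lambda>q. - (b11 q * dd 1 y q + b12 q * dd 2 y q)) p = - dd 1 (\<lambda>q. b11 q * dd 1 y q + b12 q * dd 2 y q) p"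
      by (rule dd_uminus) (use D in simp)
    then show ?thesis using D by (simp add: dd_add dd_mult)
  qed
  have 4: "dd 2 (\<lambda>q. b12 q * dd 1 y q + b22 q * dd 2 y q) p =
     b12 p * dd 2 (dd 1 y) p + dd 2 b12 p * dd 1 y p + (b22 p * dd 2 (dd 2 y) p + dd 2 b22 p * dd 2 y p)"
    using D by (simp add: dd_add dd_mult)
  show ?thesis using 1 2 3 4 sw by (simp add: \<beta>_def algebra_simps)
qed

lemma sop_y:
  assumes p: "p \<in> U"
  shows "sop (B p) (\<beta> p) y p (gradv y p) 0"
  using sop_Ck[OF open_U p y_C2, of "B p" "\<beta> p"] unfolding divergence_y[OF p] .

text \<open>Multiplication of \<open>z\<close> by the imaginary unit. Since \<open>B\<close> has
  determinant 1, solving the system for the partials of \<open>y\<close> reproduces it, and every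
  fact about \<open>y\<close> yields one about \<open>x\<close>.\<close>

lemma conjugate: "cauchy_riemann U (\<lambda>p. - y p) x b11 b12 b22"
proof
  show "Ck_on 2 U (\<lambda>p. - y p)" using Ck_on_uminus[OF open_U y_C2] .
  fix p assume p: "p \<in> U"
  have "b11 p * dd 1 x p + b12 p * dd 2 x p = (b11 p * b22 p - b12 p * b12 p) * dd 2 y p"
    "b12 p * dd 1 x p + b22 p * dd 2 x p = - (b11 p * b22 p - b12 p * b12 p) * dd 1 y p"
    unfolding cr1[OF p] cr2[OF p] by (simp_all add: algebra_simps)
  then have *: "dd 2 y p = b11 p * dd 1 x p + b12 p * dd 2 x p" "- dd 1 y p = b12 p * dd 1 x p + b22 p * dd 2 x p"
    using det[OF p] by auto
  show "dd 1 (\<lambda>p. - y p) p = b12 p * dd 1 x p + b22 p * dd 2 x p"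
    "dd 2 (\<lambda>p. - y p) p = - (b11 p * dd 1 x p + b12 p * dd 2 x p)"
    using * diff_xy[OF p] by (simp_all add: dd_uminus)
qed (use open_U x_C2 b_C1 b11_pos det in auto)

lemma sop_x:
  assumes p: "p \<in> U"
  shows "sop (B p) (\<beta> p) x p (gradv x p) 0"
proof -
  interpret c: cauchy_riemann U "\<lambda>p. - y p" x b11 b12 b22 by (rule conjugate)
  show ?thesis using c.sop_y[OF p] unfolding c.B_def c.\<beta>_def B_def \<beta>_def .
qed

lemma conformal:
  assumes p: "p \<in> U"
  shows "gradv x p \<bullet> (B p *v gradv y p) = 0" "gradv y p \<bullet> (B p *v gradv x p) = 0"
    "gradv x p \<bullet> (B p *v gradv x p) = gradv y p \<bullet> (B p *v gradv y p)"
proof -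
  note cr = cr1[OF p] cr2[OF p]
  have d: "b11 p * b22 p = 1 + b12 p * b12 p" using det[OF p] by simp
  show 1: "gradv x p \<bullet> (B p *v gradv y p) = 0"
    unfolding inner_2 mv_2 by (simp add: cr algebra_simps)
  then show "gradv y p \<bullet> (B p *v gradv x p) = 0"
    by (metis B_sym dot_lmul_matrix inner_commute transpose_matrix_vector)
  have "gradv x p \<bullet> (B p *v gradv x p) = (b11 p * b22 p - b12 p * b12 p) *
      (b11 p * (dd 1 y p)\<^sup>2 + 2 * b12 p * dd 1 y p * dd 2 y p + b22 p * (dd 2 y p)\<^sup>2)"
    unfolding inner_2 mv_2 by (simp add: cr power2_eq_square algebra_simps)
  then show "gradv x p \<bullet> (B p *v gradv x p) = gradv y p \<bullet> (B p *v gradv y p)"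
    unfolding B_quad by (simp add: det[OF p])
qed

section \<open>Logarithms of distances and accumulation of zeros\<close>

definition N2 :: "real \<Rightarrow> real \<Rightarrow> plane \<Rightarrow> real" where
  "N2 a c q = (x q - a) * (x q - a) + (y q - c) * (y q - c)"

text \<open>With \<open>m\<close> the common square length of both gradients, the operator gives
  \<open>4 m\<close> on \<open>N2\<close>, and the gradient of \<open>N2\<close> has square length
  \<open>4 * N2 * m\<close>. For the logarithm the two contributions cancel.\<close>

lemma sop_ln_N2:
  assumes p: "p \<in> U" "0 < N2 a c p"
  shows "\<exists>g. sop (B p) (\<beta> p) (\<lambda>q. ln (N2 a c q)) p g 0"
proof -
  define m where "m = gradv y p \<bullet> (B p *v gradv y p)"
  have jx: "sop (B p) (\<beta> p) (\<lambda>q. x q - a) p (gradv x p) 0"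
    using sop_diff[OF sop_x[OF p(1)] sop_const[of _ _ a]] by simp
  have jy: "sop (B p) (\<beta> p) (\<lambda>q. y q - c) p (gradv y p) 0"
    using sop_diff[OF sop_y[OF p(1)] sop_const[of _ _ c]] by simp
  define X Y where "X = x p - a" and "Y = y p - c"
  define g where "g = (X + X) *\<^sub>R gradv x p + (Y + Y) *\<^sub>R gradv y p"
  have g: "(x p - a) *\<^sub>R gradv x p + (x p - a) *\<^sub>R gradv x p + ((y p - c) *\<^sub>R gradv y p + (y p - c) *\<^sub>R gradv y p) = g"
    by (simp only: g_def X_def Y_def scaleR_add_left)
  have jN: "sop (B p) (\<beta> p) (N2 a c) p g (4 * m)"
  proof -
    have l: "(x p - a) * 0 + (x p - a) * 0 + 2 * (gradv x p \<bullet> (B p *v gradv x p)) +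
        ((y p - c) * 0 + (y p - c) * 0 + 2 * (gradv y p \<bullet> (B p *v gradv y p))) = 4 * m"
      by (simp add: m_def conformal[OF p(1)])
    show ?thesis
      using sop_add[OF sop_mult[OF jx jx B_sym] sop_mult[OF jy jy B_sym]]
      unfolding g l N2_def[abs_def] .
  qed
  have gg: "g \<bullet> (B p *v g) = 4 * N2 a c p * m"
  proof -
    have e: "B p *v g = (X + X) *\<^sub>R (B p *v gradv x p) + (Y + Y) *\<^sub>R (B p *v gradv y p)"
      unfolding g_def by (simp only: matrix_vector_mult_scaleR matrix_vector_right_distrib)
    have "g \<bullet> (B p *v g) = (X + X) * ((X + X) * m) + (Y + Y) * ((Y + Y) * m)"
      unfolding e unfolding g_def inner_add_left inner_add_right inner_scaleR_left inner_scaleR_right conformal[OF p(1)] m_def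
      by simp
    then show ?thesis unfolding N2_def X_def Y_def by (simp add: algebra_simps)
  qed
  have "\<forall>\<^sub>F t in nhds (N2 a c p). (ln has_real_derivative (inverse t)) (at t)"
  proof -
    have "\<forall>\<^sub>F t in nhds (N2 a c p). 0 < t" using p
      by (intro eventually_nhds_in_open[of "{0<..}", simplified]) auto
    then show ?thesis by eventually_elim (rule DERIV_ln)
  qed
  moreover have "(inverse has_real_derivative (- inverse ((N2 a c p)\<^sup>2))) (at (N2 a c p))"
    using p by (auto intro!: derivative_eq_intros simp: power2_eq_square)
  ultimately have "sop (B p) (\<beta> p) (\<lambda>q. ln (N2 a c q)) p (inverse (N2 a c p) *\<^sub>R g)
      (inverse (N2 a c p) * (4 * m) + (- inverse ((N2 a c p)\<^sup>2)) * (g \<bullet> (B p *v g)))"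
    by (rule sop_comp[OF jN B_sym, where \<phi>=ln and \<phi>'=inverse])
  moreover have "inverse (N2 a c p) * (4 * m) + (- inverse ((N2 a c p)\<^sup>2)) * (g \<bullet> (B p *v g)) = 0"
    unfolding gg using p by (simp add: power2_eq_square field_simps)
  ultimately show ?thesis by auto
qed

text \<open>\<open>quad c\<close> is the quadratic form of the inverse of \<open>B c\<close>, so \<open>ln (quad c (p - c)) / 2\<close> is the fundamental solution
  for the coefficients frozen at \<open>c\<close>. The second term of \<open>psi\<close> makes it a strict supersolution near \<open>c\<close>.\<close>

definition quad :: "plane \<Rightarrow> plane \<Rightarrow> real" where
  "quad c w = b22 c * (w$1 * w$1) - 2 * b12 c * (w$1 * w$2) + b11 c * (w$2 * w$2)"

definition psi :: "real \<Rightarrow> plane \<Rightarrow> plane \<Rightarrow> real" where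
  "psi M c p = 1/2 * ln (quad c (p - c)) - M * sqrt (quad c (p - c))"

text \<open>The Cayley-Hamilton identity for the matrix of \<open>quad c\<close>, which has trace
  \<open>b11 c + b22 c\<close> and determinant 1, evaluated at \<open>w\<close>.\<close>

lemma quad_eq:
  assumes "c \<in> U"
  shows "(b11 c + b22 c) * quad c w = (norm w)\<^sup>2 + ((b22 c * w$1 - b12 c * w$2)\<^sup>2 + (b11 c * w$2 - b12 c * w$1)\<^sup>2)"
proof -
  have "(b11 c + b22 c) * quad c w = (b11 c * b22 c - b12 c * b12 c) * (w$1 * w$1 + w$2 * w$2)
      + ((b22 c * w$1 - b12 c * w$2)\<^sup>2 + (b11 c * w$2 - b12 c * w$1)\<^sup>2)"
    by (simp add: quad_def power2_eq_square algebra_simps)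
  then show ?thesis using det[OF assms] by (simp add: power2_norm_eq_inner inner_2)
qed

lemma quad_bounds:
  assumes c: "c \<in> U" and K: "\<bar>b11 c\<bar> \<le> K" "\<bar>b12 c\<bar> \<le> K" "\<bar>b22 c\<bar> \<le> K"
  shows "(norm w)\<^sup>2 \<le> 2 * K * quad c w" "quad c w \<le> 2 * K * (norm w)\<^sup>2"
    "(b22 c * w$1 - b12 c * w$2)\<^sup>2 + (b11 c * w$2 - b12 c * w$1)\<^sup>2 \<le> 2 * K * quad c w"
    "0 \<le> quad c w"
proof -
  have tr: "b11 c + b22 c \<le> 2 * K" using K by simp
  have pos: "b11 c + b22 c > 0"
  proof -
    have "b11 c * b22 c > 0" using det[OF c] by (smt (verit) zero_le_square)
    then show ?thesis using b11_pos[OF c] by (simp add: zero_less_mult_iff add_pos_pos)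
  qed
  have "0 \<le> (b11 c + b22 c) * quad c w" unfolding quad_eq[OF c] by simp
  then show q: "0 \<le> quad c w" using pos by (simp add: zero_le_mult_iff)
  have "(b11 c + b22 c) * quad c w \<le> 2 * K * quad c w" using tr q by (rule mult_right_mono)
  then show "(norm w)\<^sup>2 \<le> 2 * K * quad c w"
    "(b22 c * w$1 - b12 c * w$2)\<^sup>2 + (b11 c * w$2 - b12 c * w$1)\<^sup>2 \<le> 2 * K * quad c w"
    unfolding quad_eq[OF c] by (smt (verit) zero_le_power2)+
  have "quad c w \<le> \<bar>b22 c\<bar> * (w$1 * w$1) + 2 * \<bar>b12 c\<bar> * (\<bar>w$1\<bar> * \<bar>w$2\<bar>) + \<bar>b11 c\<bar> * (w$2 * w$2)"
  proof -
    have "b22 c * (w$1 * w$1) \<le> \<bar>b22 c\<bar> * (w$1 * w$1)" "b11 c * (w$2 * w$2) \<le> \<bar>b11 c\<bar> * (w$2 * w$2)"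
      by (intro mult_right_mono; simp)+
    moreover have "- (b12 c * (w$1 * w$2)) \<le> \<bar>b12 c\<bar> * (\<bar>w$1\<bar> * \<bar>w$2\<bar>)"
      using abs_ge_minus_self[of "b12 c * (w$1 * w$2)"] by (simp add: abs_mult)
    ultimately show ?thesis by (simp add: quad_def)
  qed
  also have "\<dots> \<le> K * (w$1 * w$1) + 2 * K * (\<bar>w$1\<bar> * \<bar>w$2\<bar>) + K * (w$2 * w$2)"
    using K by (intro add_mono mult_right_mono) auto
  also have "\<dots> \<le> 2 * K * (norm w)\<^sup>2"
  proof -
    have "2 * (\<bar>w$1\<bar> * \<bar>w$2\<bar>) \<le> w$1 * w$1 + w$2 * w$2"
      using sum_squares_bound[of "\<bar>w$1\<bar>" "\<bar>w$2\<bar>"] by (simp add: power2_eq_square)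
    moreover have "0 \<le> K" using K(1) by simp
    ultimately have "K * (2 * (\<bar>w$1\<bar> * \<bar>w$2\<bar>)) \<le> K * (w$1 * w$1 + w$2 * w$2)" by (intro mult_left_mono)
    then show ?thesis by (simp add: power2_norm_eq_inner inner_2 algebra_simps)
  qed
  finally show "quad c w \<le> 2 * K * (norm w)\<^sup>2" .
qed

lemma quad_pos:
  assumes "c \<in> U" "w \<noteq> 0"
  shows "0 < quad c w"
proof -
  define K where "K = max \<bar>b11 c\<bar> (max \<bar>b12 c\<bar> \<bar>b22 c\<bar>)"
  have K: "\<bar>b11 c\<bar> \<le> K" "\<bar>b12 c\<bar> \<le> K" "\<bar>b22 c\<bar> \<le> K" by (auto simp: K_def)
  note q = quad_bounds(1,4)[OF assms(1) K, of w]
  have "quad c w \<noteq> 0" using q(1) assms(2) by auto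
  then show ?thesis using q(2) by simp
qed

lemma sop_quad:
  assumes p: "p \<in> U"
  shows "sop (B p) (\<beta> p) (\<lambda>q. quad c (q - c)) p
    (2 *\<^sub>R vector [b22 c * (p - c)$1 - b12 c * (p - c)$2, b11 c * (p - c)$2 - b12 c * (p - c)$1])
    (2 * (b11 p * b22 c - 2 * b12 p * b12 c + b22 p * b11 c)
      + 2 * (\<beta> p$1 * (b22 c * (p - c)$1 - b12 c * (p - c)$2) + \<beta> p$2 * (b11 c * (p - c)$2 - b12 c * (p - c)$1)))"
    (is "sop _ _ _ _ ?g ?l")
proof -
  have coord: "sop (B p) (\<beta> p) (\<lambda>q. (q - c) $ i) p (axis i 1) (\<beta> p $ i)" for i
    using sop_diff[OF sop_inner[of "B p" "\<beta> p" "axis i 1" p] sop_const[of "B p" "\<beta> p" "c $ i" p]]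
    by (simp add: inner_axis inner_axis')
  note c = coord[of 1] coord[of 2]
  have m: "axis 1 1 \<bullet> (B p *v axis 1 1) = b11 p" "axis 1 1 \<bullet> (B p *v axis 2 1) = b12 p" "axis 2 1 \<bullet> (B p *v axis 2 1) = b22 p"
    by (simp_all add: inner_2 mv_2 axis_def)
  from sop_add[OF sop_diff[OF sop_cmult[OF sop_mult[OF c(1) c(1) B_sym], of "b22 c"]
      sop_cmult[OF sop_mult[OF c(1) c(2) B_sym], of "2 * b12 c"]]
      sop_cmult[OF sop_mult[OF c(2) c(2) B_sym], of "b11 c"]]
  have "sop (B p) (\<beta> p) (\<lambda>q. quad c (q - c)) p
    (b22 c *\<^sub>R ((p - c)$1 *\<^sub>R axis 1 1 + (p - c)$1 *\<^sub>R axis 1 1)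
      - (2 * b12 c) *\<^sub>R ((p - c)$1 *\<^sub>R axis 2 1 + (p - c)$2 *\<^sub>R axis 1 1)
      + b11 c *\<^sub>R ((p - c)$2 *\<^sub>R axis 2 1 + (p - c)$2 *\<^sub>R axis 2 1))
    (b22 c * ((p - c)$1 * \<beta> p$1 + (p - c)$1 * \<beta> p$1 + 2 * b11 p)
      - 2 * b12 c * ((p - c)$1 * \<beta> p$2 + (p - c)$2 * \<beta> p$1 + 2 * b12 p)
      + b11 c * ((p - c)$2 * \<beta> p$2 + (p - c)$2 * \<beta> p$2 + 2 * b22 p))" (is "sop _ _ _ _ ?g' ?l'")
    unfolding quad_def m .
  moreover have "?g' = ?g" by (simp add: vec_eq_iff forall_2 axis_def algebra_simps)
  moreover have "?l' = ?l" by (simp add: algebra_simps)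
  ultimately show ?thesis by simp
qed

text \<open>Without the errors \<open>E\<close> and \<open>e1\<close> the logarithmic part cancels,
  and the square root in \<open>psi\<close> leaves \<open>- M / r\<close>. Replacing the
  coefficients at \<open>p\<close> by those at the pole costs at most
  \<open>(C1 + 2 * C2) / r\<close>.\<close>

lemma psi_estimate:
  fixes r M E e1 C1 C2 :: real
  assumes r: "0 < r" "0 \<le> M" "M * r \<le> 1" and M: "C1 + 2 * C2 < M"
    and E: "\<bar>E\<bar> \<le> C1 * r" "\<bar>e1\<bar> \<le> C2 * r ^ 3"
  shows "(1 / (2 * r\<^sup>2) - M / (2 * r)) * (4 + 2 * E) + (- 1 / (2 * r ^ 4) + M / (4 * r ^ 3)) * (4 * (r\<^sup>2 + e1)) < 0"
proof -
  define u where "u = (1 - M * r) / (2 * r\<^sup>2)"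
  define v where "v = (M * r - 2) / (4 * r ^ 4)"
  have u: "\<bar>u\<bar> \<le> 1 / (2 * r\<^sup>2)"
    unfolding u_def using r by (simp add: abs_divide divide_right_mono)
  have v: "\<bar>v\<bar> \<le> 2 / (4 * r ^ 4)"
    unfolding v_def abs_divide using r by (intro frac_le) auto
  have "(1 / (2 * r\<^sup>2) - M / (2 * r)) * (4 + 2 * E) + (- 1 / (2 * r ^ 4) + M / (4 * r ^ 3)) * (4 * (r\<^sup>2 + e1))
     = u * (4 + 2 * E) + v * (4 * (r\<^sup>2 + e1))"
  proof -
    have "1 / (2 * r\<^sup>2) - M / (2 * r) = u" unfolding u_def using r by (simp add: field_simps power2_eq_square)
    moreover have "- 1 / (2 * r ^ 4) + M / (4 * r ^ 3) = v" unfolding v_def using r by (simp add: field_simps eval_nat_numeral)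
    ultimately show ?thesis by simp
  qed
  also have "\<dots> = - M / r + u * (2 * E) + v * (4 * e1)"
  proof -
    have "u * 4 + v * (4 * r\<^sup>2) = - M / r" unfolding u_def v_def using r by (simp add: field_simps eval_nat_numeral)
    then show ?thesis by (simp add: algebra_simps)
  qed
  also have "\<dots> < 0"
  proof -
    have "u * (2 * E) \<le> \<bar>u\<bar> * (2 * \<bar>E\<bar>)" by (metis abs_ge_self abs_mult abs_numeral)
    also have "\<dots> \<le> 1 / (2 * r\<^sup>2) * (2 * (C1 * r))" using u E r by (intro mult_mono) auto
    also have "\<dots> = C1 / r" using r by (simp add: power2_eq_square)
    finally have 1: "u * (2 * E) \<le> C1 / r" .
    have "v * (4 * e1) \<le> \<bar>v\<bar> * (4 * \<bar>e1\<bar>)" by (metis abs_ge_self abs_mult abs_numeral)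
    also have "\<dots> \<le> 2 / (4 * r ^ 4) * (4 * (C2 * r ^ 3))" using v E r by (intro mult_mono) auto
    also have "\<dots> = 2 * C2 / r" using r by (simp add: field_simps eval_nat_numeral)
    finally have 2: "v * (4 * e1) \<le> 2 * C2 / r" .
    have "- M / r + C1 / r + 2 * C2 / r = (C1 + 2 * C2 - M) / r" by (simp add: add_divide_distrib diff_divide_distrib)
    also have "\<dots> < 0" using r(1) M by (simp add: divide_neg_pos)
    finally show ?thesis using 1 2 by linarith
  qed
  finally show ?thesis .
qed

text \<open>The point is uniformity in the pole \<open>c\<close>: many poles are used at the same
  time, with the same radius and the same constants.\<close>

lemma barrier:
  assumes p0: "p0 \<in> U"
  obtains \<rho> M K where "0 < \<rho>" "0 < M" "1 \<le> K" "cball p0 \<rho> \<subseteq> U"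
    "\<And>c p. c \<in> cball p0 \<rho> \<Longrightarrow> p \<in> cball p0 \<rho> \<Longrightarrow> (norm (p - c))\<^sup>2 \<le> 2 * K * quad c (p - c)"
    "\<And>c p. c \<in> cball p0 \<rho> \<Longrightarrow> p \<in> cball p0 \<rho> \<Longrightarrow> quad c (p - c) \<le> 2 * K * (norm (p - c))\<^sup>2"
    "\<And>c p. c \<in> cball p0 \<rho> \<Longrightarrow> p \<in> cball p0 \<rho> \<Longrightarrow> M * sqrt (quad c (p - c)) \<le> 1"
    "\<And>c p. c \<in> cball p0 \<rho> \<Longrightarrow> p \<in> cball p0 \<rho> \<Longrightarrow> p \<noteq> c \<Longrightarrow> \<exists>g l. sop (B p) (\<beta> p) (psi M c) p g l \<and> l < 0"
proof -
  obtain \<rho>0 where \<rho>0: "\<rho>0 > 0" "cball p0 \<rho>0 \<subseteq> U" using open_U p0 open_contains_cball by blast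
  have b1: "Ck_on (Suc 0) U b11" "Ck_on (Suc 0) U b12" "Ck_on (Suc 0) U b22" using b_C1 by (simp_all add: One_nat_def)
  note cb = Ck_on_continuous[OF b1(1)] Ck_on_continuous[OF b1(2)] Ck_on_continuous[OF b1(3)]
  have cd: "continuous_on U (dd i b11)" "continuous_on U (dd i b12)" "continuous_on U (dd i b22)" for i
    using Ck_on_continuous[OF Ck_on_dd[OF b1(1)]] Ck_on_continuous[OF Ck_on_dd[OF b1(2)]] Ck_on_continuous[OF Ck_on_dd[OF b1(3)]] .
  have bd: "\<exists>K\<ge>0. \<forall>p\<in>cball p0 \<rho>0. \<bar>f p\<bar> \<le> K" if "continuous_on U f" for f :: "plane \<Rightarrow> real"
    using continuous_on_bounded_cball[OF continuous_on_subset[OF that \<rho>0(2)]] .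
  have "continuous_on U (\<lambda>p. \<beta> p $ 1)" "continuous_on U (\<lambda>p. \<beta> p $ 2)"
    unfolding \<beta>_def vector_2 by (intro continuous_on_add cd)+
  note cbeta = this
  obtain K1 where K1: "0 \<le> K1" "\<forall>p\<in>cball p0 \<rho>0. \<bar>b11 p\<bar> \<le> K1" using bd[OF cb(1)] by blast
  obtain K2 where K2: "0 \<le> K2" "\<forall>p\<in>cball p0 \<rho>0. \<bar>b12 p\<bar> \<le> K2" using bd[OF cb(2)] by blast
  obtain K3 where K3: "0 \<le> K3" "\<forall>p\<in>cball p0 \<rho>0. \<bar>b22 p\<bar> \<le> K3" using bd[OF cb(3)] by blast
  obtain K4 where K4: "0 \<le> K4" "\<forall>p\<in>cball p0 \<rho>0. \<bar>\<beta> p $ 1\<bar> \<le> K4" using bd[OF cbeta(1)] by blast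
  obtain K5 where K5: "0 \<le> K5" "\<forall>p\<in>cball p0 \<rho>0. \<bar>\<beta> p $ 2\<bar> \<le> K5" using bd[OF cbeta(2)] by blast
  obtain K6 where K6: "0 \<le> K6" "\<forall>p\<in>cball p0 \<rho>0. \<forall>q\<in>cball p0 \<rho>0. \<bar>b11 p - b11 q\<bar> \<le> K6 * norm (p - q)"
    using C1_Lipschitz[OF open_U \<rho>0(2) b_C1(1)] by blast
  obtain K7 where K7: "0 \<le> K7" "\<forall>p\<in>cball p0 \<rho>0. \<forall>q\<in>cball p0 \<rho>0. \<bar>b12 p - b12 q\<bar> \<le> K7 * norm (p - q)"
    using C1_Lipschitz[OF open_U \<rho>0(2) b_C1(2)] by blast
  obtain K8 where K8: "0 \<le> K8" "\<forall>p\<in>cball p0 \<rho>0. \<forall>q\<in>cball p0 \<rho>0. \<bar>b22 p - b22 q\<bar> \<le> K8 * norm (p - q)"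
    using C1_Lipschitz[OF open_U \<rho>0(2) b_C1(3)] by blast
  define K where "K = K1 + K2 + K3 + K4 + K5 + K6 + K7 + K8 + 1"
  have Kle: "K1 \<le> K" "K2 \<le> K" "K3 \<le> K" "K4 \<le> K" "K5 \<le> K" "K6 \<le> K" "K7 \<le> K" "K8 \<le> K" "1 \<le> K"
    using K1(1) K2(1) K3(1) K4(1) K5(1) K6(1) K7(1) K8(1) by (simp_all add: K_def)
  have Kb: "\<bar>b11 p\<bar> \<le> K" "\<bar>b12 p\<bar> \<le> K" "\<bar>b22 p\<bar> \<le> K" "\<bar>\<beta> p $ 1\<bar> \<le> K" "\<bar>\<beta> p $ 2\<bar> \<le> K" if "p \<in> cball p0 \<rho>0" for p
    using bspec[OF K1(2) that] bspec[OF K2(2) that] bspec[OF K3(2) that] bspec[OF K4(2) that] bspec[OF K5(2) that] Kle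
    by linarith+
  have KL: "\<bar>b11 p - b11 q\<bar> \<le> K * norm (p - q)" "\<bar>b12 p - b12 q\<bar> \<le> K * norm (p - q)" "\<bar>b22 p - b22 q\<bar> \<le> K * norm (p - q)"
    if "p \<in> cball p0 \<rho>0" "q \<in> cball p0 \<rho>0" for p q
    using bspec[OF bspec[OF K6(2) that(1)] that(2)] bspec[OF bspec[OF K7(2) that(1)] that(2)]
      bspec[OF bspec[OF K8(2) that(1)] that(2)] mult_right_mono[OF Kle(6) norm_ge_zero[of "p - q"]]
      mult_right_mono[OF Kle(7) norm_ge_zero[of "p - q"]] mult_right_mono[OF Kle(8) norm_ge_zero[of "p - q"]] by linarith+
  define T where "T = sqrt (2 * K)"
  have T: "T > 0" "T\<^sup>2 = 2 * K" using Kle(9) by (auto simp: T_def)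
  \<comment> \<open>The errors are estimated below: \<open>e2\<close> by \<open>4 K^2 T r\<close>,
    the first-order term \<open>bt\<close> by \<open>2 K T r\<close>, and \<open>e1\<close> by
    \<open>K T r * 2 (T r)^2\<close>, which is \<open>C2 * r^3\<close>.\<close>
  define C1 where "C1 = 4 * K\<^sup>2 * T + 2 * K * T"
  define C2 where "C2 = 2 * K * T ^ 3"
  define M where "M = C1 + 2 * C2 + 1"
  have Cpos: "0 \<le> C1" "0 \<le> C2" using T(1) Kle(9) by (simp_all add: C1_def C2_def)
  then have M: "M > 0" "C1 + 2 * C2 < M" by (simp_all add: M_def)
  \<comment> \<open>Two points of the ball are at distance at most \<open>2 * \<rho>\<close>, so
    \<open>sqrt (quad c (p - c))\<close> is at most \<open>T * (2 * \<rho>)\<close>, and this radius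
    gives the bound 1 after multiplication by \<open>M\<close>.\<close>
  define \<rho> where "\<rho> = min \<rho>0 (1 / (2 * T * M))"
  have \<rho>: "0 < \<rho>" "cball p0 \<rho> \<subseteq> cball p0 \<rho>0" "T * (2 * \<rho>) * M \<le> 1"
  proof -
    show "0 < \<rho>" using \<rho>0 T M by (simp add: \<rho>_def)
    show "cball p0 \<rho> \<subseteq> cball p0 \<rho>0" by (auto simp: \<rho>_def)
    have "\<rho> \<le> 1 / (2 * T * M)" by (simp add: \<rho>_def)
    then show "T * (2 * \<rho>) * M \<le> 1" using T M by (simp add: field_simps)
  qed
  have main: "(norm (p - c))\<^sup>2 \<le> 2 * K * quad c (p - c)" "quad c (p - c) \<le> 2 * K * (norm (p - c))\<^sup>2"
    "M * sqrt (quad c (p - c)) \<le> 1" "p \<noteq> c \<Longrightarrow> \<exists>g l. sop (B p) (\<beta> p) (psi M c) p g l \<and> l < 0"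
    if c: "c \<in> cball p0 \<rho>" and p: "p \<in> cball p0 \<rho>" for c p
  proof -
    have c0: "c \<in> cball p0 \<rho>0" and p0': "p \<in> cball p0 \<rho>0" using c p \<rho>(2) by blast+
    have cU: "c \<in> U" and pU: "p \<in> U" using c0 p0' \<rho>0(2) by blast+
    define w where "w = p - c"
    note qb = quad_bounds[OF cU Kb(1-3)[OF c0], of w]
    show q1: "(norm (p - c))\<^sup>2 \<le> 2 * K * quad c (p - c)" "quad c (p - c) \<le> 2 * K * (norm (p - c))\<^sup>2"
      using qb(1,2) by (simp_all add: w_def)
    define r where "r = sqrt (quad c w)"
    have r0: "0 \<le> r" "r\<^sup>2 = quad c w" using qb(4) by (simp_all add: r_def)
    have "r\<^sup>2 \<le> (T * norm w)\<^sup>2" unfolding r0(2) power_mult_distrib T(2) by (rule qb(2))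
    then have "r \<le> T * norm w" by (rule power2_le_imp_le) (use T(1) in simp)
    also have "\<dots> \<le> T * (2 * \<rho>)"
    proof -
      have "norm w \<le> norm (p - p0) + norm (p0 - c)" unfolding w_def by norm
      then show ?thesis using p c T(1) by (intro mult_left_mono) (auto simp: dist_norm norm_minus_commute)
    qed
    finally have "r * M \<le> T * (2 * \<rho>) * M" using M(1) by (intro mult_right_mono) auto
    then have Mr: "M * r \<le> 1" using \<rho>(3) by (simp add: mult.commute)
    then show "M * sqrt (quad c (p - c)) \<le> 1" by (simp add: r_def w_def)
    assume "p \<noteq> c"
    then have q: "quad c w > 0" using quad_pos[OF cU] by (simp add: w_def)
    then have r: "r > 0" by (simp add: r_def)
    have wr: "norm w \<le> T * r"
    proof -
      have "(norm w)\<^sup>2 \<le> (T * r)\<^sup>2" unfolding power_mult_distrib T(2) r0(2) by (rule qb(1))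
      then show ?thesis by (rule power2_le_imp_le) (use T(1) r in simp)
    qed
    define g1 g2 where "g1 = b22 c * w$1 - b12 c * w$2" and "g2 = b11 c * w$2 - b12 c * w$1"
    have gg: "g1\<^sup>2 + g2\<^sup>2 \<le> (T * r)\<^sup>2"
      unfolding power_mult_distrib T(2) r0(2) g1_def g2_def by (rule qb(3))
    have g: "\<bar>g1\<bar> \<le> T * r" "\<bar>g2\<bar> \<le> T * r"
    proof -
      have Tr: "0 \<le> T * r" using T(1) r by simp
      have "\<bar>g1\<bar>\<^sup>2 \<le> (T * r)\<^sup>2" unfolding power2_abs using gg zero_le_power2[of g2] by linarith
      then show "\<bar>g1\<bar> \<le> T * r" using Tr by (rule power2_le_imp_le)
      have "\<bar>g2\<bar>\<^sup>2 \<le> (T * r)\<^sup>2" unfolding power2_abs using gg zero_le_power2[of g1] by linarith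
      then show "\<bar>g2\<bar> \<le> T * r" using Tr by (rule power2_le_imp_le)
    qed
    \<comment> \<open>The deviation of the second-order term from its value at \<open>p = c\<close>,
      which is \<open>2 * det (B c) = 2\<close>. The Lipschitz bound on the coefficients makes it
      small.\<close>
    define e2 where "e2 = b11 p * b22 c - 2 * b12 p * b12 c + b22 p * b11 c - 2"
    define bt where "bt = \<beta> p $ 1 * g1 + \<beta> p $ 2 * g2"
    have KL': "\<bar>b11 p - b11 c\<bar> \<le> K * norm w" "\<bar>b12 p - b12 c\<bar> \<le> K * norm w" "\<bar>b22 p - b22 c\<bar> \<le> K * norm w"
      using KL[OF p0' c0] by (simp_all add: w_def)
    have Kn: "0 \<le> K * norm w" using Kle(9) by simp
    have e2: "\<bar>e2\<bar> \<le> 4 * K\<^sup>2 * (T * r)"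
    proof -
      have "e2 = (b11 p - b11 c) * b22 c - 2 * ((b12 p - b12 c) * b12 c) + (b22 p - b22 c) * b11 c"
        using det[OF cU] by (simp add: e2_def algebra_simps)
      then have "\<bar>e2\<bar> \<le> \<bar>b11 p - b11 c\<bar> * \<bar>b22 c\<bar> + 2 * (\<bar>b12 p - b12 c\<bar> * \<bar>b12 c\<bar>) + \<bar>b22 p - b22 c\<bar> * \<bar>b11 c\<bar>"
        by (simp add: abs_mult[symmetric])
      also have "\<dots> \<le> K * norm w * K + 2 * (K * norm w * K) + K * norm w * K"
        using KL' Kb(1-3)[OF c0] Kn by (intro add_mono mult_mono order_refl) auto
      also have "\<dots> = 4 * K\<^sup>2 * norm w" by (simp add: power2_eq_square)
      also have "\<dots> \<le> 4 * K\<^sup>2 * (T * r)" using wr by (intro mult_left_mono) auto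
      finally show ?thesis .
    qed
    have bt: "\<bar>bt\<bar> \<le> 2 * K * (T * r)"
    proof -
      have "\<bar>bt\<bar> \<le> \<bar>\<beta> p $ 1\<bar> * \<bar>g1\<bar> + \<bar>\<beta> p $ 2\<bar> * \<bar>g2\<bar>" unfolding bt_def by (simp add: abs_mult[symmetric])
      also have "\<dots> \<le> K * (T * r) + K * (T * r)"
        using Kb(4,5)[OF p0'] g Kle(9) by (intro add_mono mult_mono) auto
      finally show ?thesis by simp
    qed
    have E: "\<bar>e2 + bt\<bar> \<le> C1 * r"
    proof -
      have "C1 * r = 4 * K\<^sup>2 * (T * r) + 2 * K * (T * r)" by (simp add: C1_def algebra_simps)
      then show ?thesis using e2 bt by linarith
    qed
    define e1 where "e1 = b11 p * g1\<^sup>2 + 2 * b12 p * g1 * g2 + b22 p * g2\<^sup>2 - quad c w"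
    have e1: "\<bar>e1\<bar> \<le> C2 * r ^ 3"
    proof -
      have "b11 c * g1\<^sup>2 + 2 * b12 c * g1 * g2 + b22 c * g2\<^sup>2 = (b11 c * b22 c - b12 c * b12 c) * quad c w"
        unfolding g1_def g2_def quad_def by (simp add: power2_eq_square algebra_simps)
      then have e1e: "e1 = (b11 p - b11 c) * g1\<^sup>2 + 2 * ((b12 p - b12 c) * (g1 * g2)) + (b22 p - b22 c) * g2\<^sup>2"
        using det[OF cU] by (simp add: e1_def algebra_simps)
      have "\<bar>(b11 p - b11 c) * g1\<^sup>2\<bar> = \<bar>b11 p - b11 c\<bar> * g1\<^sup>2"
        "\<bar>2 * ((b12 p - b12 c) * (g1 * g2))\<bar> = \<bar>b12 p - b12 c\<bar> * (2 * \<bar>g1 * g2\<bar>)"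
        "\<bar>(b22 p - b22 c) * g2\<^sup>2\<bar> = \<bar>b22 p - b22 c\<bar> * g2\<^sup>2"
        by (simp_all add: abs_mult)
      then have "\<bar>e1\<bar> \<le> \<bar>b11 p - b11 c\<bar> * g1\<^sup>2 + \<bar>b12 p - b12 c\<bar> * (2 * \<bar>g1 * g2\<bar>) + \<bar>b22 p - b22 c\<bar> * g2\<^sup>2"
        unfolding e1e by linarith
      also have "\<dots> \<le> K * norm w * g1\<^sup>2 + K * norm w * (2 * \<bar>g1 * g2\<bar>) + K * norm w * g2\<^sup>2"
        using KL' by (intro add_mono mult_right_mono) auto
      also have "\<dots> = K * norm w * (g1\<^sup>2 + 2 * \<bar>g1 * g2\<bar> + g2\<^sup>2)" by (simp add: algebra_simps)
      also have "\<dots> \<le> K * (T * r) * (2 * (T * r)\<^sup>2)"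
      proof (rule mult_mono)
        have "2 * \<bar>g1 * g2\<bar> \<le> g1\<^sup>2 + g2\<^sup>2"
          using sum_squares_bound[of "\<bar>g1\<bar>" "\<bar>g2\<bar>"] by (simp add: abs_mult)
        then show "g1\<^sup>2 + 2 * \<bar>g1 * g2\<bar> + g2\<^sup>2 \<le> 2 * (T * r)\<^sup>2" using gg by linarith
        show "K * norm w \<le> K * (T * r)" using wr Kle(9) by (intro mult_left_mono) auto
      qed (use Kle(9) T(1) r in auto)
      also have "\<dots> = C2 * r ^ 3" by (simp add: C2_def eval_nat_numeral algebra_simps)
      finally show ?thesis .
    qed
    let ?g = "2 *\<^sub>R vector [b22 c * (p - c)$1 - b12 c * (p - c)$2, b11 c * (p - c)$2 - b12 c * (p - c)$1] :: real^2"
    have jq: "sop (B p) (\<beta> p) (\<lambda>q. quad c (q - c)) p ?g (4 + 2 * (e2 + bt))"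
      using sop_quad[OF pU, of c] by (simp add: e2_def bt_def g1_def g2_def w_def algebra_simps)
    have Bg: "?g \<bullet> (B p *v ?g) = 4 * (r\<^sup>2 + e1)"
      unfolding r0(2) e1_def g1_def g2_def w_def
      by (simp add: inner_2 mv_2 power2_eq_square algebra_simps)
    define t where "t = quad c w"
    have t: "t > 0" "sqrt t = r" "t = r\<^sup>2" using q r0 by (auto simp: t_def r_def)
    have "\<forall>\<^sub>F s in nhds t. ((\<lambda>s. 1/2 * ln s - M * sqrt s) has_real_derivative (1/2 * inverse s - M * (inverse (sqrt s) / 2))) (at s)"
    proof -
      have "\<forall>\<^sub>F s in nhds t. 0 < s" using t
        by (intro eventually_nhds_in_open[of "{0<..}", simplified]) auto
      then show ?thesis
      proof eventually_elim
        case (elim s)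
        then show ?case by (intro DERIV_diff DERIV_cmult DERIV_ln DERIV_real_sqrt)
      qed
    qed
    moreover have "((\<lambda>s. 1/2 * inverse s - M * (inverse (sqrt s) / 2)) has_real_derivative
        (1/2 * (- inverse (t ^ 2)) - M * (- (inverse (sqrt t) ^ 3) / 4))) (at t)"
    proof (intro DERIV_diff DERIV_cmult)
      show "(inverse has_real_derivative (- inverse (t ^ 2))) (at t)"
        using t by (auto intro!: derivative_eq_intros simp: power2_eq_square)
      show "((\<lambda>s. inverse (sqrt s) / 2) has_real_derivative (- (inverse (sqrt t) ^ 3) / 4)) (at t)"
        using t(1) by (auto intro!: derivative_eq_intros simp: power3_eq_cube power2_eq_square divide_simps)
    qed
    ultimately have "sop (B p) (\<beta> p) (\<lambda>q. 1/2 * ln (quad c (q - c)) - M * sqrt (quad c (q - c))) p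
       ((1/2 * inverse t - M * (inverse (sqrt t) / 2)) *\<^sub>R ?g)
       ((1/2 * inverse t - M * (inverse (sqrt t) / 2)) * (4 + 2 * (e2 + bt))
         + (1/2 * (- inverse (t ^ 2)) - M * (- (inverse (sqrt t) ^ 3) / 4)) * (?g \<bullet> (B p *v ?g)))"
      unfolding t_def w_def by (rule sop_comp[OF jq B_sym])
    then have s: "\<exists>g. sop (B p) (\<beta> p) (psi M c) p g
        ((1/2 * inverse t - M * (inverse (sqrt t) / 2)) * (4 + 2 * (e2 + bt))
         + (1/2 * (- inverse (t ^ 2)) - M * (- (inverse (sqrt t) ^ 3) / 4)) * (?g \<bullet> (B p *v ?g)))"
      unfolding psi_def[abs_def] by blast
    have i1: "1/2 * inverse t - M * (inverse (sqrt t) / 2) = 1 / (2 * r\<^sup>2) - M / (2 * r)"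
      unfolding t(2) unfolding t(3) using r by (simp add: field_simps)
    have i2: "1/2 * (- inverse (t ^ 2)) - M * (- (inverse (sqrt t) ^ 3) / 4) = - 1 / (2 * r ^ 4) + M / (4 * r ^ 3)"
      unfolding t(2) unfolding t(3) using r by (simp add: field_simps eval_nat_numeral)
    from s psi_estimate[OF r less_imp_le[OF M(1)] Mr M(2) E e1]
    show "\<exists>g l. sop (B p) (\<beta> p) (psi M c) p g l \<and> l < 0"
      unfolding i1 i2 Bg by blast
  qed
  show thesis
    by (rule that[OF \<rho>(1) M(1) Kle(9) order_trans[OF \<rho>(2) \<rho>0(2)] main])
qed

lemma N2_nonneg: "0 \<le> N2 a c p" by (simp add: N2_def)

lemma N2_eq_0: "N2 a c p = 0 \<longleftrightarrow> x p = a \<and> y p = c"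
  unfolding N2_def by (simp add: sum_squares_eq_zero_iff)

lemma xy_cont: "continuous_on U x" "continuous_on U y"
  using Ck_on_continuous x_C2 y_C2 by blast+

lemma N2_cont: "continuous_on U (N2 a c)"
  unfolding N2_def[abs_def] by (intro continuous_intros xy_cont)

text \<open>The maximum principle applied to \<open>ln N2 - (\<Sum>z. psi M z)\<close> over \<open>n\<close> zeros \<open>z\<close> gives a bound for \<open>N2\<close>
  that decreases geometrically in \<open>n\<close>.\<close>

lemma accumulating_zeros:
  assumes p0: "p0 \<in> U" and lim: "p0 islimpt {q \<in> U. N2 a c q = 0}"
  shows "\<exists>e>0. \<forall>q\<in>ball p0 e. N2 a c q = 0"
proof -
  obtain \<rho> M K where \<rho>: "0 < \<rho>" and M: "0 < M" and K: "1 \<le> K" and sub: "cball p0 \<rho> \<subseteq> U"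
    and q1: "\<And>c p. c \<in> cball p0 \<rho> \<Longrightarrow> p \<in> cball p0 \<rho> \<Longrightarrow> (norm (p - c))\<^sup>2 \<le> 2 * K * quad c (p - c)"
    and q2: "\<And>c p. c \<in> cball p0 \<rho> \<Longrightarrow> p \<in> cball p0 \<rho> \<Longrightarrow> quad c (p - c) \<le> 2 * K * (norm (p - c))\<^sup>2"
    and q3: "\<And>c p. c \<in> cball p0 \<rho> \<Longrightarrow> p \<in> cball p0 \<rho> \<Longrightarrow> M * sqrt (quad c (p - c)) \<le> 1"
    and q4: "\<And>c p. c \<in> cball p0 \<rho> \<Longrightarrow> p \<in> cball p0 \<rho> \<Longrightarrow> p \<noteq> c \<Longrightarrow> \<exists>g l. sop (B p) (\<beta> p) (psi M c) p g l \<and> l < 0"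
    using barrier[OF p0] by blast
  define T where "T = sqrt (2 * K)"
  have T: "T > 0" "T\<^sup>2 = 2 * K" using K by (auto simp: T_def)
  define r where "r c p = sqrt (quad c (p - c))" for c p
  \<comment> \<open>\<open>u c\<close> is \<open>exp (- psi M c)\<close>, with a simple pole at
    \<open>c\<close>.\<close>
  define u where "u c p = exp (M * r c p) / r c p" for c p
  have r_le: "norm (p - c) \<le> T * r c p" "r c p \<le> T * norm (p - c)" "M * r c p \<le> 1" "0 \<le> r c p"
    if "c \<in> cball p0 \<rho>" "p \<in> cball p0 \<rho>" for c p
  proof -
    have "0 \<le> 2 * K * quad c (p - c)" using q1[OF that] zero_le_power2 order_trans by blast
    then have q0: "0 \<le> quad c (p - c)" using K by (simp add: zero_le_mult_iff)
    then show r0: "0 \<le> r c p" by (simp add: r_def)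
    have r2: "(r c p)\<^sup>2 = quad c (p - c)" using q0 by (simp add: r_def)
    have "(norm (p - c))\<^sup>2 \<le> (T * r c p)\<^sup>2" unfolding power_mult_distrib T(2) r2 by (rule q1[OF that])
    then show "norm (p - c) \<le> T * r c p" by (rule power2_le_imp_le) (use T(1) r0 in simp)
    have "(r c p)\<^sup>2 \<le> (T * norm (p - c))\<^sup>2" unfolding power_mult_distrib T(2) r2 by (rule q2[OF that])
    then show "r c p \<le> T * norm (p - c)" by (rule power2_le_imp_le) (use T(1) in simp)
    show "M * r c p \<le> 1" using q3[OF that] by (simp add: r_def)
  qed
  have r_pos: "0 < r c p" if "c \<in> cball p0 \<rho>" "p \<in> cball p0 \<rho>" "p \<noteq> c" for c p
  proof -
    have "0 < T * r c p" using r_le(1)[OF that(1,2)] that(3) by (smt (verit) zero_less_norm_iff right_minus_eq)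
    then show ?thesis using T(1) by (simp add: zero_less_mult_iff)
  qed
  have u_le: "u c p \<le> exp 1 * T / norm (p - c)" if "c \<in> cball p0 \<rho>" "p \<in> cball p0 \<rho>" "p \<noteq> c" for c p
  proof -
    have n: "norm (p - c) > 0" using that(3) by simp
    have "u c p \<le> exp 1 / (norm (p - c) / T)"
      unfolding u_def using r_le[OF that(1,2)] r_pos[OF that] T(1) n
      by (intro frac_le) (auto simp: field_simps)
    then show ?thesis by simp
  qed
  define b where "b = exp 1 * T / (\<rho> / 2)"
  have b: "b > 0" using T \<rho> by (simp add: b_def)
  \<comment> \<open>For poles this close to \<open>p0\<close>, \<open>u\<close> is at most
    \<open>b\<close> on the sphere of radius \<open>\<rho>\<close> and at least
    \<open>exp 1 * b\<close> in the small ball. Each pole thus gains a factor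
    \<open>exp 1\<close>.\<close>
  define \<epsilon> where "\<epsilon> = min (\<rho> / 2) (1 / (2 * T * (exp 1 * b)))"
  have \<epsilon>: "0 < \<epsilon>" "\<epsilon> \<le> \<rho> / 2" "\<epsilon> * (2 * T * (exp 1 * b)) \<le> 1"
  proof -
    have P: "0 < 2 * T * (exp 1 * b)" using T b by simp
    then show "0 < \<epsilon>" using \<rho> by (simp add: \<epsilon>_def)
    show "\<epsilon> \<le> \<rho> / 2" by (simp add: \<epsilon>_def)
    have "\<epsilon> \<le> 1 / (2 * T * (exp 1 * b))" by (simp add: \<epsilon>_def)
    then show "\<epsilon> * (2 * T * (exp 1 * b)) \<le> 1" using P by (simp only: pos_le_divide_eq)
  qed
  have inb: "ball p0 \<epsilon> \<subseteq> cball p0 \<rho>" using \<epsilon> \<rho> by auto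
  have u_sphere: "u c p \<le> b" if "c \<in> ball p0 \<epsilon>" "p \<in> sphere p0 \<rho>" for c p
  proof -
    have "norm (p - c) \<ge> \<rho> / 2"
    proof -
      have "\<rho> = norm (p - p0)" using that(2) by (simp add: dist_norm norm_minus_commute)
      also have "\<dots> \<le> norm (p - c) + norm (c - p0)" by norm
      also have "norm (c - p0) \<le> \<rho> / 2" using that(1) \<epsilon>(2) by (simp add: dist_norm norm_minus_commute)
      finally show ?thesis by simp
    qed
    moreover have "u c p \<le> exp 1 * T / norm (p - c)"
      using that \<rho> inb calculation by (intro u_le) auto
    moreover have "exp 1 * T / norm (p - c) \<le> b"
      unfolding b_def using calculation(1) \<rho> T by (intro divide_left_mono mult_pos_pos) auto
    ultimately show ?thesis by linarith
  qed
  have u_inner: "exp 1 * b \<le> u c p" if "c \<in> ball p0 \<epsilon>" "p \<in> ball p0 \<epsilon>" "p \<noteq> c" for c p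
  proof -
    have cp: "c \<in> cball p0 \<rho>" "p \<in> cball p0 \<rho>" using that inb by blast+
    have "norm (p - c) \<le> norm (p - p0) + norm (c - p0)" by norm
    then have "norm (p - c) \<le> 2 * \<epsilon>" using that(1,2) by (simp add: dist_norm norm_minus_commute)
    then have "r c p \<le> T * (2 * \<epsilon>)" using r_le(2)[OF cp] T(1) by (meson mult_left_mono less_imp_le order_trans)
    then have "(exp 1 * b) * r c p \<le> (exp 1 * b) * (T * (2 * \<epsilon>))" using b by (intro mult_left_mono) auto
    also have "\<dots> = \<epsilon> * (2 * T * (exp 1 * b))" by (simp add: mult_ac)
    also have "\<dots> \<le> 1" by (rule \<epsilon>(3))
    also have "1 \<le> exp (M * r c p)" using M r_le(4)[OF cp] by simp
    finally show ?thesis unfolding u_def using r_pos[OF cp that(3)] by (simp add: pos_le_divide_eq)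
  qed
  have NcontC: "continuous_on (cball p0 \<rho>) (N2 a c)" using N2_cont sub by (rule continuous_on_subset)
  obtain Mx where Mx: "0 \<le> Mx" "\<And>p. p \<in> cball p0 \<rho> \<Longrightarrow> N2 a c p \<le> Mx"
    using continuous_on_bounded_cball[OF NcontC] by (metis abs_le_D1)
  have x1: "Ck_on 1 U x" "Ck_on 1 U y" using Ck_on_Suc_imp[OF C2(1)] Ck_on_Suc_imp[OF C2(2)] by (simp_all only: One_nat_def)
  obtain Lx where Lx: "Lx \<ge> 0" "\<forall>p\<in>cball p0 \<rho>. \<forall>q\<in>cball p0 \<rho>. \<bar>x p - x q\<bar> \<le> Lx * norm (p - q)"
    using C1_Lipschitz[OF open_U sub x1(1)] by blast
  obtain Ly where Ly: "Ly \<ge> 0" "\<forall>p\<in>cball p0 \<rho>. \<forall>q\<in>cball p0 \<rho>. \<bar>y p - y q\<bar> \<le> Ly * norm (p - q)"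
    using C1_Lipschitz[OF open_U sub x1(2)] by blast
  define L where "L = Lx * Lx + Ly * Ly"
  have N_near: "N2 a c p \<le> L * (norm (p - z))\<^sup>2" if z: "z \<in> cball p0 \<rho>" "N2 a c z = 0" and p: "p \<in> cball p0 \<rho>" for p z
  proof -
    have A: "\<bar>x p - a\<bar> \<le> Lx * norm (p - z)" "\<bar>y p - c\<bar> \<le> Ly * norm (p - z)"
      using Lx(2) Ly(2) z p N2_eq_0 by metis+
    have "\<bar>x p - a\<bar> * \<bar>x p - a\<bar> \<le> (Lx * norm (p - z)) * (Lx * norm (p - z))"
      by (rule mult_mono[OF A(1) A(1)]) (use Lx(1) in simp_all)
    moreover have "\<bar>y p - c\<bar> * \<bar>y p - c\<bar> \<le> (Ly * norm (p - z)) * (Ly * norm (p - z))"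
      by (rule mult_mono[OF A(2) A(2)]) (use Ly(1) in simp_all)
    ultimately show ?thesis unfolding N2_def L_def by (simp add: power2_eq_square algebra_simps)
  qed
  have L0: "0 \<le> L" by (simp add: L_def)
  have rc: "continuous_on X (r z)" for z X
    unfolding r_def quad_def by (intro continuous_intros)
  have main: "N2 a c q * (\<Prod>z\<in>Z. u z q) \<le> Mx * b ^ card Z"
    if Z: "finite Z" "Z \<noteq> {}" "Z \<subseteq> ball p0 \<epsilon>" "\<And>z. z \<in> Z \<Longrightarrow> N2 a c z = 0" and q: "q \<in> ball p0 \<epsilon>" for Z q
  proof (rule ccontr)
    \<comment> \<open>At a zero of \<open>N2\<close> the simple pole is absorbed by quadratic
      vanishing, so \<open>E\<close> is continuous with value 0 there. An interior maximum of
      \<open>E\<close> is then positive and away from the poles, where \<open>ln E\<close> is a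
      strict subsolution.\<close>
    define E where "E p = N2 a c p * (\<Prod>z\<in>Z. u z p)" for p
    assume "\<not> ?thesis"
    then have big: "Mx * b ^ card Z < E q" by (simp add: E_def)
    have Zc: "z \<in> cball p0 \<rho>" if "z \<in> Z" for z using that Z(3) inb by blast
    have upos: "0 < u z p" if "z \<in> Z" "p \<in> cball p0 \<rho>" "p \<noteq> z" for z p
      unfolding u_def using r_pos[OF Zc] that by simp
    have contE: "continuous_on (cball p0 \<rho>) E"
      unfolding continuous_on_eq_continuous_within
    proof
      fix p assume p: "p \<in> cball p0 \<rho>"
      have uc: "continuous (at p within cball p0 \<rho>) (u z)" if "z \<in> Z" "z \<noteq> p" for z
        unfolding u_def using r_pos[OF Zc[OF that(1)] p] that rc[of "cball p0 \<rho>" z] p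
        by (intro continuous_intros) (auto simp: continuous_on_eq_continuous_within)
      have Nc: "continuous (at p within cball p0 \<rho>) (N2 a c)"
        using NcontC p by (simp add: continuous_on_eq_continuous_within)
      show "continuous (at p within cball p0 \<rho>) E"
      proof (cases "p \<in> Z")
        case False
        then show ?thesis unfolding E_def by (intro continuous_mult Nc continuous_prod uc) auto
      next
        case True
        have E': "E = (\<lambda>s. (N2 a c s * u p s) * (\<Prod>z\<in>Z - {p}. u z s))"
        proof
          fix s
          have "(\<Prod>z\<in>Z. u z s) = u p s * (\<Prod>z\<in>Z - {p}. u z s)" by (rule prod.remove[OF Z(1) True])
          then show "E s = (N2 a c s * u p s) * (\<Prod>z\<in>Z - {p}. u z s)" by (simp add: E_def)
        qed
        have "continuous (at p within cball p0 \<rho>) (\<lambda>s. N2 a c s * u p s)"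
        proof -
          have bound: "norm (N2 a c s * u p s) \<le> L * (exp 1 * T) * norm (s - p)" if s: "s \<in> cball p0 \<rho>" for s
          proof (cases "s = p")
            case False
            have n: "norm (s - p) > 0" using False by simp
            have "N2 a c s * u p s \<le> (L * (norm (s - p))\<^sup>2) * (exp 1 * T / norm (s - p))"
              using N_near[OF p Z(4)[OF True] s] u_le[OF p s False] upos[OF True s False] L0 N2_nonneg[of a c s]
              by (intro mult_mono) auto
            also have "\<dots> = L * (exp 1 * T) * norm (s - p)" using n by (simp add: power2_eq_square)
            finally show ?thesis using N2_nonneg[of a c s] upos[OF True s False] by simp
          qed (simp add: Z(4)[OF True])
          have "((\<lambda>s. N2 a c s * u p s) \<longlongrightarrow> 0) (at p within cball p0 \<rho>)"
          proof (rule Lim_null_comparison)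
            show "\<forall>\<^sub>F s in at p within cball p0 \<rho>. norm (N2 a c s * u p s) \<le> L * (exp 1 * T) * norm (s - p)"
              using bound by (auto simp: eventually_at_filter)
            show "((\<lambda>s. L * (exp 1 * T) * norm (s - p)) \<longlongrightarrow> 0) (at p within cball p0 \<rho>)"
              by (auto intro!: tendsto_eq_intros)
          qed
          then show ?thesis unfolding continuous_within using Z(4)[OF True] by simp
        qed
        then show ?thesis unfolding E' by (rule continuous_mult) (auto intro!: continuous_prod uc)
      qed
    qed
    obtain p where p: "p \<in> cball p0 \<rho>" "\<And>s. s \<in> cball p0 \<rho> \<Longrightarrow> E s \<le> E p"
      using continuous_attains_sup[OF compact_cball _ contE] \<rho> by auto
    have Ep: "Mx * b ^ card Z < E p" using big p(2)[of q] q inb by force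
    have Epos: "0 < E p" using Ep Mx(1) b by (smt (verit) mult_nonneg_nonneg zero_le_power)
    have pZ: "p \<notin> Z" using Epos Z(4)[of p] by (auto simp: E_def)
    have pN: "0 < N2 a c p" using Epos N2_nonneg[of a c p] by (auto simp: E_def less_le)
    have "p \<notin> sphere p0 \<rho>"
    proof
      assume ps: "p \<in> sphere p0 \<rho>"
      have "(\<Prod>z\<in>Z. u z p) \<le> (\<Prod>z\<in>Z. b)"
        using u_sphere[OF _ ps] upos[OF _ p(1)] pZ Z(3) by (intro prod_mono) (auto intro: less_imp_le)
      then have "E p \<le> Mx * b ^ card Z"
        unfolding E_def using Mx p(1) upos[OF _ p(1)] pZ
        by (intro mult_mono prod_nonneg) (auto intro!: less_imp_le)
      then show False using Ep by simp
    qed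
    then have pb: "p \<in> ball p0 \<rho>" using p(1) by (auto simp: less_le)
    have pU: "p \<in> U" using p(1) sub by blast
    define W where "W = ball p0 \<rho> \<inter> (U \<inter> N2 a c -` {0<..}) - Z"
    have "open W"
    proof -
      have "openin (top_of_set U) (U \<inter> N2 a c -` {0<..})"
        by (rule continuous_openin_preimage_gen[OF N2_cont]) simp
      then have "open (U \<inter> N2 a c -` {0<..})" using open_U openin_open_eq by blast
      then have "open (ball p0 \<rho> \<inter> (U \<inter> N2 a c -` {0<..}))" by (rule open_Int[OF open_ball])
      then show ?thesis unfolding W_def using finite_imp_closed[OF Z(1)] by (rule open_Diff)
    qed
    define f where "f s = ln (N2 a c s) - (\<Sum>z\<in>Z. psi M z s)" for s
    have f_ln: "f s = ln (E s) \<and> 0 < E s" if s: "s \<in> W" for s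
    proof -
      have sc: "s \<in> cball p0 \<rho>" "0 < N2 a c s" "s \<notin> Z" using s by (auto simp: W_def)
      have up: "0 < u z s" if "z \<in> Z" for z using upos[OF that sc(1)] sc(3) that by blast
      have "ln (u z s) = - psi M z s" if "z \<in> Z" for z
      proof -
        have rp: "0 < r z s" using r_pos[OF Zc[OF that] sc(1)] sc(3) that by blast
        then have "quad z (s - z) > 0" by (simp add: r_def)
        then have "ln (r z s) = 1/2 * ln (quad z (s - z))" by (simp add: r_def ln_sqrt)
        then show ?thesis unfolding u_def using rp by (simp add: ln_div psi_def r_def)
      qed
      moreover have "ln (\<Prod>z\<in>Z. u z s) = (\<Sum>z\<in>Z. ln (u z s))" using Z(1) by (intro ln_prod) (auto dest: up)
      moreover have pr: "0 < (\<Prod>z\<in>Z. u z s)" using up by (intro prod_pos) auto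
      ultimately show ?thesis unfolding f_def E_def using sc(2) by (simp add: ln_mult sum_negf)
    qed
    have pW: "p \<in> W" using pb pU pN pZ by (simp add: W_def)
    have max: "\<forall>\<^sub>F s in nhds p. f s \<le> f p"
      unfolding eventually_nhds
    proof (intro exI[of _ W] conjI ballI \<open>open W\<close> pW)
      fix s assume s: "s \<in> W"
      then have "E s \<le> E p" by (intro p(2)) (auto simp: W_def)
      then show "f s \<le> f p" using f_ln[OF s] f_ln[OF pW] by simp
    qed
    obtain g where g: "sop (B p) (\<beta> p) (\<lambda>s. ln (N2 a c s)) p g 0" using sop_ln_N2[OF pU pN] by blast
    have "\<exists>g l. sop (B p) (\<beta> p) (psi M z) p g l \<and> l < 0" if "z \<in> Z" for z
      using q4[OF Zc[OF that] p(1)] pZ that by blast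
    from sop_sum[where A="B p" and b="\<beta> p" and f="psi M" and p=p, OF Z(1) this] obtain g' l' where
      g': "sop (B p) (\<beta> p) (\<lambda>s. \<Sum>z\<in>Z. psi M z s) p g' l'" "l' < 0"
      using Z(2) by auto
    have "sop (B p) (\<beta> p) f p (g - g') (0 - l')" unfolding f_def by (rule sop_diff[OF g g'(1)])
    from sop_at_max(2)[OF this B_sym B_nonneg[OF pU] max] g'(2) show False by simp
  qed
  have "N2 a c q = 0" if q: "q \<in> ball p0 \<epsilon>" for q
  proof (rule ccontr)
    assume nz: "N2 a c q \<noteq> 0"
    define I where "I = {s \<in> U. N2 a c s = 0} \<inter> ball p0 \<epsilon>"
    have "infinite I"
      using lim \<epsilon>(1) unfolding islimpt_eq_infinite_ball I_def by blast
    \<comment> \<open>\<open>n + 1\<close> zeros give at least \<open>(exp 1 * b)^(n+1)\<close> at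
      \<open>q\<close> against \<open>b^(n+1)\<close> on the sphere. Since there are infinitely many
      zeros, \<open>n\<close> is arbitrary.\<close>
    have bnd: "N2 a c q * exp 1 ^ Suc n \<le> Mx" for n
    proof -
      obtain Z where Z: "finite Z" "card Z = Suc n" "Z \<subseteq> I"
        using infinite_arbitrarily_large[OF \<open>infinite I\<close>] by blast
      have ne: "Z \<noteq> {}" using Z(2) by auto
      have Zz: "Z \<subseteq> ball p0 \<epsilon>" "\<And>z. z \<in> Z \<Longrightarrow> N2 a c z = 0" using Z(3) by (auto simp: I_def)
      have "(exp 1 * b) ^ card Z = (\<Prod>z\<in>Z. exp 1 * b)" by simp
      also have "\<dots> \<le> (\<Prod>z\<in>Z. u z q)"
      proof (rule prod_mono)
        fix z assume z: "z \<in> Z"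
        then have "z \<in> ball p0 \<epsilon>" "q \<noteq> z" using Zz nz by auto
        then show "0 \<le> exp 1 * b \<and> exp 1 * b \<le> u z q" using u_inner[OF _ q] b by simp
      qed
      finally have "N2 a c q * (exp 1 * b) ^ card Z \<le> Mx * b ^ card Z"
        using main[OF Z(1) ne Zz q] N2_nonneg[of a c q] by (meson mult_left_mono order_trans)
      then have "(N2 a c q * exp 1 ^ card Z) * b ^ card Z \<le> Mx * b ^ card Z" by (simp add: power_mult_distrib mult_ac)
      then show ?thesis using b Z(2) by (simp only: mult_le_cancel_right_pos zero_less_power)
    qed
    have "1 < exp (1::real)" by simp
    then obtain n where "Mx / N2 a c q < exp 1 ^ n" using real_arch_pow by blast
    also have "\<dots> \<le> exp 1 ^ Suc n" by (rule power_increasing) auto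
    finally have "Mx / N2 a c q < exp 1 ^ Suc n" .
    moreover have "0 < N2 a c q" using nz N2_nonneg[of a c q] by simp
    ultimately have "Mx < exp 1 ^ Suc n * N2 a c q" by (simp only: pos_divide_less_eq)
    then have "Mx < N2 a c q * exp 1 ^ Suc n" by (simp only: mult.commute)
    then show False using bnd[of n] by simp
  qed
  then show ?thesis using \<epsilon>(1) by blast
qed

section \<open>Critical points and their values\<close>

definition crit :: "plane set" where
  "crit = {p \<in> U. gradv x p = 0 \<and> gradv y p = 0}"

lemma gradv_0: "gradv f p = 0 \<longleftrightarrow> dd 1 f p = 0 \<and> dd 2 f p = 0"
  by (auto simp: vec_eq_iff forall_2)

lemma gradv_y_0_imp: "p \<in> U \<Longrightarrow> gradv y p = 0 \<Longrightarrow> gradv x p = 0"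
  by (simp add: gradv_0 cr1 cr2)

lemma quad_b_0:
  assumes "p \<in> U" "b11 p * (u * u) + 2 * b12 p * (u * v) + b22 p * (v * v) = 0"
  shows "u = 0 \<and> v = 0"
proof -
  have "vector [u, v] \<bullet> (B p *v vector [u, v]) = (0::real)"
    unfolding B_quad using assms(2) by (simp add: power2_eq_square mult.assoc)
  then have "vector [u, v] = (0 :: real^2)" using B_pos[OF assms(1), of "vector [u, v]"] by auto
  then show ?thesis by (simp add: vec_eq_iff forall_2)
qed

text \<open>At a critical point the equation says that the trace of \<open>B\<close> against the
  Hessian of \<open>y\<close> is 0. Such a Hessian is invertible unless it is 0: a vanishing
  determinant would make the form of \<open>B\<close> vanish at its second row. So
  \<open>gradv y\<close> has an isolated zero.\<close>

lemma crit_isolated_y: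
  assumes p: "p \<in> crit" and H: "dd i (dd j y) p \<noteq> 0"
  shows "\<exists>e>0. \<forall>q\<in>ball p e. q \<in> crit \<longrightarrow> q = p"
proof -
  have pU: "p \<in> U" and g0: "gradv y p = 0" using p by (auto simp: crit_def)
  define h11 h12 h22 where "h11 = dd 1 (dd 1 y) p" and "h12 = dd 1 (dd 2 y) p" and "h22 = dd 2 (dd 2 y) p"
  have sw: "dd 2 (dd 1 y) p = h12"
    unfolding h12_def by (rule second_partials_commute[OF open_U pU, symmetric]) (use diff_xy pU in auto)
  have tr: "b11 p * h11 + 2 * b12 p * h12 + b22 p * h22 = 0"
    using divergence_y[OF pU] g0 sw by (simp add: gradv_0 h11_def h12_def h22_def)
  have nz: "\<not> (h11 = 0 \<and> h12 = 0 \<and> h22 = 0)"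
    using H sw exhaust_2[of i] exhaust_2[of j] by (auto simp: h11_def h12_def h22_def)
  let ?D = "\<lambda>v::plane. vector [h11 * v$1 + h12 * v$2, h12 * v$1 + h22 * v$2] :: real^2"
  have der: "(gradv y has_derivative ?D) (at p)"
  proof (rule has_derivative_vecI)
    fix k :: 2
    show "((\<lambda>q. gradv y q $ k) has_derivative (\<lambda>v. ?D v $ k)) (at p)"
      using derivative_dd[OF diff_xy(4)[OF pU, of 1]] derivative_dd[OF diff_xy(4)[OF pU, of 2]] exhaust_2[of k]
      unfolding sw h11_def[symmetric] h12_def[symmetric] h22_def[symmetric] by auto
  qed
  have inj: "v = 0" if v: "?D v = 0" for v :: plane
  proof -
    have e: "h11 * v$1 + h12 * v$2 = 0" "h12 * v$1 + h22 * v$2 = 0"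
      using v by (simp_all add: vec_eq_iff forall_2)
    have dt: "h11 * h22 - h12 * h12 \<noteq> 0"
    proof
      assume d: "h11 * h22 - h12 * h12 = 0"
      have "b11 p * (h12 * h12) + 2 * b12 p * (h12 * h22) + b22 p * (h22 * h22) = 0"
      proof -
        have "b11 p * (h12 * h12) + 2 * b12 p * (h12 * h22) + b22 p * (h22 * h22) =
            (b11 p * h11 + 2 * b12 p * h12 + b22 p * h22) * h22 - b11 p * (h11 * h22 - h12 * h12)" by (simp add: algebra_simps)
        then show ?thesis using tr d by simp
      qed
      then have "h12 = 0 \<and> h22 = 0" by (rule quad_b_0[OF pU])
      then show False using tr b11_pos[OF pU] nz by simp
    qed
    have "(h11 * h22 - h12 * h12) * v$1 = h22 * (h11 * v$1 + h12 * v$2) - h12 * (h12 * v$1 + h22 * v$2)"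
      "(h11 * h22 - h12 * h12) * v$2 = h11 * (h12 * v$1 + h22 * v$2) - h12 * (h11 * v$1 + h12 * v$2)"
      by (simp_all add: algebra_simps)
    then have "v$1 = 0" "v$2 = 0" using e dt by auto
    then show ?thesis by (simp add: vec_eq_iff forall_2)
  qed
  obtain e where "e > 0" "\<forall>q\<in>ball p e. q \<noteq> p \<longrightarrow> gradv y q \<noteq> 0"
    using isolated_zero[OF der g0 inj] by blast
  then show ?thesis unfolding crit_def by blast
qed

lemma crit_isolated_x:
  assumes p: "p \<in> crit" and H: "dd i (dd j x) p \<noteq> 0"
  shows "\<exists>e>0. \<forall>q\<in>ball p e. q \<in> crit \<longrightarrow> q = p"
proof -
  interpret c: cauchy_riemann U "\<lambda>p. - y p" x b11 b12 b22 by (rule conjugate)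
  have "gradv (\<lambda>p. - y p) q = - gradv y q" if "q \<in> U" for q
    using diff_xy(2)[OF that] by (simp add: vec_eq_iff forall_2 dd_uminus)
  then have "c.crit = crit" unfolding c.crit_def crit_def by auto
  then show ?thesis using c.crit_isolated_y[of p i j] p H by simp
qed

definition modulus :: "plane \<Rightarrow> real" where "modulus p = sqrt ((x p)\<^sup>2 + (y p)\<^sup>2)"

lemma modulus_diff: "\<bar>modulus p - modulus q\<bar> \<le> \<bar>x p - x q\<bar> + \<bar>y p - y q\<bar>"
proof -
  have m: "modulus p = cmod (Complex (x p) (y p))" for p by (simp add: modulus_def cmod_def)
  have "\<bar>modulus p - modulus q\<bar> \<le> cmod (Complex (x p) (y p) - Complex (x q) (y q))"
    unfolding m by (rule norm_triangle_ineq3)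
  also have "\<dots> \<le> \<bar>x p - x q\<bar> + \<bar>y p - y q\<bar>"
    using cmod_le[of "Complex (x p) (y p) - Complex (x q) (y q)"] by simp
  finally show ?thesis .
qed

text \<open>Uniform continuity keeps second derivatives below \<open>\<epsilon>\<close> along the
  segment from \<open>p\<close>. Two applications of the mean value inequality, each summing two
  partials, produce the factor 4.\<close>

lemma small_second_derivatives:
  fixes f :: "plane \<Rightarrow> real"
  assumes f: "Ck_on (Suc (Suc 0)) U f" and K: "compact K" "convex K" "K \<subseteq> U" and \<epsilon>: "0 < \<epsilon>"
  shows "\<exists>\<delta>>0. \<forall>p\<in>K. \<forall>q\<in>K. dd 1 f p = 0 \<longrightarrow> dd 2 f p = 0 \<longrightarrow> (\<forall>i j. dd i (dd j f) p = 0) \<longrightarrow>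
     norm (p - q) < \<delta> \<longrightarrow> \<bar>f p - f q\<bar> \<le> 4 * \<epsilon> * (norm (p - q))\<^sup>2"
proof -
  have c2: "continuous_on K (dd i (dd j f))" for i j
    using Ck_on_continuous[OF Ck_on_dd[OF Ck_on_dd[OF f]]] K(3) by (rule continuous_on_subset)
  have "\<exists>d>0. \<forall>p\<in>K. \<forall>q\<in>K. norm (p - q) < d \<longrightarrow> \<bar>dd i (dd j f) p - dd i (dd j f) q\<bar> < \<epsilon>" for i j
    using compact_uniformly_continuous[OF c2 K(1), of i j] \<epsilon>
    unfolding uniformly_continuous_on_def dist_norm real_norm_def by (metis norm_minus_commute abs_minus_commute)
  then obtain d where d: "\<And>i j. d i j > 0"
    "\<And>i j p q. p \<in> K \<Longrightarrow> q \<in> K \<Longrightarrow> norm (p - q) < d i j \<Longrightarrow> \<bar>dd i (dd j f) p - dd i (dd j f) q\<bar> < \<epsilon>" by metis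
  define \<delta> where "\<delta> = min (min (d 1 1) (d 1 2)) (min (d 2 1) (d 2 2))"
  have \<delta>: "\<delta> > 0" "\<delta> \<le> d i j" for i j
    using d(1) exhaust_2[of i] exhaust_2[of j] by (auto simp: \<delta>_def)
  have "\<bar>f p - f q\<bar> \<le> 4 * \<epsilon> * (norm (p - q))\<^sup>2"
    if p: "p \<in> K" "dd 1 f p = 0" "dd 2 f p = 0" "\<forall>i j. dd i (dd j f) p = 0" and q: "q \<in> K" "norm (p - q) < \<delta>" for p q
  proof -
    define n where "n = norm (p - q)"
    define S where "S = closed_segment p q"
    have S: "convex S" "p \<in> S" "q \<in> S" "S \<subseteq> K" using p(1) q(1) K(2) by (auto simp: S_def closed_segment_subset)
    have Sn: "norm (p - w) \<le> n" if "w \<in> S" for w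
      using that segment_bound(1)[of w p q] by (simp add: S_def n_def norm_minus_commute)
    have SU: "w \<in> U" if "w \<in> S" for w using that S(4) K(3) by blast
    have h: "\<bar>dd i (dd j f) w\<bar> \<le> \<epsilon>" if w: "w \<in> S" for i j w
    proof -
      have "norm (p - w) < d i j" using Sn[OF w] q(2) \<delta>(2)[of i j] by (simp add: n_def)
      from d(2)[OF p(1) _ this] show ?thesis using p(4) w S(4) by force
    qed
    have g: "\<bar>dd j f w\<bar> \<le> 2 * \<epsilon> * n" if w: "w \<in> S" for j w
    proof -
      have "\<bar>dd j f p - dd j f w\<bar> \<le> (2 * \<epsilon>) * norm (p - w)"
      proof (rule gradient_bound_Lipschitz[OF S(1) _ _ S(2) w])
        show "dd j f differentiable at v" if "v \<in> S" for v
          using Ck_on_differentiable[OF Ck_on_dd[OF f] SU[OF that]] .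
        show "\<bar>dd 1 (dd j f) v\<bar> + \<bar>dd 2 (dd j f) v\<bar> \<le> 2 * \<epsilon>" if "v \<in> S" for v
          using h[OF that, of 1 j] h[OF that, of 2 j] by simp
      qed
      moreover have "dd j f p = 0" using p(2,3) exhaust_2[of j] by auto
      moreover have "(2 * \<epsilon>) * norm (p - w) \<le> 2 * \<epsilon> * n" using Sn[OF w] \<epsilon> by simp
      ultimately show ?thesis by simp
    qed
    have "\<bar>f p - f q\<bar> \<le> (4 * \<epsilon> * n) * norm (p - q)"
    proof (rule gradient_bound_Lipschitz[OF S(1) _ _ S(2,3)])
      show "f differentiable at v" if "v \<in> S" for v using Ck_on_differentiable[OF f SU[OF that]] .
      show "\<bar>dd 1 f v\<bar> + \<bar>dd 2 f v\<bar> \<le> 4 * \<epsilon> * n" if "v \<in> S" for v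
        using g[OF that, of 1] g[OF that, of 2] by simp
    qed
    then show ?thesis by (simp add: n_def power2_eq_square mult.assoc)
  qed
  then show ?thesis using \<delta>(1) by blast
qed

text \<open>Critical points with a nonzero second derivative are isolated, hence countable in number; at the others
  \<open>x\<close> and \<open>y\<close> vary by \<open>o(|p - q|\<^sup>2)\<close>, so that the square-covering argument of Sard's theorem applies
  already to functions of class \<open>C\<^sup>2\<close>.\<close>

lemma negligible_critical_values: "negligible (modulus ` crit)"
proof -
  define C1 where "C1 = {p \<in> crit. \<exists>i j. dd i (dd j x) p \<noteq> 0 \<or> dd i (dd j y) p \<noteq> 0}"
  define Cd where "Cd = crit - C1"
  have "countable C1"
    by (rule countable_isolated[where Z=crit]) (use crit_isolated_x crit_isolated_y in \<open>auto simp: C1_def\<close>)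
  then have 1: "negligible (modulus ` C1)" 
    by (simp add: negligible_iff_null_sets null_sets_completionI countable_imp_null_set_lborel)
  have "\<exists>T. open T \<and> p \<in> T \<and> negligible (modulus ` (Cd \<inter> T))" if p: "p \<in> U" for p
  proof -
    obtain e where e: "e > 0" "cball p e \<subseteq> U" using open_U p open_contains_cball by blast
    have "negligible (modulus ` (Cd \<inter> cball p e))"
    proof (rule negligible_quadratic_image[OF e(1), where c=p])
      show "Cd \<inter> cball p e \<subseteq> {q. \<bar>q $ 1 - p $ 1\<bar> \<le> e \<and> \<bar>q $ 2 - p $ 2\<bar> \<le> e}"
      proof
        fix q assume "q \<in> Cd \<inter> cball p e"
        then have "norm (q - p) \<le> e" by (simp add: dist_norm norm_minus_commute)
        then show "q \<in> {q. \<bar>q $ 1 - p $ 1\<bar> \<le> e \<and> \<bar>q $ 2 - p $ 2\<bar> \<le> e}"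
          using component_le_norm_cart[of "q - p" 1] component_le_norm_cart[of "q - p" 2] by simp
      qed
      fix \<epsilon> :: real assume \<epsilon>: "0 < \<epsilon>"
      \<comment> \<open>Each of \<open>x\<close> and \<open>y\<close> contributes
        \<open>4 * (\<epsilon> / 8)\<close>, together \<open>\<epsilon>\<close>.\<close>
      then have e8: "0 < \<epsilon> / 8" by simp
      obtain d1 where d1: "d1 > 0" "\<forall>a\<in>cball p e. \<forall>b\<in>cball p e. dd 1 x a = 0 \<longrightarrow> dd 2 x a = 0 \<longrightarrow> (\<forall>i j. dd i (dd j x) a = 0) \<longrightarrow>
          norm (a - b) < d1 \<longrightarrow> \<bar>x a - x b\<bar> \<le> 4 * (\<epsilon> / 8) * (norm (a - b))\<^sup>2"
        using small_second_derivatives[OF C2(1) compact_cball convex_cball e(2) e8] by (elim exE conjE) (rule that)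
      obtain d2 where d2: "d2 > 0" "\<forall>a\<in>cball p e. \<forall>b\<in>cball p e. dd 1 y a = 0 \<longrightarrow> dd 2 y a = 0 \<longrightarrow> (\<forall>i j. dd i (dd j y) a = 0) \<longrightarrow>
          norm (a - b) < d2 \<longrightarrow> \<bar>y a - y b\<bar> \<le> 4 * (\<epsilon> / 8) * (norm (a - b))\<^sup>2"
        using small_second_derivatives[OF C2(2) compact_cball convex_cball e(2) e8] by (elim exE conjE) (rule that)
      have "\<bar>modulus a - modulus b\<bar> \<le> \<epsilon> * (norm (a - b))\<^sup>2"
        if "a \<in> Cd \<inter> cball p e" "b \<in> Cd \<inter> cball p e" "norm (a - b) < min d1 d2" for a b
      proof -
        have a: "dd 1 x a = 0" "dd 2 x a = 0" "\<forall>i j. dd i (dd j x) a = 0"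
          "dd 1 y a = 0" "dd 2 y a = 0" "\<forall>i j. dd i (dd j y) a = 0"
          using that(1) by (auto simp: Cd_def C1_def crit_def gradv_0)
        have "\<bar>x a - x b\<bar> \<le> 4 * (\<epsilon> / 8) * (norm (a - b))\<^sup>2"
          using d1(2)[rule_format, OF _ _ a(1,2) a(3)[rule_format]] that by simp
        moreover have "\<bar>y a - y b\<bar> \<le> 4 * (\<epsilon> / 8) * (norm (a - b))\<^sup>2"
          using d2(2)[rule_format, OF _ _ a(4,5) a(6)[rule_format]] that by simp
        ultimately show ?thesis using modulus_diff[of a b] by simp
      qed
      then show "\<exists>\<delta>>0. \<forall>a\<in>Cd \<inter> cball p e. \<forall>b\<in>Cd \<inter> cball p e. norm (a - b) < \<delta> \<longrightarrow> \<bar>modulus a - modulus b\<bar> \<le> \<epsilon> * (norm (a - b))\<^sup>2"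
        using d1(1) d2(1) by (intro exI[of _ "min d1 d2"]) simp
    qed
    then have "negligible (modulus ` (Cd \<inter> ball p e))"
      by (rule negligible_subset) (auto simp: less_imp_le)
    then show ?thesis using e(1) by (intro exI[of _ "ball p e"]) auto
  qed
  then obtain T where T: "\<And>p. p \<in> U \<Longrightarrow> open (T p)" "\<And>p. p \<in> U \<Longrightarrow> p \<in> T p"
    "\<And>p. p \<in> U \<Longrightarrow> negligible (modulus ` (Cd \<inter> T p))" by metis
  obtain \<F> where F: "\<F> \<subseteq> T ` U" "countable \<F>" "\<Union>\<F> = \<Union>(T ` U)"
    using Lindelof[of "T ` U"] T(1) by blast
  have "modulus ` Cd \<subseteq> (\<Union>S\<in>\<F>. modulus ` (Cd \<inter> S))"
  proof
    fix t assume "t \<in> modulus ` Cd"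
    then obtain p where p: "p \<in> Cd" "t = modulus p" by blast
    then have "p \<in> U" by (auto simp: Cd_def crit_def)
    then have "p \<in> \<Union>\<F>" unfolding F(3) using T(2) by blast
    then show "t \<in> (\<Union>S\<in>\<F>. modulus ` (Cd \<inter> S))" using p by blast
  qed
  moreover have "negligible (\<Union>S\<in>\<F>. modulus ` (Cd \<inter> S))"
    using F(1,2) T(3) by (intro negligible_countable_Union countable_image) auto
  ultimately have 2: "negligible (modulus ` Cd)" by (rule negligible_subset[rotated])
  have "crit \<subseteq> C1 \<union> Cd" by (auto simp: Cd_def)
  then have "modulus ` crit \<subseteq> modulus ` C1 \<union> modulus ` Cd" by blast
  then show ?thesis using negligible_Un[OF 1 2] negligible_subset by blast
qed

text \<open>Unique continuation: the set of accumulation points of zeros is relatively closed, and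
  open by \<open>accumulating_zeros\<close>. In the connected \<open>U\<close> it would be
  everything.\<close>

lemma zeros_isolated:
  assumes conn: "connected U" and nz: "\<exists>q\<in>U. N2 a c q \<noteq> 0" and p0: "p0 \<in> U"
  shows "\<not> p0 islimpt {q \<in> U. N2 a c q = 0}"
proof
  assume lim: "p0 islimpt {q \<in> U. N2 a c q = 0}"
  define E where "E = {q \<in> U. q islimpt {q \<in> U. N2 a c q = 0}}"
  have "openin (top_of_set U) E"
  proof -
    have "\<exists>T. open T \<and> q \<in> T \<and> T \<subseteq> E" if "q \<in> E" for q
    proof -
      have q: "q \<in> U" "q islimpt {q \<in> U. N2 a c q = 0}" using that by (auto simp: E_def)
      obtain e where e: "e > 0" "\<forall>r\<in>ball q e. N2 a c r = 0" using accumulating_zeros[OF q] by blast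
      have o: "open (ball q e \<inter> U)" using open_U by blast
      have sub: "ball q e \<inter> U \<subseteq> {q \<in> U. N2 a c q = 0}" using e(2) by blast
      have "r islimpt {q \<in> U. N2 a c q = 0}" if "r \<in> ball q e \<inter> U" for r
        using islimpt_subset[OF interior_limit_point[of r "ball q e \<inter> U"] sub] that unfolding interior_open[OF o] by blast
      then have "ball q e \<inter> U \<subseteq> E" by (auto simp: E_def)
      then show ?thesis using o q(1) e(1) by (intro exI[of _ "ball q e \<inter> U"]) auto
    qed
    then have "open E" using open_subopen by blast
    then show ?thesis by (rule open_openin_trans[OF open_U]) (auto simp: E_def)
  qed
  moreover have "closedin (top_of_set U) E"
  proof -
    have "E = U \<inter> {q. q islimpt {q \<in> U. N2 a c q = 0}}" by (auto simp: E_def)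
    then show ?thesis using closed_limpts closedin_closed by blast
  qed
  moreover have "p0 \<in> E" using p0 lim by (simp add: E_def)
  ultimately have EU: "E = U" using conn unfolding connected_clopen by blast
  obtain q where q: "q \<in> U" "N2 a c q \<noteq> 0" using nz by blast
  then have "q \<in> E" using EU by simp
  then obtain e where "e > 0" "\<forall>r\<in>ball q e. N2 a c r = 0"
    using accumulating_zeros unfolding E_def by blast
  then show False using q(2) by simp
qed

section \<open>Open mapping and local injectivity\<close>

lemma sop_exp_axis:
  "sop A b (\<lambda>q. exp (\<kappa> * q $ 1)) p ((\<kappa> * exp (\<kappa> * p $ 1)) *\<^sub>R axis 1 1)
     (exp (\<kappa> * p $ 1) * (\<kappa>\<^sup>2 * A $ 1 $ 1 + \<kappa> * b $ 1))" if sym: "transpose A = A" for A b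
proof -
  have 1: "sop A b (\<lambda>q. axis 1 1 \<bullet> q) p (axis 1 1) (b \<bullet> axis 1 1)" by (rule sop_inner)
  have 2: "\<forall>\<^sub>F t in nhds (axis 1 1 \<bullet> p). ((\<lambda>t. exp (\<kappa> * t)) has_real_derivative \<kappa> * exp (\<kappa> * t)) (at t)"
    by (intro always_eventually allI) (auto intro!: derivative_eq_intros)
  have 3: "((\<lambda>t. \<kappa> * exp (\<kappa> * t)) has_real_derivative \<kappa>\<^sup>2 * exp (\<kappa> * (axis 1 1 \<bullet> p))) (at (axis 1 1 \<bullet> p))"
    by (auto intro!: derivative_eq_intros simp: power2_eq_square)
  show ?thesis using sop_comp[OF 1 sym 2 3]
    by (simp add: inner_axis' inner_axis mv_2 axis_def inner_2 algebra_simps)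
qed

text \<open>The minimum modulus principle: without a zero in the ball, \<open>ln N2\<close> is
  annihilated by the operator and cannot be smaller at the centre than everywhere on the sphere. A
  small exponential supplies the strict inequality.\<close>

lemma value_attained_near:
  assumes K: "cball p r \<subseteq> U" "0 < r" and m: "0 < m" "\<And>q. dist p q = r \<Longrightarrow> m \<le> N2 a c q"
    and small: "N2 a c p < m"
  shows "\<exists>q\<in>ball p r. N2 a c q = 0"
proof (rule ccontr)
  assume no: "\<not> (\<exists>q\<in>ball p r. N2 a c q = 0)"
  have pos: "0 < N2 a c q" if "q \<in> cball p r" for q
    using no m that N2_nonneg[of a c q] by (cases "dist p q = r") (force simp: less_le)+
  let ?K = "cball p r" and ?W = "ball p r"
  have "continuous_on ?K b11" "continuous_on ?K (\<lambda>q. \<beta> q $ 1)"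
  proof -
    show "continuous_on ?K b11" using Ck_on_continuous[OF b_C1(1)] K(1) by (rule continuous_on_subset)
    have "continuous_on U (dd 1 b11)" "continuous_on U (dd 2 b12)"
      using b_C1 Ck_on_dd[of 0] Ck_on_continuous by (metis One_nat_def)+
    then have "continuous_on U (\<lambda>q. dd 1 b11 q + dd 2 b12 q)" by (rule continuous_on_add)
    then show "continuous_on ?K (\<lambda>q. \<beta> q $ 1)" unfolding \<beta>_def using K(1) by (auto intro: continuous_on_subset)
  qed
  moreover have "b11 q \<noteq> 0" if "q \<in> ?K" for q using b11_pos[of q] K(1) that by auto
  ultimately have "continuous_on ?K (\<lambda>q. \<bar>\<beta> q $ 1\<bar> / b11 q)"
    by (intro continuous_on_divide continuous_on_rabs ballI)
  from continuous_attains_sup[OF compact_cball _ this] K(2)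
  obtain q1 where "\<forall>q\<in>?K. \<bar>\<beta> q $ 1\<bar> / b11 q \<le> \<bar>\<beta> q1 $ 1\<bar> / b11 q1" by fastforce
  then obtain k where k: "\<And>q. q \<in> ?K \<Longrightarrow> \<bar>\<beta> q $ 1\<bar> / b11 q \<le> k" by blast
  \<comment> \<open>Larger than the ratio of drift to diffusion in the first coordinate, so that
    \<open>exp (\<kappa> * q $ 1)\<close> is a strict subsolution.\<close>
  define \<kappa> where "\<kappa> = \<bar>k\<bar> + 1"
  have ex: "0 < \<kappa>\<^sup>2 * b11 q + \<kappa> * \<beta> q $ 1" if "q \<in> ?K" for q
  proof -
    have b: "0 < b11 q" using b11_pos K(1) that by blast
    have "\<bar>\<beta> q $ 1\<bar> \<le> k * b11 q" using k[OF that] b by (simp add: divide_le_eq)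
    also have "\<dots> < \<kappa> * b11 q" using b by (auto simp: \<kappa>_def)
    finally have "0 < \<kappa> * (\<kappa> * b11 q + \<beta> q $ 1)" by (intro mult_pos_pos) (auto simp: \<kappa>_def)
    then show ?thesis by (simp add: power2_eq_square algebra_simps)
  qed
  define M where "M = exp (\<kappa> * (p $ 1 + r))"
  have M: "0 < M" "\<And>q. q \<in> ?K \<Longrightarrow> exp (\<kappa> * q $ 1) \<le> M"
  proof -
    show "0 < M" by (simp add: M_def)
    fix q assume "q \<in> ?K"
    then have "\<bar>(q - p) $ 1\<bar> \<le> r" using component_le_norm_cart[of "q - p" 1] by (simp add: dist_norm norm_minus_commute)
    then show "exp (\<kappa> * q $ 1) \<le> M" unfolding M_def by (auto simp: \<kappa>_def abs_le_iff intro!: mult_left_mono)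
  qed
  have l: "ln (N2 a c p) < ln m" using small pos[of p] K(2) m(1) by simp
  \<comment> \<open>The exponential is at most \<open>M\<close> on the ball, so the perturbation is
    at most half of the gap between \<open>ln (N2 a c p)\<close> and \<open>ln m\<close>.\<close>
  define \<delta> where "\<delta> = (ln m - ln (N2 a c p)) / (2 * M)"
  have \<delta>: "0 < \<delta>" using l M(1) by (simp add: \<delta>_def)
  define f where "f q = \<delta> * exp (\<kappa> * q $ 1) - ln (N2 a c q)" for q
  have "\<exists>q\<in>?K - ?W. f p \<le> f q"
  proof (rule strict_maximum_principle[where A=B and b=\<beta>])
    show "continuous_on ?K f" unfolding f_def
      using pos continuous_on_subset[OF N2_cont K(1)] 
      by (intro continuous_intros) (auto dest: pos)
    fix q assume q: "q \<in> ?W"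
    then have qU: "q \<in> U" "q \<in> ?K" using K(1) by (auto simp: subset_iff)
    show "transpose (B q) = B q" by (rule B_sym)
    show "0 \<le> v \<bullet> (B q *v v)" for v using B_nonneg[OF qU(1)] .
    obtain g where g: "sop (B q) (\<beta> q) (\<lambda>q. ln (N2 a c q)) q g 0" using sop_ln_N2[OF qU(1) pos[OF qU(2)]] by blast
    show "\<exists>g l. sop (B q) (\<beta> q) f q g l \<and> 0 < l"
      using sop_diff[OF sop_cmult[OF sop_exp_axis[OF B_sym], of q "\<beta> q" \<delta> \<kappa> q] g] \<delta> ex[OF qU(2)]
      unfolding f_def[abs_def] by (force simp: zero_less_mult_iff)
  qed (use K(2) in auto)
  then obtain q where q: "dist p q = r" "f p \<le> f q" by auto
  have "ln m \<le> ln (N2 a c q)" using m q(1) pos[of q] by simp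
  moreover have "\<delta> * exp (\<kappa> * q $ 1) \<le> \<delta> * M" using M(2)[of q] q(1) \<delta> by (intro mult_left_mono) auto
  moreover have "0 < \<delta> * exp (\<kappa> * p $ 1)" using \<delta> by simp
  moreover have "\<delta> * M = (ln m - ln (N2 a c p)) / 2" using M(1) by (simp add: \<delta>_def)
  ultimately show False using q(2) l unfolding f_def by (simp add: field_simps)
qed

text \<open>On a small sphere about \<open>p\<close> the values stay at a distance at least
  \<open>s > 0\<close> from \<open>z p\<close>. For a value \<open>w'\<close> closer than
  \<open>s / 2\<close>, the distance to \<open>w'\<close> is then smaller at \<open>p\<close> than
  on the sphere, so \<open>w'\<close> is attained.\<close>

lemma open_map:
  assumes conn: "connected U" and nc: "\<And>a c. \<exists>q\<in>U. N2 a c q \<noteq> 0" and W: "open W" "W \<subseteq> U"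
  shows "open ((\<lambda>p. Complex (x p) (y p)) ` W)"
  unfolding open_dist
proof
  fix w assume "w \<in> (\<lambda>p. Complex (x p) (y p)) ` W"
  then obtain p where p: "p \<in> W" "w = Complex (x p) (y p)" by blast
  then have pU: "p \<in> U" using W(2) by blast
  let ?N = "N2 (x p) (y p)"
  have "\<not> p islimpt {q \<in> U. ?N q = 0}" using zeros_isolated[OF conn nc pU] .
  then obtain T where T: "open T" "p \<in> T" "\<And>q. q \<in> U \<Longrightarrow> ?N q = 0 \<Longrightarrow> q \<in> T \<Longrightarrow> q = p"
    unfolding islimpt_def by blast
  obtain r where r: "0 < r" "cball p r \<subseteq> T \<inter> W"
    using open_contains_cball[of "T \<inter> W"] T(1,2) W(1) p(1) by blast
  have KU: "cball p r \<subseteq> U" using r(2) W(2) by blast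
  have sne: "sphere p r \<noteq> {}" using r(1) by simp
  have sc: "continuous_on (sphere p r) (\<lambda>q. sqrt (?N q))"
    using continuous_on_subset[OF N2_cont, of "sphere p r"] KU by (intro continuous_intros) (auto simp: subset_iff)
  obtain q0 where q0: "q0 \<in> sphere p r" "\<And>q. q \<in> sphere p r \<Longrightarrow> sqrt (?N q0) \<le> sqrt (?N q)"
    using continuous_attains_inf[OF compact_sphere sne sc] by blast
  define s where "s = sqrt (?N q0)"
  have N_dist: "sqrt (N2 a c q) = dist (Complex (x q) (y q)) (Complex a c)" for a c q
    by (simp add: N2_def dist_norm cmod_def power2_eq_square)
  have "?N q0 \<noteq> 0" using T(3)[of q0] q0(1) r KU by (auto simp: subset_iff)
  then have s: "0 < s" using N2_nonneg[of "x p" "y p" q0] by (simp add: s_def less_le)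
  show "\<exists>e>0. \<forall>w'. dist w' w < e \<longrightarrow> w' \<in> (\<lambda>p. Complex (x p) (y p)) ` W"
  proof (intro exI[of _ "s / 2"] conjI allI impI)
    fix w' assume w': "dist w' w < s / 2"
    define a c where "a = Re w'" and "c = Im w'"
    have wac: "w' = Complex a c" by (simp add: a_def c_def)
    have "\<exists>q\<in>ball p r. N2 a c q = 0"
    proof (rule value_attained_near[OF KU r(1)])
      show "0 < (s / 2)\<^sup>2" using s by simp
      show "(s / 2)\<^sup>2 \<le> N2 a c q" if "dist p q = r" for q
      proof -
        have "s \<le> dist (Complex (x q) (y q)) w" using q0(2)[of q] that by (simp add: s_def N_dist p(2))
        also have "\<dots> \<le> dist (Complex (x q) (y q)) w' + dist w' w" by (rule dist_triangle)
        finally have "s / 2 \<le> sqrt (N2 a c q)" using w' by (simp add: N_dist wac)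
        then show ?thesis using s by (metis N2_nonneg half_gt_zero less_imp_le power_mono real_sqrt_pow2)
      qed
      have "sqrt (N2 a c p) < s / 2" using w' by (simp add: N_dist wac p(2) dist_commute)
      then show "N2 a c p < (s / 2)\<^sup>2" using s N2_nonneg by (metis real_less_rsqrt real_sqrt_less_iff real_sqrt_abs abs_of_pos half_gt_zero)
    qed
    then obtain q where "q \<in> ball p r" "x q = a" "y q = c" by (auto simp: N2_eq_0)
    moreover from this have "q \<in> W" using r(2) by (auto simp: subset_iff)
    ultimately show "w' \<in> (\<lambda>p. Complex (x p) (y p)) ` W" using wac by blast
  qed (use s in simp)
qed

text \<open>By the system, the Jacobian determinant of \<open>(x, y)\<close> is the square length
  \<open>d\<close> of \<open>gradv y\<close> with respect to \<open>B\<close>, which is positive off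
  \<open>crit\<close>. The rest is the inverse function theorem.\<close>

lemma locally_injective:
  assumes p: "p \<in> U" "p \<notin> crit"
  shows "\<exists>W. open W \<and> p \<in> W \<and> W \<subseteq> U \<and> inj_on (\<lambda>q. Complex (x q) (y q)) W"
proof -
  define f where "f q = (vector [x q, y q] :: real^2)" for q
  define f' where "f' q v = (vector [gradv x q \<bullet> v, gradv y q \<bullet> v] :: real^2)" for q v
  have f': "(f has_derivative f' q) (at q)" if "q \<in> U" for q
  proof (rule has_derivative_vecI)
    fix i :: 2
    show "((\<lambda>q. f q $ i) has_derivative (\<lambda>v. f' q v $ i)) (at q)"
      using gradv_has_derivative[OF diff_xy(1)[OF that]] gradv_has_derivative[OF diff_xy(2)[OF that]]
        exhaust_2[of i] by (auto simp: f_def f'_def)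
  qed
  have lin: "bounded_linear (f' p)" using f'[OF p(1)] has_derivative_bounded_linear by blast
  have gy: "gradv y p \<noteq> 0" using p gradv_y_0_imp by (auto simp: crit_def)
  have "inj (f' p)"
  proof (subst linear_injective_0[OF bounded_linear.linear[OF lin]], intro allI impI)
    fix v assume "f' p v = 0"
    then have 1: "gradv x p \<bullet> v = 0" "gradv y p \<bullet> v = 0" by (auto simp: f'_def vec_eq_iff forall_2)
    define d where "d = gradv y p \<bullet> (B p *v gradv y p)"
    have d: "0 < d" unfolding d_def using B_pos[OF p(1) gy] .
    have "dd 1 x p * v $ 1 + dd 2 x p * v $ 2 = 0" "dd 1 y p * v $ 1 + dd 2 y p * v $ 2 = 0"
      using 1 by (simp_all add: inner_2)
    moreover have "dd 1 x p * dd 2 y p - dd 2 x p * dd 1 y p = d"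
      unfolding d_def cr1[OF p(1)] cr2[OF p(1)] inner_2 mv_2 by (simp add: algebra_simps)
    ultimately have "d * v $ 1 = 0" "d * v $ 2 = 0" by algebra+
    then show "v = 0" using d by (simp add: vec_eq_iff forall_2)
  qed
  then obtain g' where g': "linear g'" "g' \<circ> f' p = id"
    using linear_injective_left_inverse[OF bounded_linear.linear[OF lin]] by blast
  have bg: "bounded_linear g'" using g'(1) linear_conv_bounded_linear by blast
  have cont: "\<exists>d>0. \<forall>q. dist p q < d \<longrightarrow> onorm (\<lambda>v. f' q v - f' p v) < e" if e: "e > 0" for e
  proof -
    have cd: "isCont (dd i x) p" "isCont (dd i y) p" for i
      using diff_xy(3,4)[OF p(1)] differentiable_imp_continuous_within by blast+
    have "\<exists>d>0. \<forall>q. dist q p < d \<longrightarrow> dist (dd i x q) (dd i x p) < e / 8" for i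
      using cd(1)[of i] e unfolding continuous_at_eps_delta by (metis divide_pos_pos zero_less_numeral)
    then obtain D1 where D1: "\<And>i. D1 i > 0"
      "\<And>i q. dist q p < D1 i \<Longrightarrow> dist (dd i x q) (dd i x p) < e / 8" by metis
    have "\<exists>d>0. \<forall>q. dist q p < d \<longrightarrow> dist (dd i y q) (dd i y p) < e / 8" for i
      using cd(2)[of i] e unfolding continuous_at_eps_delta by (metis divide_pos_pos zero_less_numeral)
    then obtain D2 where D2: "\<And>i. D2 i > 0"
      "\<And>i q. dist q p < D2 i \<Longrightarrow> dist (dd i y q) (dd i y p) < e / 8" by metis
    define d where "d = min (min (D1 1) (D1 2)) (min (D2 1) (D2 2))"
    show ?thesis
    proof (intro exI[of _ d] conjI allI impI)
      show "0 < d" using D1(1) D2(1) by (simp add: d_def)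
      fix q assume "dist p q < d"
      then have h: "\<bar>dd i g q - dd i g p\<bar> \<le> e / 8" if "g \<in> {x, y}" for i g
        using D1(2)[of q i] D2(2)[of q i] exhaust_2[of i] that by (auto simp: d_def dist_commute dist_real_def abs_minus_commute)
      have "norm (f' q v - f' p v) \<le> (e / 2) * norm v" for v
      proof -
        have c: "\<bar>(f' q v - f' p v) $ i\<bar> \<le> e / 8 * \<bar>v $ 1\<bar> + e / 8 * \<bar>v $ 2\<bar>" for i
        proof -
          have "\<bar>(dd 1 g q - dd 1 g p) * v $ 1 + (dd 2 g q - dd 2 g p) * v $ 2\<bar>
              \<le> e / 8 * \<bar>v $ 1\<bar> + e / 8 * \<bar>v $ 2\<bar>" if "g \<in> {x, y}" for g
            by (rule order_trans[OF abs_triangle_ineq], unfold abs_mult) (intro add_mono mult_right_mono h that abs_ge_zero)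
          from this[of x] this[of y] show ?thesis
            using exhaust_2[of i] by (auto simp: f'_def inner_2 algebra_simps)
        qed
        have "norm (f' q v - f' p v) \<le> \<bar>(f' q v - f' p v) $ 1\<bar> + \<bar>(f' q v - f' p v) $ 2\<bar>"
          using norm_le_l1_cart[of "f' q v - f' p v"] by (simp add: sum_2)
        also have "\<dots> \<le> 2 * (e / 8 * \<bar>v $ 1\<bar> + e / 8 * \<bar>v $ 2\<bar>)" using add_mono[OF c[of 1] c[of 2]] by (simp only: mult_2)
        also have "\<dots> \<le> 2 * (e / 8 * norm v + e / 8 * norm v)" using e
          by (intro mult_left_mono add_mono component_le_norm_cart) auto
        finally show ?thesis by simp
      qed
      then have "onorm (\<lambda>v. f' q v - f' p v) \<le> e / 2" using e by (intro onorm_bound) auto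
      then show "onorm (\<lambda>v. f' q v - f' p v) < e" using e by simp
    qed
  qed
  obtain r where "r > 0" "ball p r \<subseteq> U" "inj_on f (ball p r)"
    using has_derivative_locally_injective[OF p(1) open_U bg g'(2) f' cont] by blast
  moreover from this have "inj_on (\<lambda>q. Complex (x q) (y q)) (ball p r)"
    by (auto simp: inj_on_def f_def)
  ultimately show ?thesis by (intro exI[of _ "ball p r"]) auto
qed

text \<open>\<open>trace B\<close> times the form equals the square norm of \<open>B v\<close> plus
  \<open>det B\<close> times that of \<open>v\<close>. An upper bound on the trace thus bounds the
  ellipticity from below.\<close>

lemma trace_quad: "p \<in> U \<Longrightarrow> v \<bullet> v \<le> (b11 p + b22 p) * (v \<bullet> (B p *v v))"
proof -
  assume p: "p \<in> U"
  have "(b11 p + b22 p) * (v \<bullet> (B p *v v)) = (B p *v v) \<bullet> (B p *v v) + (b11 p * b22 p - b12 p * b12 p) * (v \<bullet> v)"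
    unfolding B_quad inner_2 mv_2 by (simp add: power2_eq_square algebra_simps)
  then show ?thesis using det[OF p] by simp
qed

text \<open>Otherwise \<open>ln (N2 a 0)\<close> would be annihilated by the operator and tend to \<open>-\<infinity>\<close> at a piece of
  the boundary; multiples of a barrier that vanishes on the rest of the boundary of a cap show that it is
  then \<open>-\<infinity>\<close> inside.\<close>

lemma no_constant_boundary_values:
  fixes j :: 2
  assumes U: "U = {u \<in> ball u0 r. 0 < u $ j}" and u0: "u0 $ j = 0" and r: "0 < r"
    and M: "\<And>p. p \<in> U \<Longrightarrow> b11 p + b22 p \<le> M" "\<And>p. p \<in> U \<Longrightarrow> norm (\<beta> p) \<le> M"
    and cont: "continuous_on {u \<in> ball u0 r. 0 \<le> u $ j} x" "continuous_on {u \<in> ball u0 r. 0 \<le> u $ j} y"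
    and bdry: "\<And>u. u \<in> ball u0 r \<Longrightarrow> u $ j = 0 \<Longrightarrow> x u = a \<and> y u = 0"
    and pos: "\<And>u. u \<in> U \<Longrightarrow> y u \<noteq> 0"
  shows False
proof -
  define s where "s = r / 4"
  have s: "0 < s" "r = 4 * s" using r by (auto simp: s_def)
  \<comment> \<open>The centre lies at depth \<open>s\<close> below the edge; the disc of radius
    \<open>2 * s\<close> about it cuts off a cap whose boundary is a piece of the edge and a
    circular arc.\<close>
  define c where "c = u0 - s *\<^sub>R axis j 1"
  define \<rho> where "\<rho> q = (q - c) \<bullet> (q - c)" for q
  have \<rho>_norm: "\<rho> q = (norm (q - c))\<^sup>2" for q unfolding \<rho>_def by (simp add: dot_square_norm)
  define K where "K = {q. norm (q - c) \<le> 2 * s \<and> 0 \<le> q $ j}"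
  define W where "W = {q. norm (q - c) < 2 * s \<and> 0 < q $ j}"
  have cj: "c $ j = - s" by (simp add: c_def u0)
  have nc: "norm (u0 - c) = s" using s by (simp add: c_def)
  have K_ball: "q \<in> ball u0 r" if "q \<in> K" for q
  proof -
    have "norm (u0 - q) \<le> norm (u0 - c) + norm (c - q)" using norm_triangle_ineq[of "u0 - c" "c - q"] by simp
    then show ?thesis using that s nc by (simp add: K_def dist_norm norm_minus_commute)
  qed
  have WK: "W \<subseteq> K" by (auto simp: W_def K_def)
  have WU: "q \<in> U" if "q \<in> W" for q using K_ball that WK by (auto simp: U W_def)
  have "closed {q. norm (q - c) \<le> 2 * s}" "closed {q::plane. 0 \<le> q $ j}"
    by (intro closed_Collect_le continuous_intros)+
  then have "closed K" unfolding K_def by (simp add: Collect_conj_eq closed_Int)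
  moreover have "K \<subseteq> cball c (2 * s)" by (auto simp: K_def dist_norm norm_minus_commute)
  then have "bounded K" using bounded_subset bounded_cball by blast
  ultimately have cK: "compact K" by (simp add: compact_eq_bounded_closed)
  have "open {q. norm (q - c) < 2 * s}" "open {q::plane. 0 < q $ j}"
    by (intro open_Collect_less continuous_intros)+
  then have oW: "open W" unfolding W_def by (simp add: Collect_conj_eq open_Int)
  have lower: "s\<^sup>2 \<le> \<rho> q" if "q \<in> K" for q
  proof -
    have "s \<le> \<bar>(q - c) $ j\<bar>" using that s by (simp add: cj K_def)
    also have "\<dots> \<le> norm (q - c)" by (rule component_le_norm_cart)
    finally show ?thesis unfolding \<rho>_norm using s by (intro power_mono) auto
  qed
  define u1 where "u1 = u0 + (s / 2) *\<^sub>R axis j 1"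
  have "u1 - c = (3 * s / 2) *\<^sub>R axis j 1" unfolding u1_def c_def by (simp add: scaleR_add_left[symmetric])
  then have u1n: "norm (u1 - c) = 3 * s / 2" using s by simp
  have "u1 $ j = s / 2" by (simp add: u1_def u0)
  then have u1: "u1 \<in> W" using s u1n by (simp add: W_def)
  have M0: "0 < M"
  proof -
    have "0 < axis j 1 \<bullet> axis j (1::real)" by simp
    also have "\<dots> \<le> (b11 u1 + b22 u1) * (axis j 1 \<bullet> (B u1 *v axis j 1))" by (rule trace_quad[OF WU[OF u1]])
    finally have "0 < b11 u1 + b22 u1"
      using B_nonneg[OF WU[OF u1], of "axis j 1"] by (simp add: zero_less_mult_iff)
    then show ?thesis using M(1)[OF WU[OF u1]] by simp
  qed
  \<comment> \<open>On the cap \<open>|q - c| \<ge> s\<close>, so the form of \<open>B\<close> at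
    \<open>q - c\<close> is at least \<open>s^2 / M\<close>. With this \<open>\<alpha>\<close> the
    second-order term of the Hopf barrier \<open>h\<close> exceeds the remaining ones, bounded by
    \<open>2 * M + 4 * M * s\<close>.\<close>
  define \<alpha> where "\<alpha> = M * (2 * M + 4 * M * s + 1) / s\<^sup>2"
  have \<alpha>: "0 < \<alpha>" using M0 s by (simp add: \<alpha>_def add_pos_pos)
  have \<alpha>s: "\<alpha> * s\<^sup>2 = M * (2 * M + 4 * M * s + 1)" using s by (simp add: \<alpha>_def)
  define h where "h q = exp (- \<alpha> * \<rho> q)" for q
  have h_sop: "\<exists>g l. sop (B q) (\<beta> q) h q g l \<and> 0 < l" if q: "q \<in> W" for q
  proof -
    define q1 q2 where "q1 = q $ 1 - c $ 1" and "q2 = q $ 2 - c $ 2"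
    define g :: plane where "g = (q1 + q1) *\<^sub>R axis 1 1 + (q2 + q2) *\<^sub>R axis 2 1"
    define l where "l = 2 * (B q $ 1 $ 1 + B q $ 2 $ 2) + 2 * (\<beta> q \<bullet> (q - c))"
    have g2: "g = (2::real) *\<^sub>R (q - c)"
      by (simp add: g_def q1_def q2_def vec_eq_iff forall_2 axis_def)
    have 1: "sop (B q) (\<beta> q) \<rho> q g l"
      using sop_dist_square[OF B_sym q1_def q2_def] unfolding \<rho>_def[abs_def] g_def l_def .
    have 2: "\<forall>\<^sub>F t in nhds (\<rho> q). ((\<lambda>t. exp (- \<alpha> * t)) has_real_derivative - \<alpha> * exp (- \<alpha> * t)) (at t)"
      by (intro always_eventually allI) (auto intro!: derivative_eq_intros)
    have 3: "((\<lambda>t. - \<alpha> * exp (- \<alpha> * t)) has_real_derivative \<alpha> * \<alpha> * exp (- \<alpha> * \<rho> q)) (at (\<rho> q))"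
      by (auto intro!: derivative_eq_intros)
    have qU: "q \<in> U" and qK: "q \<in> K" using WU q WK by auto
    have "\<bar>\<beta> q \<bullet> (q - c)\<bar> \<le> M * (2 * s)"
    proof -
      have "\<bar>\<beta> q \<bullet> (q - c)\<bar> \<le> norm (\<beta> q) * norm (q - c)" by (rule Cauchy_Schwarz_ineq2)
      also have "\<dots> \<le> M * (2 * s)" using M(2)[OF qU] qK M0 by (intro mult_mono) (auto simp: K_def)
      finally show ?thesis .
    qed
    then have l: "l \<le> 2 * M + 4 * M * s" using M(1)[OF qU] by (simp add: l_def)
    define w where "w = (q - c) \<bullet> (B q *v (q - c))"
    have "s\<^sup>2 \<le> (b11 q + b22 q) * w" using lower[OF qK] trace_quad[OF qU, of "q - c"] by (simp add: \<rho>_def w_def)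
    also have "\<dots> \<le> M * w" using M(1)[OF qU] B_nonneg[OF qU] by (intro mult_right_mono) (auto simp: w_def)
    finally have "\<alpha> * s\<^sup>2 \<le> \<alpha> * (M * w)" using \<alpha> by (intro mult_left_mono) auto
    then have "M * (2 * M + 4 * M * s + 1) \<le> M * (\<alpha> * w)" unfolding \<alpha>s by (simp add: mult.left_commute)
    then have aw: "2 * M + 4 * M * s + 1 \<le> \<alpha> * w" using M0 by simp
    have "g \<bullet> (B q *v g) = 4 * w" unfolding g2 w_def by (simp add: matrix_vector_mult_scaleR)
    then have "- \<alpha> * exp (- \<alpha> * \<rho> q) * l + \<alpha> * \<alpha> * exp (- \<alpha> * \<rho> q) * (g \<bullet> (B q *v g)) =
        \<alpha> * exp (- \<alpha> * \<rho> q) * (4 * (\<alpha> * w) - l)" by (simp add: algebra_simps)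
    also have "\<dots> > 0"
    proof -
      have "0 < 2 * M + 4 * M * s" using M0 s by (simp add: add_pos_pos)
      then have "0 < 4 * (\<alpha> * w) - l" using aw l by linarith
      then show ?thesis using \<alpha> by simp
    qed
    finally show ?thesis using sop_comp[OF 1 B_sym 2 3] unfolding h_def[abs_def] by blast
  qed
  have Ksub: "K \<subseteq> {u \<in> ball u0 r. 0 \<le> u $ j}" using K_ball by (auto simp: K_def)
  note cxy = continuous_on_subset[OF cont(1) Ksub] continuous_on_subset[OF cont(2) Ksub]
  have cN: "continuous_on K (N2 a 0)" unfolding N2_def[abs_def] by (intro continuous_intros cxy)
  obtain q1 where "\<forall>q\<in>K. N2 a 0 q \<le> N2 a 0 q1"
    using continuous_attains_sup[OF cK _ cN] u1 WK by blast
  then obtain C where C: "\<And>q. q \<in> K \<Longrightarrow> N2 a 0 q \<le> C" by blast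
  have Npos: "0 < N2 a 0 q" if "q \<in> W" for q
  proof -
    have "N2 a 0 q \<noteq> 0" using pos[OF WU[OF that]] by (simp add: N2_eq_0)
    then show ?thesis using N2_nonneg[of a 0 q] by simp
  qed
  \<comment> \<open>The value of \<open>h\<close> on the circular arc, so \<open>h - k\<close>
    vanishes there.\<close>
  define k where "k = exp (- \<alpha> * (2 * s)\<^sup>2)"
  have hk: "k < h u1" using \<alpha> s by (simp add: k_def h_def \<rho>_norm u1n power2_eq_square)
  have bound: "N2 a 0 u1 * exp (n * (h u1 - k)) \<le> C" if n: "0 < n" for n
  proof -
    \<comment> \<open>Exponentiating \<open>ln N2 + n * (h - k)\<close> keeps a strict subsolution
      and makes it continuous up to the edge, where \<open>N2 = 0\<close>. On the arc it is
      \<open>N2\<close>, hence at most \<open>C\<close>.\<close>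
    define F where "F q = N2 a 0 q * exp (n * (h q - k))" for q
    have "\<exists>q\<in>K - W. F u1 \<le> F q"
    proof (rule strict_maximum_principle[OF cK _ _ oW WK, where A=B and b=\<beta>])
      show "continuous_on K F" unfolding F_def h_def \<rho>_def by (intro continuous_intros cN)
      show "u1 \<in> K" using u1 WK by blast
      fix q assume q: "q \<in> W"
      show "transpose (B q) = B q" by (rule B_sym)
      show "0 \<le> v \<bullet> (B q *v v)" for v using B_nonneg[OF WU[OF q]] .
      define f where "f q = ln (N2 a 0 q) + n * (h q - k)" for q
      obtain g where g: "sop (B q) (\<beta> q) (\<lambda>q. ln (N2 a 0 q)) q g 0"
        using sop_ln_N2[OF WU[OF q] Npos[OF q]] by blast
      obtain g' l' where g': "sop (B q) (\<beta> q) h q g' l'" "0 < l'" using h_sop[OF q] by blast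
      have fs: "sop (B q) (\<beta> q) f q (g + n *\<^sub>R g') (n * l')"
        using sop_add[OF g sop_cmult[OF sop_diff[OF g'(1) sop_const[of _ _ k]], of n]] unfolding f_def[abs_def] by simp
      have 2: "\<forall>\<^sub>F t in nhds (f q). (exp has_real_derivative exp t) (at t)"
        by (intro always_eventually allI DERIV_exp)
      have ev: "\<forall>\<^sub>F p in nhds q. exp (f p) = F p"
      proof -
        have "\<forall>\<^sub>F p in nhds q. p \<in> W" using oW q by (rule eventually_nhds_in_open)
        then show ?thesis by eventually_elim (simp add: f_def F_def exp_add Npos)
      qed
      define G where "G = g + n *\<^sub>R g'"
      have "0 < exp (f q) * (n * l') + exp (f q) * (G \<bullet> (B q *v G))"
        using n g'(2) B_nonneg[OF WU[OF q], of G] by (intro add_pos_nonneg mult_pos_pos mult_nonneg_nonneg) auto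
      then show "\<exists>g l. sop (B q) (\<beta> q) F q g l \<and> 0 < l"
        using sop_cong[OF sop_comp[OF fs B_sym 2 DERIV_exp] ev] unfolding G_def by blast
    qed
    then obtain q where q: "q \<in> K" "q \<notin> W" "F u1 \<le> F q" by blast
    have C0: "0 < C" using C[of u1] u1 WK Npos[OF u1] by force
    have "F q \<le> C"
    proof (cases "q $ j = 0")
      case True
      then have "N2 a 0 q = 0" using bdry[OF K_ball[OF q(1)]] by (simp add: N2_def)
      then show ?thesis using C0 by (simp add: F_def)
    next
      case False
      then have "norm (q - c) = 2 * s" using q(1,2) by (auto simp: K_def W_def)
      then have "h q = k" by (simp add: h_def k_def \<rho>_norm)
      then show ?thesis using C[OF q(1)] by (simp add: F_def)
    qed
    then show ?thesis using q(3) by (simp add: F_def)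
  qed
  define d where "d = h u1 - k"
  have d: "0 < d" using hk by (simp add: d_def)
  define m where "m = N2 a 0 u1"
  have m: "0 < m" using Npos[OF u1] by (simp add: m_def)
  have C0: "0 < C" using C[of u1] u1 WK m by (force simp: m_def)
  \<comment> \<open>Then \<open>m * (1 + n * d) = m + C\<close>, which exceeds the bound
    \<open>C\<close>.\<close>
  define n where "n = C / m / d"
  have n: "0 < n" using C0 m d by (simp add: n_def)
  have nd: "n * d = C / m" using d by (simp add: n_def)
  have "m * (1 + n * d) \<le> m * exp (n * d)" using m exp_ge_add_one_self[of "n * d"] by (intro mult_left_mono) auto
  also have "\<dots> \<le> C" using bound[OF n] by (simp add: m_def d_def)
  finally show False unfolding nd using m by (simp add: distrib_left)
qed

end

section \<open>The metric in the interior\<close>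

lemma matrix_inv_eq:
  fixes A B :: "real^'n^'n"
  assumes "A ** B = mat 1"
  shows "matrix_inv A = B"
proof -
  have "B ** A = mat 1" using assms matrix_left_right_inverse by blast
  then have "A ** matrix_inv A = mat 1"
    using someI[of "\<lambda>C. A ** C = mat 1 \<and> C ** A = mat 1" B] assms unfolding matrix_inv_def by blast
  then have "B ** (A ** matrix_inv A) = B" by simp
  then show ?thesis using \<open>B ** A = mat 1\<close> by (simp add: matrix_mul_assoc)
qed

lemma matrix_mult_2: "(A ** B) $ i $ j = A $ i $ 1 * B $ 1 $ j + A $ i $ 2 * B $ 2 $ j" for A :: "real^2^'n"
  by (simp add: matrix_matrix_mult_def sum_2)

lemma matrix_inv_2:
  fixes M :: "real^2^2"
  assumes "det M \<noteq> 0"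
  shows "matrix_inv M $ 1 $ 1 = M $ 2 $ 2 / det M" "matrix_inv M $ 1 $ 2 = - M $ 1 $ 2 / det M"
    "matrix_inv M $ 2 $ 1 = - M $ 2 $ 1 / det M" "matrix_inv M $ 2 $ 2 = M $ 1 $ 1 / det M"
proof -
  define N :: "real^2^2" where "N = vector [vector [M $ 2 $ 2 / det M, - M $ 1 $ 2 / det M], vector [- M $ 2 $ 1 / det M, M $ 1 $ 1 / det M]]"
  have "matrix_inv M = N"
  proof (rule matrix_inv_eq)
    have "M $ 1 $ 1 * M $ 2 $ 2 / det M - M $ 1 $ 2 * M $ 2 $ 1 / det M = det M / det M"
      by (simp only: det_2 diff_divide_distrib)
    then have "M $ 1 $ 1 * M $ 2 $ 2 / det M = 1 + M $ 1 $ 2 * M $ 2 $ 1 / det M" using assms by simp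
    then show "M ** N = mat 1"
      by (auto simp: vec_eq_iff forall_2 matrix_mult_2 N_def mat_def algebra_simps)
  qed
  then show "matrix_inv M $ 1 $ 1 = M $ 2 $ 2 / det M" "matrix_inv M $ 1 $ 2 = - M $ 1 $ 2 / det M"
    "matrix_inv M $ 2 $ 1 = - M $ 2 $ 1 / det M" "matrix_inv M $ 2 $ 2 = M $ 1 $ 1 / det M"
    by (simp_all add: N_def)
qed

lemma pos_def_entries:
  assumes "pos_def M"
  shows "M $ 2 $ 1 = M $ 1 $ 2" "0 < M $ 1 $ 1" "0 < M $ 2 $ 2" "0 < det M"
proof -
  have s: "transpose M = M" and p: "\<And>v. v \<noteq> 0 \<Longrightarrow> 0 < v \<bullet> (M *v v)" using assms by (auto simp: pos_def_def)
  show 21: "M $ 2 $ 1 = M $ 1 $ 2" using arg_cong[OF s, of "\<lambda>N. N $ 1 $ 2"] by (simp add: transpose_def)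
  show 11: "0 < M $ 1 $ 1" using p[of "axis 1 1"] by (simp add: inner_2 mv_2 axis_eq_0_iff) (simp add: axis_def)
  show "0 < M $ 2 $ 2" using p[of "axis 2 1"] by (simp add: inner_2 mv_2 axis_eq_0_iff) (simp add: axis_def)
  define v :: plane where "v = vector [- M $ 1 $ 2, M $ 1 $ 1]"
  have "v \<noteq> 0" using 11 by (auto simp: v_def vec_eq_iff forall_2)
  from p[OF this] have "0 < M $ 1 $ 1 * det M"
    by (simp add: v_def inner_2 mv_2 det_2 21 algebra_simps)
  then show "0 < det M" using 11 by (simp add: zero_less_mult_iff)
qed

text \<open>In dimension 2 the form of the inverse is the original form after rotation by a right
  angle, divided by the determinant.\<close>

lemma pos_def_matrix_inv:
  assumes "pos_def M"
  shows "pos_def (matrix_inv M)"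
proof -
  note M = pos_def_entries[OF assms]
  have d: "det M \<noteq> 0" using M(4) by simp
  have "0 < v \<bullet> (matrix_inv M *v v)" if "v \<noteq> 0" for v
  proof -
    define w :: plane where "w = vector [- v $ 2, v $ 1]"
    have "w \<noteq> 0" using that by (auto simp: w_def vec_eq_iff forall_2)
    then have "0 < w \<bullet> (M *v w)" using assms by (simp add: pos_def_def)
    also have "w \<bullet> (M *v w) = det M * (v \<bullet> (matrix_inv M *v v))"
      using d by (simp add: w_def inner_2 mv_2 matrix_inv_2 M(1) field_simps)
    finally show ?thesis using M(4) by (simp add: zero_less_mult_iff)
  qed
  moreover have "transpose (matrix_inv M) = matrix_inv M"
    using d by (simp add: vec_eq_iff forall_2 transpose_def matrix_inv_2 M(1))
  ultimately show ?thesis by (simp add: pos_def_def)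
qed

lemma pos_def_congruent:
  assumes "pos_def M" "det J \<noteq> 0"
  shows "pos_def (J ** M ** transpose J)"
proof -
  have "0 < v \<bullet> ((J ** M ** transpose J) *v v)" if "v \<noteq> 0" for v
  proof -
    have "transpose J *v v \<noteq> 0" using assms(2) that
      by (metis det_transpose invertible_det_nz matrix_left_invertible_ker invertible_def)
    then have "0 < (transpose J *v v) \<bullet> (M *v (transpose J *v v))" using assms(1) by (simp add: pos_def_def)
    also have "\<dots> = v \<bullet> ((J ** M ** transpose J) *v v)"
      by (metis dot_lmul_matrix matrix_vector_mul_assoc transpose_matrix_vector transpose_transpose)
    finally show ?thesis .
  qed
  moreover have "transpose M = M" using assms(1) by (simp add: pos_def_def)
  then have "transpose (J ** M ** transpose J) = J ** M ** transpose J"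
    by (simp add: matrix_transpose_mul matrix_mul_assoc)
  ultimately show ?thesis by (simp add: pos_def_def)
qed

lemma sop_rescale:
  assumes "sop B b f p g l"
  shows "sop (c *\<^sub>R B) 0 f p g (c * (l - b \<bullet> g))"
proof -
  obtain F D where "\<forall>\<^sub>F q in nhds p. (f has_derivative (\<lambda>v. F q \<bullet> v)) (at q)"
    "F p = g" "(F has_derivative D) (at p)" "l = (\<Sum>i\<in>UNIV. (B *v axis i 1) \<bullet> D (axis i 1)) + b \<bullet> g"
    using assms unfolding sop_def by blast
  then show ?thesis
    by (intro sopI[where F=F and D=D]) (auto simp: sum_distrib_left scaleR_matrix_vector_assoc[symmetric])
qed

lemma grad_coordinate:
  assumes "open S" "p \<in> S"
  shows "grad S G (\<lambda>p. p $ i) p = matrix_inv (G p) *v axis i 1"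
proof -
  have "((\<lambda>p::plane. p $ i) has_derivative (\<lambda>v. v $ i)) (at p)"
    by (rule bounded_linear_imp_has_derivative[OF bounded_linear_vec_nth])
  from frechet_derivative_eq[OF this] have "pd S j (\<lambda>p. p $ i) p = axis i 1 $ j" for j
    unfolding pd_def at_within_open[OF assms(2,1)] by (simp add: axis_def)
  then have "(\<chi> j. pd S j (\<lambda>p. p $ i) p) = axis i 1" by (simp add: vec_eq_iff)
  then show ?thesis by (simp add: grad_def)
qed

locale metric_interior =
  fixes \<Sigma> :: "plane set" and G :: "plane \<Rightarrow> real^2^2" and x y :: "plane \<Rightarrow> real"
  assumes G_pos_def: "\<And>p. p \<in> interior \<Sigma> \<Longrightarrow> pos_def (G p)"
    and inverse_metric_Ck: "\<And>k i j. Ck_on k (interior \<Sigma>) (\<lambda>p. matrix_inv (G p) $ i $ j)"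
    and bracket: "\<And>p. p \<in> interior \<Sigma> \<Longrightarrow>
      lie_bracket (interior \<Sigma>) (grad_phi \<Sigma> G 1) (grad_phi \<Sigma> G 2) p = 0"
    and y_vol: "\<And>p. p \<in> interior \<Sigma> \<Longrightarrow> y p = sqrt (volV \<Sigma> G p)"
    and x_conjugate: "\<And>p. p \<in> interior \<Sigma> \<Longrightarrow>
      (x has_derivative (\<lambda>v. - J_form G p (frechet_derivative y (at p)) v)) (at p)"
begin

definition A :: "plane \<Rightarrow> real^2^2" where "A p = matrix_inv (G p)"
definition a11 :: "plane \<Rightarrow> real" where "a11 p = A p $ 1 $ 1"
definition a12 :: "plane \<Rightarrow> real" where "a12 p = A p $ 1 $ 2"
definition a22 :: "plane \<Rightarrow> real" where "a22 p = A p $ 2 $ 2"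

abbreviation "S0 \<equiv> interior \<Sigma>"

lemma a_C: "Ck_on k S0 a11" "Ck_on k S0 a12" "Ck_on k S0 a22"
  using inverse_metric_Ck unfolding a11_def[abs_def] a12_def[abs_def] a22_def[abs_def] A_def by blast+

lemma A_pos_def: "p \<in> S0 \<Longrightarrow> pos_def (A p)"
  unfolding A_def by (rule pos_def_matrix_inv[OF G_pos_def])

lemma A_nth: "p \<in> S0 \<Longrightarrow> A p $ 1 $ 1 = a11 p" "p \<in> S0 \<Longrightarrow> A p $ 1 $ 2 = a12 p"
   "p \<in> S0 \<Longrightarrow> A p $ 2 $ 1 = a12 p" "p \<in> S0 \<Longrightarrow> A p $ 2 $ 2 = a22 p"
  using pos_def_entries(1)[OF A_pos_def] by (simp_all add: a11_def a12_def a22_def)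

lemma det_A_pos: "p \<in> S0 \<Longrightarrow> 0 < a11 p * a22 p - a12 p * a12 p"
  using pos_def_entries(4)[OF A_pos_def] by (simp add: det_2 A_nth)

lemma a11_pos: "p \<in> S0 \<Longrightarrow> 0 < a11 p"
  using pos_def_entries(2)[OF A_pos_def] by (simp add: A_nth)

lemma G_A: "p \<in> S0 \<Longrightarrow> G p ** A p = mat 1"
proof -
  assume p: "p \<in> S0"
  have "det (G p) \<noteq> 0" using pos_def_entries(4)[OF G_pos_def[OF p]] by simp
  then obtain C where "G p ** C = mat 1" unfolding invertible_det_nz[symmetric] invertible_def by blast
  then show ?thesis unfolding A_def using matrix_inv_eq by metis
qed

lemma G_eq:
  assumes p: "p \<in> S0"
  shows "G p $ 1 $ 1 = a22 p / (a11 p * a22 p - a12 p * a12 p)"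
    "G p $ 1 $ 2 = - a12 p / (a11 p * a22 p - a12 p * a12 p)"
    "G p $ 2 $ 2 = a11 p / (a11 p * a22 p - a12 p * a12 p)"
proof -
  have "A p ** G p = mat 1" using G_A[OF p] matrix_left_right_inverse by blast
  then have "matrix_inv (A p) = G p" by (rule matrix_inv_eq)
  moreover have "det (A p) = a11 p * a22 p - a12 p * a12 p" by (simp add: det_2 A_nth p)
  moreover from this have "det (A p) \<noteq> 0" using det_A_pos[OF p] by simp
  ultimately show "G p $ 1 $ 1 = a22 p / (a11 p * a22 p - a12 p * a12 p)"
    "G p $ 1 $ 2 = - a12 p / (a11 p * a22 p - a12 p * a12 p)"
    "G p $ 2 $ 2 = a11 p / (a11 p * a22 p - a12 p * a12 p)"
    using matrix_inv_2[of "A p"] A_nth[OF p] by auto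
qed

lemma grad_phi_eq: "p \<in> S0 \<Longrightarrow> grad_phi \<Sigma> G i p = A p *v axis i 1"
  unfolding grad_phi_def A_def by (rule grad_coordinate) auto

text \<open>\<open>volV\<close> is the Gram determinant of the two gradients, which are the columns
  of \<open>A\<close> and have the entries of \<open>A\<close> as inner products.\<close>

lemma y_eq:
  assumes p: "p \<in> S0"
  shows "y p = sqrt (a11 p * a22 p - a12 p * a12 p)"
proof -
  have "ip G p (grad_phi \<Sigma> G i p) (grad_phi \<Sigma> G j p) = A p $ j $ i" for i j
  proof -
    have "G p *v (A p *v axis j 1) = axis j 1" by (simp add: matrix_vector_mul_assoc G_A[OF p])
    moreover have "(A p *v axis i 1) \<bullet> axis j (1::real) = A p $ j $ i"
      by (simp add: inner_axis matrix_vector_mult_basis column_def)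
    ultimately show ?thesis unfolding ip_def grad_phi_eq[OF p] by simp
  qed
  then have "volV \<Sigma> G p = a11 p * a22 p - a12 p * a12 p"
    unfolding volV_def by (simp add: A_nth[OF p] power2_eq_square)
  then show ?thesis using y_vol[OF p] by simp
qed

lemma y_pos: "p \<in> S0 \<Longrightarrow> 0 < y p"
  using y_eq det_A_pos by simp

lemma y_C: "Ck_on k S0 y"
proof (rule Ck_on_cong[OF open_interior])
  show "Ck_on k S0 (\<lambda>p. sqrt (a11 p * a22 p - a12 p * a12 p))"
    by (intro Ck_on_sqrt Ck_on_diff Ck_on_mult a_C det_A_pos open_interior)
qed (simp add: y_eq)

lemma y_square: "p \<in> S0 \<Longrightarrow> y p * y p = a11 p * a22 p - a12 p * a12 p"
  using y_eq det_A_pos[of p] by simp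

lemma diff: "p \<in> S0 \<Longrightarrow> y differentiable (at p)" "p \<in> S0 \<Longrightarrow> a11 differentiable (at p)"
   "p \<in> S0 \<Longrightarrow> a12 differentiable (at p)" "p \<in> S0 \<Longrightarrow> a22 differentiable (at p)"
  using Ck_on_differentiable y_C a_C by blast+

lemma x_derivative:
  assumes p: "p \<in> S0"
  shows "(x has_derivative (\<lambda>v. ((a12 p * dd 1 y p + a22 p * dd 2 y p) / y p) * v $ 1
     + (- ((a11 p * dd 1 y p + a12 p * dd 2 y p) / y p)) * v $ 2)) (at p)"
proof -
  have Dy: "frechet_derivative y (at p) v = dd 1 y p * v $ 1 + dd 2 y p * v $ 2" for v
    using frechet_derivative_eq[OF derivative_dd[OF diff(1)[OF p]]] .
  define d where "d = y p * y p"
  have yp: "0 < y p" using y_pos[OF p] .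
  have dn: "d > 0" using yp by (simp add: d_def)
  have d: "a11 p * a22 p - a12 p * a12 p = d" using y_square[OF p] by (simp add: d_def)
  note g = G_eq[OF p, unfolded d]
  have 21: "G p $ 2 $ 1 = G p $ 1 $ 2" using pos_def_entries(1)[OF G_pos_def[OF p]] .
  have "det (G p) = (a11 p * a22 p - a12 p * a12 p) / (d * d)"
    using dn by (simp add: det_2 g 21 field_simps)
  then have "det (G p) = 1 / d" unfolding d using dn by simp
  then have sq: "sqrt (det (G p)) = 1 / y p" using yp by (simp add: d_def real_sqrt_divide real_sqrt_mult_self)
  have "complex_structure G p v = vector [(a12 p * v $ 1 - a11 p * v $ 2) / y p, (a22 p * v $ 1 - a12 p * v $ 2) / y p]" for v
    unfolding complex_structure_def sq using yp
    by (simp add: vec_eq_iff forall_2 g d_def field_simps)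
  then have "(\<lambda>v. - J_form G p (frechet_derivative y (at p)) v) =
      (\<lambda>v. ((a12 p * dd 1 y p + a22 p * dd 2 y p) / y p) * v $ 1
     + (- ((a11 p * dd 1 y p + a12 p * dd 2 y p) / y p)) * v $ 2)"
    unfolding J_form_def Dy using yp by (simp add: fun_eq_iff field_simps)
  then show ?thesis using x_conjugate[OF p] by simp
qed

lemma div_y_C: "Ck_on k S0 f \<Longrightarrow> Ck_on k S0 (\<lambda>p. f p / y p)"
  unfolding divide_inverse
proof (intro Ck_on_mult Ck_on_inverse y_C open_interior)
  show "y p \<noteq> 0" if "p \<in> S0" for p using y_pos[OF that] by simp
qed

lemma x_C: "Ck_on (Suc k) S0 x"
proof (rule Ck_on_ddI[OF open_interior x_derivative])
  have "Ck_on k S0 (\<lambda>p. b p * dd 1 y p + c p * dd 2 y p)" if "Ck_on k S0 b" "Ck_on k S0 c" for b c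
    by (intro Ck_on_add Ck_on_mult that Ck_on_dd y_C open_interior)
  note * = div_y_C[OF this]
  show "Ck_on k S0 (\<lambda>p. (a12 p * dd 1 y p + a22 p * dd 2 y p) / y p)"
    "Ck_on k S0 (\<lambda>p. - ((a11 p * dd 1 y p + a12 p * dd 2 y p) / y p))"
    by (rule *[OF a_C(2,3)], rule Ck_on_uminus[OF open_interior *[OF a_C(1,2)]])
qed

lemma interior_cauchy_riemann:
  "cauchy_riemann S0 x y (\<lambda>p. a11 p / y p) (\<lambda>p. a12 p / y p) (\<lambda>p. a22 p / y p)"
proof
  show "Ck_on 2 S0 x" unfolding numeral_2_eq_2 by (rule x_C)
  fix p assume p: "p \<in> S0"
  show "0 < a11 p / y p" using a11_pos[OF p] y_pos[OF p] by simp
  show "a11 p / y p * (a22 p / y p) - a12 p / y p * (a12 p / y p) = 1"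
    using y_pos[OF p] y_square[OF p] by (simp add: field_simps)
  show "dd 1 x p = a12 p / y p * dd 1 y p + a22 p / y p * dd 2 y p"
    "dd 2 x p = - (a11 p / y p * dd 1 y p + a12 p / y p * dd 2 y p)"
    unfolding dd_eq[OF x_derivative[OF p]] by (simp_all add: axis_def add_divide_distrib)
qed (simp_all only: open_interior y_C div_y_C a_C)

text \<open>Commuting independent fields, here the columns of \<open>A\<close>, are coordinate
  fields of local coordinates; the divergence of such a field in the plane is its derivative of
  \<open>ln (det A)\<close>, that is, of \<open>2 * ln y\<close>. Formally the identities follow by
  algebra from the bracket and the derivative of \<open>y^2 = det A\<close>.\<close>

lemma bracket_divergence:
  assumes p: "p \<in> S0"
  shows "y p * (dd 1 a11 p + dd 2 a12 p) = 2 * (a11 p * dd 1 y p + a12 p * dd 2 y p)"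
    "y p * (dd 1 a12 p + dd 2 a22 p) = 2 * (a12 p * dd 1 y p + a22 p * dd 2 y p)"
proof -
  have e1: "grad_phi \<Sigma> G 1 q = vector [a11 q, a12 q]" "grad_phi \<Sigma> G 2 q = vector [a12 q, a22 q]" if "q \<in> S0" for q
    unfolding grad_phi_eq[OF that] using A_nth[OF that]
    by (simp_all add: vec_eq_iff forall_2 mv_2 axis_def)
  define D where "D f v = dd 1 f p * v $ 1 + dd 2 f p * v $ 2" for f :: "plane \<Rightarrow> real" and v :: plane
  have FD: "frechet_derivative F (at p within S0) v = vector [D f v, D g v]"
    if "f differentiable (at p)" "g differentiable (at p)" "\<And>q. q \<in> S0 \<Longrightarrow> F q = vector [f q, g q]" for F :: "plane \<Rightarrow> plane" and f g v
  proof -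
    have "((\<lambda>q. vector [f q, g q] :: plane) has_derivative (\<lambda>v. vector [D f v, D g v])) (at p)"
    proof (rule has_derivative_vecI)
      fix i :: 2
      show "((\<lambda>q. vector [f q, g q] $ i :: real) has_derivative (\<lambda>v. vector [D f v, D g v] $ i)) (at p)"
        using derivative_dd[OF that(1)] derivative_dd[OF that(2)] exhaust_2[of i] by (auto simp: D_def)
    qed
    from has_derivative_transform_within_open[OF this open_interior p, of F] that(3)
    have "(F has_derivative (\<lambda>v. vector [D f v, D g v])) (at p)" by simp
    then show ?thesis using frechet_derivative_eq at_within_open[OF p open_interior] by metis
  qed
  have "lie_bracket S0 (grad_phi \<Sigma> G 1) (grad_phi \<Sigma> G 2) p =
      vector [D a12 (vector [a11 p, a12 p]), D a22 (vector [a11 p, a12 p])] -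
      vector [D a11 (vector [a12 p, a22 p]), D a12 (vector [a12 p, a22 p])]"
    unfolding lie_bracket_def using FD[OF diff(3)[OF p] diff(4)[OF p] e1(2)] FD[OF diff(2)[OF p] diff(3)[OF p] e1(1)]
    by (simp add: e1[OF p])
  then have E: "dd 1 a12 p * a11 p + dd 2 a12 p * a12 p = dd 1 a11 p * a12 p + dd 2 a11 p * a22 p"
    "dd 1 a22 p * a11 p + dd 2 a22 p * a12 p = dd 1 a12 p * a12 p + dd 2 a12 p * a22 p"
    using bracket[OF p] by (simp_all add: vec_eq_iff forall_2 D_def)
  have v: "2 * (y p * dd i y p) = a11 p * dd i a22 p + dd i a11 p * a22 p - 2 * (a12 p * dd i a12 p)" for i
  proof -
    have "dd i (\<lambda>q. y q * y q) p = dd i (\<lambda>q. a11 q * a22 q + - (a12 q * a12 q)) p"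
      by (rule dd_cong[OF open_interior p]) (use y_square diff[OF p] in auto)
    moreover have "dd i (\<lambda>q. a11 q * a22 q + - (a12 q * a12 q)) p =
        dd i (\<lambda>q. a11 q * a22 q) p + dd i (\<lambda>q. - (a12 q * a12 q)) p"
      by (rule dd_add) (use diff[OF p] in auto)
    moreover have "dd i (\<lambda>q. - (a12 q * a12 q)) p = - dd i (\<lambda>q. a12 q * a12 q) p"
      by (rule dd_uminus) (use diff[OF p] in auto)
    ultimately show ?thesis using diff[OF p] by (simp add: dd_mult algebra_simps)
  qed
  have yn: "y p \<noteq> 0" using y_pos[OF p] by simp
  have "y p * (y p * (dd 1 a11 p + dd 2 a12 p)) = y p * (2 * (a11 p * dd 1 y p + a12 p * dd 2 y p))"
    using E v[of 1] v[of 2] y_square[OF p] by algebra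
  then show "y p * (dd 1 a11 p + dd 2 a12 p) = 2 * (a11 p * dd 1 y p + a12 p * dd 2 y p)" using yn by simp
  have "y p * (y p * (dd 1 a12 p + dd 2 a22 p)) = y p * (2 * (a12 p * dd 1 y p + a22 p * dd 2 y p))"
    using E v[of 1] v[of 2] y_square[OF p] by algebra
  then show "y p * (dd 1 a12 p + dd 2 a22 p) = 2 * (a12 p * dd 1 y p + a22 p * dd 2 y p)" using yn by simp
qed

interpretation cr: cauchy_riemann S0 x y "\<lambda>p. a11 p / y p" "\<lambda>p. a12 p / y p" "\<lambda>p. a22 p / y p"
  by (rule interior_cauchy_riemann)

lemma A_eq_B: "p \<in> S0 \<Longrightarrow> A p = y p *\<^sub>R cr.B p"
  using y_pos[of p] by (simp add: vec_eq_iff forall_2 A_nth)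

text \<open>For \<open>B = A / y\<close> the product rule gives
  \<open>div A / y - A (grad y) / y^2\<close>. Since \<open>div A\<close> is
  \<open>2 A (grad y) / y\<close>, one of the two multiples of \<open>A (grad y) / y^2\<close>
  remains.\<close>

lemma beta_eq:
  assumes p: "p \<in> S0"
  shows "y p *\<^sub>R cr.\<beta> p = cr.B p *v gradv y p"
proof -
  have yn: "y p \<noteq> 0" using y_pos[OF p] by simp
  have q: "y p * y p * dd i (\<lambda>p. f p / y p) p = y p * dd i f p - f p * dd i y p" if "f differentiable (at p)" for f i
  proof -
    have "dd i f p = dd i (\<lambda>q. (f q / y q) * y q) p"
      by (rule dd_cong[OF open_interior p]) (use that y_pos in \<open>force+\<close>)
    also have "\<dots> = (f p / y p) * dd i y p + dd i (\<lambda>p. f p / y p) p * y p"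
      by (rule dd_mult) (use diff[OF p] that yn in auto)
    finally show ?thesis using yn by (simp add: field_simps)
  qed
  have "y p * y p * y p * cr.\<beta> p $ i = y p * y p * (cr.B p *v gradv y p) $ i" for i
  proof -
    have 1: "y p * y p * cr.\<beta> p $ 1 = a11 p * dd 1 y p + a12 p * dd 2 y p"
      using q[OF diff(2)[OF p], of 1] q[OF diff(3)[OF p], of 2] bracket_divergence(1)[OF p]
      by (simp add: cr.\<beta>_def distrib_left)
    have 2: "y p * y p * cr.\<beta> p $ 2 = a12 p * dd 1 y p + a22 p * dd 2 y p"
      using q[OF diff(3)[OF p], of 1] q[OF diff(4)[OF p], of 2] bracket_divergence(2)[OF p]
      by (simp add: cr.\<beta>_def distrib_left)
    have "y p * (y p * y p * cr.\<beta> p $ i) = y p * y p * (cr.B p *v gradv y p) $ i"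
      using 1 2 yn exhaust_2[of i] by (auto simp: mv_2 field_simps)
    then show ?thesis by (simp only: ac_simps)
  qed
  then show ?thesis using yn by (simp add: vec_eq_iff)
qed

text \<open>\<open>A : D^2\<close> is \<open>y\<close> times the difference of the divergence-form
  operator and its drift. The first annihilates \<open>x\<close> and \<open>y\<close>, and by
  \<open>beta_eq\<close> the drift contributes the \<open>B\<close>-product with
  \<open>gradv y\<close>: zero for \<open>x\<close> by orthogonality, the square length for
  \<open>y\<close>.\<close>

lemma xy_sop:
  assumes p: "p \<in> S0"
  shows "\<exists>gx gy. sop (A p) 0 x p gx 0 \<and> sop (A p) 0 y p gy (- (gy \<bullet> (A p *v gy)) / y p) \<and>
     gx \<bullet> (A p *v gy) = 0 \<and> gx \<bullet> (A p *v gx) = gy \<bullet> (A p *v gy)"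
proof (rule exI[of _ "gradv x p"], rule exI[of _ "gradv y p"], intro conjI)
  note c = cr.conformal[OF p]
  have yn: "y p \<noteq> 0" using y_pos[OF p] by simp
  have b: "y p * (cr.\<beta> p \<bullet> g) = g \<bullet> (cr.B p *v gradv y p)" for g
    using arg_cong[OF beta_eq[OF p], of "\<lambda>v. g \<bullet> v"] by (simp add: inner_commute)
  have Am: "A p *v v = y p *\<^sub>R (cr.B p *v v)" for v
    unfolding A_eq_B[OF p] by (simp add: scaleR_matrix_vector_assoc[symmetric])
  show "sop (A p) 0 x p (gradv x p) 0"
    using sop_rescale[OF cr.sop_x[OF p], of "y p"] b[of "gradv x p"] unfolding c A_eq_B[OF p] by simp
  show "sop (A p) 0 y p (gradv y p) (- (gradv y p \<bullet> (A p *v gradv y p)) / y p)"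
    using sop_rescale[OF cr.sop_y[OF p], of "y p"] b[of "gradv y p"] yn unfolding Am unfolding A_eq_B[OF p] by simp
  show "gradv x p \<bullet> (A p *v gradv y p) = 0" "gradv x p \<bullet> (A p *v gradv x p) = gradv y p \<bullet> (A p *v gradv y p)"
    unfolding Am using c by simp_all
qed

end

section \<open>Charts at the boundary\<close>

lemma continuous_nonzero_sign:
  fixes f :: "'a::topological_space \<Rightarrow> real"
  assumes "connected U" "continuous_on U f" "\<And>u. u \<in> U \<Longrightarrow> f u \<noteq> 0"
  shows "\<exists>\<sigma>. \<sigma> * \<sigma> = 1 \<and> (\<forall>u\<in>U. 0 < \<sigma> * f u)"
proof -
  have "(\<forall>u\<in>U. 0 < f u) \<or> (\<forall>u\<in>U. f u < 0)"
  proof (rule ccontr)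
    assume "\<not> ?thesis"
    then obtain u v where "u \<in> U" "v \<in> U" "f u \<le> 0" "0 \<le> f v" by (auto simp: not_less)
    moreover have "connected (f ` U)" using assms(1,2) by (rule connected_continuous_image[rotated])
    ultimately have "0 \<in> f ` U" using connectedD_interval by blast
    then show False using assms(3) by auto
  qed
  then show ?thesis by (elim disjE) (auto intro: exI[of _ 1] exI[of _ "- 1"])
qed

lemma smooth_on_Ck:
  assumes "smooth_on S f" "open V" "V \<subseteq> S"
  shows "Ck_on k V f"
proof (rule Ck_on_local)
  fix p assume p: "p \<in> V"
  then obtain W F where W: "open W" "p \<in> W" "Ck_on k W F" "\<forall>u\<in>S \<inter> W. F u = f u"
    using assms(1,3) unfolding smooth_on_def by (meson subsetD)
  have "Ck_on k (W \<inter> V) f"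
    by (rule Ck_on_cong[OF _ _ Ck_on_subset[OF W(3)], of "W \<inter> V"]) (use W assms in auto)
  then show "\<exists>T. open T \<and> p \<in> T \<and> Ck_on k T f" using W p assms(2) by (intro exI[of _ "W \<inter> V"]) auto
qed

lemma interior_quadrant: "interior quadrant = {u. \<forall>i. 0 < u $ i}"
proof -
  have q: "quadrant = {u. u $ 1 \<ge> 0} \<inter> {u. u $ 2 \<ge> 0}" by (auto simp: quadrant_def forall_2)
  show ?thesis unfolding q interior_Int interior_halfspace_component_ge by (auto simp: forall_2)
qed

lemma continuous_within_local:
  assumes "open W" "u \<in> W" "u \<in> D" "continuous_on (D \<inter> W) f"
  shows "continuous (at u within D) f"
proof -
  have "at u within D = at u within (D \<inter> W)" by (rule at_within_nhd[OF assms(2,1)]) auto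
  then show ?thesis using assms by (simp add: continuous_on_eq_continuous_within)
qed

locale polygon_chart =
  fixes \<Sigma> :: "plane set" and G :: "plane \<Rightarrow> real^2^2" and D :: "plane set" and X :: "plane \<Rightarrow> plane"
  assumes param: "polygon_param \<Sigma> (D, X)"
    and h_pos_def: "\<And>u. u \<in> D \<Longrightarrow> pos_def (metric_in G (D, X) u)"
    and h_smooth: "smooth_on (D - {0}) (metric_in G (D, X))"
    and h_lipschitz: "0 \<in> D \<Longrightarrow> lipschitz_near D 0 (metric_in G (D, X))"
begin

abbreviation "h \<equiv> metric_in G (D, X)"
abbreviation "V \<equiv> interior D"

definition J :: "plane \<Rightarrow> real^2^2" where "J u = jacobian X (at u within D)"

lemma param_facts:
  shows "openin (top_of_set quadrant) D" "openin (top_of_set \<Sigma>) (X ` D)" "homeomorphism D (X ` D) X (inv_into D X)"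
    "\<And>u. u \<in> D \<Longrightarrow> X u \<in> interior \<Sigma> \<longleftrightarrow> u \<in> interior quadrant"
    "\<And>u. u \<in> D \<Longrightarrow> X u extreme_point_of \<Sigma> \<longleftrightarrow> u = 0"
    "smooth_on (D - {0}) X" "\<And>u. u \<in> D \<Longrightarrow> X differentiable (at u within D)"
    "continuous_on D J" "\<And>u. u \<in> V \<Longrightarrow> invertible (jacobian X (at u))"
  using param unfolding polygon_param_def J_def by auto

lemma open_extension: "\<exists>T. open T \<and> D = quadrant \<inter> T"
  using param_facts(1) unfolding openin_open by blast

lemma interior_iff: "u \<in> V \<longleftrightarrow> u \<in> D \<and> u \<in> interior quadrant"
proof -
  obtain T where "open T" "D = quadrant \<inter> T" using open_extension by blast
  then have "V = interior quadrant \<inter> T" by (simp add: interior_open)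
  then show ?thesis using \<open>D = quadrant \<inter> T\<close> interior_subset by blast
qed

lemma nonneg: "u \<in> D \<Longrightarrow> 0 \<le> u $ i"
  using open_extension by (auto simp: quadrant_def)

lemma X_interior: "u \<in> D \<Longrightarrow> X u \<in> interior \<Sigma> \<longleftrightarrow> u \<in> V"
  using param_facts(4) interior_iff by blast

lemma inv_X: "u \<in> D \<Longrightarrow> inv_into D X (X u) = u"
  using param_facts(3) unfolding homeomorphism_def by blast

lemma X_cont: "continuous_on D X"
  using param_facts(3) unfolding homeomorphism_def by blast

lemma X_in: "u \<in> D \<Longrightarrow> X u \<in> \<Sigma>"
  using param_facts(2) openin_imp_subset by blast

lemma near_boundary:
  assumes u: "u \<in> D" and w: "\<And>i. 0 \<le> w $ i"
  shows "\<exists>\<epsilon>>0. \<forall>t. 0 < t \<longrightarrow> t < \<epsilon> \<longrightarrow> u + t *\<^sub>R w \<in> D"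
proof -
  obtain T where T: "open T" "D = quadrant \<inter> T" using open_extension by blast
  obtain r where r: "r > 0" "ball u r \<subseteq> T" using T u open_contains_ball by blast
  show ?thesis
  proof (intro exI[of _ "r / (norm w + 1)"] conjI allI impI)
    have n: "0 < norm w + 1" by (simp add: add_nonneg_pos)
    show "0 < r / (norm w + 1)" using r(1) n by simp
    fix t :: real assume t: "0 < t" "t < r / (norm w + 1)"
    have "norm (t *\<^sub>R w) \<le> t * (norm w + 1)" using t by simp
    also have "\<dots> < r" using t(2) n by (simp add: less_divide_eq)
    finally have "u + t *\<^sub>R w \<in> ball u r" by (simp add: dist_norm)
    moreover have "u + t *\<^sub>R w \<in> quadrant" using nonneg[OF u] w t by (simp add: quadrant_def)
    ultimately show "u + t *\<^sub>R w \<in> D" using r T by blast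
  qed
qed

text \<open>From every point of \<open>D\<close>, boundary or not, the positive axis directions stay
  in \<open>D\<close> for a short time, and they determine a linear map.\<close>

lemma derivative_unique:
  fixes f :: "plane \<Rightarrow> 'b::real_normed_vector"
  assumes "u \<in> D" "(f has_derivative f') (at u within D)"
  shows "frechet_derivative f (at u within D) = f'"
proof -
  have "(f has_derivative frechet_derivative f (at u within D)) (at u within D)"
    using assms(2) frechet_derivative_works differentiable_def by blast
  then show ?thesis
  proof (rule frechet_derivative_unique_within[OF _ assms(2)])
    fix i :: plane and e :: real assume i: "i \<in> Basis" and e: "e > 0"
    have "0 \<le> i $ k" for k using i by (auto simp: Basis_vec_def axis_def)
    then obtain \<epsilon> where "\<epsilon> > 0" "\<forall>t. 0 < t \<longrightarrow> t < \<epsilon> \<longrightarrow> u + t *\<^sub>R i \<in> D" using near_boundary[OF assms(1)] by blast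
    then show "\<exists>d. 0 < \<bar>d\<bar> \<and> \<bar>d\<bar> < e \<and> u + d *\<^sub>R i \<in> D"
      using e by (intro exI[of _ "min e \<epsilon> / 2"]) auto
  qed
qed

lemma limit_of_interior: "u \<in> D \<Longrightarrow> u islimpt V"
proof -
  assume u: "u \<in> D"
  show ?thesis unfolding islimpt_approachable
  proof (intro allI impI)
    fix e :: real assume e: "0 < e"
    obtain \<epsilon> where \<epsilon>: "\<epsilon> > 0" "\<forall>t. 0 < t \<longrightarrow> t < \<epsilon> \<longrightarrow> u + t *\<^sub>R (vector [1, 1]) \<in> D"
    proof -
      have "0 \<le> (vector [1, 1] :: plane) $ i" for i using exhaust_2[of i] by auto
      from near_boundary[OF u this] show ?thesis using that by blast
    qed
    define n where "n = norm (vector [1, 1] :: plane) + 1"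
    have n: "0 < n" unfolding n_def by (simp add: add_nonneg_pos)
    define t where "t = min (\<epsilon> / 2) (e / (2 * n))"
    have t: "0 < t" "t < \<epsilon>" "t * n < e" 
    proof -
      show "0 < t" "t < \<epsilon>" using \<epsilon>(1) e n by (auto simp: t_def min_less_iff_disj)
      have "t * n \<le> e / (2 * n) * n" using n by (intro mult_right_mono) (auto simp: t_def)
      also have "\<dots> < e" using n e by simp
      finally show "t * n < e" .
    qed
    let ?q = "u + t *\<^sub>R (vector [1, 1] :: plane)"
    have "?q \<in> D" using \<epsilon>(2) t by blast
    moreover have "?q \<in> interior quadrant"
      using nonneg[OF u, of 1] nonneg[OF u, of 2] t(1) by (simp add: interior_quadrant forall_2)
    ultimately have "?q \<in> V" using interior_iff by blast
    moreover have "?q \<noteq> u" using t(1) by (auto simp: vec_eq_iff forall_2)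
    moreover have "dist ?q u < e"
    proof -
      have "dist ?q u = t * norm (vector [1, 1] :: plane)" using t(1) by (simp add: dist_norm)
      also have "\<dots> \<le> t * n" using t(1) by (intro mult_left_mono) (auto simp: n_def)
      finally show ?thesis using t(3) by simp
    qed
    ultimately show "\<exists>x'\<in>V. x' \<noteq> u \<and> dist x' u < e" by blast
  qed
qed

lemma equal_on_D:
  fixes f g :: "plane \<Rightarrow> real"
  assumes "continuous_on D f" "continuous_on D g" "\<And>u. u \<in> V \<Longrightarrow> f u = g u" "u \<in> D"
  shows "f u = g u"
proof -
  have "at u within V \<le> at u within D" by (rule at_le) (rule interior_subset)
  then have "(f \<longlongrightarrow> f u) (at u within V)" "(g \<longlongrightarrow> g u) (at u within V)"
    using assms(1,2,4) tendsto_mono unfolding continuous_on_def by blast+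
  moreover have "\<forall>\<^sub>F v in at u within V. f v = g v"
    unfolding eventually_at_filter by (rule always_eventually) (use assms(3) in auto)
  ultimately have "(g \<longlongrightarrow> f u) (at u within V)" "(g \<longlongrightarrow> g u) (at u within V)"
    using tendsto_cong by blast+
  moreover have "\<not> trivial_limit (at u within V)" using limit_of_interior[OF assms(4)] by (simp add: trivial_limit_within)
  ultimately show ?thesis using tendsto_unique by blast
qed

lemma h_cont: "continuous_on D h"
  unfolding continuous_on_eq_continuous_within
proof
  fix u assume u: "u \<in> D"
  show "continuous (at u within D) h"
  proof (cases "u = 0")
    case True
    then obtain r L where "r > 0" "L-lipschitz_on (D \<inter> ball 0 r) h" using h_lipschitz u unfolding lipschitz_near_def by blast
    then show ?thesis
      using continuous_within_local[OF open_ball _ u, of 0 r] True lipschitz_on_continuous_on by fastforce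
  next
    case False
    then obtain W F where W: "open W" "u \<in> W" "Ck_on 0 W F" "\<forall>u\<in>(D - {0}) \<inter> W. F u = h u"
      using h_smooth u unfolding smooth_on_def by (meson DiffI singletonD)
    have "continuous_on (D \<inter> (W - {0})) F" using W(3) continuous_on_subset by (auto intro: continuous_on_subset)
    then have "continuous_on (D \<inter> (W - {0})) h"
      by (rule continuous_on_eq) (use W(4) in auto)
    then show ?thesis using continuous_within_local[of "W - {0}" u D h] W(1,2) u False by auto
  qed
qed

lemma X_derivative: "u \<in> D \<Longrightarrow> ((\<lambda>w. X w $ i) has_derivative (\<lambda>v. (J u *v v) $ i)) (at u within D)"
proof -
  assume "u \<in> D"
  then have "(X has_derivative (\<lambda>v. J u *v v)) (at u within D)"
    using param_facts(7) jacobian_works unfolding J_def by blast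
  then show ?thesis by (rule bounded_linear.has_derivative[OF bounded_linear_vec_nth])
qed

lemma pd_X: "u \<in> D \<Longrightarrow> pd D j (\<lambda>w. X w $ i) u = J u $ i $ j"
  unfolding pd_def using derivative_unique[OF _ X_derivative] by (simp add: matrix_vector_mult_basis column_def)

lemma at_V: "u \<in> V \<Longrightarrow> at u within D = at u"
  by (rule at_within_interior)

lemma dd_X: "u \<in> V \<Longrightarrow> dd j (\<lambda>w. X w $ i) u = J u $ i $ j"
  using pd_X[of u j i] interior_subset[of D] at_V[of u] by (auto simp: pd_def dd_def)

lemma det_J: "u \<in> V \<Longrightarrow> det (J u) \<noteq> 0"
  using param_facts(9) at_V[of u] by (simp add: J_def invertible_det_nz)

lemma h_eq: "u \<in> V \<Longrightarrow> h u = transpose (J u) ** G (X u) ** J u"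
  using at_V[of u] by (simp add: metric_in_def boundary_ext_def J_def)

lemma h_inverse: "u \<in> D \<Longrightarrow> h u ** matrix_inv (h u) = mat 1"
proof -
  assume "u \<in> D"
  then have "det (h u) \<noteq> 0" using pos_def_entries(4)[OF h_pos_def] by force
  then obtain C where "h u ** C = mat 1" unfolding invertible_det_nz[symmetric] invertible_def by blast
  then show ?thesis using matrix_inv_eq by metis
qed

lemma inverse_metric:
  assumes u: "u \<in> V"
  shows "G (X u) ** (J u ** matrix_inv (h u) ** transpose (J u)) = mat 1"
proof -
  have "u \<in> D" using u interior_subset by blast
  from h_inverse[OF this] have "transpose (J u) ** (G (X u) ** J u ** matrix_inv (h u)) = mat 1"
    unfolding h_eq[OF u] by (simp add: matrix_mul_assoc)
  then have "(G (X u) ** J u ** matrix_inv (h u)) ** transpose (J u) = mat 1"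
    using matrix_left_right_inverse by blast
  then show ?thesis by (simp add: matrix_mul_assoc)
qed

lemma A_eq: "u \<in> V \<Longrightarrow> matrix_inv (G (X u)) = J u ** matrix_inv (h u) ** transpose (J u)"
  using matrix_inv_eq[OF inverse_metric] .

lemma A_pos_def:
  assumes u: "u \<in> V"
  shows "pos_def (matrix_inv (G (X u)))"
  unfolding A_eq[OF u] using u interior_subset[of D]
  by (intro pos_def_congruent pos_def_matrix_inv h_pos_def det_J) auto

lemma G_pos_def:
  assumes u: "u \<in> V"
  shows "pos_def (G (X u))"
proof -
  have "matrix_inv (G (X u)) ** G (X u) = mat 1"
    using inverse_metric[OF u] A_eq[OF u] matrix_left_right_inverse by metis
  then have "matrix_inv (matrix_inv (G (X u))) = G (X u)" by (rule matrix_inv_eq)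
  then show ?thesis using pos_def_matrix_inv[OF A_pos_def[OF u]] by simp
qed

lemma X_C: "Ck_on k V (\<lambda>u. X u $ i)"
proof (rule Ck_on_linear[OF open_interior bounded_linear_vec_nth], rule smooth_on_Ck[OF param_facts(6) open_interior])
  show "V \<subseteq> D - {0}" using interior_iff by (auto simp: interior_quadrant)
qed

lemma h_C: "Ck_on k V (\<lambda>u. h u $ i $ j)"
proof -
  have "V \<subseteq> D - {0}" using interior_iff by (auto simp: interior_quadrant)
  then have "Ck_on k V h" by (rule smooth_on_Ck[OF h_smooth open_interior])
  then have "Ck_on k V (\<lambda>u. h u $ i)" by (rule Ck_on_linear[OF open_interior bounded_linear_vec_nth])
  then show ?thesis by (rule Ck_on_linear[OF open_interior bounded_linear_vec_nth])
qed

lemma J_C: "Ck_on k V (\<lambda>u. J u $ i $ j)"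
  by (rule Ck_on_cong[OF open_interior dd_X Ck_on_dd[OF X_C]])

lemma image_V: "X ` V = X ` D \<inter> interior \<Sigma>"
  using X_interior interior_subset[of D] by auto

lemma open_image_V: "open (X ` V)"
proof -
  obtain T where "open T" "X ` D = \<Sigma> \<inter> T" using param_facts(2) unfolding openin_open by blast
  then have "X ` V = interior \<Sigma> \<inter> T" using image_V interior_subset[of \<Sigma>] by auto
  then show ?thesis using \<open>open T\<close> by auto
qed

text \<open>Smoothness of the metric is known in charts. There the inverse metric is
  \<open>J\<close>, the inverse of \<open>h\<close> and the transpose of \<open>J\<close> multiplied
  together, and this product is carried back by the smooth inverse of \<open>X\<close>.\<close>

lemma inverse_metric_Ck: "Ck_on k (X ` V) (\<lambda>p. matrix_inv (G p) $ i $ j)"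
proof -
  let ?Y = "inv_into D X"
  have VD: "V \<subseteq> D" by (rule interior_subset)
  have Y: "?Y ` X ` V \<subseteq> V" using inv_X VD by auto
  have Yc: "continuous_on (X ` V) ?Y"
    using param_facts(3) VD unfolding homeomorphism_def by (meson continuous_on_subset image_mono)
  have YC: "Ck_on k (X ` V) (\<lambda>p. ?Y p $ i)" for k i
  proof (rule Ck_on_inverse_function[OF open_interior open_image_V Y Yc])
    show "X (?Y p) = p" if "p \<in> X ` V" for p using that inv_X VD by auto
    show "dd 1 (\<lambda>u. X u $ 1) u * dd 2 (\<lambda>u. X u $ 2) u - dd 2 (\<lambda>u. X u $ 1) u * dd 1 (\<lambda>u. X u $ 2) u \<noteq> 0"
      if "u \<in> V" for u using det_J[OF that] by (simp add: dd_X[OF that] det_2)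
  qed (rule X_C)
  have dC: "Ck_on k V (\<lambda>u. inverse (det (h u)))"
  proof (rule Ck_on_inverse[OF open_interior])
    show "Ck_on k V (\<lambda>u. det (h u))" unfolding det_2 by (intro Ck_on_diff Ck_on_mult open_interior h_C)
    show "det (h u) \<noteq> 0" if "u \<in> V" for u using pos_def_entries(4)[OF h_pos_def] that VD by force
  qed
  have hiC: "Ck_on k V (\<lambda>u. matrix_inv (h u) $ i $ j)" for i j
  proof (rule Ck_on_cong[OF open_interior])
    define N where "N u = (vector [vector [h u $ 2 $ 2, - h u $ 1 $ 2], vector [- h u $ 2 $ 1, h u $ 1 $ 1]] :: real^2^2)" for u
    show "Ck_on k V (\<lambda>u. inverse (det (h u)) * N u $ i $ j)"
    proof (rule Ck_on_mult[OF open_interior dC])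
      show "Ck_on k V (\<lambda>u. N u $ i $ j)"
        using exhaust_2[of i] exhaust_2[of j] h_C Ck_on_uminus[OF open_interior h_C] by (auto simp: N_def)
    qed
    show "inverse (det (h u)) * N u $ i $ j = matrix_inv (h u) $ i $ j" if "u \<in> V" for u
      using pos_def_entries(4)[OF h_pos_def[of u]] that VD exhaust_2[of i] exhaust_2[of j]
      by (auto simp: N_def matrix_inv_2 divide_inverse)
  qed
  have AC: "Ck_on k V (\<lambda>u. (J u ** matrix_inv (h u) ** transpose (J u)) $ i $ j)"
    unfolding matrix_mult_2 transpose_def vec_lambda_beta
    by (intro Ck_on_add Ck_on_mult open_interior J_C hiC)
  show ?thesis
  proof (rule Ck_on_cong[OF open_image_V _ Ck_on_compose[OF open_image_V open_interior Y AC YC]])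
    fix p assume "p \<in> X ` V"
    then obtain u where u: "u \<in> V" "p = X u" by blast
    then have "?Y p = u" using inv_X VD by auto
    then show "(J (?Y p) ** matrix_inv (h (?Y p)) ** transpose (J (?Y p))) $ i $ j = matrix_inv (G p) $ i $ j"
      using A_eq[OF u(1)] u(2) by simp
  qed
qed

lemma det_A: "u \<in> V \<Longrightarrow> det (matrix_inv (G (X u))) * det (h u) = (det (J u))\<^sup>2"
proof -
  assume u: "u \<in> V"
  have "det (h u) * det (matrix_inv (h u)) = 1"
    using arg_cong[OF h_inverse, of u det] u interior_subset[of D] by (auto simp: det_mul det_I)
  then show ?thesis unfolding A_eq[OF u] by (simp add: det_mul power2_eq_square algebra_simps)
qed

text \<open>The two gradients are the rows of \<open>J u ** matrix_inv (h u)\<close>, so they would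
  be independent if \<open>J u\<close> were invertible.\<close>

lemma det_J_boundary:
  assumes u: "u \<in> D" and dim: "dim (span {grad_phi_in G (D, X) 1 u, grad_phi_in G (D, X) 2 u}) \<noteq> 2"
  shows "det (J u) = 0"
proof (rule ccontr)
  assume nz: "det (J u) \<noteq> 0"
  define M where "M = J u ** matrix_inv (h u)"
  have s: "transpose (matrix_inv (h u)) = matrix_inv (h u)"
    using pos_def_matrix_inv[OF h_pos_def[OF u]] by (simp add: pos_def_def)
  have "grad_phi_in G (D, X) i u = M $ i" for i
  proof -
    have "(\<chi> j. pd D j (\<lambda>w. X w $ i) u) = J u $ i" by (simp add: pd_X[OF u] vec_eq_iff)
    then have "grad_phi_in G (D, X) i u = matrix_inv (h u) *v (J u $ i)" by (simp add: grad_phi_in_def grad_def)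
    also have "\<dots> = transpose (matrix_inv (h u)) *v (J u $ i)" unfolding s ..
    also have "\<dots> = M $ i"
      by (simp add: vec_eq_iff M_def matrix_matrix_mult_def matrix_vector_mult_def transpose_def mult.commute)
    finally show ?thesis .
  qed
  then have d: "dim (span {M $ 1, M $ 2}) \<noteq> 2" using dim by simp
  have "det (h u) * det (matrix_inv (h u)) = 1"
    using arg_cong[OF h_inverse[OF u], of det] by (simp add: det_mul det_I)
  then have M: "det M \<noteq> 0" using nz by (auto simp: M_def det_mul)
  have "rows M = {M $ 1, M $ 2}" by (auto simp: rows_def row_def) (metis exhaust_2)
  then have "independent {M $ 1, M $ 2}" using M det_dependent_rows[of M] by (auto simp: dependent_vec_eq)
  moreover have "M $ 1 \<noteq> M $ 2" using M by (auto simp: det_2)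
  ultimately have "dim (span {M $ 1, M $ 2}) = 2" using dim_eq_card_independent[of "{M $ 1, M $ 2}"] by simp
  then show False using d by blast
qed

text \<open>\<open>G\<close> has no limit at the boundary, but
  \<open>y^2 * det h = (det J)^2\<close> relates functions that are continuous on all of
  \<open>D\<close>, vertex included. It extends from the interior by continuity, and
  \<open>det J\<close> vanishes on the boundary.\<close>

lemma vanishes_on_boundary:
  assumes y: "continuous_on \<Sigma> y" "\<And>u. u \<in> V \<Longrightarrow> y (X u) = sqrt (det (matrix_inv (G (X u))))"
    and u: "u \<in> D" and dim: "dim (span {grad_phi_in G (D, X) 1 u, grad_phi_in G (D, X) 2 u}) \<noteq> 2"
  shows "y (X u) = (0::real)"
proof -
  have yc: "continuous_on D (\<lambda>u. y (X u))"
    using continuous_on_compose2[OF y(1) X_cont] X_in by blast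
  have "continuous_on D (\<lambda>u. h u $ i $ j)" "continuous_on D (\<lambda>u. J u $ i $ j)" for i j
    by (intro continuous_on_component h_cont param_facts(8))+
  note c = this
  have "(y (X u))\<^sup>2 * det (h u) = (det (J u))\<^sup>2"
  proof (rule equal_on_D[OF _ _ _ u])
    show "continuous_on D (\<lambda>u. (y (X u))\<^sup>2 * det (h u))" "continuous_on D (\<lambda>u. (det (J u))\<^sup>2)"
      unfolding det_2 by (intro continuous_intros c yc)+
    show "(y (X w))\<^sup>2 * det (h w) = (det (J w))\<^sup>2" if w: "w \<in> V" for w
      using pos_def_entries(4)[OF A_pos_def[OF w]] det_A[OF w] y(2)[OF w] by simp
  qed
  then have "(y (X u))\<^sup>2 * det (h u) = 0" using det_J_boundary[OF u dim] by simp
  then show ?thesis using pos_def_entries(4)[OF h_pos_def[OF u]] by simp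
qed

text \<open>The Cauchy-Riemann system is invariant under coordinate changes, up to orientation.
  Pulled back to a half-disc at an edge point it has coefficients regular up to the edge, so
  \<open>no_constant_boundary_values\<close> applies.\<close>

lemma no_constant_arc:
  assumes mi: "metric_interior \<Sigma> G x y"
    and cont: "continuous_on \<Sigma> x" "continuous_on \<Sigma> y"
    and y0: "\<And>u. u \<in> D \<Longrightarrow> X u \<notin> interior \<Sigma> \<Longrightarrow> y (X u) = 0"
    and u0: "u0 \<in> D" "u0 \<noteq> 0" "X u0 \<notin> interior \<Sigma>"
    and Q: "open Q" "X u0 \<in> Q" "\<And>p. p \<in> Q \<Longrightarrow> p \<in> \<Sigma> \<Longrightarrow> p \<notin> interior \<Sigma> \<Longrightarrow> x p = a"
  shows False
proof -
  interpret m: metric_interior \<Sigma> G x y by (rule mi)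
  have VD: "V \<subseteq> D" by (rule interior_subset)
  have "u0 \<notin> interior quadrant" using u0(1,3) param_facts(4) by blast
  then obtain j where "\<not> 0 < u0 $ j" by (auto simp: interior_quadrant)
  then have j: "u0 $ j = 0" using nonneg[OF u0(1), of j] by simp
  obtain k where k: "u0 $ k \<noteq> 0" using u0(2) by (auto simp: vec_eq_iff)
  then have k: "0 < u0 $ k" "k \<noteq> j" using nonneg[OF u0(1), of k] j by auto
  have jk: "i = j \<or> i = k" for i using k(2) exhaust_2[of i] exhaust_2[of j] exhaust_2[of k] by auto
  \<comment> \<open>A smooth extension of the metric across the edge; it bounds the coefficients and
    their derivatives up to the edge. Off \<open>D\<close> its symmetry is unknown, hence
    \<open>\<delta>\<close> is formed from the upper triangle.\<close>
  obtain W F where W: "open W" "u0 \<in> W" "\<And>n. Ck_on n W F" "\<And>u. u \<in> D \<Longrightarrow> u \<noteq> 0 \<Longrightarrow> u \<in> W \<Longrightarrow> F u = h u"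
    using h_smooth u0 unfolding smooth_on_def by (metis DiffI Int_iff singletonD)
  have FC: "Ck_on n W (\<lambda>u. F u $ i $ l)" for n i l
    using Ck_on_linear[OF W(1) bounded_linear_vec_nth Ck_on_linear[OF W(1) bounded_linear_vec_nth W(3)]] .
  define \<delta> where "\<delta> u = F u $ 1 $ 1 * F u $ 2 $ 2 - F u $ 1 $ 2 * F u $ 1 $ 2" for u
  have \<delta>C: "Ck_on n W \<delta>" for n unfolding \<delta>_def[abs_def] by (intro Ck_on_diff Ck_on_mult W(1) FC)
  have \<delta>h: "\<delta> u = det (h u)" "0 < \<delta> u" "0 < F u $ 2 $ 2" if "u \<in> D" "u \<noteq> 0" "u \<in> W" for u
  proof -
    note e = pos_def_entries[OF h_pos_def[OF that(1)]]
    show "\<delta> u = det (h u)" unfolding \<delta>_def W(4)[OF that] det_2 using e(1) by simp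
    then show "0 < \<delta> u" using e(4) by simp
    show "0 < F u $ 2 $ 2" unfolding W(4)[OF that] using e(3) by simp
  qed
  define P where "P = {u \<in> W. 0 < \<delta> u \<and> 0 < F u $ 2 $ 2}"
  have oP: "open P"
  proof -
    have c: "continuous_on W \<delta>" "continuous_on W (\<lambda>u. F u $ 2 $ 2)"
      using \<delta>C FC Ck_on_continuous by blast+
    have "open (W \<inter> \<delta> -` {0<..})" "open (W \<inter> (\<lambda>u. F u $ 2 $ 2) -` {0<..})"
      using continuous_open_preimage[OF c(1) W(1)] continuous_open_preimage[OF c(2) W(1)] open_greaterThan by blast+
    moreover have "P = (W \<inter> \<delta> -` {0<..}) \<inter> (W \<inter> (\<lambda>u. F u $ 2 $ 2) -` {0<..})" by (auto simp: P_def)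
    ultimately show ?thesis by (simp only: open_Int)
  qed
  have PW: "P \<subseteq> W" by (auto simp: P_def)
  define s where "s u = sqrt (\<delta> u)" for u
  have s: "0 < s u" "s u * s u = \<delta> u" if "u \<in> P" for u using that by (auto simp: s_def P_def)
  define e where "e u = inverse (s u)" for u
  have eC: "Ck_on n P e" for n
    unfolding e_def[abs_def] s_def
    by (intro Ck_on_inverse Ck_on_sqrt oP Ck_on_subset[OF \<delta>C PW]) (auto simp: P_def)
  define b11 where "b11 u = F u $ 2 $ 2 * e u" for u
  define b12 where "b12 u = (- F u $ 1 $ 2) * e u" for u
  define b22 where "b22 u = F u $ 1 $ 1 * e u" for u
  have bC: "Ck_on n P b11" "Ck_on n P b12" "Ck_on n P b22" for n
    unfolding b11_def[abs_def] b12_def[abs_def] b22_def[abs_def]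
    by (intro Ck_on_mult Ck_on_uminus oP eC Ck_on_subset[OF FC PW])+
  obtain T where T: "open T" "D = quadrant \<inter> T" using open_extension by blast
  obtain Q' where Q': "open Q'" "Q' \<inter> D = X -` Q \<inter> D"
    using X_cont Q(1) unfolding continuous_on_open_invariant by blast
  have "open {u::plane. 0 < u $ k}" by (intro open_Collect_less continuous_intros)
  then have "open (P \<inter> T \<inter> Q' \<inter> {u. 0 < u $ k})" using oP T(1) Q'(1) by blast
  moreover have "u0 \<in> P \<inter> T \<inter> Q' \<inter> {u. 0 < u $ k}"
    using \<delta>h[OF u0(1,2) W(2)] W(2) u0(1) T(2) Q' Q(2) k(1) by (auto simp: P_def)
  \<comment> \<open>The condition \<open>0 < u $ k\<close> keeps the disc away from the vertex and
    from the other edge, so \<open>D\<close> meets it in a half-disc.\<close>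
  ultimately obtain r where r: "0 < r" "cball u0 r \<subseteq> P \<inter> T \<inter> Q' \<inter> {u. 0 < u $ k}"
    using open_contains_cball by meson
  have rb: "u \<in> P" "u \<in> T" "u \<in> Q'" "0 < u $ k" if "u \<in> ball u0 r" for u
    using r(2) that by (auto simp: subset_iff less_imp_le)
  have inD: "u \<in> D" if "u \<in> ball u0 r" "0 \<le> u $ j" for u
  proof -
    have "0 \<le> u $ i" for i using jk[of i] rb(4)[OF that(1)] that(2) by auto
    then show ?thesis using T(2) rb(2)[OF that(1)] by (simp add: quadrant_def)
  qed
  define U where "U = {u \<in> ball u0 r. 0 < u $ j}"
  have UV: "u \<in> V" if "u \<in> U" for u
  proof -
    have "0 < u $ i" for i using jk[of i] rb(4)[of u] that by (auto simp: U_def)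
    then show ?thesis using interior_iff inD that by (auto simp: U_def interior_quadrant less_imp_le)
  qed
  have "open {u::plane. 0 < u $ j}" by (intro open_Collect_less continuous_intros)
  moreover have "U = ball u0 r \<inter> {u. 0 < u $ j}" by (auto simp: U_def)
  ultimately have oU: "open U" by auto
  have "convex U"
  proof -
    have "U = ball u0 r \<inter> {u. axis j 1 \<bullet> u > 0}" by (auto simp: U_def inner_axis')
    then show ?thesis by (simp add: convex_Int convex_halfspace_gt)
  qed
  then have cU: "connected U" by (rule convex_connected)
  have UP: "U \<subseteq> P" using rb(1) by (auto simp: U_def)
  have dJc: "continuous_on U (\<lambda>u. det (J u))"
    unfolding det_2 using param_facts(8) UV VD
    by (intro continuous_intros continuous_on_component) (auto intro: continuous_on_subset)
  \<comment> \<open>A chart may reverse orientation, which changes the sign in the Cauchy-Riemann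
    system. Replacing \<open>x\<close> by \<open>\<sigma> * x\<close> restores it.\<close>
  obtain \<sigma> where \<sigma>: "\<sigma> * \<sigma> = (1::real)" "\<And>u. u \<in> U \<Longrightarrow> 0 < \<sigma> * det (J u)"
    using continuous_nonzero_sign[OF cU dJc det_J] UV by blast
  have XS: "X u \<in> interior \<Sigma>" if "u \<in> U" for u using X_interior UV[OF that] VD by blast
  have Fh: "F u = h u" if "u \<in> U" for u
  proof -
    have "u \<noteq> 0" using that by (auto simp: U_def)
    then show ?thesis using W(4) UV[OF that] VD UP PW that by blast
  qed
  \<comment> \<open>The squares agree because \<open>y^2\<close> is the determinant of the inverse
    metric; \<open>\<sigma>\<close> selects the positive root.\<close>
  have yX: "y (X u) * s u = \<sigma> * det (J u)" if u: "u \<in> U" for u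
  proof -
    have un: "u \<noteq> 0" "u \<in> D" "u \<in> W" using u UV VD UP PW by (auto simp: U_def)
    have "det (matrix_inv (G (X u))) = y (X u) * y (X u)"
      unfolding m.y_square[OF XS[OF u]] m.A_def[symmetric] by (simp add: det_2 m.A_nth[OF XS[OF u]])
    then have "(y (X u) * s u)\<^sup>2 = (det (J u))\<^sup>2"
    proof -
      have "(y (X u) * s u)\<^sup>2 = (y (X u) * y (X u)) * (s u * s u)" by (simp add: power2_eq_square)
      also have "s u * s u = det (h u)" using s(2)[of u] \<delta>h(1)[OF un(2,1,3)] UP u by auto
      finally show ?thesis using det_A[OF UV[OF u]] \<open>det (matrix_inv (G (X u))) = y (X u) * y (X u)\<close> by simp
    qed
    also have "\<dots> = (\<sigma> * det (J u))\<^sup>2" using \<sigma>(1) by (simp add: power_mult_distrib power2_eq_square)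
    finally show ?thesis
      using \<sigma>(2)[OF u] m.y_pos[OF XS[OF u]] s(1)[of u] UP u
      by (metis power2_eq_imp_eq less_imp_le mult_nonneg_nonneg subsetD)
  qed
  have XUS: "X ` U \<subseteq> interior \<Sigma>" using XS by blast
  have XUC: "Ck_on n U (\<lambda>u. X u $ i)" for n i
    using Ck_on_subset[OF X_C] UV by blast
  have x2: "Ck_on 2 (interior \<Sigma>) x" unfolding numeral_2_eq_2 by (rule m.x_C)
  have dchain: "dd i (\<lambda>u. f (X u)) u = dd 1 f (X u) * J u $ 1 $ i + dd 2 f (X u) * J u $ 2 $ i"
    if "f differentiable (at (X u))" "u \<in> U" for f :: "plane \<Rightarrow> real" and i u
  proof -
    have "X differentiable (at u)" using param_facts(7)[of u] at_V[OF UV[OF that(2)]] UV[OF that(2)] VD by auto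
    then have "(X has_derivative (\<lambda>v. J u *v v)) (at u)"
      using jacobian_works at_V[OF UV[OF that(2)]] unfolding J_def by metis
    from diff_chain_at[OF this derivative_dd[OF that(1)]]
    have "((\<lambda>u. f (X u)) has_derivative (\<lambda>v. dd 1 f (X u) * (J u *v v) $ 1 + dd 2 f (X u) * (J u *v v) $ 2)) (at u)"
      by (simp add: o_def)
    from dd_eq[OF this] show ?thesis by (simp add: matrix_vector_mult_basis column_def)
  qed
  have Aij: "m.a11 (X u) * \<delta> u = J u $ 1 $ 1 * J u $ 1 $ 1 * F u $ 2 $ 2 - 2 * (J u $ 1 $ 1 * J u $ 1 $ 2 * F u $ 1 $ 2) + J u $ 1 $ 2 * J u $ 1 $ 2 * F u $ 1 $ 1"
     "m.a12 (X u) * \<delta> u = J u $ 1 $ 1 * J u $ 2 $ 1 * F u $ 2 $ 2 - (J u $ 1 $ 1 * J u $ 2 $ 2 + J u $ 1 $ 2 * J u $ 2 $ 1) * F u $ 1 $ 2 + J u $ 1 $ 2 * J u $ 2 $ 2 * F u $ 1 $ 1"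
     "m.a22 (X u) * \<delta> u = J u $ 2 $ 1 * J u $ 2 $ 1 * F u $ 2 $ 2 - 2 * (J u $ 2 $ 1 * J u $ 2 $ 2 * F u $ 1 $ 2) + J u $ 2 $ 2 * J u $ 2 $ 2 * F u $ 1 $ 1"
    if u: "u \<in> U" for u
  proof -
    have uD: "u \<in> D" "u \<noteq> 0" "u \<in> W" using u UV VD UP PW by (auto simp: U_def)
    note pe = pos_def_entries[OF h_pos_def[OF uD(1)]]
    have dn: "det (h u) \<noteq> 0" using pe(4) by simp
    have A: "m.A (X u) = J u ** matrix_inv (h u) ** transpose (J u)" unfolding m.A_def A_eq[OF UV[OF u]] ..
    have mi: "matrix_inv (h u) $ 1 $ 1 * \<delta> u = F u $ 2 $ 2" "matrix_inv (h u) $ 1 $ 2 * \<delta> u = - F u $ 1 $ 2"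
      "matrix_inv (h u) $ 2 $ 1 * \<delta> u = - F u $ 1 $ 2" "matrix_inv (h u) $ 2 $ 2 * \<delta> u = F u $ 1 $ 1"
      unfolding \<delta>h(1)[OF uD] Fh[OF u] matrix_inv_2[OF dn] using dn pe(1) by simp_all
    have AA: "(J u ** matrix_inv (h u) ** transpose (J u)) $ i $ l * \<delta> u =
      J u $ i $ 1 * J u $ l $ 1 * (matrix_inv (h u) $ 1 $ 1 * \<delta> u) + J u $ i $ 1 * J u $ l $ 2 * (matrix_inv (h u) $ 1 $ 2 * \<delta> u) +
      J u $ i $ 2 * J u $ l $ 1 * (matrix_inv (h u) $ 2 $ 1 * \<delta> u) + J u $ i $ 2 * J u $ l $ 2 * (matrix_inv (h u) $ 2 $ 2 * \<delta> u)" for i l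
      unfolding matrix_mult_2 transpose_def vec_lambda_beta by (simp add: algebra_simps)
    show "m.a11 (X u) * \<delta> u = J u $ 1 $ 1 * J u $ 1 $ 1 * F u $ 2 $ 2 - 2 * (J u $ 1 $ 1 * J u $ 1 $ 2 * F u $ 1 $ 2) + J u $ 1 $ 2 * J u $ 1 $ 2 * F u $ 1 $ 1"
     "m.a12 (X u) * \<delta> u = J u $ 1 $ 1 * J u $ 2 $ 1 * F u $ 2 $ 2 - (J u $ 1 $ 1 * J u $ 2 $ 2 + J u $ 1 $ 2 * J u $ 2 $ 1) * F u $ 1 $ 2 + J u $ 1 $ 2 * J u $ 2 $ 2 * F u $ 1 $ 1"
     "m.a22 (X u) * \<delta> u = J u $ 2 $ 1 * J u $ 2 $ 1 * F u $ 2 $ 2 - 2 * (J u $ 2 $ 1 * J u $ 2 $ 2 * F u $ 1 $ 2) + J u $ 2 $ 2 * J u $ 2 $ 2 * F u $ 1 $ 1"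
      unfolding m.a11_def m.a12_def m.a22_def A AA mi by (simp_all add: algebra_simps)
  qed
  interpret c: cauchy_riemann U "\<lambda>u. \<sigma> * x (X u)" "\<lambda>u. y (X u)" b11 b12 b22
  proof
    show "open U" by (rule oU)
    show "Ck_on 2 U (\<lambda>u. \<sigma> * x (X u))"
      by (intro Ck_on_mult Ck_on_const oU Ck_on_compose[OF oU open_interior XUS x2 XUC])
    show "Ck_on 2 U (\<lambda>u. y (X u))" by (rule Ck_on_compose[OF oU open_interior XUS m.y_C XUC])
    show "Ck_on 1 U b11" "Ck_on 1 U b12" "Ck_on 1 U b22" using Ck_on_subset[OF _ UP] bC by blast+
    fix u assume u: "u \<in> U"
    then have uP: "u \<in> P" using UP by blast
    note su = s[OF uP]
    have es: "e u * s u = 1" using su by (simp add: e_def)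
    show "0 < b11 u" using uP su(1) by (simp add: b11_def e_def P_def)
    have "b11 u * b22 u - b12 u * b12 u = \<delta> u * (e u * e u)"
      unfolding b11_def b12_def b22_def \<delta>_def by (simp add: algebra_simps)
    also have "\<dots> = (e u * s u) * (e u * s u)" unfolding su(2)[symmetric] by (simp only: ac_simps)
    finally show "b11 u * b22 u - b12 u * b12 u = 1" by (simp add: es)
    note D = dchain[OF m.diff(1)[OF XS[OF u]] u]
    have xd: "x differentiable (at (X u))" using m.x_derivative[OF XS[OF u]] differentiable_def by blast
    have "(\<lambda>u. x (X u)) differentiable (at u)"
      using Ck_on_differentiable[OF Ck_on_compose[OF oU open_interior XUS m.x_C XUC, of 0] u] .
    then have Dx: "dd i (\<lambda>u. \<sigma> * x (X u)) u = \<sigma> * (dd 1 x (X u) * J u $ 1 $ i + dd 2 x (X u) * J u $ 2 $ i)" for i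
      using dd_mult[of "\<lambda>_. \<sigma>" u "\<lambda>u. x (X u)" i] dchain[OF xd u] dd_eq[OF has_derivative_const, of i \<sigma> u] by simp
    define P1 P2 where "P1 = dd 1 y (X u)" and "P2 = dd 2 y (X u)"
    \<comment> \<open>Multiplying the equations by \<open>n\<close> clears \<open>y\<close> and
      \<open>s\<close> from the denominators. What remains is a polynomial identity in the entries
      of \<open>J\<close> and \<open>F\<close> and the partials of \<open>y\<close>.\<close>
    define n where "n = det (J u) * s u"
    have n0: "n \<noteq> 0" using det_J[OF UV[OF u]] su by (simp add: n_def)
    have yn: "\<delta> u * y (X u) = \<sigma> * n" using yX[OF u] unfolding n_def su(2)[symmetric] by (simp add: algebra_simps)
    have y0: "y (X u) \<noteq> 0" "\<delta> u \<noteq> 0" "\<sigma> \<noteq> 0" using m.y_pos[OF XS[OF u]] uP \<sigma>(1) by (auto simp: P_def)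
    have Q: "dd 1 x (X u) * y (X u) = m.a12 (X u) * P1 + m.a22 (X u) * P2"
      "dd 2 x (X u) * y (X u) = - (m.a11 (X u) * P1 + m.a12 (X u) * P2)"
      unfolding dd_eq[OF m.x_derivative[OF XS[OF u]]] P1_def P2_def using y0(1) by (simp_all add: axis_def)
    have Q1: "\<sigma> * dd 1 x (X u) * n = (m.a12 (X u) * \<delta> u) * P1 + (m.a22 (X u) * \<delta> u) * P2"
    proof -
      have "\<sigma> * dd 1 x (X u) * n = (dd 1 x (X u) * y (X u)) * \<delta> u" using yn by (simp add: algebra_simps)
      then show ?thesis unfolding Q by (simp add: algebra_simps)
    qed
    have Q2: "\<sigma> * dd 2 x (X u) * n = - ((m.a11 (X u) * \<delta> u) * P1 + (m.a12 (X u) * \<delta> u) * P2)"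
    proof -
      have "\<sigma> * dd 2 x (X u) * n = (dd 2 x (X u) * y (X u)) * \<delta> u" using yn by (simp add: algebra_simps)
      then show ?thesis unfolding Q by (simp add: algebra_simps)
    qed
    have bn: "b11 u * n = det (J u) * F u $ 2 $ 2" "b12 u * n = - (det (J u) * F u $ 1 $ 2)" "b22 u * n = det (J u) * F u $ 1 $ 1"
      unfolding b11_def b12_def b22_def n_def using es by (simp_all add: algebra_simps)
    have "dd 1 (\<lambda>u. \<sigma> * x (X u)) u * n =
       (b12 u * n) * dd 1 (\<lambda>u. y (X u)) u + (b22 u * n) * dd 2 (\<lambda>u. y (X u)) u"
    proof -
      have "dd 1 (\<lambda>u. \<sigma> * x (X u)) u * n = (\<sigma> * dd 1 x (X u) * n) * J u $ 1 $ 1 + (\<sigma> * dd 2 x (X u) * n) * J u $ 2 $ 1"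
        unfolding Dx by (simp add: algebra_simps)
      also have "\<dots> = (b12 u * n) * dd 1 (\<lambda>u. y (X u)) u + (b22 u * n) * dd 2 (\<lambda>u. y (X u)) u"
        unfolding Q1 Q2 Aij[OF u] bn D P1_def[symmetric] P2_def[symmetric] det_2 by (simp add: algebra_simps)
      finally show ?thesis .
    qed
    also have "\<dots> = (b12 u * dd 1 (\<lambda>u. y (X u)) u + b22 u * dd 2 (\<lambda>u. y (X u)) u) * n" by (simp add: algebra_simps)
    finally show "dd 1 (\<lambda>u. \<sigma> * x (X u)) u = b12 u * dd 1 (\<lambda>u. y (X u)) u + b22 u * dd 2 (\<lambda>u. y (X u)) u"
      using n0 by simp
    have "dd 2 (\<lambda>u. \<sigma> * x (X u)) u * n =
       - ((b11 u * n) * dd 1 (\<lambda>u. y (X u)) u + (b12 u * n) * dd 2 (\<lambda>u. y (X u)) u)"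
    proof -
      have "dd 2 (\<lambda>u. \<sigma> * x (X u)) u * n = (\<sigma> * dd 1 x (X u) * n) * J u $ 1 $ 2 + (\<sigma> * dd 2 x (X u) * n) * J u $ 2 $ 2"
        unfolding Dx by (simp add: algebra_simps)
      also have "\<dots> = - ((b11 u * n) * dd 1 (\<lambda>u. y (X u)) u + (b12 u * n) * dd 2 (\<lambda>u. y (X u)) u)"
        unfolding Q1 Q2 Aij[OF u] bn D P1_def[symmetric] P2_def[symmetric] det_2 by (simp add: algebra_simps)
      finally show ?thesis .
    qed
    also have "\<dots> = - (b11 u * dd 1 (\<lambda>u. y (X u)) u + b12 u * dd 2 (\<lambda>u. y (X u)) u) * n" by (simp add: algebra_simps)
    finally show "dd 2 (\<lambda>u. \<sigma> * x (X u)) u = - (b11 u * dd 1 (\<lambda>u. y (X u)) u + b12 u * dd 2 (\<lambda>u. y (X u)) u)"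
      using n0 by simp
  qed
  have cP: "cball u0 r \<subseteq> P" using r(2) by blast
  have bc: "continuous_on (cball u0 r) (\<lambda>u. b11 u + b22 u)"
    by (intro continuous_on_add continuous_on_subset[OF Ck_on_continuous cP] bC)
  have "continuous_on P (dd i f)" if "Ck_on (Suc 0) P f" for i f
    using Ck_on_continuous[OF Ck_on_dd[OF that]] .
  note dc = continuous_on_subset[OF this cP]
  have \<beta>c: "continuous_on (cball u0 r) (\<lambda>u. \<bar>dd 1 b11 u + dd 2 b12 u\<bar> + \<bar>dd 1 b12 u + dd 2 b22 u\<bar>)"
    by (intro continuous_on_add continuous_on_rabs dc bC)
  obtain M1 where M1: "\<forall>u\<in>cball u0 r. b11 u + b22 u \<le> M1"
    using continuous_attains_sup[OF compact_cball _ bc] r(1) by fastforce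
  obtain M2 where M2: "\<forall>u\<in>cball u0 r. \<bar>dd 1 b11 u + dd 2 b12 u\<bar> + \<bar>dd 1 b12 u + dd 2 b22 u\<bar> \<le> M2"
    using continuous_attains_sup[OF compact_cball _ \<beta>c] r(1) by fastforce
  have UB: "u \<in> cball u0 r" if "u \<in> U" for u using that by (auto simp: U_def)
  have XD: "X ` {u \<in> ball u0 r. 0 \<le> u $ j} \<subseteq> \<Sigma>" using inD X_in by blast
  have Xc: "continuous_on {u \<in> ball u0 r. 0 \<le> u $ j} X"
    by (rule continuous_on_subset[OF X_cont]) (use inD in blast)
  show False
  proof (rule c.no_constant_boundary_values[OF U_def j r(1), where M="max M1 M2" and a="\<sigma> * a"])
    show "b11 u + b22 u \<le> max M1 M2" if "u \<in> U" for u
      using M1 UB[OF that] by (auto simp: le_max_iff_disj)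
    show "norm (c.\<beta> u) \<le> max M1 M2" if "u \<in> U" for u
    proof -
      have "norm (c.\<beta> u) \<le> \<bar>c.\<beta> u $ 1\<bar> + \<bar>c.\<beta> u $ 2\<bar>" using norm_le_l1_cart[of "c.\<beta> u"] by (simp add: sum_2)
      also have "\<dots> \<le> M2" using M2 UB[OF that] by (simp add: c.\<beta>_def)
      finally show ?thesis by simp
    qed
    show "continuous_on {u \<in> ball u0 r. 0 \<le> u $ j} (\<lambda>u. \<sigma> * x (X u))"
      "continuous_on {u \<in> ball u0 r. 0 \<le> u $ j} (\<lambda>u. y (X u))"
      using continuous_on_compose2[OF cont(1) Xc XD] continuous_on_compose2[OF cont(2) Xc XD]
      by (auto intro: continuous_on_mult_left)
    show "\<sigma> * x (X u) = \<sigma> * a \<and> y (X u) = 0" if u: "u \<in> ball u0 r" "u $ j = 0" for u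
    proof -
      have uD: "u \<in> D" using inD u by simp
      have "u \<notin> V" using u(2) interior_iff by (auto simp: interior_quadrant) (metis less_irrefl)
      then have ni: "X u \<notin> interior \<Sigma>" using X_interior[OF uD] by simp
      have "X u \<in> Q" using Q'(2) rb(3)[OF u(1)] uD by blast
      then show ?thesis using Q(3)[OF _ X_in[OF uD] ni] y0[OF uD ni] by simp
    qed
    show "y (X u) \<noteq> 0" if "u \<in> U" for u using m.y_pos[OF XS[OF that]] by simp
  qed
qed

end

section \<open>The volumetric normal function\<close>

lemma chart_of_atlas:
  assumes "polygon_atlas \<Sigma> \<A>" "cond_C \<A> G" "(D, X) \<in> \<A>"
  shows "polygon_chart \<Sigma> G D X"
  using assms unfolding polygon_atlas_def cond_C_def polygon_chart_def by fastforce

lemma point_of_atlas: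
  assumes "polygon_atlas \<Sigma> \<A>" "p \<in> \<Sigma>"
  shows "\<exists>D X u. (D, X) \<in> \<A> \<and> u \<in> D \<and> p = X u"
  using assms unfolding polygon_atlas_def by fastforce

theorem proposition1p3:
  fixes \<Sigma> :: "(real^2) set"
    and \<A> :: "((real^2) set \<times> (real^2 \<Rightarrow> real^2)) set"
    and G :: "real^2 \<Rightarrow> real^2^2"
    and z :: "real^2 \<Rightarrow> complex"
  assumes "polygon_atlas \<Sigma> \<A>"
    and "cond_A \<Sigma>" and "cond_B \<Sigma>" and "cond_C \<A> G" and "cond_D \<A> G"
    and "cond_E \<Sigma> \<A> G" and "cond_F \<Sigma> G"
    and "frontier \<Sigma> \<noteq> {}"
    and "volumetric_normal_function \<Sigma> G z"
  shows "bij_betw z \<Sigma> {w. 0 \<le> Im w}"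
proof -
  define x where "x p = Re (z p)" for p
  define y where "y p = Im (z p)" for p
  have z: "z p = Complex (x p) (y p)" for p by (simp add: x_def y_def)
  note chart = chart_of_atlas[OF assms(1,4)]
  note point = point_of_atlas[OF assms(1)]
  have closed: "closed \<Sigma>" and convex: "convex \<Sigma>" and int: "interior \<Sigma> \<noteq> {}" and ub: "\<not> bounded \<Sigma>"
    using assms(2) polyhedron_imp_closed polyhedron_imp_convex compact_eq_bounded_closed unfolding cond_A_def by blast+
  have fr: "p \<in> frontier \<Sigma> \<longleftrightarrow> p \<in> \<Sigma> \<and> p \<notin> interior \<Sigma>" for p
    using closed by (simp add: frontier_def)
  have zc: "continuous_on \<Sigma> z" and zy: "\<And>p. p \<in> interior \<Sigma> \<Longrightarrow> y p = sqrt (volV \<Sigma> G p)"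
    and zx: "\<And>p. p \<in> interior \<Sigma> \<Longrightarrow> (x has_derivative (\<lambda>v. - J_form G p (frechet_derivative y (at p)) v)) (at p)"
    using assms(9) unfolding volumetric_normal_function_def x_def[abs_def] y_def[abs_def] by auto
  have xc: "continuous_on \<Sigma> x" and yc: "continuous_on \<Sigma> y"
    unfolding x_def[abs_def] y_def[abs_def] by (intro continuous_intros zc)+
  have int_chart: "\<exists>D X u. (D, X) \<in> \<A> \<and> u \<in> interior D \<and> p = X u" if p: "p \<in> interior \<Sigma>" for p
  proof -
    obtain D X u where u: "(D, X) \<in> \<A>" "u \<in> D" "p = X u" using point p interior_subset by blast
    interpret c: polygon_chart \<Sigma> G D X by (rule chart[OF u(1)])
    show ?thesis using c.X_interior[OF u(2)] u p by blast
  qed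
  have mi: "metric_interior \<Sigma> G x y"
  proof
    fix p assume p: "p \<in> interior \<Sigma>"
    show "lie_bracket (interior \<Sigma>) (grad_phi \<Sigma> G 1) (grad_phi \<Sigma> G 2) p = 0"
      using assms(6) p unfolding cond_E_def by blast
    obtain D X u where u: "(D, X) \<in> \<A>" "u \<in> interior D" "p = X u" using int_chart[OF p] by blast
    interpret c: polygon_chart \<Sigma> G D X by (rule chart[OF u(1)])
    show "pos_def (G p)" using c.G_pos_def[OF u(2)] u(3) by simp
  next
    fix k i j
    show "Ck_on k (interior \<Sigma>) (\<lambda>p. matrix_inv (G p) $ i $ j)"
    proof (rule Ck_on_local)
      fix p assume p: "p \<in> interior \<Sigma>"
      obtain D X u where u: "(D, X) \<in> \<A>" "u \<in> interior D" "p = X u" using int_chart[OF p] by blast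
      interpret c: polygon_chart \<Sigma> G D X by (rule chart[OF u(1)])
      show "\<exists>T. open T \<and> p \<in> T \<and> Ck_on k T (\<lambda>p. matrix_inv (G p) $ i $ j)"
        using c.open_image_V c.inverse_metric_Ck u by blast
    qed
  qed (use zy zx in auto)
  interpret m: metric_interior \<Sigma> G x y by (rule mi)
  have y0: "y (X u) = 0" if "(D, X) \<in> \<A>" "u \<in> D" "X u \<notin> interior \<Sigma>" for D X u
  proof -
    interpret c: polygon_chart \<Sigma> G D X by (rule chart[OF that(1)])
    show ?thesis
    proof (rule c.vanishes_on_boundary[OF yc _ that(2)])
      fix w assume w: "w \<in> interior D"
      then have p: "X w \<in> interior \<Sigma>" using c.X_interior interior_subset by blast
      show "y (X w) = sqrt (det (matrix_inv (G (X w))))"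
        unfolding m.y_eq[OF p] m.A_def[symmetric] by (simp add: det_2 m.A_nth[OF p])
    next
      have "dim (span {grad_phi_in G (D, X) 1 u, grad_phi_in G (D, X) 2 u}) =
          (if X u \<in> interior \<Sigma> then 2 else if X u extreme_point_of \<Sigma> then 0 else 1)"
        using assms(6) that unfolding cond_E_def by fastforce
      then show "dim (span {grad_phi_in G (D, X) 1 u, grad_phi_in G (D, X) 2 u}) \<noteq> 2" using that(3) by simp
    qed
  qed
  have yf: "y p = 0" if "p \<in> frontier \<Sigma>" for p
    using point[of p] y0 that fr by blast
  have no_flat: "\<exists>q\<in>Q \<inter> frontier \<Sigma>. x q \<noteq> a" if Q: "open Q" "Q \<inter> frontier \<Sigma> \<noteq> {}" for Q a
  proof (rule ccontr)
    assume no: "\<not> ?thesis"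
    obtain p where p: "p \<in> Q" "p \<in> frontier \<Sigma>" using Q(2) by blast
    then obtain D X u where u: "(D, X) \<in> \<A>" "u \<in> D" "p = X u" using point fr by blast
    interpret c: polygon_chart \<Sigma> G D X by (rule chart[OF u(1)])
    \<comment> \<open>Flatness has to be refuted at an edge point; from a vertex one is reached by a
      small step along the first axis of the quadrant.\<close>
    have "\<exists>v\<in>D. v \<noteq> 0 \<and> X v \<notin> interior \<Sigma> \<and> X v \<in> Q"
    proof (cases "u = 0")
      case False
      then show ?thesis using u p fr by blast
    next
      case True
      obtain Q' where Q': "open Q'" "Q' \<inter> D = X -` Q \<inter> D"
        using c.X_cont Q(1) unfolding continuous_on_open_invariant by blast
      have "u \<in> Q'" using Q'(2) u p(1) by blast
      then obtain \<rho> where \<rho>: "\<rho> > 0" "ball 0 \<rho> \<subseteq> Q'" using Q'(1) True open_contains_ball by blast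
      have "0 \<le> axis (1::2) (1::real) $ i" for i by (simp add: axis_def)
      then obtain \<epsilon> where \<epsilon>: "\<epsilon> > 0" "\<forall>t. 0 < t \<longrightarrow> t < \<epsilon> \<longrightarrow> u + t *\<^sub>R axis 1 1 \<in> D"
        using c.near_boundary[OF u(2)] by blast
      define t where "t = min \<epsilon> \<rho> / 2"
      have t: "0 < t" "t < \<epsilon>" "t < \<rho>" using \<epsilon>(1) \<rho>(1) by (auto simp: t_def min_def)
      define v :: plane where "v = t *\<^sub>R axis 1 1"
      have vD: "v \<in> D" using \<epsilon>(2) t True by (simp add: v_def)
      have v0: "v $ 2 = 0" "v $ 1 = t" by (simp_all add: v_def axis_def)
      have "v \<in> Q'" using \<rho>(2) t by (auto simp: v_def subset_iff)
      then have "X v \<in> Q" using Q'(2) vD by blast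
      moreover have "v \<notin> interior quadrant" using v0(1) by (auto simp: interior_quadrant) (metis less_irrefl)
      then have "X v \<notin> interior \<Sigma>" using c.param_facts(4)[OF vD] by simp
      moreover have "v \<noteq> 0" using v0(2) t(1) by auto
      ultimately show ?thesis using vD by blast
    qed
    then obtain v where v: "v \<in> D" "v \<noteq> 0" "X v \<notin> interior \<Sigma>" "X v \<in> Q" by blast
    show False
    proof (rule c.no_constant_arc[OF mi xc yc _ v(1,2,3) Q(1) v(4)])
      show "y (X w) = 0" if "w \<in> D" "X w \<notin> interior \<Sigma>" for w using y0[OF u(1) that] .
      show "x q = a" if "q \<in> Q" "q \<in> \<Sigma>" "q \<notin> interior \<Sigma>" for q using no that fr by blast
    qed
  qed
  have cf: "connected (frontier \<Sigma>)"
    using assms(3,8) Union_components[of "frontier \<Sigma>"] in_components_connected unfolding cond_B_def by fastforce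
  interpret c: cauchy_riemann "interior \<Sigma>" x y "\<lambda>p. m.a11 p / y p" "\<lambda>p. m.a12 p / y p" "\<lambda>p. m.a22 p / y p"
    by (rule m.interior_cauchy_riemann)
  have ci: "connected (interior \<Sigma>)" using convex convex_connected convex_interior by blast
  \<comment> \<open>If \<open>z\<close> were constant inside, \<open>y\<close> would be a positive
    constant there and, by continuity, the same on the boundary, where it is 0.\<close>
  have nc: "\<exists>q\<in>interior \<Sigma>. c.N2 a b q \<noteq> 0" for a b
  proof (rule ccontr)
    assume "\<not> ?thesis"
    then have yb: "\<And>q. q \<in> interior \<Sigma> \<Longrightarrow> y q = b" by (auto simp: c.N2_eq_0)
    obtain p where p: "p \<in> frontier \<Sigma>" using assms(8) by blast
    have cl: "closure (interior \<Sigma>) = \<Sigma>" using convex_closure_interior[OF convex int] closed by simp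
    have "y p = b" 
      by (rule continuous_constant_on_closure[of "interior \<Sigma>" y]) (use yb yc cl p fr in auto)
    moreover obtain q where "q \<in> interior \<Sigma>" using int by blast
    ultimately show False using yf[OF p] yb m.y_pos by force
  qed
  interpret v: volumetric_chart \<Sigma> m.A x y "c.modulus ` c.crit"
  proof
    show "transpose (m.A p) = m.A p" if "p \<in> interior \<Sigma>" for p
      using m.A_pos_def[OF that] by (simp add: pos_def_def)
    show "0 < w \<bullet> (m.A p *v w)" if "p \<in> interior \<Sigma>" "w \<noteq> 0" for p w
      using m.A_pos_def[OF that(1)] that(2) by (simp add: pos_def_def)
    show "open ((\<lambda>p. Complex (x p) (y p)) ` W)" if "open W" "W \<subseteq> interior \<Sigma>" for W
      using c.open_map[OF ci nc that] .
    show "\<exists>W. open W \<and> p \<in> W \<and> W \<subseteq> interior \<Sigma> \<and> inj_on (\<lambda>p. Complex (x p) (y p)) W"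
      if "p \<in> interior \<Sigma>" "sqrt ((x p)\<^sup>2 + (y p)\<^sup>2) \<notin> c.modulus ` c.crit" for p
      using c.locally_injective[OF that(1)] that(2) by (auto simp: c.modulus_def)
  qed (use closed convex int ub cf assms(8) xc yc m.y_pos yf m.xy_sop no_flat c.negligible_critical_values in auto)
  have "v.z = z" by (simp add: fun_eq_iff v.z_def z)
  then show ?thesis using v.bijective by simp
qed

end
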